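(* Let $\mathbb{K}$ be a principal ideal domain, let $A$ be a free finitely generated $\mathbb{K}$-module, and let $\Phi:\mathsf{Mod}(\mathbb{K})\to\mathsf{Mod}(\mathbb{K})$ be a functor that takes free finitely generated modules to free finitely generated modules. Then there is an isomorphism of complexes $$\mathsf{Lim}_{(\mathsf{id})}\,\Phi\mathsf{R}_A\;\cong\;\big(N_\bullet(\Phi^\#(K(A^\vee,1)))\big)^\vee,$$ and for each $i$ there is a short exact sequence $$0\to (L_{i-1}\Phi^\#(A^\vee,1))^\diamond\to \lim^i\,\Phi\mathsf{R}_A\to (L_i\Phi^\#(A^\vee,1))^\vee\to 0 .$$
   Context: $M^\vee=\mathrm{Hom}_{\mathbb{K}}(M,\mathbb{K})$ (applied degreewise to complexes, turning a chain complex into a cochain complex), $M^\diamond=\mathrm{Ext}^1_{\mathbb{K}}(M,\mathbb{K})$, and the Kuhn dual of $\Phi$ is $\Phi^\#(M)=\Phi(M^\vee)^\vee$. $\mathsf{Pres}(A)$ is the category of epimorphisms $p:F\twoheadrightarrow A$ with $F$ a free $\mathbb{K}$-module and homomorphisms over $A$; $\mathsf{R}_A(p)=\mathrm{Ker}(p)$; $\Phi\mathsf{R}_A=\Phi\circ\mathsf{R}_A:\mathsf{Pres}(A)\to\mathsf{Mod}(\mathbb{K})$. $\lim^i$ is the $i$-th right derived functor of the limit over $\mathsf{Pres}(A)$. For $p:F\twoheadrightarrow A$, the coproduct in $\mathsf{Pres}(A)$ of $n+1$ copies of $p$ is $p^{\sqcup n+1}:F^{\oplus n+1}\to A$, $(a_0,\dots,a_n)\mapsto\sum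 p(a_i)$. These form a cosimplicial object $p^\bullet$ with $(p^\bullet)^n=p^{\sqcup n+1}$, with coface $d^i$ inserting $0$ at position $i$ and codegeneracy $s^i$ replacing the entries $a_i,a_{i+1}$ by $a_i+a_{i+1}$. $\mathsf{Lim}_{(p)}\Phi\mathsf{R}_A$ is the normalized cochain complex $N^\bullet(\Phi(\mathsf{R}_A(p^\bullet)))$ (intersection of kernels of codegeneracies, differential $\sum(-1)^id^i$). $\mathsf{Lim}_{(\mathsf{id})}$ is the case $p=\mathsf{id}_A$. $N_\bullet$ is the normalized chain complex of a simplicial module and $\mathsf{DK}_\bullet$ is the inverse Dold–Kan functor. For a free module $B$, $K(B,1)=\mathsf{DK}_\bullet(B[1])$, where $B[1]$ is $B$ concentrated in degree $1$. $L_i\Psi(B,n)=\pi_i\Psi(\mathsf{DK}_\bullet(P_\bullet[n]))$ is the Dold–Puppe derived functor, with $P_\bullet$ a projective resolution of $B$ and $P_\bullet[n]$ its shift into degrees $\ge n$; so for $B$ free $L_i\Psi(B,1)=\pi_i\Psi(K(B,1))$. By convention $L_i\Psi=0$ for $i<0$. *)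

theory Defs
  imports "HOL-Algebra.Module" "HOL-Algebra.AbelCoset" "HOL-Algebra.Ring_Divisibility"
begin

section \<open>Modules over a commutative ring\<close>

text \<open>The record type of modules extends that of rings; the fields \<open>mult\<close> and \<open>one\<close> are not
  constrained by the locale \<open>module\<close> and are filled with the zero element here.\<close>

definition mk_module ::
  "'a set \<Rightarrow> 'a \<Rightarrow> ('a \<Rightarrow> 'a \<Rightarrow> 'a) \<Rightarrow> ('k \<Rightarrow> 'a \<Rightarrow> 'a) \<Rightarrow> ('k, 'a) module" where
  "mk_module C z pl sm =
     \<lparr>carrier = C, mult = (\<lambda>_ _. z), one = z, zero = z, add = pl, smult = sm\<rparr>"

definition zero_module :: "('k, 'a) module" where
  "zero_module = mk_module {undefined} undefined (\<lambda>_ _. undefined) (\<lambda>_ _. undefined)"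

definition self_module :: "'k ring \<Rightarrow> ('k, 'k) module" where
  "self_module K = mk_module (carrier K) (zero K) (add K) (mult K)"

text \<open>Linear maps are extensional functions, so that equality of morphisms is equality in HOL.\<close>

definition mod_hom ::
  "'k ring \<Rightarrow> ('k, 'a) module \<Rightarrow> ('k, 'b) module \<Rightarrow> ('a \<Rightarrow> 'b) set" where
  "mod_hom K M N = {f \<in> carrier M \<rightarrow>\<^sub>E carrier N.
     (\<forall>x\<in>carrier M. \<forall>y\<in>carrier M. f (x \<oplus>\<^bsub>M\<^esub> y) = f x \<oplus>\<^bsub>N\<^esub> f y) \<and>
     (\<forall>a\<in>carrier K. \<forall>x\<in>carrier M. f (a \<odot>\<^bsub>M\<^esub> x) = a \<odot>\<^bsub>N\<^esub> f x)}"

definition hom_module ::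
  "'k ring \<Rightarrow> ('k, 'a) module \<Rightarrow> ('k, 'b) module \<Rightarrow> ('k, 'a \<Rightarrow> 'b) module" where
  "hom_module K M N = mk_module (mod_hom K M N) (\<lambda>x\<in>carrier M. \<zero>\<^bsub>N\<^esub>)
     (\<lambda>f g. \<lambda>x\<in>carrier M. f x \<oplus>\<^bsub>N\<^esub> g x) (\<lambda>a f. \<lambda>x\<in>carrier M. a \<odot>\<^bsub>N\<^esub> f x)"

definition prod_module :: "'i set \<Rightarrow> ('i \<Rightarrow> ('k, 'a) module) \<Rightarrow> ('k, 'i \<Rightarrow> 'a) module" where
  "prod_module I M = mk_module (\<Pi>\<^sub>E i\<in>I. carrier (M i)) (\<lambda>i\<in>I. \<zero>\<^bsub>M i\<^esub>)
     (\<lambda>x y. \<lambda>i\<in>I. x i \<oplus>\<^bsub>M i\<^esub> y i) (\<lambda>a x. \<lambda>i\<in>I. a \<odot>\<^bsub>M i\<^esub> x i)"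

definition quot_module :: "('k, 'a) module \<Rightarrow> 'a set \<Rightarrow> ('k, 'a set) module" where
  "quot_module M S = mk_module (a_rcosets\<^bsub>M\<^esub> S) S (\<lambda>X Y. X <+>\<^bsub>M\<^esub> Y)
     (\<lambda>a X. \<Union>x\<in>X. S +>\<^bsub>M\<^esub> (a \<odot>\<^bsub>M\<^esub> x))"

definition short_exact ::
  "'k ring \<Rightarrow> ('k, 'a) module \<Rightarrow> ('a \<Rightarrow> 'b) \<Rightarrow> ('k, 'b) module \<Rightarrow> ('b \<Rightarrow> 'c) \<Rightarrow> ('k, 'c) module \<Rightarrow> bool"
  where
  "short_exact K X f Y g Z \<longleftrightarrow>
     f \<in> mod_hom K X Y \<and> g \<in> mod_hom K Y Z \<and>
     inj_on f (carrier X) \<and> f ` carrier X = a_kernel Y Z g \<and> g ` carrier Y = carrier Z"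

subsection \<open>Free and finitely generated modules\<close>

definition fin_supp :: "'k ring \<Rightarrow> 'b set \<Rightarrow> ('b \<Rightarrow> 'k) set" where
  "fin_supp K B = {c \<in> B \<rightarrow>\<^sub>E carrier K. finite {b\<in>B. c b \<noteq> \<zero>\<^bsub>K\<^esub>}}"

definition lin_comb :: "'k ring \<Rightarrow> ('k, 'a) module \<Rightarrow> 'a set \<Rightarrow> ('a \<Rightarrow> 'k) \<Rightarrow> 'a" where
  "lin_comb K M B c = finsum M (\<lambda>b. c b \<odot>\<^bsub>M\<^esub> b) {b\<in>B. c b \<noteq> \<zero>\<^bsub>K\<^esub>}"

definition is_basis :: "'k ring \<Rightarrow> ('k, 'a) module \<Rightarrow> 'a set \<Rightarrow> bool" where
  "is_basis K M B \<longleftrightarrow>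
     B \<subseteq> carrier M \<and> bij_betw (lin_comb K M B) (fin_supp K B) (carrier M)"

definition free_module :: "'k ring \<Rightarrow> ('k, 'a) module \<Rightarrow> bool" where
  "free_module K M \<longleftrightarrow> module K M \<and> (\<exists>B. is_basis K M B)"

definition fin_gen_module :: "'k ring \<Rightarrow> ('k, 'a) module \<Rightarrow> bool" where
  "fin_gen_module K M \<longleftrightarrow> module K M \<and>
     (\<exists>S. finite S \<and> S \<subseteq> carrier M \<and> lin_comb K M S ` fin_supp K S = carrier M)"

definition free_on :: "'k ring \<Rightarrow> 'b set \<Rightarrow> ('k, 'b \<Rightarrow> 'k) module" where
  "free_on K B = (prod_module B (\<lambda>_. self_module K))\<lparr>carrier := fin_supp K B\<rparr>"

subsection \<open>The dualities Hom(-,K) and Ext1(-,K)\<close>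

definition dual_module :: "'k ring \<Rightarrow> ('k, 'a) module \<Rightarrow> ('k, 'a \<Rightarrow> 'k) module" where
  "dual_module K M = hom_module K M (self_module K)"

definition dual_map ::
  "'k ring \<Rightarrow> ('k, 'a) module \<Rightarrow> ('k, 'b) module \<Rightarrow> ('a \<Rightarrow> 'b) \<Rightarrow> ('b \<Rightarrow> 'k) \<Rightarrow> ('a \<Rightarrow> 'k)" where
  "dual_map K M N f = (\<lambda>\<phi>\<in>carrier (dual_module K N). \<lambda>x\<in>carrier M. \<phi> (f x))"

text \<open>Ext1(M,N) is the cokernel of Hom(P,N) \<open>\<rightarrow>\<close> Hom(R,N), where 0 \<open>\<rightarrow>\<close> R \<open>\<rightarrow>\<close> P \<open>\<rightarrow>\<close> M \<open>\<rightarrow>\<close> 0 is the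
  canonical presentation of M, with P free on the underlying set of M.\<close>

definition ext1 ::
  "'k ring \<Rightarrow> ('k, 'a) module \<Rightarrow> ('k, 'b) module \<Rightarrow> ('k, (('a \<Rightarrow> 'k) \<Rightarrow> 'b) set) module" where
  "ext1 K M N =
     (let P = free_on K (carrier M);
          R = P\<lparr>carrier := a_kernel P M (lin_comb K M (carrier M))\<rparr>
      in quot_module (hom_module K R N) ((\<lambda>\<phi>. restrict \<phi> (carrier R)) ` mod_hom K P N))"

definition diamond :: "'k ring \<Rightarrow> ('k, 'a) module \<Rightarrow> ('k, (('a \<Rightarrow> 'k) \<Rightarrow> 'k) set) module" where
  "diamond K M = ext1 K M (self_module K)"

subsection \<open>Changing the underlying type\<close>

text \<open>The category of modules is represented by the modules whose carrier lies in a type \<open>'u\<close>.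
  A functor may take values in modules over another type \<open>'v\<close>, since HOL types do not form
  universes closed under, say, duals: taking \<open>'v\<close> larger than \<open>'u\<close> covers functors that raise
  cardinality.
  Constructions such as finite powers and duals produce modules over other types; \<open>copy M\<close> is the
  isomorphic module over \<open>'u\<close>, obtained by transport along an injection of the carrier of \<open>M\<close> into
  \<open>'u\<close>. It is meaningful only if such an injection exists, which the cardinality assumptions of
  the theorem guarantee for all modules to which \<open>copy\<close> is applied.\<close>

definition code :: "'a set \<Rightarrow> 'a \<Rightarrow> 'u" where
  "code S = (SOME e. inj_on e S)"

definition decode :: "'a set \<Rightarrow> 'u \<Rightarrow> 'a" where
  "decode S = inv_into S (code S)"

definition copy :: "('k, 'a) module \<Rightarrow> ('k, 'u) module" where
  "copy M = (let C = carrier M in mk_module (code C ` C) (code C \<zero>\<^bsub>M\<^esub>)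
     (\<lambda>x y. code C (decode C x \<oplus>\<^bsub>M\<^esub> decode C y)) (\<lambda>a x. code C (a \<odot>\<^bsub>M\<^esub> decode C x)))"

definition copy_map ::
  "('k, 'a) module \<Rightarrow> ('k, 'b) module \<Rightarrow> ('a \<Rightarrow> 'b) \<Rightarrow> ('u \<Rightarrow> 'v)" where
  "copy_map M N f =
     (\<lambda>x \<in> code (carrier M) ` carrier M. code (carrier N) (f (decode (carrier M) x)))"

section \<open>Categories and functors\<close>

text \<open>\<open>Comp C X g f\<close> is the composite of \<open>f\<close>, with source \<open>X\<close>, and \<open>g\<close>.\<close>

record ('o, 'a) category =
  Ob :: "'o set"
  Hom :: "'o \<Rightarrow> 'o \<Rightarrow> 'a set"
  Id :: "'o \<Rightarrow> 'a"
  Comp :: "'o \<Rightarrow> 'a \<Rightarrow> 'a \<Rightarrow> 'a"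

record ('o, 'a, 'p, 'b) ftr =
  Fo :: "'o \<Rightarrow> 'p"
  Fa :: "'o \<Rightarrow> 'o \<Rightarrow> 'a \<Rightarrow> 'b"

definition is_functor ::
  "('o, 'a) category \<Rightarrow> ('p, 'b) category \<Rightarrow> ('o, 'a, 'p, 'b) ftr \<Rightarrow> bool" where
  "is_functor C D T \<longleftrightarrow>
     (\<forall>X\<in>Ob C. Fo T X \<in> Ob D) \<and>
     (\<forall>X\<in>Ob C. \<forall>Y\<in>Ob C. \<forall>f\<in>Hom C X Y. Fa T X Y f \<in> Hom D (Fo T X) (Fo T Y)) \<and>
     (\<forall>X\<in>Ob C. Fa T X X (Id C X) = Id D (Fo T X)) \<and>
     (\<forall>X\<in>Ob C. \<forall>Y\<in>Ob C. \<forall>Z\<in>Ob C. \<forall>f\<in>Hom C X Y. \<forall>g\<in>Hom C Y Z.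
        Fa T X Z (Comp C X g f) = Comp D (Fo T X) (Fa T Y Z g) (Fa T X Y f))"

definition ftr_comp ::
  "('p, 'b, 'q, 'c) ftr \<Rightarrow> ('o, 'a, 'p, 'b) ftr \<Rightarrow> ('o, 'a, 'q, 'c) ftr" where
  "ftr_comp S T = \<lparr>Fo = (\<lambda>X. Fo S (Fo T X)),
                   Fa = (\<lambda>X Y f. Fa S (Fo T X) (Fo T Y) (Fa T X Y f))\<rparr>"

definition Mods :: "'k ring \<Rightarrow> (('k, 'u) module, 'u \<Rightarrow> 'u) category" where
  "Mods K = \<lparr>Ob = {M. module K M}, Hom = mod_hom K, Id = (\<lambda>M. \<lambda>x\<in>carrier M. x),
            Comp = (\<lambda>M g f. compose (carrier M) g f)\<rparr>"

type_synonym ('k, 'u) pres = "('k, 'u) module \<times> ('u \<Rightarrow> 'u)"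

definition Pres :: "'k ring \<Rightarrow> ('k, 'u) module \<Rightarrow> (('k, 'u) pres, 'u \<Rightarrow> 'u) category" where
  "Pres K A =
     \<lparr>Ob = {(F, p). free_module K F \<and> p \<in> mod_hom K F A \<and> p ` carrier F = carrier A},
      Hom = (\<lambda>(F, p) (G, q). {f \<in> mod_hom K F G. \<forall>x\<in>carrier F. q (f x) = p x}),
      Id = (\<lambda>(F, p). \<lambda>x\<in>carrier F. x),
      Comp = (\<lambda>(F, p) g f. compose (carrier F) g f)\<rparr>"

definition id_pres :: "('k, 'u) module \<Rightarrow> ('k, 'u) pres" where
  "id_pres A = (A, \<lambda>x\<in>carrier A. x)"

definition relations ::
  "('k, 'u) module \<Rightarrow> (('k, 'u) pres, 'u \<Rightarrow> 'u, ('k, 'u) module, 'u \<Rightarrow> 'u) ftr" where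
  "relations A = \<lparr>Fo = (\<lambda>(F, p). F\<lparr>carrier := a_kernel F A p\<rparr>),
                  Fa = (\<lambda>(F, p) (G, q) f. restrict f (a_kernel F A p))\<rparr>"

text \<open>The functor \<open>M \<mapsto> \<Phi>(M\<^sup>\<or>)\<^sup>\<or>\<close>.\<close>

definition kuhn_dual ::
  "'k ring \<Rightarrow> (('k, 'u) module, 'u \<Rightarrow> 'u, ('k, 'v) module, 'v \<Rightarrow> 'v) ftr \<Rightarrow>
   (('k, 't) module, 't \<Rightarrow> 't, ('k, 'v \<Rightarrow> 'k) module, ('v \<Rightarrow> 'k) \<Rightarrow> ('v \<Rightarrow> 'k)) ftr" where
  "kuhn_dual K \<Phi> =
     \<lparr>Fo = (\<lambda>M. dual_module K (Fo \<Phi> (copy (dual_module K M)))),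
      Fa = (\<lambda>M N f.
        let M' = copy (dual_module K M); N' = copy (dual_module K N);
            f' = copy_map (dual_module K N) (dual_module K M) (dual_map K M N f)
        in dual_map K (Fo \<Phi> N') (Fo \<Phi> M') (Fa \<Phi> N' M' f'))\<rparr>"

section \<open>Complexes\<close>

text \<open>One record serves for chain complexes, where \<open>Cd C n\<close> maps degree \<open>n + 1\<close> to degree \<open>n\<close>, and
  for cochain complexes, where \<open>Cd C n\<close> maps degree \<open>n\<close> to degree \<open>n + 1\<close>.\<close>

record ('k, 'a) cpx =
  Cm :: "nat \<Rightarrow> ('k, 'a) module"
  Cd :: "nat \<Rightarrow> 'a \<Rightarrow> 'a"

definition homology :: "('k, 'a) cpx \<Rightarrow> nat \<Rightarrow> ('k, 'a set) module" where
  "homology C n =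
     (let Z = (case n of 0 \<Rightarrow> carrier (Cm C 0) | Suc m \<Rightarrow> a_kernel (Cm C n) (Cm C m) (Cd C m))
      in quot_module ((Cm C n)\<lparr>carrier := Z\<rparr>) (Cd C n ` carrier (Cm C (Suc n))))"

definition cohomology :: "('k, 'a) cpx \<Rightarrow> nat \<Rightarrow> ('k, 'a set) module" where
  "cohomology C n =
     (let Z = a_kernel (Cm C n) (Cm C (Suc n)) (Cd C n);
          B = (case n of 0 \<Rightarrow> {\<zero>\<^bsub>Cm C 0\<^esub>} | Suc m \<Rightarrow> Cd C m ` carrier (Cm C m))
      in quot_module ((Cm C n)\<lparr>carrier := Z\<rparr>) B)"

definition dual_cpx :: "'k ring \<Rightarrow> ('k, 'a) cpx \<Rightarrow> ('k, 'a \<Rightarrow> 'k) cpx" where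
  "dual_cpx K C = \<lparr>Cm = (\<lambda>n. dual_module K (Cm C n)),
                   Cd = (\<lambda>n. dual_map K (Cm C (Suc n)) (Cm C n) (Cd C n))\<rparr>"

definition cochain_isomorphic :: "'k ring \<Rightarrow> ('k, 'a) cpx \<Rightarrow> ('k, 'b) cpx \<Rightarrow> bool" where
  "cochain_isomorphic K C D \<longleftrightarrow>
     (\<exists>f. (\<forall>n. f n \<in> mod_hom K (Cm C n) (Cm D n) \<and>
               bij_betw (f n) (carrier (Cm C n)) (carrier (Cm D n))) \<and>
          (\<forall>n. \<forall>x\<in>carrier (Cm C n). f (Suc n) (Cd C n x) = Cd D n (f n x)))"

definition concentrated :: "('k, 'a) module \<Rightarrow> nat \<Rightarrow> ('k, 'a) cpx" where
  "concentrated B n =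
     \<lparr>Cm = (\<lambda>m. if m = n then B else B\<lparr>carrier := {\<zero>\<^bsub>B\<^esub>}\<rparr>),
      Cd = (\<lambda>m. \<lambda>x \<in> (if Suc m = n then carrier B else {\<zero>\<^bsub>B\<^esub>}). \<zero>\<^bsub>B\<^esub>)\<rparr>"

section \<open>Cosimplicial and simplicial modules\<close>

text \<open>\<open>coface X n i\<close>, \<open>i \<le> n + 1\<close>, maps level \<open>n\<close> to level \<open>n + 1\<close>, and \<open>codegen X n i\<close>, \<open>i \<le> n\<close>,
  maps level \<open>n + 1\<close> to level \<open>n\<close>; dually for \<open>face\<close> and \<open>degen\<close>.\<close>

record ('o, 'a) cosimplicial =
  cob :: "nat \<Rightarrow> 'o"
  coface :: "nat \<Rightarrow> nat \<Rightarrow> 'a"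
  codegen :: "nat \<Rightarrow> nat \<Rightarrow> 'a"

record ('o, 'a) simplicial =
  sob :: "nat \<Rightarrow> 'o"
  face :: "nat \<Rightarrow> nat \<Rightarrow> 'a"
  degen :: "nat \<Rightarrow> nat \<Rightarrow> 'a"

definition cosimp_map ::
  "('o, 'a, 'p, 'b) ftr \<Rightarrow> ('o, 'a) cosimplicial \<Rightarrow> ('p, 'b) cosimplicial" where
  "cosimp_map T X =
     \<lparr>cob = (\<lambda>n. Fo T (cob X n)),
      coface = (\<lambda>n i. Fa T (cob X n) (cob X (Suc n)) (coface X n i)),
      codegen = (\<lambda>n i. Fa T (cob X (Suc n)) (cob X n) (codegen X n i))\<rparr>"

definition simp_map ::
  "('o, 'a, 'p, 'b) ftr \<Rightarrow> ('o, 'a) simplicial \<Rightarrow> ('p, 'b) simplicial" where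
  "simp_map T X =
     \<lparr>sob = (\<lambda>n. Fo T (sob X n)),
      face = (\<lambda>n i. Fa T (sob X (Suc n)) (sob X n) (face X n i)),
      degen = (\<lambda>n i. Fa T (sob X n) (sob X (Suc n)) (degen X n i))\<rparr>"

definition conormalized :: "(('k, 'a) module, 'a \<Rightarrow> 'a) cosimplicial \<Rightarrow> ('k, 'a) cpx" where
  "conormalized X =
     (let N = (\<lambda>n. {x \<in> carrier (cob X n).
                  \<forall>m i. n = Suc m \<longrightarrow> i \<le> m \<longrightarrow> codegen X m i x = \<zero>\<^bsub>cob X m\<^esub>})
      in \<lparr>Cm = (\<lambda>n. (cob X n)\<lparr>carrier := N n\<rparr>),
          Cd = (\<lambda>n. \<lambda>x\<in>N n. finsum (cob X (Suc n))
                 (\<lambda>i. if even i then coface X n i x else \<ominus>\<^bsub>cob X (Suc n)\<^esub> coface X n i x)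
                 {..Suc n})\<rparr>)"

text \<open>Moore normalization: the joint kernel of the faces \<open>d\<^sub>i\<close> with \<open>i \<ge> 1\<close>. The alternating sum
  of the faces restricts to \<open>d\<^sub>0\<close> on it.\<close>

definition normalized :: "(('k, 'a) module, 'a \<Rightarrow> 'a) simplicial \<Rightarrow> ('k, 'a) cpx" where
  "normalized X =
     (let N = (\<lambda>n. {x \<in> carrier (sob X n).
                  \<forall>m i. n = Suc m \<longrightarrow> 1 \<le> i \<longrightarrow> i \<le> n \<longrightarrow> face X m i x = \<zero>\<^bsub>sob X m\<^esub>})
      in \<lparr>Cm = (\<lambda>n. (sob X n)\<lparr>carrier := N n\<rparr>),
          Cd = (\<lambda>n. restrict (face X n 0) (N (Suc n)))\<rparr>)"

subsection \<open>The inverse Dold-Kan functor\<close>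

text \<open>The monotone surjections from \<open>[n]\<close> onto \<open>[k]\<close> for all \<open>k\<close>; necessarily \<open>k = \<sigma> n\<close>.\<close>

definition surjections :: "nat \<Rightarrow> (nat \<Rightarrow> nat) set" where
  "surjections n = {\<sigma> \<in> extensional {..n}. mono_on {..n} \<sigma> \<and> \<sigma> ` {..n} = {..\<sigma> n}}"

definition dk_module :: "('k, 'a) cpx \<Rightarrow> nat \<Rightarrow> ('k, (nat \<Rightarrow> nat) \<Rightarrow> 'a) module" where
  "dk_module C n = prod_module (surjections n) (\<lambda>\<sigma>. Cm C (\<sigma> n))"

text \<open>The operator \<open>DK\<^sub>n \<rightarrow> DK\<^sub>m\<close> induced by a monotone map \<open>\<alpha> : [m] \<rightarrow> [n]\<close>. Write \<open>\<sigma> \<circ> \<alpha>\<close> as a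
  surjection \<open>\<tau>\<close> followed by an injection \<open>\<epsilon>\<close>. The summand of \<open>\<sigma>\<close> is mapped to that of \<open>\<tau>\<close> by the
  identity if \<open>\<epsilon>\<close> is the identity, by the differential if \<open>\<epsilon>\<close> is the coface omitting \<open>0\<close>, and to zero
  otherwise. This matches the choice of \<open>d\<^sub>0\<close> in \<open>normalized\<close>.\<close>

definition dk_map ::
  "('k, 'a) cpx \<Rightarrow> nat \<Rightarrow> nat \<Rightarrow> (nat \<Rightarrow> nat) \<Rightarrow> ((nat \<Rightarrow> nat) \<Rightarrow> 'a) \<Rightarrow> ((nat \<Rightarrow> nat) \<Rightarrow> 'a)" where
  "dk_map C m n \<alpha> = (\<lambda>x\<in>carrier (dk_module C n). \<lambda>\<tau>\<in>surjections m.
     finsum (Cm C (\<tau> m))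
       (\<lambda>\<sigma>. if \<sigma> n = \<tau> m \<and> (\<forall>j\<le>m. \<sigma> (\<alpha> j) = \<tau> j) then x \<sigma>
             else if \<sigma> n = Suc (\<tau> m) \<and> (\<forall>j\<le>m. \<sigma> (\<alpha> j) = Suc (\<tau> j)) then Cd C (\<tau> m) (x \<sigma>)
             else \<zero>\<^bsub>Cm C (\<tau> m)\<^esub>)
       (surjections n))"

definition dold_kan ::
  "('k, 'a) cpx \<Rightarrow> (('k, (nat \<Rightarrow> nat) \<Rightarrow> 'a) module, ((nat \<Rightarrow> nat) \<Rightarrow> 'a) \<Rightarrow> ((nat \<Rightarrow> nat) \<Rightarrow> 'a)) simplicial"
  where
  "dold_kan C =
     \<lparr>sob = dk_module C,
      face = (\<lambda>n i. dk_map C n (Suc n) (\<lambda>j. if j < i then j else Suc j)),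
      degen = (\<lambda>n i. dk_map C (Suc n) n (\<lambda>j. if j \<le> i then j else j - 1))\<rparr>"

definition eilenberg_maclane ::
  "('k, 'a) module \<Rightarrow> nat \<Rightarrow>
   (('k, (nat \<Rightarrow> nat) \<Rightarrow> 'a) module, ((nat \<Rightarrow> nat) \<Rightarrow> 'a) \<Rightarrow> ((nat \<Rightarrow> nat) \<Rightarrow> 'a)) simplicial" where
  "eilenberg_maclane B n = dold_kan (concentrated B n)"

text \<open>The Dold-Puppe derived functor \<open>L\<^sub>i\<Psi>(B,n)\<close> of a free module \<open>B\<close>, for which \<open>B\<close> itself serves
  as the projective resolution; it vanishes for negative \<open>i\<close>.\<close>

definition dold_puppe_free ::
  "(('k, (nat \<Rightarrow> nat) \<Rightarrow> 'a) module, ((nat \<Rightarrow> nat) \<Rightarrow> 'a) \<Rightarrow> ((nat \<Rightarrow> nat) \<Rightarrow> 'a),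
    ('k, 'b) module, 'b \<Rightarrow> 'b) ftr \<Rightarrow> ('k, 'a) module \<Rightarrow> nat \<Rightarrow> int \<Rightarrow> ('k, 'b set) module" where
  "dold_puppe_free \<Psi> B n i =
     (if i < 0 then zero_module
      else homology (normalized (simp_map \<Psi> (eilenberg_maclane B n))) (nat i))"

section \<open>The standard complex of a presentation\<close>

text \<open>Level \<open>n\<close> is the coproduct of \<open>n + 1\<close> copies of the presentation \<open>p : F \<rightarrow> A\<close>, with elements
  the families \<open>(a\<^sub>0, \<dots>, a\<^sub>n)\<close> in \<open>F\<close>.\<close>

definition power_module :: "('k, 'u) module \<Rightarrow> nat \<Rightarrow> ('k, nat \<Rightarrow> 'u) module" where
  "power_module F n = prod_module {..n} (\<lambda>_. F)"

definition pres_power :: "('k, 'u) module \<Rightarrow> ('k, 'u) pres \<Rightarrow> nat \<Rightarrow> ('k, 'u) pres" where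
  "pres_power A P n = (case P of (F, p) \<Rightarrow>
     (copy (power_module F n),
      \<lambda>x \<in> carrier (copy (power_module F n)).
        finsum A (\<lambda>i. p (decode (carrier (power_module F n)) x i)) {..n}))"

definition insert_zero ::
  "('k, 'u) module \<Rightarrow> nat \<Rightarrow> nat \<Rightarrow> (nat \<Rightarrow> 'u) \<Rightarrow> (nat \<Rightarrow> 'u)" where
  "insert_zero F n i = (\<lambda>a\<in>carrier (power_module F n). \<lambda>j\<in>{..Suc n}.
     if j < i then a j else if j = i then \<zero>\<^bsub>F\<^esub> else a (j - 1))"

definition merge_entries ::
  "('k, 'u) module \<Rightarrow> nat \<Rightarrow> nat \<Rightarrow> (nat \<Rightarrow> 'u) \<Rightarrow> (nat \<Rightarrow> 'u)" where
  "merge_entries F n i = (\<lambda>a\<in>carrier (power_module F (Suc n)). \<lambda>j\<in>{..n}.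
     if j < i then a j else if j = i then a i \<oplus>\<^bsub>F\<^esub> a (Suc i) else a (Suc j))"

definition pres_cosimplicial ::
  "('k, 'u) module \<Rightarrow> ('k, 'u) pres \<Rightarrow> (('k, 'u) pres, 'u \<Rightarrow> 'u) cosimplicial" where
  "pres_cosimplicial A P =
     \<lparr>cob = pres_power A P,
      coface = (\<lambda>n i. copy_map (power_module (fst P) n) (power_module (fst P) (Suc n))
                         (insert_zero (fst P) n i)),
      codegen = (\<lambda>n i. copy_map (power_module (fst P) (Suc n)) (power_module (fst P) n)
                         (merge_entries (fst P) n i))\<rparr>"

definition Lim_complex ::
  "('k, 'u) module \<Rightarrow> ('k, 'u) pres \<Rightarrow>
   (('k, 'u) pres, 'u \<Rightarrow> 'u, ('k, 'v) module, 'v \<Rightarrow> 'v) ftr \<Rightarrow> ('k, 'v) cpx" where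
  "Lim_complex A P T = conormalized (cosimp_map T (pres_cosimplicial A P))"

section \<open>Right derived functors of the limit\<close>

text \<open>Natural transformations between functors to modules. The two functors may take values in
  modules over different types.\<close>

definition mod_nat ::
  "'k ring \<Rightarrow> ('o, 'a) category \<Rightarrow> ('o, 'a, ('k, 'v) module, 'v \<Rightarrow> 'v) ftr \<Rightarrow>
   ('o, 'a, ('k, 'w) module, 'w \<Rightarrow> 'w) ftr \<Rightarrow> ('o \<Rightarrow> 'v \<Rightarrow> 'w) \<Rightarrow> bool" where
  "mod_nat K C S T \<eta> \<longleftrightarrow>
     (\<forall>c\<in>Ob C. \<eta> c \<in> mod_hom K (Fo S c) (Fo T c)) \<and>
     (\<forall>c\<in>Ob C. \<forall>c'\<in>Ob C. \<forall>f\<in>Hom C c c'. \<forall>x\<in>carrier (Fo S c).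
        \<eta> c' (Fa S c c' f x) = Fa T c c' f (\<eta> c x))"

text \<open>Injective objects of the category of functors from \<open>C\<close> to modules with carrier in \<open>'w\<close>;
  monomorphisms and exactness in this category are pointwise.\<close>

definition injective_ftr ::
  "'k ring \<Rightarrow> ('o, 'a) category \<Rightarrow> ('o, 'a, ('k, 'w) module, 'w \<Rightarrow> 'w) ftr \<Rightarrow> bool" where
  "injective_ftr K C I \<longleftrightarrow> is_functor C (Mods K) I \<and>
     (\<forall>(X :: ('o, 'a, ('k, 'w) module, 'w \<Rightarrow> 'w) ftr)
       (Y :: ('o, 'a, ('k, 'w) module, 'w \<Rightarrow> 'w) ftr) m g.
        is_functor C (Mods K) X \<longrightarrow> is_functor C (Mods K) Y \<longrightarrow>
        mod_nat K C X Y m \<longrightarrow> (\<forall>c\<in>Ob C. inj_on (m c) (carrier (Fo X c))) \<longrightarrow>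
        mod_nat K C X I g \<longrightarrow>
        (\<exists>h. mod_nat K C Y I h \<and> (\<forall>c\<in>Ob C. \<forall>x\<in>carrier (Fo X c). h c (m c x) = g c x)))"

definition injective_resolution ::
  "'k ring \<Rightarrow> ('o, 'a) category \<Rightarrow> ('o, 'a, ('k, 'v) module, 'v \<Rightarrow> 'v) ftr \<Rightarrow>
   (nat \<Rightarrow> ('o, 'a, ('k, 'w) module, 'w \<Rightarrow> 'w) ftr) \<Rightarrow> (nat \<Rightarrow> 'o \<Rightarrow> 'w \<Rightarrow> 'w) \<Rightarrow>
   ('o \<Rightarrow> 'v \<Rightarrow> 'w) \<Rightarrow> bool" where
  "injective_resolution K C T I \<delta> \<epsilon> \<longleftrightarrow>
     (\<forall>n. injective_ftr K C (I n)) \<and>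
     mod_nat K C T (I 0) \<epsilon> \<and> (\<forall>n. mod_nat K C (I n) (I (Suc n)) (\<delta> n)) \<and>
     (\<forall>c\<in>Ob C.
        inj_on (\<epsilon> c) (carrier (Fo T c)) \<and>
        \<epsilon> c ` carrier (Fo T c) = a_kernel (Fo (I 0) c) (Fo (I 1) c) (\<delta> 0 c) \<and>
        (\<forall>n. \<delta> n c ` carrier (Fo (I n) c) =
             a_kernel (Fo (I (Suc n)) c) (Fo (I (Suc (Suc n))) c) (\<delta> (Suc n) c)))"

definition lim_module ::
  "('o, 'a) category \<Rightarrow> ('o, 'a, ('k, 'w) module, 'w \<Rightarrow> 'w) ftr \<Rightarrow> ('k, 'o \<Rightarrow> 'w) module" where
  "lim_module C T = (prod_module (Ob C) (Fo T))\<lparr>carrier :=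
     {s \<in> \<Pi>\<^sub>E c\<in>Ob C. carrier (Fo T c).
        \<forall>c\<in>Ob C. \<forall>c'\<in>Ob C. \<forall>f\<in>Hom C c c'. Fa T c c' f (s c) = s c'}\<rparr>"

definition lim_map ::
  "('o, 'a) category \<Rightarrow> ('o, 'a, ('k, 'w) module, 'w \<Rightarrow> 'w) ftr \<Rightarrow> ('o \<Rightarrow> 'w \<Rightarrow> 'w) \<Rightarrow>
   ('o \<Rightarrow> 'w) \<Rightarrow> ('o \<Rightarrow> 'w)" where
  "lim_map C T \<eta> = (\<lambda>s\<in>carrier (lim_module C T). \<lambda>c\<in>Ob C. \<eta> c (s c))"

text \<open>The value of the \<open>i\<close>-th right derived functor of the limit computed by the injective
  resolution given by \<open>I\<close> and \<open>\<delta>\<close>; another resolution gives an isomorphic module. The functor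
  category has enough injectives, so that resolutions exist, if \<open>'w\<close> is infinite, is at least as
  large as the base ring and the values of the functors, and satisfies \<open>|'w|\<^sup>m = |'w|\<close>, where \<open>m\<close> is the
  number of morphisms of \<open>C\<close>. For \<open>Pres K A\<close> over an infinite type \<open>'u\<close>, \<open>m\<close> is at most the cardinality
  of the type \<open>('k, 'u) pres\<close>, which also exceeds that of \<open>'k\<close>.\<close>

definition derived_lim ::
  "('o, 'a) category \<Rightarrow> (nat \<Rightarrow> ('o, 'a, ('k, 'w) module, 'w \<Rightarrow> 'w) ftr) \<Rightarrow>
   (nat \<Rightarrow> 'o \<Rightarrow> 'w \<Rightarrow> 'w) \<Rightarrow> nat \<Rightarrow> ('k, ('o \<Rightarrow> 'w) set) module" where
  "derived_lim C I \<delta> i =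
     cohomology \<lparr>Cm = (\<lambda>n. lim_module C (I n)), Cd = (\<lambda>n. lim_map C (I n) (\<delta> n))\<rparr> i"

end

theory Submission imports Defs
begin

text \<open>In the category of presentations the identity of \<open>A\<close> is weakly initial and has copowers. An injective
  functor is a retract of a cofree one, and on a cofree functor the cosimplicial object of these
  copowers has a contraction; hence, comparing an injective resolution with the copowers through a
  double complex, \<open>lim\<^sup>i\<close> of any functor is the cohomology of its normalized cosimplicial complex.

  At level \<open>n\<close> the relations are the tuples \<open>(a\<^sub>0, \<dots>, a\<^sub>n)\<close> with sum zero. A monotone surjection \<open>\<sigma>\<close> onto
  \<open>{0, 1}\<close> sends such a tuple to the partial sum of the \<open>a\<^sub>i\<close> with \<open>\<sigma> i = 0\<close>, and these surjections index
  \<open>K(A\<^sup>\<or>, 1)\<^sub>n\<close>. The resulting perfect pairing of \<open>K(A\<^sup>\<or>, 1)\<^sub>n\<close> with the relations is natural for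
  monotone maps, so \<open>\<Phi>\<close> of the relations is dual to \<open>\<Phi>\<^sup>#(K(A\<^sup>\<or>, 1))\<close> by reflexivity. Evaluation
  identifies the normalized cochains with the dual of the Moore complex, and the universal
  coefficient theorem gives the short exact sequence.\<close>

section \<open>Linear maps, submodules and quotients\<close>

text \<open>The statement quantifies over all injective resolutions with values over the fixed type
  \<open>'w\<close>, so no convenient resolution may be chosen. Injectivity can only be tested
  against functors over \<open>'w\<close>; the cofree functor has to be coded there, which is what
  the closure hypothesis on \<open>'w\<close> provides. Weak initiality of the identity of
  \<open>A\<close> is projectivity of \<open>A\<close>, and for the identity to be a presentation at
  all \<open>A\<close> must be free. The other obstacle lies in the exact sequence:
  \<open>diamond\<close> is the cokernel for the canonical presentation, free on all elements of a
  homology module, while dualizing a complex yields the cokernel for the presentation by cycles and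
  boundaries. Over a principal ideal domain the cycles are projective, so each presentation maps to
  the other, and these two maps replace a general theory of Ext. Finally, functors accept modules
  over one fixed type only, so powers and duals enter as coded copies. That the dual of
  \<open>K(A^v, 1)\<close> has codes in \<open>'u\<close> is itself a consequence of its duality
  with tuples in \<open>A\<close>.\<close>

definition lin ::
  "'k ring \<Rightarrow> ('k, 'a) module \<Rightarrow> ('k, 'b) module \<Rightarrow> ('a \<Rightarrow> 'b) \<Rightarrow> bool" where
  "lin K M N f \<longleftrightarrow>
     (\<forall>x\<in>carrier M. f x \<in> carrier N) \<and>
     (\<forall>x\<in>carrier M. \<forall>y\<in>carrier M. f (x \<oplus>\<^bsub>M\<^esub> y) = f x \<oplus>\<^bsub>N\<^esub> f y) \<and>
     (\<forall>a\<in>carrier K. \<forall>x\<in>carrier M. f (a \<odot>\<^bsub>M\<^esub> x) = a \<odot>\<^bsub>N\<^esub> f x)"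

definition submod :: "'k ring \<Rightarrow> ('k, 'a) module \<Rightarrow> 'a set \<Rightarrow> bool" where
  "submod K M S \<longleftrightarrow> S \<subseteq> carrier M \<and> \<zero>\<^bsub>M\<^esub> \<in> S \<and>
     (\<forall>x\<in>S. \<forall>y\<in>S. x \<oplus>\<^bsub>M\<^esub> y \<in> S) \<and> (\<forall>a\<in>carrier K. \<forall>x\<in>S. a \<odot>\<^bsub>M\<^esub> x \<in> S)"

lemma mk_module_sel [simp]:
  "carrier (mk_module C z p s) = C" "\<zero>\<^bsub>mk_module C z p s\<^esub> = z"
  "add (mk_module C z p s) = p" "smult (mk_module C z p s) = s"
  by (simp_all add: mk_module_def)

lemma self_module_sel [simp]:
  "carrier (self_module K) = carrier K" "\<zero>\<^bsub>self_module K\<^esub> = \<zero>\<^bsub>K\<^esub>"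
  "add (self_module K) = add K" "smult (self_module K) = mult K"
  by (simp_all add: self_module_def)

lemma zero_module_sel [simp]:
  "carrier zero_module = {undefined}" "\<zero>\<^bsub>zero_module\<^esub> = undefined"
  "x \<oplus>\<^bsub>zero_module\<^esub> y = undefined" "a \<odot>\<^bsub>zero_module\<^esub> x = undefined"
  by (simp_all add: zero_module_def)

lemma prod_module_sel [simp]:
  "carrier (prod_module I M) = (\<Pi>\<^sub>E i\<in>I. carrier (M i))"
  "\<zero>\<^bsub>prod_module I M\<^esub> = (\<lambda>i\<in>I. \<zero>\<^bsub>M i\<^esub>)"
  "x \<oplus>\<^bsub>prod_module I M\<^esub> y = (\<lambda>i\<in>I. x i \<oplus>\<^bsub>M i\<^esub> y i)"
  "a \<odot>\<^bsub>prod_module I M\<^esub> x = (\<lambda>i\<in>I. a \<odot>\<^bsub>M i\<^esub> x i)"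
  by (simp_all add: prod_module_def)

lemma hom_module_sel [simp]:
  "carrier (hom_module K M N) = mod_hom K M N"
  "\<zero>\<^bsub>hom_module K M N\<^esub> = (\<lambda>x\<in>carrier M. \<zero>\<^bsub>N\<^esub>)"
  "f \<oplus>\<^bsub>hom_module K M N\<^esub> g = (\<lambda>x\<in>carrier M. f x \<oplus>\<^bsub>N\<^esub> g x)"
  "a \<odot>\<^bsub>hom_module K M N\<^esub> f = (\<lambda>x\<in>carrier M. a \<odot>\<^bsub>N\<^esub> f x)"
  by (simp_all add: hom_module_def)

lemma dual_module_sel [simp]:
  "carrier (dual_module K M) = mod_hom K M (self_module K)"
  "\<zero>\<^bsub>dual_module K M\<^esub> = (\<lambda>x\<in>carrier M. \<zero>\<^bsub>K\<^esub>)"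
  "f \<oplus>\<^bsub>dual_module K M\<^esub> g = (\<lambda>x\<in>carrier M. f x \<oplus>\<^bsub>K\<^esub> g x)"
  "a \<odot>\<^bsub>dual_module K M\<^esub> f = (\<lambda>x\<in>carrier M. a \<otimes>\<^bsub>K\<^esub> f x)"
  by (simp_all add: dual_module_def)

text \<open>Calculations use \<open>lin\<close>, which does not ask for extensionality: lambda terms
  can then be composed and added without restrictions. Extensionality returns only where a map has
  to be an element of \<open>mod_hom\<close>.\<close>

lemma mod_hom_iff: "f \<in> mod_hom K M N \<longleftrightarrow> lin K M N f \<and> f \<in> extensional (carrier M)"
  by (auto simp: mod_hom_def lin_def PiE_def Pi_def)

lemma mod_hom_lin: "f \<in> mod_hom K M N \<Longrightarrow> lin K M N f"
  by (simp add: mod_hom_iff)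

lemma mod_hom_undefined: "f \<in> mod_hom K M N \<Longrightarrow> x \<notin> carrier M \<Longrightarrow> f x = undefined"
  by (auto simp: mod_hom_iff extensional_def)

lemma mod_hom_eqI:
  "f \<in> mod_hom K M N \<Longrightarrow> g \<in> mod_hom K M N' \<Longrightarrow> (\<And>x. x \<in> carrier M \<Longrightarrow> f x = g x) \<Longrightarrow> f = g"
  unfolding mod_hom_iff by (blast intro: extensionalityI)

lemma lin_closed: "lin K M N f \<Longrightarrow> x \<in> carrier M \<Longrightarrow> f x \<in> carrier N"
  and lin_add: "lin K M N f \<Longrightarrow> x \<in> carrier M \<Longrightarrow> y \<in> carrier M \<Longrightarrow> f (x \<oplus>\<^bsub>M\<^esub> y) = f x \<oplus>\<^bsub>N\<^esub> f y"
  and lin_smult: "lin K M N f \<Longrightarrow> a \<in> carrier K \<Longrightarrow> x \<in> carrier M \<Longrightarrow> f (a \<odot>\<^bsub>M\<^esub> x) = a \<odot>\<^bsub>N\<^esub> f x"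
  by (auto simp: lin_def)

lemma linI:
  assumes "\<And>x. x \<in> carrier M \<Longrightarrow> f x \<in> carrier N"
    and "\<And>x y. x \<in> carrier M \<Longrightarrow> y \<in> carrier M \<Longrightarrow> f (x \<oplus>\<^bsub>M\<^esub> y) = f x \<oplus>\<^bsub>N\<^esub> f y"
    and "\<And>a x. a \<in> carrier K \<Longrightarrow> x \<in> carrier M \<Longrightarrow> f (a \<odot>\<^bsub>M\<^esub> x) = a \<odot>\<^bsub>N\<^esub> f x"
  shows "lin K M N f"
  using assms by (auto simp: lin_def)

lemma module_cring: "module K M \<Longrightarrow> cring K"
  by (simp add: module_def)

lemma module_abelian_group: "module K M \<Longrightarrow> abelian_group M"
  by (simp add: module_def)

lemma lin_cong:
  assumes "module K M" "\<And>x. x \<in> carrier M \<Longrightarrow> f x = g x"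
  shows "lin K M N f \<longleftrightarrow> lin K M N g"
proof -
  interpret module K M by fact
  show ?thesis using assms(2) by (auto simp: lin_def)
qed

lemma lin_restrict: "module K M \<Longrightarrow> lin K M N (restrict f (carrier M)) \<longleftrightarrow> lin K M N f"
  by (rule lin_cong) auto

lemma restrict_mod_hom: "module K M \<Longrightarrow> lin K M N f \<Longrightarrow> restrict f (carrier M) \<in> mod_hom K M N"
  by (simp add: mod_hom_iff lin_restrict)

lemma lin_zero:
  assumes "module K M" "module K N" "lin K M N f"
  shows "f \<zero>\<^bsub>M\<^esub> = \<zero>\<^bsub>N\<^esub>"
proof -
  interpret M: module K M by fact
  interpret N: module K N by fact
  have "f (\<zero>\<^bsub>K\<^esub> \<odot>\<^bsub>M\<^esub> \<zero>\<^bsub>M\<^esub>) = \<zero>\<^bsub>K\<^esub> \<odot>\<^bsub>N\<^esub> f \<zero>\<^bsub>M\<^esub>"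
    by (rule lin_smult[OF assms(3)]) auto
  thus ?thesis using lin_closed[OF assms(3), of "\<zero>\<^bsub>M\<^esub>"] by simp
qed

lemma module_uminus:
  assumes "module K M" "x \<in> carrier M"
  shows "(\<ominus>\<^bsub>K\<^esub> \<one>\<^bsub>K\<^esub>) \<odot>\<^bsub>M\<^esub> x = \<ominus>\<^bsub>M\<^esub> x"
proof -
  interpret M: module K M by fact
  show ?thesis using assms(2) by (simp add: M.smult_l_minus)
qed

lemma lin_uminus:
  assumes "module K M" "module K N" "lin K M N f" "x \<in> carrier M"
  shows "f (\<ominus>\<^bsub>M\<^esub> x) = \<ominus>\<^bsub>N\<^esub> f x"
proof -
  interpret M: module K M by fact
  show ?thesis
    using lin_smult[OF assms(3), of "\<ominus>\<^bsub>K\<^esub> \<one>\<^bsub>K\<^esub>" x] assms(4) lin_closed[OF assms(3)]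
    by (simp add: module_uminus[OF assms(1)] module_uminus[OF assms(2)])
qed

lemma lin_diff:
  assumes "module K M" "module K N" "lin K M N f" "x \<in> carrier M" "y \<in> carrier M"
  shows "f (x \<ominus>\<^bsub>M\<^esub> y) = f x \<ominus>\<^bsub>N\<^esub> f y"
proof -
  interpret M: module K M by fact
  show ?thesis
    using assms by (simp add: a_minus_def lin_add[OF assms(3)] lin_uminus[OF assms(1-3)])
qed

lemma lin_comp: "lin K M N f \<Longrightarrow> lin K N P g \<Longrightarrow> lin K M P (\<lambda>x. g (f x))"
  by (simp add: lin_def)

lemma lin_ident: "lin K M M (\<lambda>x. x)"
  by (simp add: lin_def)

lemma lin_const_zero: "module K N \<Longrightarrow> lin K M N (\<lambda>x. \<zero>\<^bsub>N\<^esub>)"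
proof -
  assume "module K N"
  then interpret N: module K N .
  show ?thesis by (simp add: lin_def)
qed

lemma lin_plus:
  assumes "module K N" "lin K M N f" "lin K M N g"
  shows "lin K M N (\<lambda>x. f x \<oplus>\<^bsub>N\<^esub> g x)"
proof -
  interpret N: module K N by fact
  note [simp] = lin_closed[OF assms(2)] lin_closed[OF assms(3)]
  show ?thesis
    by (rule linI) (auto simp: lin_add[OF assms(2)] lin_add[OF assms(3)] lin_smult[OF assms(2)]
        lin_smult[OF assms(3)] N.smult_r_distr N.a_ac)
qed

lemma lin_scale:
  assumes "module K N" "lin K M N f" "a \<in> carrier K"
  shows "lin K M N (\<lambda>x. a \<odot>\<^bsub>N\<^esub> f x)"
proof -
  interpret N: module K N by fact
  note [simp] = lin_closed[OF assms(2)] assms(3)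
  show ?thesis
    by (rule linI) (auto simp: lin_add[OF assms(2)] lin_smult[OF assms(2)] N.smult_r_distr
       N.smult_assoc1[symmetric] N.R.m_comm)
qed

lemma lin_neg:
  assumes "module K M" "module K N" "lin K M N f"
  shows "lin K M N (\<lambda>x. \<ominus>\<^bsub>N\<^esub> f x)"
proof -
  interpret N: module K N by fact
  have "lin K M N (\<lambda>x. (\<ominus>\<^bsub>K\<^esub> \<one>\<^bsub>K\<^esub>) \<odot>\<^bsub>N\<^esub> f x)"
    by (rule lin_scale) (use assms in auto)
  thus ?thesis
    by (subst lin_cong[OF assms(1)])
      (auto simp: module_uminus[OF assms(2)] lin_closed[OF assms(3)])
qed

lemma lin_minus:
  assumes "module K M" "module K N" "lin K M N f" "lin K M N g"
  shows "lin K M N (\<lambda>x. f x \<ominus>\<^bsub>N\<^esub> g x)"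
  unfolding a_minus_def by (intro lin_plus lin_neg assms)

lemma lin_scale_by:
  assumes "module K M" "module K N" "lin K M (self_module K) c" "s \<in> carrier N"
  shows "lin K M N (\<lambda>x. c x \<odot>\<^bsub>N\<^esub> s)"
proof -
  interpret N: module K N by fact
  have c: "c x \<in> carrier K" if "x \<in> carrier M" for x using lin_closed[OF assms(3) that] by simp
  show ?thesis
    using assms(4) by (intro linI) (auto simp: c lin_add[OF assms(3)] lin_smult[OF assms(3)]
        N.smult_l_distr N.smult_assoc1)
qed

lemma lin_finsum:
  assumes "module K M" "module K N" "lin K M N f" "finite I" "\<And>i. i \<in> I \<Longrightarrow> x i \<in> carrier M"
  shows "f (finsum M x I) = finsum N (\<lambda>i. f (x i)) I"
  using assms(4,5)
proof (induction I rule: finite_induct)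
  case empty
  interpret M: module K M by fact
  interpret N: module K N by fact
  show ?case by (simp add: lin_zero[OF assms(1-3)])
next
  case (insert i I)
  interpret M: module K M by fact
  interpret N: module K N by fact
  have "finsum M x I \<in> carrier M" by (rule M.finsum_closed) (use insert in auto)
  then show ?case using insert lin_closed[OF assms(3)]
    by (simp add: Pi_def lin_add[OF assms(3)])
qed

lemma lin_sum:
  assumes "module K M" "module K N" "finite I" "\<And>i. i \<in> I \<Longrightarrow> lin K M N (f i)"
  shows "lin K M N (\<lambda>x. finsum N (\<lambda>i. f i x) I)"
  using assms(3,4)
proof (induction I rule: finite_induct)
  case empty
  interpret N: module K N by fact
  show ?case by (simp add: lin_const_zero[OF assms(2)])
next
  case (insert i I)
  interpret N: module K N by fact
  have "lin K M N (\<lambda>x. f i x \<oplus>\<^bsub>N\<^esub> finsum N (\<lambda>i. f i x) I)"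
    by (rule lin_plus) (use assms insert in auto)
  moreover have "finsum N (\<lambda>i. f i x) (insert i I) = f i x \<oplus>\<^bsub>N\<^esub> finsum N (\<lambda>i. f i x) I"
    if "x \<in> carrier M" for x
    using insert that by (intro N.finsum_insert) (auto intro: lin_closed)
  ultimately show ?case by (subst lin_cong[OF assms(1)])
qed

lemma lin_proj:
  assumes "i \<in> I" shows "lin K (prod_module I M) (M i) (\<lambda>x. x i)"
  using assms by (auto simp: lin_def)

lemma lin_into_prod:
  assumes "module K X" "\<And>i. i \<in> I \<Longrightarrow> lin K X (M i) (\<lambda>x. f x i)"
  shows "lin K X (prod_module I M) (\<lambda>x. \<lambda>i\<in>I. f x i)"
  by (rule linI) (auto simp: restrict_def fun_eq_iff lin_add[OF assms(2)] lin_smult[OF assms(2)]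
      intro: lin_closed[OF assms(2)])

lemma lin_inv:
  assumes "module K M" "lin K M N f" "bij_betw f (carrier M) (carrier N)"
  shows "lin K N M (inv_into (carrier M) f)"
proof -
  interpret M: module K M by fact
  have im: "f ` carrier M = carrier N" and inj: "inj_on f (carrier M)"
    using assms(3) by (auto simp: bij_betw_def)
  have cl: "inv_into (carrier M) f y \<in> carrier M" if "y \<in> carrier N" for y
    using that im by (metis inv_into_into)
  have r: "f (inv_into (carrier M) f y) = y" if "y \<in> carrier N" for y
    using that im by (metis f_inv_into_f)
  have l: "inv_into (carrier M) f (f x) = x" if "x \<in> carrier M" for x
    using that inj by simp
  show ?thesis
  proof (rule linI)
    fix x y assume x: "x \<in> carrier N" and y: "y \<in> carrier N"
    have "x \<oplus>\<^bsub>N\<^esub> y = f (inv_into (carrier M) f x \<oplus>\<^bsub>M\<^esub> inv_into (carrier M) f y)"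
      using x y by (simp add: lin_add[OF assms(2)] cl r)
    thus "inv_into (carrier M) f (x \<oplus>\<^bsub>N\<^esub> y) = inv_into (carrier M) f x \<oplus>\<^bsub>M\<^esub> inv_into (carrier M) f y"
      using x y by (simp add: l cl)
  next
    fix a x assume a: "a \<in> carrier K" and x: "x \<in> carrier N"
    have "a \<odot>\<^bsub>N\<^esub> x = f (a \<odot>\<^bsub>M\<^esub> inv_into (carrier M) f x)"
      using a x by (simp add: lin_smult[OF assms(2)] cl r)
    thus "inv_into (carrier M) f (a \<odot>\<^bsub>N\<^esub> x) = a \<odot>\<^bsub>M\<^esub> inv_into (carrier M) f x"
      using a x by (simp add: l cl)
  qed (rule cl)
qed

lemma module_minus_eq_zero_iff:
  assumes "module K M" "x \<in> carrier M" "y \<in> carrier M"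
  shows "x \<ominus>\<^bsub>M\<^esub> y = \<zero>\<^bsub>M\<^esub> \<longleftrightarrow> x = y"
proof -
  interpret M: module K M by fact
  have "x = (x \<ominus>\<^bsub>M\<^esub> y) \<oplus>\<^bsub>M\<^esub> y" using assms(2,3) by (simp add: M.minus_eq M.a_assoc M.l_neg)
  thus ?thesis using assms(2,3) by (auto simp: M.minus_eq M.r_neg)
qed

lemma lin_inj_on:
  assumes "module K M" "module K N" "lin K M N f"
    and "\<And>x. x \<in> carrier M \<Longrightarrow> f x = \<zero>\<^bsub>N\<^esub> \<Longrightarrow> x = \<zero>\<^bsub>M\<^esub>"
  shows "inj_on f (carrier M)"
proof (rule inj_onI)
  interpret M: module K M by fact
  interpret N: module K N by fact
  fix x y assume *: "x \<in> carrier M" "y \<in> carrier M" "f x = f y"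
  have "f (x \<ominus>\<^bsub>M\<^esub> y) = \<zero>\<^bsub>N\<^esub>"
    using * lin_closed[OF assms(3)] by (simp add: lin_diff[OF assms(1-3)] N.r_neg N.minus_eq)
  with assms(4)[of "x \<ominus>\<^bsub>M\<^esub> y"] * show "x = y"
    by (simp add: module_minus_eq_zero_iff[OF assms(1)])
qed

subsection \<open>Constructing modules\<close>

text \<open>The axioms pass along a surjection compatible with the operations. Quotients, coded
  copies and Hom modules arise as such images, since their operations are defined through
  representatives, codes or another record.\<close>

lemma module_image:
  assumes "module K M" and im: "f ` carrier M = carrier N"
    and add: "\<And>x y. x \<in> carrier M \<Longrightarrow> y \<in> carrier M \<Longrightarrow> f x \<oplus>\<^bsub>N\<^esub> f y = f (x \<oplus>\<^bsub>M\<^esub> y)"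
    and sm: "\<And>a x. a \<in> carrier K \<Longrightarrow> x \<in> carrier M \<Longrightarrow> a \<odot>\<^bsub>N\<^esub> f x = f (a \<odot>\<^bsub>M\<^esub> x)"
    and zero: "f \<zero>\<^bsub>M\<^esub> = \<zero>\<^bsub>N\<^esub>"
  shows "module K N"
proof -
  interpret M: module K M by fact
  have ex: "\<exists>u\<in>carrier M. x = f u" if "x \<in> carrier N" for x using that im by blast
  have cl: "f x \<in> carrier N" if "x \<in> carrier M" for x using that im by blast
  show ?thesis
  proof (rule moduleI)
    show "abelian_group N"
    proof (rule abelian_groupI)
      show "\<zero>\<^bsub>N\<^esub> \<in> carrier N" using cl[OF M.zero_closed] zero by simp
    next
      fix x assume "x \<in> carrier N"
      then obtain u where u: "u \<in> carrier M" "x = f u" using ex by blast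
      show "\<zero>\<^bsub>N\<^esub> \<oplus>\<^bsub>N\<^esub> x = x"
        using u add[OF M.zero_closed u(1)] by (simp add: zero)
      show "\<exists>y\<in>carrier N. y \<oplus>\<^bsub>N\<^esub> x = \<zero>\<^bsub>N\<^esub>"
        by (rule bexI[of _ "f (\<ominus>\<^bsub>M\<^esub> u)"]) (use u in \<open>auto simp: add M.l_neg zero cl\<close>)
    qed (auto dest!: ex simp: add cl M.a_assoc intro: M.a_comm[THEN arg_cong[where f=f]])
  qed (auto dest!: ex simp: add cl sm M.smult_l_distr M.smult_r_distr M.smult_assoc1 M.is_cring)
qed

lemma module_self: "cring K \<Longrightarrow> module K (self_module K)"
proof -
  assume "cring K"
  then interpret K: cring K .
  show ?thesis
  proof (rule moduleI)
    show "abelian_group (self_module K)"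
    proof (rule abelian_groupI)
      show "\<exists>y\<in>carrier (self_module K). y \<oplus>\<^bsub>self_module K\<^esub> x = \<zero>\<^bsub>self_module K\<^esub>"
        if "x \<in> carrier (self_module K)" for x
        by (rule bexI[of _ "\<ominus>\<^bsub>K\<^esub> x"]) (use that in \<open>auto simp: K.l_neg\<close>)
    qed (auto simp: K.a_ac)
  qed (auto simp: K.l_distr K.r_distr K.m_assoc K.is_cring)
qed

lemma module_zero: "cring K \<Longrightarrow> module K zero_module"
  by (rule moduleI) (auto intro!: abelian_groupI)

lemma module_prod:
  assumes "cring K" "\<And>i. i \<in> I \<Longrightarrow> module K (M i)"
  shows "module K (prod_module I M)"
proof -
  interpret K: cring K by fact
  have g: "abelian_group (M i)" if "i \<in> I" for i using assms(2)[OF that] by (rule module_abelian_group)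
  have g': "abelian_monoid (M i)" if "i \<in> I" for i using g[OF that] by (simp add: abelian_group_def)
  show ?thesis
  proof (rule moduleI)
    show "abelian_group (prod_module I M)"
    proof (rule abelian_groupI)
      show "\<exists>y\<in>carrier (prod_module I M). y \<oplus>\<^bsub>prod_module I M\<^esub> x = \<zero>\<^bsub>prod_module I M\<^esub>"
        if "x \<in> carrier (prod_module I M)" for x
        by (rule bexI[of _ "\<lambda>i\<in>I. \<ominus>\<^bsub>M i\<^esub> x i"])
          (use that g in \<open>auto simp: abelian_group.l_neg PiE_iff fun_eq_iff restrict_def
            extensional_def intro: abelian_group.a_inv_closed\<close>)
    qed (auto simp: g' g abelian_monoid.a_closed abelian_monoid.a_assoc abelian_monoid.a_comm[OF g']
        abelian_monoid.zero_closed abelian_monoid.l_zero PiE_iff fun_eq_iff restrict_def extensional_def)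
  qed (use assms in \<open>auto simp: PiE_iff fun_eq_iff restrict_def extensional_def module.smult_closed[OF assms(2)]
     module.smult_l_distr[OF assms(2)] module.smult_r_distr[OF assms(2)] module.smult_assoc1[OF assms(2)]
     module.smult_one[OF assms(2)]\<close>)
qed

lemma submodI:
  assumes "S \<subseteq> carrier M" "\<zero>\<^bsub>M\<^esub> \<in> S" "\<And>x y. x \<in> S \<Longrightarrow> y \<in> S \<Longrightarrow> x \<oplus>\<^bsub>M\<^esub> y \<in> S"
    "\<And>a x. a \<in> carrier K \<Longrightarrow> x \<in> S \<Longrightarrow> a \<odot>\<^bsub>M\<^esub> x \<in> S"
  shows "submod K M S"
  using assms by (auto simp: submod_def)

lemma submod_uminus:
  assumes "module K M" "submod K M S" "x \<in> S"
  shows "\<ominus>\<^bsub>M\<^esub> x \<in> S"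
proof -
  interpret M: module K M by fact
  have "(\<ominus>\<^bsub>K\<^esub> \<one>\<^bsub>K\<^esub>) \<odot>\<^bsub>M\<^esub> x \<in> S" using assms(2,3) by (simp add: submod_def)
  thus ?thesis using assms by (simp add: module_uminus[OF assms(1)] submod_def subset_iff)
qed

lemma submod_diff:
  assumes "module K M" "submod K M S" "x \<in> S" "y \<in> S"
  shows "x \<ominus>\<^bsub>M\<^esub> y \<in> S"
  using submod_uminus[OF assms(1,2,4)] assms(2,3) by (simp add: a_minus_def submod_def)

lemma submod_closed: "submod K M S \<Longrightarrow> x \<in> S \<Longrightarrow> x \<in> carrier M"
  by (auto simp: submod_def)

lemma module_submod:
  assumes "module K M" "submod K M S"
  shows "module K (M\<lparr>carrier := S\<rparr>)"
proof -
  interpret M: module K M by fact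
  have S: "\<And>x. x \<in> S \<Longrightarrow> x \<in> carrier M" using assms(2) by (auto simp: submod_def)
  show ?thesis
  proof (rule moduleI)
    show "abelian_group (M\<lparr>carrier := S\<rparr>)"
    proof (rule abelian_groupI)
      show "\<exists>y\<in>carrier (M\<lparr>carrier := S\<rparr>). y \<oplus>\<^bsub>M\<lparr>carrier := S\<rparr>\<^esub> x = \<zero>\<^bsub>M\<lparr>carrier := S\<rparr>\<^esub>"
        if "x \<in> carrier (M\<lparr>carrier := S\<rparr>)" for x
        by (rule bexI[of _ "\<ominus>\<^bsub>M\<^esub> x"])
          (use that submod_uminus[OF assms] S in \<open>auto simp: M.l_neg\<close>)
    qed (use assms(2) in \<open>auto simp: submod_def S M.a_ac\<close>)
  qed (use assms(2) in \<open>auto simp: submod_def S M.is_cring M.smult_l_distr M.smult_r_distr M.smult_assoc1\<close>)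
qed

lemma submod_carrier: "module K M \<Longrightarrow> submod K M (carrier M)"
proof -
  assume "module K M"
  then interpret module K M .
  show ?thesis by (rule submodI) auto
qed

lemma submod_zero: "module K M \<Longrightarrow> submod K M {\<zero>\<^bsub>M\<^esub>}"
proof -
  assume "module K M"
  then interpret module K M .
  show ?thesis by (rule submodI) auto
qed

lemma submod_inter: "submod K M S \<Longrightarrow> submod K M T \<Longrightarrow> submod K M (S \<inter> T)"
  by (auto simp: submod_def)

lemma submod_restrict: "submod K M S \<Longrightarrow> S \<subseteq> T \<Longrightarrow> submod K (M\<lparr>carrier := T\<rparr>) S"
  by (auto simp: submod_def)

lemma submod_kernel:
  assumes "module K M" "module K N" "lin K M N f"
  shows "submod K M {x \<in> carrier M. f x = \<zero>\<^bsub>N\<^esub>}"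
proof -
  interpret M: module K M by fact
  interpret N: module K N by fact
  show ?thesis
    by (rule submodI) (auto simp: lin_zero[OF assms] lin_add[OF assms(3)] lin_smult[OF assms(3)])
qed

lemma submod_image:
  assumes "module K M" "module K N" "lin K M N f" "submod K M S"
  shows "submod K N (f ` S)"
proof (rule submodI)
  have S: "\<And>x. x \<in> S \<Longrightarrow> x \<in> carrier M" using assms(4) by (auto simp: submod_def)
  show "f ` S \<subseteq> carrier N" using S lin_closed[OF assms(3)] by auto
  show "\<zero>\<^bsub>N\<^esub> \<in> f ` S"
    using lin_zero[OF assms(1-3)] assms(4) by (metis image_eqI submod_def)
  show "x \<oplus>\<^bsub>N\<^esub> y \<in> f ` S" if "x \<in> f ` S" "y \<in> f ` S" for x y
  proof -
    from that obtain u v where u: "u \<in> S" "v \<in> S" "x = f u" "y = f v" by blast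
    hence "x \<oplus>\<^bsub>N\<^esub> y = f (u \<oplus>\<^bsub>M\<^esub> v)" using S by (simp add: lin_add[OF assms(3)])
    thus ?thesis using u assms(4) by (auto simp: submod_def)
  qed
  show "a \<odot>\<^bsub>N\<^esub> x \<in> f ` S" if "a \<in> carrier K" "x \<in> f ` S" for a x
  proof -
    from that obtain u where u: "u \<in> S" "x = f u" by blast
    hence "a \<odot>\<^bsub>N\<^esub> x = f (a \<odot>\<^bsub>M\<^esub> u)" using S that by (simp add: lin_smult[OF assms(3)])
    thus ?thesis using u that assms(4) by (auto simp: submod_def)
  qed
qed

lemma lin_sub_dom: "lin K M N f \<Longrightarrow> S \<subseteq> carrier M \<Longrightarrow> lin K (M\<lparr>carrier := S\<rparr>) N f"
  by (simp add: lin_def subset_iff)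

lemma lin_sub_cod:
  "lin K M N f \<Longrightarrow> (\<And>x. x \<in> carrier M \<Longrightarrow> f x \<in> S) \<Longrightarrow> lin K M (N\<lparr>carrier := S\<rparr>) f"
  by (auto simp: lin_def)

lemma lin_incl: "lin K M (N\<lparr>carrier := S\<rparr>) f \<Longrightarrow> S \<subseteq> carrier N \<Longrightarrow> lin K M N f"
  by (auto simp: lin_def)

lemma mod_hom_closed: "f \<in> mod_hom K M N \<Longrightarrow> x \<in> carrier M \<Longrightarrow> f x \<in> carrier N"
  by (auto simp: mod_hom_def)

text \<open>Extensional functions on the carrier of \<open>M\<close> are the elements of a product
  of copies of \<open>N\<close>, and the linear ones form a submodule of it. The final image along
  the identity only changes the record.\<close>

lemma module_hom:
  assumes "module K M" "module K N"
  shows "module K (hom_module K M N)"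
proof -
  interpret M: module K M by fact
  interpret N: module K N by fact
  let ?P = "prod_module (carrier M) (\<lambda>_. N)"
  have P: "module K ?P" by (rule module_prod) (use M.is_cring assms in auto)
  have S: "submod K ?P (mod_hom K M N)"
  proof (rule submodI)
    show "mod_hom K M N \<subseteq> carrier ?P" by (auto simp: mod_hom_def)
    show "\<zero>\<^bsub>?P\<^esub> \<in> mod_hom K M N"
      using restrict_mod_hom[OF assms(1) lin_const_zero[OF assms(2)]] by simp
    show "x \<oplus>\<^bsub>?P\<^esub> y \<in> mod_hom K M N" if "x \<in> mod_hom K M N" "y \<in> mod_hom K M N" for x y
      using restrict_mod_hom[OF assms(1) lin_plus[OF assms(2) that[THEN mod_hom_lin]]] by simp
    show "a \<odot>\<^bsub>?P\<^esub> x \<in> mod_hom K M N" if "a \<in> carrier K" "x \<in> mod_hom K M N" for a x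
      using restrict_mod_hom[OF assms(1) lin_scale[OF assms(2) that(2)[THEN mod_hom_lin] that(1)]]
      by simp
  qed
  show ?thesis
    by (rule module_image[OF module_submod[OF P S], of "\<lambda>x. x"]) auto
qed

lemma module_dual: "module K M \<Longrightarrow> module K (dual_module K M)"
  unfolding dual_module_def by (intro module_hom module_self) (auto dest: module_cring)

lemma a_kernel_eq: "a_kernel M N f = {x \<in> carrier M. f x = \<zero>\<^bsub>N\<^esub>}"
  by (simp add: a_kernel_def')

subsection \<open>Quotient modules\<close>

lemma abelian_subgroup_submod:
  assumes "module K M" "submod K M S"
  shows "abelian_subgroup S M"
proof -
  interpret M: module K M by fact
  show ?thesis
  proof (rule abelian_subgroupI3)
    show "additive_subgroup S M"
      by (rule additive_subgroup.intro, rule M.add.subgroupI)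
        (use assms(2) submod_uminus[OF assms] in \<open>auto simp: submod_def a_inv_def\<close>)
  qed (rule M.abelian_group_axioms)
qed

lemma quot_module_sel:
  "carrier (quot_module M S) = {S +>\<^bsub>M\<^esub> x | x. x \<in> carrier M}"
  "\<zero>\<^bsub>quot_module M S\<^esub> = S"
  "X \<oplus>\<^bsub>quot_module M S\<^esub> Y = X <+>\<^bsub>M\<^esub> Y"
  "a \<odot>\<^bsub>quot_module M S\<^esub> X = (\<Union>x\<in>X. S +>\<^bsub>M\<^esub> (a \<odot>\<^bsub>M\<^esub> x))"
  by (auto simp: quot_module_def A_RCOSETS_def')

lemma coset_mem_iff:
  assumes "module K M" "submod K M S" "x \<in> carrier M"
  shows "y \<in> S +>\<^bsub>M\<^esub> x \<longleftrightarrow> y \<in> carrier M \<and> y \<ominus>\<^bsub>M\<^esub> x \<in> S"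
proof -
  interpret M: module K M by fact
  have S: "\<And>s. s \<in> S \<Longrightarrow> s \<in> carrier M" using assms(2) by (auto simp: submod_def)
  have 1: "(s \<oplus>\<^bsub>M\<^esub> x) \<ominus>\<^bsub>M\<^esub> x = s" if "s \<in> S" for s
    using S[OF that] assms(3) by (simp add: a_minus_def M.a_assoc M.r_neg)
  have 2: "y = (y \<ominus>\<^bsub>M\<^esub> x) \<oplus>\<^bsub>M\<^esub> x" if "y \<in> carrier M"
    using that assms(3) by (simp add: a_minus_def M.a_assoc M.l_neg)
  show ?thesis
    using S assms(3) 1 2 by (auto simp: a_r_coset_def') 
qed

lemma coset_eq_iff:
  assumes "module K M" "submod K M S" "x \<in> carrier M" "y \<in> carrier M"
  shows "S +>\<^bsub>M\<^esub> x = S +>\<^bsub>M\<^esub> y \<longleftrightarrow> x \<ominus>\<^bsub>M\<^esub> y \<in> S"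
proof
  interpret M: module K M by fact
  have S: "\<And>s. s \<in> S \<Longrightarrow> s \<in> carrier M" using assms(2) by (auto simp: submod_def)
  assume "S +>\<^bsub>M\<^esub> x = S +>\<^bsub>M\<^esub> y"
  moreover have "x \<in> S +>\<^bsub>M\<^esub> x"
    using assms by (simp add: coset_mem_iff a_minus_def M.r_neg submod_def)
  ultimately show "x \<ominus>\<^bsub>M\<^esub> y \<in> S" using assms by (simp add: coset_mem_iff)
next
  interpret M: module K M by fact
  assume d: "x \<ominus>\<^bsub>M\<^esub> y \<in> S"
  have 1: "z \<ominus>\<^bsub>M\<^esub> y = (z \<ominus>\<^bsub>M\<^esub> x) \<oplus>\<^bsub>M\<^esub> (x \<ominus>\<^bsub>M\<^esub> y)" if "z \<in> carrier M" for z
    using that assms(3,4) by (simp add: a_minus_def M.a_assoc M.r_neg1 M.r_neg2)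
  have 2: "z \<ominus>\<^bsub>M\<^esub> x = (z \<ominus>\<^bsub>M\<^esub> y) \<oplus>\<^bsub>M\<^esub> (y \<ominus>\<^bsub>M\<^esub> x)" if "z \<in> carrier M" for z
    using that assms(3,4) by (simp add: a_minus_def M.a_assoc M.r_neg1 M.r_neg2)
  have "y \<ominus>\<^bsub>M\<^esub> x = \<ominus>\<^bsub>M\<^esub> (x \<ominus>\<^bsub>M\<^esub> y)"
    using assms(3,4) by (simp add: a_minus_def M.minus_add M.a_comm)
  hence d': "y \<ominus>\<^bsub>M\<^esub> x \<in> S" using submod_uminus[OF assms(1,2) d] by simp
  show "S +>\<^bsub>M\<^esub> x = S +>\<^bsub>M\<^esub> y"
  proof (rule Set.set_eqI)
    fix z
    show "z \<in> S +>\<^bsub>M\<^esub> x \<longleftrightarrow> z \<in> S +>\<^bsub>M\<^esub> y"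
      using assms(2) d d' 1[of z] 2[of z] unfolding submod_def
      by (simp only: coset_mem_iff[OF assms(1,2,3)] coset_mem_iff[OF assms(1,2,4)]) metis
  qed
qed

lemma coset_self: "module K M \<Longrightarrow> submod K M S \<Longrightarrow> x \<in> carrier M \<Longrightarrow> x \<in> S +>\<^bsub>M\<^esub> x"
proof -
  assume a: "module K M" "submod K M S" "x \<in> carrier M"
  interpret M: module K M by fact
  show ?thesis using a by (simp add: coset_mem_iff a_minus_def M.r_neg submod_def)
qed

lemma coset_zero_iff:
  assumes "module K M" "submod K M S" "x \<in> carrier M"
  shows "S +>\<^bsub>M\<^esub> x = S \<longleftrightarrow> x \<in> S"
proof -
  interpret M: module K M by fact
  have "S +>\<^bsub>M\<^esub> \<zero>\<^bsub>M\<^esub> = S" using assms(2) by (simp add: submod_def)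
  thus ?thesis using coset_eq_iff[OF assms M.zero_closed] assms(3)
    by (simp add: a_minus_def M.add.inv_one[folded a_inv_def])
qed

lemma coset_add:
  assumes "module K M" "submod K M S" "x \<in> carrier M" "y \<in> carrier M"
  shows "(S +>\<^bsub>M\<^esub> x) \<oplus>\<^bsub>quot_module M S\<^esub> (S +>\<^bsub>M\<^esub> y) = S +>\<^bsub>M\<^esub> (x \<oplus>\<^bsub>M\<^esub> y)"
  using abelian_subgroup.a_rcos_sum[OF abelian_subgroup_submod[OF assms(1,2)] assms(3,4)]
  by (simp add: quot_module_sel)

text \<open>Scaling in the quotient is a union over all representatives; the cosets in this union
  coincide, so it equals any one of them.\<close>

lemma coset_smult:
  assumes "module K M" "submod K M S" "a \<in> carrier K" "x \<in> carrier M"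
  shows "a \<odot>\<^bsub>quot_module M S\<^esub> (S +>\<^bsub>M\<^esub> x) = S +>\<^bsub>M\<^esub> (a \<odot>\<^bsub>M\<^esub> x)"
proof -
  interpret M: module K M by fact
  have "S +>\<^bsub>M\<^esub> (a \<odot>\<^bsub>M\<^esub> y) = S +>\<^bsub>M\<^esub> (a \<odot>\<^bsub>M\<^esub> x)" if "y \<in> S +>\<^bsub>M\<^esub> x" for y
  proof -
    have y: "y \<in> carrier M" "y \<ominus>\<^bsub>M\<^esub> x \<in> S" using that assms by (auto simp: coset_mem_iff)
    have "a \<odot>\<^bsub>M\<^esub> y \<ominus>\<^bsub>M\<^esub> a \<odot>\<^bsub>M\<^esub> x = a \<odot>\<^bsub>M\<^esub> (y \<ominus>\<^bsub>M\<^esub> x)"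
      using assms y by (simp add: a_minus_def M.smult_r_distr M.smult_r_minus)
    also have "\<dots> \<in> S" using assms y by (auto simp: submod_def)
    finally show ?thesis using assms y by (simp add: coset_eq_iff)
  qed
  hence "(\<Union>y\<in>S +>\<^bsub>M\<^esub> x. S +>\<^bsub>M\<^esub> (a \<odot>\<^bsub>M\<^esub> y)) = (\<Union>y\<in>S +>\<^bsub>M\<^esub> x. S +>\<^bsub>M\<^esub> (a \<odot>\<^bsub>M\<^esub> x))"
    by (rule SUP_cong[OF refl])
  also have "\<dots> = S +>\<^bsub>M\<^esub> (a \<odot>\<^bsub>M\<^esub> x)" using coset_self[OF assms(1,2,4)] by blast
  finally show ?thesis by (simp only: quot_module_sel)
qed

lemma lin_coset: "module K M \<Longrightarrow> submod K M S \<Longrightarrow> lin K M (quot_module M S) (\<lambda>x. S +>\<^bsub>M\<^esub> x)"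
  by (rule linI) (auto simp: coset_add coset_smult quot_module_sel(1))

lemma module_quot:
  assumes "module K M" "submod K M S"
  shows "module K (quot_module M S)"
proof -
  interpret M: module K M by fact
  show ?thesis
  proof (rule module_image[OF assms(1)])
    show "S +>\<^bsub>M\<^esub> \<zero>\<^bsub>M\<^esub> = \<zero>\<^bsub>quot_module M S\<^esub>"
      using coset_zero_iff[OF assms, of "\<zero>\<^bsub>M\<^esub>"] assms(2) by (simp add: submod_def quot_module_sel)
  qed (auto simp: coset_add[OF assms] coset_smult[OF assms] quot_module_sel(1))
qed

section \<open>Free modules\<close>

text \<open>In contrast to \<open>lin_comb\<close>, the vectors form an arbitrary family indexed by
  \<open>B\<close>, possibly with repetitions. As a function of \<open>c\<close> this is the linear
  map out of the free module on \<open>B\<close> that sends the unit vector at \<open>b\<close> to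
  \<open>f b\<close>.\<close>

definition fsum :: "'k ring \<Rightarrow> ('k, 'a) module \<Rightarrow> 'b set \<Rightarrow> ('b \<Rightarrow> 'a) \<Rightarrow> ('b \<Rightarrow> 'k) \<Rightarrow> 'a" where
  "fsum K M B f c = finsum M (\<lambda>b. c b \<odot>\<^bsub>M\<^esub> f b) {b\<in>B. c b \<noteq> \<zero>\<^bsub>K\<^esub>}"

lemma lin_comb_fsum: "lin_comb K M B c = fsum K M B (\<lambda>b. b) c"
  by (simp add: lin_comb_def fsum_def)

text \<open>The support of a sum or of a multiple differs from the supports of the arguments;
  enlarging the range of summation to a common finite set lets linearity of \<open>fsum\<close> be
  checked termwise.\<close>

lemma fsum_superset:
  assumes "module K M" "finite T" "{b\<in>B. c b \<noteq> \<zero>\<^bsub>K\<^esub>} \<subseteq> T" "T \<subseteq> B"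
    "\<And>b. b \<in> B \<Longrightarrow> f b \<in> carrier M" "\<And>b. b \<in> B \<Longrightarrow> c b \<in> carrier K"
  shows "fsum K M B f c = finsum M (\<lambda>b. c b \<odot>\<^bsub>M\<^esub> f b) T"
proof -
  interpret M: module K M by fact
  show ?thesis unfolding fsum_def
    by (rule M.add.finprod_mono_neutral_cong_left) (use assms in \<open>auto simp: subset_iff\<close>)
qed

lemma free_on_sel [simp]:
  "carrier (free_on K B) = fin_supp K B"
  "\<zero>\<^bsub>free_on K B\<^esub> = (\<lambda>b\<in>B. \<zero>\<^bsub>K\<^esub>)"
  "x \<oplus>\<^bsub>free_on K B\<^esub> y = (\<lambda>i\<in>B. x i \<oplus>\<^bsub>K\<^esub> y i)"
  "a \<odot>\<^bsub>free_on K B\<^esub> x = (\<lambda>i\<in>B. a \<otimes>\<^bsub>K\<^esub> x i)"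
  by (simp_all add: free_on_def)

lemma submod_fin_supp:
  assumes "cring K" shows "submod K (prod_module B (\<lambda>_. self_module K)) (fin_supp K B)"
proof -
  interpret K: cring K by fact
  have "finite {b \<in> B. x b \<oplus>\<^bsub>K\<^esub> y b \<noteq> \<zero>\<^bsub>K\<^esub>}"
    if "finite {b \<in> B. x b \<noteq> \<zero>\<^bsub>K\<^esub>}" "finite {b \<in> B. y b \<noteq> \<zero>\<^bsub>K\<^esub>}" for x y
    by (rule finite_subset[OF _ finite_UnI[OF that]]) auto
  moreover have "finite {b \<in> B. a \<otimes>\<^bsub>K\<^esub> x b \<noteq> \<zero>\<^bsub>K\<^esub>}"
    if "finite {b \<in> B. x b \<noteq> \<zero>\<^bsub>K\<^esub>}" "a \<in> carrier K" for x a
    by (rule finite_subset[OF _ that(1)]) (use that in auto)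
  ultimately show ?thesis
    by (intro submodI) (auto simp: fin_supp_def PiE_iff extensional_def cong: conj_cong)
qed

lemma module_free_on: "cring K \<Longrightarrow> module K (free_on K B)"
  unfolding free_on_def
  by (intro module_submod submod_fin_supp module_prod module_self)

lemma fin_suppD:
  assumes "c \<in> fin_supp K B"
  shows "finite {b\<in>B. c b \<noteq> \<zero>\<^bsub>K\<^esub>}" "b \<in> B \<Longrightarrow> c b \<in> carrier K"
  using assms by (auto simp: fin_supp_def)

lemma lin_fsum:
  assumes "module K M" "\<And>b. b \<in> B \<Longrightarrow> f b \<in> carrier M"
  shows "lin K (free_on K B) M (fsum K M B f)"
proof (rule linI)
  interpret M: module K M by fact
  note [simp] = assms(2)
  show "fsum K M B f x \<in> carrier M" if "x \<in> carrier (free_on K B)" for x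
    unfolding fsum_def by (rule M.finsum_closed) (use that in \<open>auto simp: fin_supp_def\<close>)
  show "fsum K M B f (x \<oplus>\<^bsub>free_on K B\<^esub> y) = fsum K M B f x \<oplus>\<^bsub>M\<^esub> fsum K M B f y"
    if x: "x \<in> carrier (free_on K B)" and y: "y \<in> carrier (free_on K B)" for x y
  proof -
    let ?T = "{b\<in>B. x b \<noteq> \<zero>\<^bsub>K\<^esub>} \<union> {b\<in>B. y b \<noteq> \<zero>\<^bsub>K\<^esub>}"
    have fin: "finite ?T" using x y by (auto simp: fin_supp_def)
    have xc: "x b \<in> carrier K" "y b \<in> carrier K" if "b \<in> B" for b
      using x y that by (auto simp: fin_supp_def)
    have "fsum K M B f (x \<oplus>\<^bsub>free_on K B\<^esub> y)
        = finsum M (\<lambda>b. (x \<oplus>\<^bsub>free_on K B\<^esub> y) b \<odot>\<^bsub>M\<^esub> f b) ?T"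
      by (rule fsum_superset[OF assms(1) fin]) (auto simp: xc)
    also have "\<dots> = finsum M (\<lambda>b. x b \<odot>\<^bsub>M\<^esub> f b \<oplus>\<^bsub>M\<^esub> y b \<odot>\<^bsub>M\<^esub> f b) ?T"
      by (rule M.finsum_cong') (auto simp: xc M.smult_l_distr)
    also have "\<dots> = finsum M (\<lambda>b. x b \<odot>\<^bsub>M\<^esub> f b) ?T \<oplus>\<^bsub>M\<^esub> finsum M (\<lambda>b. y b \<odot>\<^bsub>M\<^esub> f b) ?T"
      by (rule M.finsum_addf) (auto simp: xc)
    also have "finsum M (\<lambda>b. x b \<odot>\<^bsub>M\<^esub> f b) ?T = fsum K M B f x"
      by (rule fsum_superset[OF assms(1) fin, symmetric]) (auto simp: xc)
    also have "finsum M (\<lambda>b. y b \<odot>\<^bsub>M\<^esub> f b) ?T = fsum K M B f y"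
      by (rule fsum_superset[OF assms(1) fin, symmetric]) (auto simp: xc)
    finally show ?thesis .
  qed
  show "fsum K M B f (a \<odot>\<^bsub>free_on K B\<^esub> x) = a \<odot>\<^bsub>M\<^esub> fsum K M B f x"
    if a: "a \<in> carrier K" and x: "x \<in> carrier (free_on K B)" for a x
  proof -
    let ?T = "{b\<in>B. x b \<noteq> \<zero>\<^bsub>K\<^esub>}"
    have fin: "finite ?T" using x by (auto simp: fin_supp_def)
    have xc: "x b \<in> carrier K" if "b \<in> B" for b
      using x that by (auto simp: fin_supp_def)
    have "fsum K M B f (a \<odot>\<^bsub>free_on K B\<^esub> x)
        = finsum M (\<lambda>b. (a \<odot>\<^bsub>free_on K B\<^esub> x) b \<odot>\<^bsub>M\<^esub> f b) ?T"
      by (rule fsum_superset[OF assms(1) fin]) (use a in \<open>auto simp: xc\<close>)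
    also have "\<dots> = finsum M (\<lambda>b. a \<odot>\<^bsub>M\<^esub> (x b \<odot>\<^bsub>M\<^esub> f b)) ?T"
      by (rule M.finsum_cong') (use a in \<open>auto simp: xc M.smult_assoc1\<close>)
    also have "\<dots> = a \<odot>\<^bsub>M\<^esub> finsum M (\<lambda>b. x b \<odot>\<^bsub>M\<^esub> f b) ?T"
      by (rule lin_finsum[OF assms(1,1) lin_scale[OF assms(1) lin_ident a] fin, symmetric])
         (auto simp: xc)
    finally show ?thesis by (simp add: fsum_def)
  qed
qed

lemma lin_of_fsum:
  assumes "module K M" "module K N" "lin K M N g" "c \<in> fin_supp K B"
    "\<And>b. b \<in> B \<Longrightarrow> f b \<in> carrier M"
  shows "g (fsum K M B f c) = fsum K N B (\<lambda>b. g (f b)) c"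
proof -
  interpret N: module K N by fact
  interpret M: module K M by fact
  note c = fin_suppD[OF assms(4)]
  show ?thesis unfolding fsum_def
    by (subst lin_finsum[OF assms(1-3) c(1)], use c assms(5) in force, rule N.finsum_cong')
       (use c assms(5) lin_closed[OF assms(3)] in \<open>auto simp: lin_smult[OF assms(3)]\<close>)
qed

section \<open>Unit vectors, finite dual bases and reflexivity\<close>

definition delta :: "'k ring \<Rightarrow> 'b set \<Rightarrow> 'b \<Rightarrow> 'b \<Rightarrow> 'k" where
  "delta K B b = (\<lambda>x\<in>B. if x = b then \<one>\<^bsub>K\<^esub> else \<zero>\<^bsub>K\<^esub>)"

lemma delta_fin_supp: "cring K \<Longrightarrow> delta K B b \<in> fin_supp K B"
proof -
  assume "cring K" then interpret K: cring K .
  have "finite {x \<in> B. delta K B b x \<noteq> \<zero>\<^bsub>K\<^esub>}"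
    by (rule finite_subset[of _ "{b}"]) (auto simp: delta_def)
  thus ?thesis by (auto simp: fin_supp_def delta_def)
qed

lemma fsum_delta:
  assumes "module K M" "b \<in> B" "\<And>b. b \<in> B \<Longrightarrow> f b \<in> carrier M"
  shows "fsum K M B f (delta K B b) = f b"
proof -
  interpret M: module K M by fact
  have "fsum K M B f (delta K B b) = finsum M (\<lambda>x. delta K B b x \<odot>\<^bsub>M\<^esub> f x) {b}"
    by (rule fsum_superset) (use assms in \<open>auto simp: delta_def\<close>)
  thus ?thesis using assms by (simp add: delta_def)
qed

text \<open>A finite dual basis in the sense of projective modules: the vectors \<open>e j\<close>
  span with coefficients given by functionals, but may be dependent. Separation by functionals and
  reflexivity rest on this alone; \<open>biorthogonal\<close> turns the vectors into a
  basis.\<close>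

definition coord_system ::
  "'k ring \<Rightarrow> ('k, 'a) module \<Rightarrow> 'j set \<Rightarrow> ('j \<Rightarrow> 'a) \<Rightarrow> ('j \<Rightarrow> 'a \<Rightarrow> 'k) \<Rightarrow> bool" where
  "coord_system K M J e c \<longleftrightarrow> module K M \<and> finite J \<and>
     (\<forall>j\<in>J. e j \<in> carrier M \<and> lin K M (self_module K) (c j)) \<and>
     (\<forall>x\<in>carrier M. finsum M (\<lambda>j. c j x \<odot>\<^bsub>M\<^esub> e j) J = x)"

definition biorthogonal :: "'k ring \<Rightarrow> 'j set \<Rightarrow> ('j \<Rightarrow> 'a) \<Rightarrow> ('j \<Rightarrow> 'a \<Rightarrow> 'k) \<Rightarrow> bool" where
  "biorthogonal K J e c \<longleftrightarrow>
     (\<forall>i\<in>J. \<forall>j\<in>J. c i (e j) = (if i = j then \<one>\<^bsub>K\<^esub> else \<zero>\<^bsub>K\<^esub>))"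

text \<open>The given basis might be infinite. The finitely many generators involve finitely many
  basis elements, and every other coordinate vanishes on the generators, hence on the whole
  module.\<close>

lemma free_fin_gen_coord_system:
  assumes "domain K" "free_module K M" "fin_gen_module K M"
  shows "\<exists>J c. coord_system K M J (\<lambda>b. b) c \<and> biorthogonal K J (\<lambda>b. b) c"
proof -
  have M: "module K M" using assms(2) by (simp add: free_module_def)
  interpret M: module K M by fact
  interpret K: domain K by fact
  obtain B where B: "B \<subseteq> carrier M" "bij_betw (lin_comb K M B) (fin_supp K B) (carrier M)"
    using assms(2) by (auto simp: free_module_def is_basis_def)
  obtain S where S: "finite S" "S \<subseteq> carrier M" "lin_comb K M S ` fin_supp K S = carrier M"
    using assms(3) by (auto simp: fin_gen_module_def)
  have F: "module K (free_on K B)" by (rule module_free_on) (rule M.is_cring)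
  have lB: "lin K (free_on K B) M (lin_comb K M B)"
    unfolding lin_comb_fsum by (rule lin_fsum[OF M]) (use B in auto)
  define cf where "cf = inv_into (fin_supp K B) (lin_comb K M B)"
  have cf: "lin K M (free_on K B) cf"
    using lin_inv[OF F lB] B(2) by (simp add: cf_def)
  define c where "c = (\<lambda>b x. cf x b)"
  have lc: "lin K M (self_module K) (c b)" if "b \<in> B" for b
    using cf that unfolding c_def by (auto simp: lin_def fin_supp_def)
  have cf_lc: "cf (lin_comb K M B a) = a" if "a \<in> fin_supp K B" for a
    unfolding cf_def using B(2) that by (simp add: bij_betw_def)
  have lc_cf: "lin_comb K M B (cf x) = x" if "x \<in> carrier M" for x
    unfolding cf_def using B(2) that by (metis bij_betw_def f_inv_into_f)
  define J where "J = (\<Union>s\<in>S. {b\<in>B. cf s b \<noteq> \<zero>\<^bsub>K\<^esub>})"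
  have cfS: "cf s \<in> fin_supp K B" if "s \<in> carrier M" for s
    using lin_closed[OF cf that] by simp
  have J: "finite J" "J \<subseteq> B" using S(1,2) cfS by (auto simp: J_def fin_supp_def)
  have van: "c b x = \<zero>\<^bsub>K\<^esub>" if b: "b \<in> B" "b \<notin> J" and x: "x \<in> carrier M" for b x
  proof -
    obtain a where a: "a \<in> fin_supp K S" "x = fsum K M S (\<lambda>b. b) a"
      using x S(3) unfolding lin_comb_fsum by blast
    have "c b x = fsum K (self_module K) S (\<lambda>s. c b s) a"
      unfolding a(2) by (rule lin_of_fsum[OF M module_self lc[OF b(1)] a(1)])
        (use S(2) M.is_cring in auto)
    also have "\<dots> = finsum (self_module K) (\<lambda>s. \<zero>\<^bsub>self_module K\<^esub>) {s\<in>S. a s \<noteq> \<zero>\<^bsub>K\<^esub>}"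
    proof -
      interpret KK: module K "self_module K" by (rule module_self) (rule M.is_cring)
      show ?thesis unfolding fsum_def
        by (rule KK.finsum_cong') (use b a S(2) in \<open>auto simp: J_def c_def fin_supp_def PiE_iff\<close>)
    qed
    also have "\<dots> = \<zero>\<^bsub>K\<^esub>"
    proof -
      interpret KK: module K "self_module K" by (rule module_self) (rule M.is_cring)
      show ?thesis using KK.finsum_zero by simp
    qed
    finally show ?thesis .
  qed
  have "finsum M (\<lambda>j. c j x \<odot>\<^bsub>M\<^esub> j) J = x" if x: "x \<in> carrier M" for x
  proof -
    have "fsum K M B (\<lambda>b. b) (cf x) = finsum M (\<lambda>b. cf x b \<odot>\<^bsub>M\<^esub> b) J"
      by (rule fsum_superset[OF M J(1)])
        (use van[OF _ _ x] B(1) J(2) cfS[OF x] in \<open>auto simp: c_def fin_supp_def\<close>)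
    thus ?thesis using lc_cf[OF x] by (simp add: lin_comb_fsum c_def)
  qed
  moreover have "c i j = (if i = j then \<one>\<^bsub>K\<^esub> else \<zero>\<^bsub>K\<^esub>)" if "i \<in> J" "j \<in> J" for i j
  proof -
    have "cf j = delta K B j"
      using cf_lc[OF delta_fin_supp[OF M.is_cring], of j] fsum_delta[OF M, of j B "\<lambda>b. b"] that J(2) B(1)
      by (simp add: lin_comb_fsum subset_iff)
    thus ?thesis using that J(2) by (auto simp: c_def delta_def)
  qed
  ultimately show ?thesis
    using J lc B(1) M by (intro exI[of _ J] exI[of _ c]) (auto simp: coord_system_def biorthogonal_def)
qed

text \<open>A basis is a set here, so the family \<open>e\<close> has to be injective; since one
  differs from zero in a domain, biorthogonality forces this. Applying \<open>c i\<close> to a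
  combination recovers its coefficients.\<close>

lemma coord_system_free:
  assumes "domain K" "coord_system K M J e c" "biorthogonal K J e c"
  shows "free_module K M \<and> fin_gen_module K M"
proof -
  have M: "module K M" and J: "finite J" and e: "\<And>j. j \<in> J \<Longrightarrow> e j \<in> carrier M"
    and c: "\<And>j. j \<in> J \<Longrightarrow> lin K M (self_module K) (c j)"
    and sum: "\<And>x. x \<in> carrier M \<Longrightarrow> finsum M (\<lambda>j. c j x \<odot>\<^bsub>M\<^esub> e j) J = x"
    using assms(2) by (auto simp: coord_system_def)
  interpret M: module K M by fact
  interpret K: domain K by fact
  interpret KK: module K "self_module K" by (rule module_self) (rule M.is_cring)
  have orth: "c i (e j) = (if i = j then \<one>\<^bsub>K\<^esub> else \<zero>\<^bsub>K\<^esub>)" if "i \<in> J" "j \<in> J" for i j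
    using assms(3) that by (auto simp: biorthogonal_def)
  have inj: "inj_on e J"
    by (rule inj_onI) (metis orth K.one_not_zero)
  have cc: "c j x \<in> carrier K" if "j \<in> J" "x \<in> carrier M" for j x
    using lin_closed[OF c[OF that(1)] that(2)] by simp
  have lc: "lin_comb K M (e ` J) a = finsum M (\<lambda>j. a (e j) \<odot>\<^bsub>M\<^esub> e j) J" if "a \<in> fin_supp K (e ` J)" for a
  proof -
    have "lin_comb K M (e ` J) a = finsum M (\<lambda>b. a b \<odot>\<^bsub>M\<^esub> b) (e ` J)"
      unfolding lin_comb_fsum by (rule fsum_superset[OF M]) (use J e that in \<open>auto simp: fin_supp_def\<close>)
    also have "\<dots> = finsum M (\<lambda>j. a (e j) \<odot>\<^bsub>M\<^esub> e j) J"
      by (rule M.finsum_reindex[OF _ inj]) (use e that in \<open>auto simp: fin_supp_def\<close>)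
    finally show ?thesis .
  qed
  have "inj_on (lin_comb K M (e ` J)) (fin_supp K (e ` J))"
  proof (rule inj_onI)
    have *: "c i (lin_comb K M (e ` J) a) = a (e i)" if a: "a \<in> fin_supp K (e ` J)" and i: "i \<in> J" for a i
    proof -
      have ac: "a (e j) \<in> carrier K" if "j \<in> J" for j using a that by (auto simp: fin_supp_def)
      have "c i (lin_comb K M (e ` J) a) = finsum (self_module K) (\<lambda>j. c i (a (e j) \<odot>\<^bsub>M\<^esub> e j)) J"
        unfolding lc[OF a]
        by (rule lin_finsum[OF M KK.module_axioms c[OF i] J]) (auto simp: e ac)
      also have "\<dots> = finsum (self_module K) (\<lambda>j. if i = j then a (e j) else \<zero>\<^bsub>self_module K\<^esub>) J"
        by (rule KK.finsum_cong') (auto simp: lin_smult[OF c[OF i]] e ac orth i)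
      also have "\<dots> = a (e i)" by (rule KK.finsum_singleton[OF i J]) (auto simp: ac)
      finally show ?thesis .
    qed
    fix a b assume ab: "a \<in> fin_supp K (e ` J)" "b \<in> fin_supp K (e ` J)"
      "lin_comb K M (e ` J) a = lin_comb K M (e ` J) b"
    show "a = b"
    proof (rule extensionalityI)
      show "a \<in> extensional (e ` J)" "b \<in> extensional (e ` J)" using ab by (auto simp: fin_supp_def PiE_def)
      show "a x = b x" if "x \<in> e ` J" for x using that *[OF ab(1)] *[OF ab(2)] ab(3) by auto
    qed
  qed
  moreover have "lin_comb K M (e ` J) ` fin_supp K (e ` J) = carrier M"
  proof
    have "lin K (free_on K (e ` J)) M (lin_comb K M (e ` J))"
      unfolding lin_comb_fsum by (rule lin_fsum[OF M]) (use e in auto)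
    thus "lin_comb K M (e ` J) ` fin_supp K (e ` J) \<subseteq> carrier M" by (auto dest: lin_closed)
    show "carrier M \<subseteq> lin_comb K M (e ` J) ` fin_supp K (e ` J)"
    proof
      fix x assume x: "x \<in> carrier M"
      let ?a = "\<lambda>b\<in>e ` J. c (inv_into J e b) x"
      have a: "?a \<in> fin_supp K (e ` J)" using J inj x by (auto simp: fin_supp_def cc)
      have "lin_comb K M (e ` J) ?a = finsum M (\<lambda>j. c j x \<odot>\<^bsub>M\<^esub> e j) J"
        unfolding lc[OF a] by (rule M.finsum_cong') (use inj e x cc in auto)
      hence "x = lin_comb K M (e ` J) ?a" by (simp only: sum[OF x])
      thus "x \<in> lin_comb K M (e ` J) ` fin_supp K (e ` J)" by (rule image_eqI[OF _ a])
    qed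
  qed
  moreover have "e ` J \<subseteq> carrier M" "finite (e ` J)" using J e by auto
  ultimately show ?thesis
    using M unfolding free_module_def is_basis_def bij_betw_def fin_gen_module_def by blast
qed

lemma coord_system_iso:
  assumes "coord_system K M J e c" "module K N" "lin K M N h" "bij_betw h (carrier M) (carrier N)"
  shows "coord_system K N J (\<lambda>j. h (e j)) (\<lambda>j y. c j (inv_into (carrier M) h y))"
proof -
  have M: "module K M" and J: "finite J" and e: "\<And>j. j \<in> J \<Longrightarrow> e j \<in> carrier M"
    and c: "\<And>j. j \<in> J \<Longrightarrow> lin K M (self_module K) (c j)"
    and sum: "\<And>x. x \<in> carrier M \<Longrightarrow> finsum M (\<lambda>j. c j x \<odot>\<^bsub>M\<^esub> e j) J = x"
    using assms(1) by (auto simp: coord_system_def)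
  interpret M: module K M by fact
  interpret N: module K N by fact
  let ?g = "inv_into (carrier M) h"
  have g: "lin K N M ?g" by (rule lin_inv[OF M assms(3,4)])
  have hg: "h (?g y) = y" if "y \<in> carrier N" for y
    using that assms(4) by (metis bij_betw_def f_inv_into_f)
  have cc: "c j x \<in> carrier K" if "j \<in> J" "x \<in> carrier M" for j x
    using lin_closed[OF c[OF that(1)] that(2)] by simp
  have "finsum N (\<lambda>j. c j (?g y) \<odot>\<^bsub>N\<^esub> h (e j)) J = y" if y: "y \<in> carrier N" for y
  proof -
    note gy = lin_closed[OF g y]
    have "h (finsum M (\<lambda>j. c j (?g y) \<odot>\<^bsub>M\<^esub> e j) J) = finsum N (\<lambda>j. h (c j (?g y) \<odot>\<^bsub>M\<^esub> e j)) J"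
      by (rule lin_finsum[OF M assms(2,3) J]) (auto simp: cc e gy)
    also have "\<dots> = finsum N (\<lambda>j. c j (?g y) \<odot>\<^bsub>N\<^esub> h (e j)) J"
      by (rule N.finsum_cong') (use lin_closed[OF assms(3)] in \<open>auto simp: lin_smult[OF assms(3)] cc e gy\<close>)
    finally show ?thesis using sum[OF gy] hg[OF y] by simp
  qed
  thus ?thesis
    using lin_comp[OF g c] e lin_closed[OF assms(3)] J assms(2) by (simp add: coord_system_def)
qed

lemma biorthogonal_iso:
  assumes "coord_system K M J e c" "biorthogonal K J e c" "bij_betw h (carrier M) (carrier N)"
  shows "biorthogonal K J (\<lambda>j. h (e j)) (\<lambda>j y. c j (inv_into (carrier M) h y))"
  using assms by (auto simp: biorthogonal_def coord_system_def bij_betw_def)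

text \<open>The entry of the sum at \<open>k\<close> receives only the terms with first index
  \<open>k\<close>, and these reassemble the entry of \<open>x\<close> at \<open>k\<close> by the
  formula in \<open>A\<close>.\<close>

lemma coord_system_prod:
  assumes A: "coord_system K A J e c" "biorthogonal K J e c" and I: "finite I"
  defines "P \<equiv> prod_module I (\<lambda>_. A)"
  defines "e' \<equiv> (\<lambda>(i, j). \<lambda>k\<in>I. if k = i then e j else \<zero>\<^bsub>A\<^esub>)"
  defines "c' \<equiv> (\<lambda>(i, j) x. c j (x i))"
  shows "coord_system K P (I \<times> J) e' c'" "biorthogonal K (I \<times> J) e' c'"
proof -
  have M: "module K A" and J: "finite J" and e: "\<And>j. j \<in> J \<Longrightarrow> e j \<in> carrier A"
    and c: "\<And>j. j \<in> J \<Longrightarrow> lin K A (self_module K) (c j)"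
    and sum: "\<And>x. x \<in> carrier A \<Longrightarrow> finsum A (\<lambda>j. c j x \<odot>\<^bsub>A\<^esub> e j) J = x"
    using A(1) by (auto simp: coord_system_def)
  interpret A: module K A by fact
  have P: "module K P" unfolding P_def by (rule module_prod) (use M A.is_cring in auto)
  interpret P: module K P by fact
  have KK: "module K (self_module K)" by (rule module_self) (rule A.is_cring)
  have cc: "c j x \<in> carrier K" if "j \<in> J" "x \<in> carrier A" for j x
    using lin_closed[OF c[OF that(1)] that(2)] by simp
  have e': "e' p \<in> carrier P" if "p \<in> I \<times> J" for p
    using that e by (auto simp: e'_def P_def split: prod.splits)
  have "finsum P (\<lambda>p. c' p x \<odot>\<^bsub>P\<^esub> e' p) (I \<times> J) = x" (is "?S = x") if x: "x \<in> carrier P" for x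
  proof (rule extensionalityI)
    have S: "?S \<in> carrier P"
      by (rule P.finsum_closed, rule Pi_I, rule P.smult_closed[OF _ e'])
        (use x cc in \<open>auto simp: c'_def P_def\<close>)
    thus "?S \<in> extensional I" "x \<in> extensional I" using x by (auto simp: P_def PiE_def)
    fix k assume k: "k \<in> I"
    have cx: "c j (x i) \<in> carrier K" if "i \<in> I" "j \<in> J" for i j
      using x that by (auto simp: P_def intro!: cc)
    have xk: "x k \<in> carrier A" using x k by (auto simp: P_def)
    have "?S k = finsum A (\<lambda>p. (c' p x \<odot>\<^bsub>P\<^esub> e' p) k) (I \<times> J)"
      by (rule lin_finsum[OF P M])
        (use k I J cx in \<open>auto simp: P_def c'_def e'_def e intro!: lin_proj\<close>)
    also have "\<dots> = finsum A (\<lambda>p. c (snd p) (x k) \<odot>\<^bsub>A\<^esub> e (snd p)) (Pair k ` J)"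
      by (rule A.add.finprod_mono_neutral_cong_right)
        (use k I J x e cc xk in \<open>auto simp: c'_def e'_def P_def PiE_iff\<close>)
    also have "\<dots> = finsum A (\<lambda>j. c j (x k) \<odot>\<^bsub>A\<^esub> e j) J"
      by (subst A.finsum_reindex) (use e cc xk in \<open>auto simp: inj_on_def\<close>)
    also have "\<dots> = x k" by (rule sum[OF xk])
    finally show "?S k = x k" .
  qed
  moreover have "lin K P (self_module K) (c' p)" if "p \<in> I \<times> J" for p
    using that lin_comp[OF lin_proj[of _ I K "\<lambda>_. A"] c] by (auto simp: c'_def P_def)
  ultimately show "coord_system K P (I \<times> J) e' c'"
    using e' I J P by (auto simp: coord_system_def)
  show "biorthogonal K (I \<times> J) e' c'"
    using A(2) lin_zero[OF M KK c] by (auto simp: biorthogonal_def e'_def c'_def)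
qed

lemma coord_system_separated:
  assumes "coord_system K M J e c" "x \<in> carrier M" "\<And>j. j \<in> J \<Longrightarrow> c j x = \<zero>\<^bsub>K\<^esub>"
  shows "x = \<zero>\<^bsub>M\<^esub>"
proof -
  interpret M: module K M using assms(1) by (simp add: coord_system_def)
  have "x = finsum M (\<lambda>j. c j x \<odot>\<^bsub>M\<^esub> e j) J" using assms(1,2) by (simp add: coord_system_def)
  also have "\<dots> = finsum M (\<lambda>j. \<zero>\<^bsub>M\<^esub>) J"
    by (rule M.finsum_cong') (use assms in \<open>auto simp: coord_system_def\<close>)
  finally show ?thesis by simp
qed

text \<open>The vector is the sum of \<open>F (c j)\<close> times \<open>e j\<close>. Every
  functional \<open>\<phi>\<close> expands as the sum of \<open>\<phi> (e j)\<close> times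
  \<open>c j\<close>, and applying \<open>F\<close> to this expansion gives the value of
  \<open>\<phi>\<close> at that vector.\<close>

lemma coord_system_reflexive:
  assumes "coord_system K M J e c" "lin K (dual_module K M) (self_module K) F"
  shows "\<exists>v\<in>carrier M. \<forall>\<phi>\<in>mod_hom K M (self_module K). F \<phi> = \<phi> v"
proof -
  have M: "module K M" and J: "finite J" and e: "\<And>j. j \<in> J \<Longrightarrow> e j \<in> carrier M"
    and c: "\<And>j. j \<in> J \<Longrightarrow> lin K M (self_module K) (c j)"
    and sum: "\<And>x. x \<in> carrier M \<Longrightarrow> finsum M (\<lambda>j. c j x \<odot>\<^bsub>M\<^esub> e j) J = x"
    using assms(1) by (auto simp: coord_system_def)
  interpret M: module K M by fact
  have KK: "module K (self_module K)" by (rule module_self) (rule M.is_cring)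
  interpret KK: module K "self_module K" by fact
  have D: "module K (dual_module K M)" by (rule module_dual[OF M])
  interpret D: module K "dual_module K M" by fact
  let ?c = "\<lambda>j. restrict (c j) (carrier M)"
  have c': "?c j \<in> carrier (dual_module K M)" if "j \<in> J" for j
    using restrict_mod_hom[OF M c[OF that]] by simp
  have Fc: "F (?c j) \<in> carrier K" if "j \<in> J" for j using lin_closed[OF assms(2) c'[OF that]] by simp
  have cc: "c j x \<in> carrier K" if "j \<in> J" "x \<in> carrier M" for j x
    using lin_closed[OF c[OF that(1)] that(2)] by simp
  let ?v = "finsum M (\<lambda>j. F (?c j) \<odot>\<^bsub>M\<^esub> e j) J"
  have v: "?v \<in> carrier M" by (rule M.finsum_closed) (auto simp: Fc e)
  have "F \<phi> = \<phi> ?v" if \<phi>: "\<phi> \<in> mod_hom K M (self_module K)" for \<phi>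
  proof -
    note l\<phi> = mod_hom_lin[OF \<phi>]
    have \<phi>e: "\<phi> (e j) \<in> carrier K" if "j \<in> J" for j using lin_closed[OF l\<phi> e[OF that]] by simp
    have ev: "lin K (dual_module K M) (self_module K) (\<lambda>\<psi>. \<psi> x)" if "x \<in> carrier M" for x
      using that by (auto simp: lin_def mod_hom_def)
    let ?S = "finsum (dual_module K M) (\<lambda>j. \<phi> (e j) \<odot>\<^bsub>dual_module K M\<^esub> ?c j) J"
    have S: "?S \<in> carrier (dual_module K M)"
      by (rule D.finsum_closed) (intro Pi_I D.smult_closed \<phi>e c')
    have "?S = \<phi>"
    proof (rule mod_hom_eqI)
      show "?S \<in> mod_hom K M (self_module K)" using S by simp
      show "\<phi> \<in> mod_hom K M (self_module K)" by fact
      fix x assume x: "x \<in> carrier M"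
      have "?S x = finsum (self_module K) (\<lambda>j. (\<phi> (e j) \<odot>\<^bsub>dual_module K M\<^esub> ?c j) x) J"
        by (rule lin_finsum[OF D KK ev[OF x] J]) (intro D.smult_closed \<phi>e c')
      also have "\<dots> = finsum (self_module K) (\<lambda>j. \<phi> (c j x \<odot>\<^bsub>M\<^esub> e j)) J"
        by (rule KK.finsum_cong') (use x in \<open>auto simp: \<phi>e cc e lin_smult[OF l\<phi>] M.m_comm\<close>)
      also have "\<dots> = \<phi> (finsum M (\<lambda>j. c j x \<odot>\<^bsub>M\<^esub> e j) J)"
        by (rule lin_finsum[OF M KK l\<phi> J, symmetric]) (use x in \<open>auto simp: cc e\<close>)
      finally show "?S x = \<phi> x" using sum[OF x] by simp
    qed
    hence "F \<phi> = F ?S" by simp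
    also have "\<dots> = finsum (self_module K) (\<lambda>j. F (\<phi> (e j) \<odot>\<^bsub>dual_module K M\<^esub> ?c j)) J"
      by (rule lin_finsum[OF D KK assms(2) J]) (intro D.smult_closed \<phi>e c')
    also have "\<dots> = finsum (self_module K) (\<lambda>j. \<phi> (F (?c j) \<odot>\<^bsub>M\<^esub> e j)) J"
    proof (rule KK.finsum_cong')
      fix j assume j: "j \<in> J"
      have "F (\<phi> (e j) \<odot>\<^bsub>dual_module K M\<^esub> ?c j) = \<phi> (e j) \<otimes>\<^bsub>K\<^esub> F (?c j)"
        using lin_smult[OF assms(2) \<phi>e[OF j] c'[OF j]] by (simp del: dual_module_sel)
      also have "\<dots> = \<phi> (F (?c j) \<odot>\<^bsub>M\<^esub> e j)"
        using lin_smult[OF l\<phi> Fc[OF j] e[OF j]] \<phi>e[OF j] Fc[OF j] by (simp add: M.m_comm)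
      finally show "F (\<phi> (e j) \<odot>\<^bsub>dual_module K M\<^esub> ?c j) = \<phi> (F (?c j) \<odot>\<^bsub>M\<^esub> e j)" .
    qed (use \<phi>e Fc e lin_closed[OF l\<phi>] in auto)
    also have "\<dots> = \<phi> ?v"
      by (rule lin_finsum[OF M KK l\<phi> J, symmetric]) (auto simp: Fc e)
    finally show ?thesis .
  qed
  with v show ?thesis by blast
qed

section \<open>Submodules of free modules and universal coefficients\<close>

text \<open>An embedding into \<open>K^n\<close> given by its coordinates, which are numbered to
  allow induction on \<open>n\<close>. In contrast to a dual basis, this property passes to
  submodules.\<close>

definition separated :: "'k ring \<Rightarrow> ('k, 'a) module \<Rightarrow> bool" where
  "separated K S \<longleftrightarrow> (\<exists>(n::nat) c. (\<forall>j<n. lin K S (self_module K) (c j)) \<and>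
     (\<forall>x\<in>carrier S. (\<forall>j<n. c j x = \<zero>\<^bsub>K\<^esub>) \<longrightarrow> x = \<zero>\<^bsub>S\<^esub>))"

lemma separated_sub:
  assumes "separated K M" "S \<subseteq> carrier M" shows "separated K (M\<lparr>carrier := S\<rparr>)"
proof -
  from assms(1) obtain n :: nat and c where "\<forall>j<n. lin K M (self_module K) (c j)"
    "\<forall>x\<in>carrier M. (\<forall>j<n. c j x = \<zero>\<^bsub>K\<^esub>) \<longrightarrow> x = \<zero>\<^bsub>M\<^esub>" unfolding separated_def by blast
  thus ?thesis using assms(2) unfolding separated_def
    by (intro exI[of _ n] exI[of _ c]) (auto intro: lin_sub_dom)
qed

lemma submod_self_ideal:
  assumes "cring K" "submod K (self_module K) I"
  shows "ideal I K"
proof -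
  interpret K: cring K by fact
  have neg: "\<ominus>\<^bsub>K\<^esub> x \<in> I" if "x \<in> I" for x
  proof -
    have "\<ominus>\<^bsub>K\<^esub> \<one>\<^bsub>K\<^esub> \<otimes>\<^bsub>K\<^esub> x \<in> I" "x \<in> carrier K" using assms(2) that by (auto simp: submod_def)
    thus ?thesis by (simp add: K.l_minus)
  qed
  show ?thesis
  proof (rule idealI)
    show "subgroup I (add_monoid K)"
      by (rule K.add.subgroupI) (use assms(2) neg in \<open>auto simp: submod_def a_inv_def\<close>)
    show "x \<otimes>\<^bsub>K\<^esub> a \<in> I" if "a \<in> I" "x \<in> carrier K" for a x
      using assms(2) that by (auto simp: submod_def)
    thus "a \<otimes>\<^bsub>K\<^esub> x \<in> I" if "a \<in> I" "x \<in> carrier K" for a x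
      using assms(2) that by (auto simp: submod_def K.m_comm subset_iff)
  qed (rule K.ring_axioms)
qed

text \<open>The values of \<open>c\<close> form an ideal, generated by some \<open>c s\<close>, and
  \<open>k x\<close> is the quotient of \<open>c x\<close> by this generator. Cancellation makes the
  quotient unique and therefore linear; if the generator is zero, \<open>k\<close> is taken to be
  zero.\<close>

lemma principal_functional:
  assumes "principal_domain K" "module K S" "lin K S (self_module K) c"
  shows "\<exists>s\<in>carrier S. \<exists>k. lin K S (self_module K) k \<and> (\<forall>x\<in>carrier S. c x = k x \<otimes>\<^bsub>K\<^esub> c s)"
proof -
  interpret K: principal_domain K by fact
  interpret S: module K S by fact
  note cr = module_cring[OF assms(2)]
  have KK: "module K (self_module K)" by (rule module_self) (rule cr)
  have cc: "c x \<in> carrier K" if "x \<in> carrier S" for x using lin_closed[OF assms(3) that] by simp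
  have "ideal (c ` carrier S) K"
    by (rule submod_self_ideal[OF cr submod_image[OF assms(2) KK assms(3) submod_carrier[OF assms(2)]]])
  then obtain a where a: "a \<in> carrier K" "c ` carrier S = PIdl\<^bsub>K\<^esub> a" using K.exists_gen by blast
  have "a \<in> PIdl\<^bsub>K\<^esub> a" using a(1) K.cgenideal_self by blast
  then obtain s where s: "s \<in> carrier S" "c s = a" using a(2) by (metis imageE)
  have ex: "\<exists>k\<in>carrier K. c x = k \<otimes>\<^bsub>K\<^esub> a" if "x \<in> carrier S" for x
    using that a(2) unfolding cgenideal_def by blast
  show ?thesis
  proof (cases "a = \<zero>\<^bsub>K\<^esub>")
    case True
    have "c x = \<zero>\<^bsub>K\<^esub> \<otimes>\<^bsub>K\<^esub> c s" if "x \<in> carrier S" for x using ex[OF that] s True by auto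
    thus ?thesis using lin_const_zero[OF KK, of S]
      by (intro bexI[OF _ s(1)] exI[of _ "\<lambda>_. \<zero>\<^bsub>K\<^esub>"]) simp
  next
    case False
    define k where "k x = (SOME k. k \<in> carrier K \<and> c x = k \<otimes>\<^bsub>K\<^esub> a)" for x
    have k: "k x \<in> carrier K \<and> c x = k x \<otimes>\<^bsub>K\<^esub> a" if "x \<in> carrier S" for x
      unfolding k_def by (rule someI_ex) (use ex[OF that] in blast)
    have uniq: "u = v" if "u \<in> carrier K" "v \<in> carrier K" "u \<otimes>\<^bsub>K\<^esub> a = v \<otimes>\<^bsub>K\<^esub> a" for u v
      using K.m_rcancel[OF False a(1) that(1,2)] that(3) by simp
    have "lin K S (self_module K) k"
    proof (rule linI)
      fix x y assume xy: "x \<in> carrier S" "y \<in> carrier S"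
      show "k (x \<oplus>\<^bsub>S\<^esub> y) = k x \<oplus>\<^bsub>self_module K\<^esub> k y"
        by (rule uniq) (use k[OF xy(1)] k[OF xy(2)] k[of "x \<oplus>\<^bsub>S\<^esub> y"] xy a
            lin_add[OF assms(3) xy] in \<open>auto simp: K.l_distr\<close>)
    next
      fix r x assume rx: "r \<in> carrier K" "x \<in> carrier S"
      show "k (r \<odot>\<^bsub>S\<^esub> x) = r \<odot>\<^bsub>self_module K\<^esub> k x"
        by (rule uniq) (use k[OF rx(2)] k[of "r \<odot>\<^bsub>S\<^esub> x"] rx a
            lin_smult[OF assms(3) rx] in \<open>auto simp: K.m_assoc\<close>)
    qed (use k in auto)
    moreover have "\<forall>x\<in>carrier S. c x = k x \<otimes>\<^bsub>K\<^esub> c s" using k s(2) by blast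
    ultimately show ?thesis using s(1) by blast
  qed
qed

text \<open>Submodules of finitely generated free modules over a principal ideal domain are projective:
  the coordinates are split off one at a time, the image of each being a principal ideal.\<close>

lemma separated_lift:
  fixes K :: "'k ring" and S :: "('k, 'd) module"
  assumes pd: "principal_domain K" and S: "module K S" "separated K S"
    and P: "module K P" and H: "module K H" and \<pi>: "lin K P H \<pi>" "\<pi> ` carrier P = carrier H"
    and q: "lin K S H q"
  shows "\<exists>\<eta>. lin K S P \<eta> \<and> (\<forall>x\<in>carrier S. \<pi> (\<eta> x) = q x)"
proof -
  interpret P: module K P by fact
  interpret H: module K H by fact
  have KK: "module K (self_module K)" by (rule module_self) (rule P.is_cring)
  have "\<exists>\<eta>. lin K S P \<eta> \<and> (\<forall>x\<in>carrier S. \<pi> (\<eta> x) = q x)"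
    if "module K S" "lin K S H q" "\<forall>j<n. lin K S (self_module K) (c j)"
      "\<forall>x\<in>carrier S. (\<forall>j<n. c j x = \<zero>\<^bsub>K\<^esub>) \<longrightarrow> x = \<zero>\<^bsub>S\<^esub>" for n :: nat and c and S :: "('k, 'd) module"
    using that
  proof (induction n arbitrary: S)
    case 0
    hence "\<pi> \<zero>\<^bsub>P\<^esub> = q x" if "x \<in> carrier S" for x
      using that lin_zero[OF P H \<pi>(1)] lin_zero[OF 0(1) H 0(2)] by auto
    thus ?case using lin_const_zero[OF P] by blast
  next
    case (Suc n)
    interpret S: module K S by fact
    note cn = Suc.prems(3)[rule_format, OF lessI]
    obtain s k where s: "s \<in> carrier S" and k: "lin K S (self_module K) k"
      and ck: "\<And>x. x \<in> carrier S \<Longrightarrow> c n x = k x \<otimes>\<^bsub>K\<^esub> c n s"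
      using principal_functional[OF pd Suc.prems(1) cn] by blast
    have cnc: "c n x \<in> carrier K" if "x \<in> carrier S" for x using lin_closed[OF cn that] by simp
    have kc: "k x \<in> carrier K" if "x \<in> carrier S" for x using lin_closed[OF k that] by simp
    let ?T = "{x \<in> carrier S. c n x = \<zero>\<^bsub>K\<^esub>}"
    have T: "submod K S ?T" using submod_kernel[OF Suc.prems(1) KK cn] by simp
    have "\<exists>\<eta>. lin K (S\<lparr>carrier := ?T\<rparr>) P \<eta> \<and> (\<forall>x\<in>carrier (S\<lparr>carrier := ?T\<rparr>). \<pi> (\<eta> x) = q x)"
    proof (rule Suc.IH)
      show "module K (S\<lparr>carrier := ?T\<rparr>)" by (rule module_submod[OF Suc.prems(1) T])
      show "lin K (S\<lparr>carrier := ?T\<rparr>) H q" by (rule lin_sub_dom[OF Suc.prems(2)]) auto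
      show "\<forall>j<n. lin K (S\<lparr>carrier := ?T\<rparr>) (self_module K) (c j)"
        using Suc.prems(3) by (auto intro: lin_sub_dom)
      show "\<forall>x\<in>carrier (S\<lparr>carrier := ?T\<rparr>). (\<forall>j<n. c j x = \<zero>\<^bsub>K\<^esub>) \<longrightarrow> x = \<zero>\<^bsub>S\<lparr>carrier := ?T\<rparr>\<^esub>"
        using Suc.prems(4) by (auto simp: less_Suc_eq)
    qed
    then obtain \<eta> where \<eta>: "lin K (S\<lparr>carrier := ?T\<rparr>) P \<eta>" "\<And>x. x \<in> ?T \<Longrightarrow> \<pi> (\<eta> x) = q x" by auto
    obtain m where m: "m \<in> carrier P" "\<pi> m = q s"
      using \<pi>(2) lin_closed[OF Suc.prems(2) s] by (metis imageE)
    \<comment> \<open>Since \<open>c n x\<close> is \<open>k x\<close> times \<open>c n s\<close>,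
      subtracting \<open>k x\<close> times \<open>s\<close> lands in the kernel of the last
      coordinate, where the induction hypothesis gives a lift; the multiple of \<open>s\<close> is
      lifted through the single vector \<open>m\<close>.\<close>
    let ?r = "\<lambda>x. x \<ominus>\<^bsub>S\<^esub> k x \<odot>\<^bsub>S\<^esub> s"
    have r: "lin K S S ?r"
      by (intro lin_minus lin_ident lin_scale_by Suc.prems(1) k s)
    have rT: "?r x \<in> ?T" if x: "x \<in> carrier S" for x
    proof -
      have "c n (?r x) = c n x \<ominus>\<^bsub>self_module K\<^esub> (k x \<otimes>\<^bsub>K\<^esub> c n s)"
        using x s kc by (simp add: lin_diff[OF Suc.prems(1) KK cn] lin_smult[OF cn])
      also have "\<dots> = \<zero>\<^bsub>K\<^esub>"
        using module_minus_eq_zero_iff[OF KK, of "c n x" "c n x"] cnc[OF x] ck[OF x] by simp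
      finally show ?thesis using lin_closed[OF r x] by simp
    qed
    have r': "lin K S (S\<lparr>carrier := ?T\<rparr>) ?r" using rT by (intro lin_sub_cod[OF r])
    let ?\<eta> = "\<lambda>x. \<eta> (?r x) \<oplus>\<^bsub>P\<^esub> k x \<odot>\<^bsub>P\<^esub> m"
    have "lin K S P ?\<eta>"
      by (intro lin_plus P lin_comp[OF r' \<eta>(1)] lin_scale_by Suc.prems(1) k m)
    moreover have "\<pi> (?\<eta> x) = q x" if x: "x \<in> carrier S" for x
    proof -
      have "\<pi> (?\<eta> x) = \<pi> (\<eta> (?r x)) \<oplus>\<^bsub>H\<^esub> k x \<odot>\<^bsub>H\<^esub> \<pi> m"
        using lin_closed[OF lin_comp[OF r' \<eta>(1)] x] kc[OF x] m
        by (simp add: lin_add[OF \<pi>(1)] lin_smult[OF \<pi>(1)])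
      also have "\<dots> = q (?r x) \<oplus>\<^bsub>H\<^esub> k x \<odot>\<^bsub>H\<^esub> q s" using \<eta>(2)[OF rT[OF x]] m by simp
      also have "\<dots> = q (?r x \<oplus>\<^bsub>S\<^esub> k x \<odot>\<^bsub>S\<^esub> s)"
        using lin_closed[OF r x] kc[OF x] s
        by (simp add: lin_add[OF Suc.prems(2)] lin_smult[OF Suc.prems(2)])
      also have "?r x \<oplus>\<^bsub>S\<^esub> k x \<odot>\<^bsub>S\<^esub> s = x"
        using x kc[OF x] s by (simp add: S.minus_eq S.a_assoc S.l_neg)
      finally show ?thesis .
    qed
    ultimately show ?case by (intro exI[of _ ?\<eta>]) blast
  qed
  with S q show ?thesis unfolding separated_def by blast
qed

text \<open>As a submodule of a separated module the image of \<open>d\<close> is projective, so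
  \<open>d\<close> splits over it; subtracting the splitting projects \<open>M\<close> onto the
  kernel.\<close>

lemma image_section:
  fixes K :: "'k ring" and M :: "('k, 'a) module" and N :: "('k, 'b) module"
  assumes pd: "principal_domain K" and M: "module K M" and N: "module K N" "separated K N"
    and d: "lin K M N d"
  shows "\<exists>t. lin K (N\<lparr>carrier := d ` carrier M\<rparr>) M t \<and> (\<forall>x\<in>d ` carrier M. d (t x) = x) \<and>
    lin K M (M\<lparr>carrier := {x \<in> carrier M. d x = \<zero>\<^bsub>N\<^esub>}\<rparr>) (\<lambda>x. x \<ominus>\<^bsub>M\<^esub> t (d x))"
proof -
  interpret N: module K N by fact
  let ?B = "d ` carrier M"
  let ?N = "N\<lparr>carrier := ?B\<rparr>"
  have B: "submod K N ?B" by (rule submod_image[OF M N(1) d submod_carrier[OF M]])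
  note mB = module_submod[OF N(1) B]
  have sB: "?B \<subseteq> carrier N" using submod_closed[OF B] by blast
  have dB: "lin K M ?N d" by (rule lin_sub_cod[OF d]) simp
  have "\<exists>t. lin K ?N M t \<and> (\<forall>x\<in>carrier ?N. d (t x) = x)"
    by (rule separated_lift[OF pd mB separated_sub[OF N(2) sB] M mB dB _ lin_ident]) simp
  then obtain t where t: "lin K ?N M t" "\<forall>x\<in>carrier ?N. d (t x) = x" by blast
  note td = lin_comp[OF dB t(1)]
  have "lin K M (M\<lparr>carrier := {x \<in> carrier M. d x = \<zero>\<^bsub>N\<^esub>}\<rparr>) (\<lambda>x. x \<ominus>\<^bsub>M\<^esub> t (d x))"
  proof (rule lin_sub_cod)
    show l: "lin K M M (\<lambda>x. x \<ominus>\<^bsub>M\<^esub> t (d x))" by (intro lin_minus M lin_ident td)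
    show "x \<ominus>\<^bsub>M\<^esub> t (d x) \<in> {x \<in> carrier M. d x = \<zero>\<^bsub>N\<^esub>}" if x: "x \<in> carrier M" for x
      using lin_closed[OF l x] t(2) x lin_diff[OF M N(1) d x lin_closed[OF td x]] lin_closed[OF d x]
      by (simp add: N.minus_eq N.r_neg)
  qed
  with t show ?thesis by auto
qed

lemma quot_lift:
  assumes "module K M" "submod K M S" "module K N" "lin K M N F" "\<And>s. s \<in> S \<Longrightarrow> F s = \<zero>\<^bsub>N\<^esub>"
  shows "\<exists>f\<in>mod_hom K (quot_module M S) N. \<forall>x\<in>carrier M. f (S +>\<^bsub>M\<^esub> x) = F x"
proof -
  interpret N: module K N by fact
  interpret M: module K M by fact
  let ?f = "\<lambda>X\<in>carrier (quot_module M S). F (SOME x. x \<in> carrier M \<and> S +>\<^bsub>M\<^esub> x = X)"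
  have f: "?f (S +>\<^bsub>M\<^esub> x) = F x" if x: "x \<in> carrier M" for x
  proof -
    let ?y = "SOME y. y \<in> carrier M \<and> S +>\<^bsub>M\<^esub> y = S +>\<^bsub>M\<^esub> x"
    have y: "?y \<in> carrier M \<and> S +>\<^bsub>M\<^esub> ?y = S +>\<^bsub>M\<^esub> x" by (rule someI) (use x in blast)
    hence "?y \<ominus>\<^bsub>M\<^esub> x \<in> S" using coset_eq_iff[OF assms(1,2)] x by blast
    hence "F ?y \<ominus>\<^bsub>N\<^esub> F x = \<zero>\<^bsub>N\<^esub>"
      using assms(5) lin_diff[OF assms(1,3,4)] x y by metis
    hence "F ?y = F x"
      using module_minus_eq_zero_iff[OF assms(3)] lin_closed[OF assms(4)] x y by blast
    thus ?thesis using x by (auto simp: quot_module_sel(1))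
  qed
  have "lin K (quot_module M S) N ?f"
  proof (rule linI)
    fix X assume "X \<in> carrier (quot_module M S)"
    then obtain x where x: "x \<in> carrier M" "X = S +>\<^bsub>M\<^esub> x" by (auto simp: quot_module_sel(1))
    show "?f X \<in> carrier N" using f x lin_closed[OF assms(4)] by simp
    { fix Y assume "Y \<in> carrier (quot_module M S)"
      then obtain y where y: "y \<in> carrier M" "Y = S +>\<^bsub>M\<^esub> y" by (auto simp: quot_module_sel(1))
      show "?f (X \<oplus>\<^bsub>quot_module M S\<^esub> Y) = ?f X \<oplus>\<^bsub>N\<^esub> ?f Y"
        unfolding x(2) y(2) coset_add[OF assms(1,2) x(1) y(1)]
        using x y by (simp only: f lin_add[OF assms(4)] M.a_closed) }
    fix a assume a: "a \<in> carrier K"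
    show "?f (a \<odot>\<^bsub>quot_module M S\<^esub> X) = a \<odot>\<^bsub>N\<^esub> ?f X"
      unfolding x(2) coset_smult[OF assms(1,2) a x(1)]
      using x a by (simp only: f lin_smult[OF assms(4)] M.smult_closed)
  qed
  thus ?thesis using f by (intro bexI[of _ ?f]) (auto simp: mod_hom_iff)
qed

text \<open>Subtraction in \<open>M\<lparr>carrier := S\<rparr>\<close> is formally a different
  operation, since inverses are chosen within the carrier. The statement uses the subtraction of
  \<open>M\<close> and is derived from additivity.\<close>

lemma lin_diff_sub:
  assumes "module K M" "submod K M S" "module K N" "lin K (M\<lparr>carrier := S\<rparr>) N f" "x \<in> S" "y \<in> S"
  shows "f (x \<ominus>\<^bsub>M\<^esub> y) = f x \<ominus>\<^bsub>N\<^esub> f y"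
proof -
  interpret M: module K M by fact
  interpret N: module K N by fact
  note xy = submod_closed[OF assms(2,5)] submod_closed[OF assms(2,6)]
  have d: "x \<ominus>\<^bsub>M\<^esub> y \<in> S" by (rule submod_diff[OF assms(1,2,5,6)])
  have fc: "f z \<in> carrier N" if "z \<in> S" for z using lin_closed[OF assms(4)] that by simp
  have "x = (x \<ominus>\<^bsub>M\<^esub> y) \<oplus>\<^bsub>M\<^esub> y" using xy by (simp add: M.minus_eq M.a_assoc M.l_neg)
  hence "f x = f (x \<ominus>\<^bsub>M\<^esub> y) \<oplus>\<^bsub>N\<^esub> f y"
    using lin_add[OF assms(4), of "x \<ominus>\<^bsub>M\<^esub> y" y] d assms(6) by simp
  thus ?thesis using fc d assms(5,6) by (simp add: N.minus_eq N.a_assoc N.r_neg)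
qed

text \<open>Here \<open>d\<close> is the differential between two consecutive degrees,
  \<open>B\<close> the boundaries in \<open>C\<close>, \<open>Z'\<close> the cycles in
  \<open>C'\<close>, and \<open>q\<close> presents the homology \<open>H'\<close> of the lower
  degree; it is kept abstract so that the zero module can stand below degree 0. Restricting cocycles
  to cycles maps onto the dual of the homology because the cycles of \<open>C\<close> split off; the
  kernel consists of the cocycles that factor through the boundaries in \<open>C'\<close>. These are
  compared with functionals on the relations of the canonical presentation of \<open>H'\<close> by
  linear maps over \<open>H'\<close> in both directions.\<close>

lemma universal_coefficients:
  fixes K :: "'k ring" and C :: "('k, 'c) module" and C' :: "('k, 'd) module" and H' :: "('k, 'h) module"
  assumes pd: "principal_domain K" and C: "module K C" and C': "module K C'" "separated K C'"
    and d: "lin K C C' d" and B: "submod K C B" "\<And>b. b \<in> B \<Longrightarrow> d b = \<zero>\<^bsub>C'\<^esub>"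
    and Z': "submod K C' Z'" "\<And>x. x \<in> carrier C \<Longrightarrow> d x \<in> Z'"
    and H': "module K H'" and q: "lin K (C'\<lparr>carrier := Z'\<rparr>) H' q" "q ` Z' = carrier H'"
      "\<And>z. z \<in> Z' \<Longrightarrow> q z = \<zero>\<^bsub>H'\<^esub> \<longleftrightarrow> z \<in> d ` carrier C"
    and ext: "\<And>\<phi>. lin K (C'\<lparr>carrier := Z'\<rparr>) (self_module K) \<phi> \<Longrightarrow>
                \<exists>\<psi>. lin K C' (self_module K) \<psi> \<and> (\<forall>z\<in>Z'. \<psi> z = \<phi> z)"
  shows "\<exists>f g. short_exact K (diamond K H') f
    (quot_module ((dual_module K C)\<lparr>carrier := {\<phi> \<in> carrier (dual_module K C). \<forall>b\<in>B. \<phi> b = \<zero>\<^bsub>K\<^esub>}\<rparr>)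
       ((\<lambda>\<psi>. \<lambda>x\<in>carrier C. \<psi> (d x)) ` carrier (dual_module K C'))) g
    (dual_module K (quot_module (C\<lparr>carrier := {x \<in> carrier C. d x = \<zero>\<^bsub>C'\<^esub>}\<rparr>) B))"
proof -
  interpret C: module K C by fact
  interpret C': module K C' by fact
  interpret H': module K H' by fact
  note cr = module_cring[OF C]
  let ?KK = "self_module K"
  have KK: "module K ?KK" by (rule module_self[OF cr])
  interpret KK: module K ?KK by fact
  define Z where "Z = {x \<in> carrier C. d x = \<zero>\<^bsub>C'\<^esub>}"
  define ZZ where "ZZ = {\<phi> \<in> mod_hom K C ?KK. \<forall>b\<in>B. \<phi> b = \<zero>\<^bsub>K\<^esub>}"
  define BB where "BB = (\<lambda>\<psi>. \<lambda>x\<in>carrier C. \<psi> (d x)) ` mod_hom K C' ?KK"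
  define D where "D = (dual_module K C)\<lparr>carrier := ZZ\<rparr>"
  define H where "H = quot_module (C\<lparr>carrier := Z\<rparr>) B"
  define dC where "dC = d ` carrier C"
  let ?CZ = "C\<lparr>carrier := Z\<rparr>" and ?CZ' = "C'\<lparr>carrier := Z'\<rparr>" and ?CB' = "C'\<lparr>carrier := dC\<rparr>"
  have Z: "submod K C Z" unfolding Z_def by (rule submod_kernel[OF C C'(1) d])
  have BZ: "submod K ?CZ B"
    using B by (intro submod_restrict) (auto simp: Z_def submod_def)
  note mCZ = module_submod[OF C Z]
  have dC: "submod K C' dC" unfolding dC_def
    by (rule submod_image[OF C C'(1) d submod_carrier[OF C]])
  note mCB' = module_submod[OF C'(1) dC] and mCZ' = module_submod[OF C'(1) Z'(1)]
  have Z'c: "z \<in> carrier C'" if "z \<in> Z'" for z using Z'(1) that by (auto simp: submod_def)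
  have dCZ': "dC \<subseteq> Z'" using Z'(2) by (auto simp: dC_def)
  have dCc: "dC \<subseteq> carrier C'" using dCZ' Z'c by blast
  note mDC = module_dual[OF C]
  have ZZ: "submod K (dual_module K C) ZZ"
  proof (rule submodI)
    interpret DC: module K "dual_module K C" by fact
    show "ZZ \<subseteq> carrier (dual_module K C)" by (auto simp: ZZ_def)
    have Bc: "b \<in> carrier C" if "b \<in> B" for b using submod_closed[OF B(1) that] .
    show "\<zero>\<^bsub>dual_module K C\<^esub> \<in> ZZ" using DC.zero_closed Bc by (simp add: ZZ_def)
    show "x \<oplus>\<^bsub>dual_module K C\<^esub> y \<in> ZZ" if "x \<in> ZZ" "y \<in> ZZ" for x y
      using DC.a_closed[of x y] that Bc by (simp add: ZZ_def)
    show "a \<odot>\<^bsub>dual_module K C\<^esub> x \<in> ZZ" if "a \<in> carrier K" "x \<in> ZZ" for a x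
      using DC.smult_closed[of a x] that Bc by (simp add: ZZ_def)
  qed
  have D: "module K D" unfolding D_def by (rule module_submod[OF mDC ZZ])
  have pull: "lin K (dual_module K C') D (\<lambda>\<psi>. \<lambda>x\<in>carrier C. \<psi> (d x))"
  proof (rule linI)
    fix \<psi> assume \<psi>: "\<psi> \<in> carrier (dual_module K C')"
    hence l\<psi>: "lin K C' ?KK \<psi>" by (simp add: mod_hom_lin)
    show "(\<lambda>x\<in>carrier C. \<psi> (d x)) \<in> carrier D"
      using restrict_mod_hom[OF C lin_comp[OF d l\<psi>]] lin_zero[OF C'(1) KK l\<psi>] submod_closed[OF B(1)]
      by (simp add: D_def ZZ_def B(2))
  qed (auto simp: D_def lin_closed[OF d] fun_eq_iff restrict_def)
  have BB: "submod K D BB"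
    using submod_image[OF module_dual[OF C'(1)] D pull submod_carrier[OF module_dual[OF C'(1)]]]
    by (simp add: BB_def)
  let ?Y = "quot_module D BB"
  have Y: "module K ?Y" by (rule module_quot[OF D BB])
  have mH: "module K H" unfolding H_def by (rule module_quot[OF mCZ BZ])
  \<comment> \<open>A coboundary is the pullback of a functional on all of \<open>C'\<close>; by
    \<open>ext\<close> a functional on the cycles suffices.\<close>
  have BBI: "(\<lambda>x\<in>carrier C. \<psi> (d x)) \<in> BB" if "lin K ?CZ' ?KK \<psi>" for \<psi>
  proof -
    from ext[OF that] obtain \<psi>' where \<psi>': "lin K C' ?KK \<psi>'" "\<forall>z\<in>Z'. \<psi>' z = \<psi> z" by blast
    show ?thesis unfolding BB_def
      by (rule image_eqI[OF _ restrict_mod_hom[OF C'(1) \<psi>'(1)]])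
        (use \<psi>'(2) Z'(2) lin_closed[OF d] in \<open>auto simp: fun_eq_iff restrict_def\<close>)
  qed
  obtain t where t: "lin K ?CB' C t" "\<forall>x\<in>dC. d (t x) = x"
    and split: "lin K C ?CZ (\<lambda>x. x \<ominus>\<^bsub>C\<^esub> t (d x))"
    using image_section[OF pd C C' d] unfolding dC_def Z_def by blast
  define P where "P = free_on K (carrier H')"
  define L where "L = lin_comb K H' (carrier H')"
  have mP: "module K P" unfolding P_def by (rule module_free_on[OF cr])
  interpret P: module K P by fact
  have L: "lin K P H' L" unfolding P_def L_def lin_comb_fsum by (rule lin_fsum[OF H'])
  have Ld: "L (delta K (carrier H') h) = h" if "h \<in> carrier H'" for h
    unfolding L_def lin_comb_fsum by (rule fsum_delta[OF H' that])
  have Lsurj: "L ` carrier P = carrier H'"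
  proof (intro equalityI subsetI)
    show "x \<in> carrier H'" if "x \<in> L ` carrier P" for x using that lin_closed[OF L] by blast
    show "x \<in> L ` carrier P" if "x \<in> carrier H'" for x
      using Ld[OF that] delta_fin_supp[OF cr, of "carrier H'" x]
      by (intro image_eqI[of _ _ "delta K (carrier H') x"]) (simp_all add: P_def)
  qed
  have "Z' \<subseteq> carrier C'" using Z'c by blast
  \<comment> \<open>The cycles are projective, so the projection to \<open>H'\<close> lifts through
    the canonical presentation \<open>P\<close>.\<close>
  from separated_lift[OF pd mCZ' separated_sub[OF C'(2) this] mP H' L Lsurj q(1)]
  obtain \<eta> where \<eta>: "lin K ?CZ' P \<eta>" "\<forall>z\<in>carrier ?CZ'. L (\<eta> z) = q z" by blast
  hence \<eta>L: "L (\<eta> z) = q z" if "z \<in> Z'" for z using that by simp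
  define r where "r h = (SOME z. z \<in> Z' \<and> q z = h)" for h
  have r: "r h \<in> Z' \<and> q (r h) = h" if "h \<in> carrier H'" for h
  proof -
    have "\<exists>z. z \<in> Z' \<and> q z = h" using that unfolding q(2)[symmetric] by blast
    thus ?thesis unfolding r_def by (rule someI_ex)
  qed
  \<comment> \<open>The representatives \<open>r h\<close> are chosen without regard to linearity;
    as \<open>P\<close> is free on the elements of \<open>H'\<close>, they still define a linear
    map, and it lies over \<open>H'\<close>.\<close>
  define \<theta> where "\<theta> = fsum K ?CZ' (carrier H') r"
  have \<theta>: "lin K P ?CZ' \<theta>" unfolding P_def \<theta>_def by (rule lin_fsum[OF mCZ']) (simp add: r)
  have q\<theta>: "q (\<theta> p) = L p" if "p \<in> carrier P" for p
  proof -
    have p: "p \<in> fin_supp K (carrier H')" using that by (simp add: P_def)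
    have "q (\<theta> p) = fsum K H' (carrier H') (\<lambda>h. q (r h)) p"
      unfolding \<theta>_def by (rule lin_of_fsum[OF mCZ' H' q(1) p]) (simp add: r)
    also have "\<dots> = L p" unfolding L_def lin_comb_fsum fsum_def
      by (rule H'.finsum_cong') (use fin_suppD[OF p] in \<open>auto simp: r\<close>)
    finally show ?thesis .
  qed
  define R0 where "R0 = {p \<in> carrier P. L p = \<zero>\<^bsub>H'\<^esub>}"
  let ?R = "P\<lparr>carrier := R0\<rparr>"
  have R0: "submod K P R0" unfolding R0_def by (rule submod_kernel[OF mP H' L])
  have R: "module K ?R" by (rule module_submod[OF mP R0])
  have R0c: "R0 \<subseteq> carrier P" by (auto simp: R0_def)
  define X0 where "X0 = hom_module K ?R ?KK"
  define S where "S = (\<lambda>\<phi>. restrict \<phi> R0) ` mod_hom K P ?KK"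
  have dia: "diamond K H' = quot_module X0 S"
    by (simp add: diamond_def ext1_def Let_def X0_def S_def R0_def L_def P_def a_kernel_eq)
  have X0: "module K X0" unfolding X0_def by (rule module_hom[OF R KK])
  have res: "lin K (dual_module K P) X0 (\<lambda>\<phi>. restrict \<phi> R0)"
  proof (rule linI)
    show "restrict x R0 \<in> carrier X0" if "x \<in> carrier (dual_module K P)" for x
      using restrict_mod_hom[OF R lin_sub_dom[OF mod_hom_lin R0c], of x ?KK] that by (simp add: X0_def)
  qed (use R0c in \<open>auto simp: X0_def fun_eq_iff restrict_def\<close>)
  have S: "submod K X0 S"
    using submod_image[OF module_dual[OF mP] X0 res submod_carrier[OF module_dual[OF mP]]]
    by (simp add: S_def)
  have \<eta>R: "\<eta> z \<in> R0" if "z \<in> dC" for z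
    using that dCZ' \<eta>L lin_closed[OF \<eta>(1), of z] q(3)[of z] by (auto simp: R0_def dC_def)
  have \<theta>R: "\<theta> p \<in> dC" if "p \<in> R0" for p
  proof -
    have "p \<in> carrier P" "q (\<theta> p) = \<zero>\<^bsub>H'\<^esub>" using that q\<theta> by (auto simp: R0_def)
    thus ?thesis using lin_closed[OF \<theta>] q(3)[of "\<theta> p"] by (simp add: dC_def)
  qed
  have \<eta>dC: "lin K ?CB' ?R \<eta>"
    using lin_sub_cod[of K ?CB' P \<eta> R0] lin_sub_dom[OF \<eta>(1), of dC] dCZ' \<eta>R by simp
  have \<theta>dC: "lin K ?R ?CB' \<theta>"
    using lin_sub_cod[of K ?R C' \<theta> dC] lin_sub_dom[OF lin_incl[OF \<theta>] R0c] Z'c \<theta>R by (simp add: subsetI)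
  have dd: "lin K C ?CB' d" by (rule lin_sub_cod[OF d]) (simp add: dC_def)
  \<comment> \<open>The value \<open>d x\<close> is a boundary, hence trivial in \<open>H'\<close>,
    so \<open>\<eta>\<close> maps it to a relation, where \<open>\<rho>\<close> is defined.\<close>
  define F where "F = (\<lambda>\<rho> :: ('h \<Rightarrow> 'k) \<Rightarrow> 'k. \<lambda>x\<in>carrier C. \<rho> (\<eta> (d x)))"
  have F: "lin K X0 D F"
  proof (rule linI)
    fix \<rho> assume \<rho>: "\<rho> \<in> carrier X0"
    hence l\<rho>: "lin K ?R ?KK \<rho>" by (simp add: X0_def mod_hom_lin)
    note l = lin_comp[OF dd lin_comp[OF \<eta>dC l\<rho>]]
    have "\<rho> (\<eta> \<zero>\<^bsub>C'\<^esub>) = \<zero>\<^bsub>K\<^esub>"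
      using lin_zero[OF mCB' KK lin_comp[OF \<eta>dC l\<rho>]] by simp
    thus "F \<rho> \<in> carrier D"
      using restrict_mod_hom[OF C l] submod_closed[OF B(1)] by (simp add: F_def D_def ZZ_def B(2))
  qed (auto simp: F_def X0_def D_def fun_eq_iff restrict_def dC_def \<eta>R)
  have FS: "F \<rho> \<in> BB" if \<rho>: "\<rho> \<in> S" for \<rho>
  proof -
    from \<rho> obtain \<phi> where \<phi>: "\<phi> \<in> mod_hom K P ?KK" "\<rho> = restrict \<phi> R0" by (auto simp: S_def)
    have "F \<rho> = (\<lambda>x\<in>carrier C. \<phi> (\<eta> (d x)))"
      using \<phi>(2) \<eta>R by (auto simp: F_def fun_eq_iff restrict_def dC_def)
    thus ?thesis using BBI[OF lin_comp[OF \<eta>(1) mod_hom_lin[OF \<phi>(1)]]] by simp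
  qed
  \<comment> \<open>The induced functional on homology. The choice is harmless: the cosets of cycles
    exhaust \<open>H\<close>, so \<open>G_eqI\<close> makes it unique.\<close>
  define G where "G (\<phi> :: 'c \<Rightarrow> 'k) = (SOME g. g \<in> mod_hom K H ?KK \<and> (\<forall>z\<in>Z. g (B +>\<^bsub>?CZ\<^esub> z) = \<phi> z))" for \<phi>
  have G: "G \<phi> \<in> mod_hom K H ?KK" "\<And>z. z \<in> Z \<Longrightarrow> G \<phi> (B +>\<^bsub>?CZ\<^esub> z) = \<phi> z"
    if \<phi>: "\<phi> \<in> ZZ" for \<phi>
  proof -
    have "lin K C ?KK \<phi>" using \<phi> by (simp add: ZZ_def mod_hom_lin)
    hence "lin K ?CZ ?KK \<phi>" by (rule lin_sub_dom) (auto simp: Z_def)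
    from quot_lift[OF mCZ BZ KK this] \<phi>
    have "\<exists>g. g \<in> mod_hom K H ?KK \<and> (\<forall>z\<in>Z. g (B +>\<^bsub>?CZ\<^esub> z) = \<phi> z)"
      by (auto simp: ZZ_def H_def)
    from someI_ex[OF this] show "G \<phi> \<in> mod_hom K H ?KK" "\<And>z. z \<in> Z \<Longrightarrow> G \<phi> (B +>\<^bsub>?CZ\<^esub> z) = \<phi> z"
      unfolding G_def[symmetric] by auto
  qed
  have Hc: "carrier H = (\<lambda>z. B +>\<^bsub>?CZ\<^esub> z) ` Z" by (auto simp: H_def quot_module_sel(1))
  have G_eqI: "G \<phi> = g" if "\<phi> \<in> ZZ" "g \<in> mod_hom K H ?KK" "\<And>z. z \<in> Z \<Longrightarrow> g (B +>\<^bsub>?CZ\<^esub> z) = \<phi> z" for \<phi> g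
    by (rule mod_hom_eqI[OF G(1)[OF that(1)] that(2)]) (use G(2)[OF that(1)] that(3) in \<open>auto simp: Hc\<close>)
  note mDH = module_dual[OF mH]
  interpret DH: module K "dual_module K H" by fact
  have Zc: "Z \<subseteq> carrier C" by (auto simp: Z_def)
  have Gl: "lin K D (dual_module K H) G"
  proof (rule linI)
    show "G x \<in> carrier (dual_module K H)" if "x \<in> carrier D" for x
      using G(1) that by (simp add: D_def)
    show "G (x \<oplus>\<^bsub>D\<^esub> y) = G x \<oplus>\<^bsub>dual_module K H\<^esub> G y" if "x \<in> carrier D" "y \<in> carrier D" for x y
    proof (rule G_eqI)
      interpret D: module K D by fact
      show "x \<oplus>\<^bsub>D\<^esub> y \<in> ZZ" using D.a_closed[OF that] by (simp add: D_def)
      show "G x \<oplus>\<^bsub>dual_module K H\<^esub> G y \<in> mod_hom K H ?KK"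
        using DH.a_closed[of "G x" "G y"] G(1) that by (simp add: D_def)
    qed (use that G(2) Zc in \<open>auto simp: D_def Hc\<close>)
    show "G (a \<odot>\<^bsub>D\<^esub> x) = a \<odot>\<^bsub>dual_module K H\<^esub> G x" if "a \<in> carrier K" "x \<in> carrier D" for a x
    proof (rule G_eqI)
      interpret D: module K D by fact
      show "a \<odot>\<^bsub>D\<^esub> x \<in> ZZ" using D.smult_closed[OF that] by (simp add: D_def)
      show "a \<odot>\<^bsub>dual_module K H\<^esub> G x \<in> mod_hom K H ?KK"
        using DH.smult_closed[of a "G x"] G(1) that by (simp add: D_def)
    qed (use that G(2) Zc in \<open>auto simp: D_def Hc\<close>)
  qed
  have G0: "G \<phi> = \<zero>\<^bsub>dual_module K H\<^esub> \<longleftrightarrow> (\<forall>z\<in>Z. \<phi> z = \<zero>\<^bsub>K\<^esub>)" if "\<phi> \<in> ZZ" for \<phi>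
  proof
    assume g: "G \<phi> = \<zero>\<^bsub>dual_module K H\<^esub>"
    show "\<forall>z\<in>Z. \<phi> z = \<zero>\<^bsub>K\<^esub>" using G(2)[OF that, unfolded g] by (simp add: Hc)
  next
    assume "\<forall>z\<in>Z. \<phi> z = \<zero>\<^bsub>K\<^esub>"
    thus "G \<phi> = \<zero>\<^bsub>dual_module K H\<^esub>"
      using DH.zero_closed by (intro G_eqI[OF that]) (auto simp: Hc)
  qed
  have GBB: "G \<phi> = \<zero>\<^bsub>dual_module K H\<^esub>" if "\<phi> \<in> BB" for \<phi>
  proof -
    obtain \<psi> where \<psi>: "\<psi> \<in> mod_hom K C' ?KK" "\<phi> = (\<lambda>x\<in>carrier C. \<psi> (d x))"
      using \<open>\<phi> \<in> BB\<close> by (auto simp: BB_def)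
    have "\<phi> \<in> ZZ" using submod_closed[OF BB that] by (simp add: D_def)
    thus ?thesis unfolding G0[OF \<open>\<phi> \<in> ZZ\<close>]
      using lin_zero[OF C'(1) KK mod_hom_lin[OF \<psi>(1)]] Zc by (auto simp: \<psi>(2) Z_def)
  qed
  let ?c = "\<lambda>\<phi>. BB +>\<^bsub>D\<^esub> \<phi>"
  note lc = lin_coset[OF D BB]
  have F0: "?c (F \<rho>) = \<zero>\<^bsub>?Y\<^esub>" if "\<rho> \<in> S" for \<rho>
    using coset_zero_iff[OF D BB] lin_closed[OF F submod_closed[OF S that]] FS[OF that]
    by (simp add: quot_module_sel)
  from quot_lift[OF X0 S Y lin_comp[OF F lc] F0]
  obtain f where f: "f \<in> mod_hom K (diamond K H') ?Y" "\<And>\<rho>. \<rho> \<in> carrier X0 \<Longrightarrow> f (S +>\<^bsub>X0\<^esub> \<rho>) = ?c (F \<rho>)"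
    unfolding dia by auto
  from quot_lift[OF D BB mDH Gl GBB]
  obtain g where g: "g \<in> mod_hom K ?Y (dual_module K H)" "\<And>\<phi>. \<phi> \<in> ZZ \<Longrightarrow> g (?c \<phi>) = G \<phi>"
    by (auto simp: D_def)
  have mdia: "module K (diamond K H')" unfolding dia by (rule module_quot[OF X0 S])
  have diac: "carrier (diamond K H') = (\<lambda>\<rho>. S +>\<^bsub>X0\<^esub> \<rho>) ` carrier X0"
    by (auto simp: dia quot_module_sel(1))
  have Yc: "carrier ?Y = ?c ` ZZ" by (auto simp: D_def quot_module_sel(1))
  have Fc: "F \<rho> \<in> ZZ" if "\<rho> \<in> carrier X0" for \<rho> using lin_closed[OF F that] by (simp add: D_def)
  have \<rho>l: "lin K ?R ?KK \<rho>" if "\<rho> \<in> carrier X0" for \<rho> using that by (simp add: X0_def mod_hom_lin)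
  have "inj_on f (carrier (diamond K H'))"
  proof (rule lin_inj_on[OF mdia Y mod_hom_lin[OF f(1)]])
    fix X assume X: "X \<in> carrier (diamond K H')" "f X = \<zero>\<^bsub>?Y\<^esub>"
    then obtain \<rho> where \<rho>: "\<rho> \<in> carrier X0" "X = S +>\<^bsub>X0\<^esub> \<rho>" by (auto simp: diac)
    have "F \<rho> \<in> BB"
      using X \<rho> f(2)[OF \<rho>(1)] coset_zero_iff[OF D BB] lin_closed[OF F \<rho>(1)] by (simp add: quot_module_sel)
    then obtain \<psi> where \<psi>: "\<psi> \<in> mod_hom K C' ?KK" "F \<rho> = (\<lambda>x\<in>carrier C. \<psi> (d x))"
      by (auto simp: BB_def)
    have \<psi>e: "\<rho> (\<eta> z) = \<psi> z" if "z \<in> dC" for z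
    proof -
      from that obtain x where x: "x \<in> carrier C" "z = d x" by (auto simp: dC_def)
      thus ?thesis using fun_cong[OF \<psi>(2), of x] by (simp add: F_def)
    qed
    \<comment> \<open>\<open>\<rho>\<close> is extended from the relations to \<open>P\<close>: the
      part \<open>p - \<eta> (\<theta> p)\<close> is a relation, and on the remaining part
      \<open>\<psi>\<close> takes over, because it agrees with \<open>\<rho>\<close> after
      \<open>\<eta>\<close> on boundaries.\<close>
    let ?\<mu> = "\<lambda>p. p \<ominus>\<^bsub>P\<^esub> \<eta> (\<theta> p)"
    have \<mu>P: "lin K P P ?\<mu>" by (intro lin_minus mP lin_ident lin_comp[OF \<theta> \<eta>(1)])
    have \<mu>: "lin K P ?R ?\<mu>"
    proof (rule lin_sub_cod[OF \<mu>P])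
      fix p assume p: "p \<in> carrier P"
      have "L (?\<mu> p) = L p \<ominus>\<^bsub>H'\<^esub> q (\<theta> p)"
        using p lin_closed[OF \<theta> p] lin_closed[OF lin_comp[OF \<theta> \<eta>(1)] p]
        by (simp add: lin_diff[OF mP H' L] \<eta>L)
      thus "?\<mu> p \<in> R0" using lin_closed[OF \<mu>P p] lin_closed[OF L p] q\<theta>[OF p]
        by (simp add: R0_def H'.minus_eq H'.r_neg)
    qed
    let ?\<phi> = "\<lambda>p. \<rho> (?\<mu> p) \<oplus>\<^bsub>?KK\<^esub> \<psi> (\<theta> p)"
    have \<phi>: "lin K P ?KK ?\<phi>"
      by (intro lin_plus KK lin_comp[OF \<mu> \<rho>l[OF \<rho>(1)]] lin_comp[OF lin_incl[OF \<theta>] mod_hom_lin[OF \<psi>(1)]])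
        (use Z'c in auto)
    have "?\<phi> p = \<rho> p" if p: "p \<in> R0" for p
    proof -
      have r: "\<rho> p \<in> carrier K" "\<rho> (\<eta> (\<theta> p)) \<in> carrier K"
        using lin_closed[OF \<rho>l[OF \<rho>(1)]] p \<eta>R[OF \<theta>R[OF p]] by auto
      have "\<rho> (?\<mu> p) = \<rho> p \<ominus>\<^bsub>?KK\<^esub> \<rho> (\<eta> (\<theta> p))"
        by (rule lin_diff_sub[OF mP R0 KK \<rho>l[OF \<rho>(1)] p \<eta>R[OF \<theta>R[OF p]]])
      thus ?thesis
        using r \<psi>e[OF \<theta>R[OF p], symmetric] KK.l_neg[of "\<rho> (\<eta> (\<theta> p))"]
        by (simp add: a_minus_def KK.a_assoc[simplified] KK.a_inv_closed[simplified])
    qed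
    hence "\<rho> \<in> S" unfolding S_def
      using R0c \<rho>(1) restrict_mod_hom[OF mP \<phi>]
      by (intro image_eqI[of _ _ "restrict ?\<phi> (carrier P)"])
        (auto simp: X0_def mod_hom_iff extensional_def fun_eq_iff restrict_def subset_iff)
    thus "X = \<zero>\<^bsub>diamond K H'\<^esub>"
      using coset_zero_iff[OF X0 S \<rho>(1)] \<rho>(2) by (simp add: dia quot_module_sel)
  qed
  moreover have "f ` carrier (diamond K H') = {y \<in> carrier ?Y. g y = \<zero>\<^bsub>dual_module K H\<^esub>}"
  proof (intro equalityI subsetI)
    fix y assume "y \<in> f ` carrier (diamond K H')"
    then obtain \<rho> where \<rho>: "\<rho> \<in> carrier X0" "y = ?c (F \<rho>)" by (auto simp: diac f(2))
    have "\<rho> (\<eta> \<zero>\<^bsub>C'\<^esub>) = \<zero>\<^bsub>K\<^esub>"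
      using lin_zero[OF mCB' KK lin_comp[OF \<eta>dC \<rho>l[OF \<rho>(1)]]] by simp
    hence "G (F \<rho>) = \<zero>\<^bsub>dual_module K H\<^esub>" unfolding G0[OF Fc[OF \<rho>(1)]] using Zc by (auto simp: F_def Z_def)
    thus "y \<in> {y \<in> carrier ?Y. g y = \<zero>\<^bsub>dual_module K H\<^esub>}"
      using \<rho> Fc[OF \<rho>(1)] by (auto simp: Yc g(2))
  next
    fix y assume "y \<in> {y \<in> carrier ?Y. g y = \<zero>\<^bsub>dual_module K H\<^esub>}"
    then obtain \<phi> where \<phi>: "\<phi> \<in> ZZ" "y = ?c \<phi>" "G \<phi> = \<zero>\<^bsub>dual_module K H\<^esub>" by (auto simp: Yc g(2))
    have van: "\<phi> z = \<zero>\<^bsub>K\<^esub>" if "z \<in> Z" for z using G0[OF \<phi>(1)] \<phi>(3) that by blast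
    have l\<phi>: "lin K C ?KK \<phi>" using \<phi>(1) by (simp add: ZZ_def mod_hom_lin)
    let ?\<psi> = "\<lambda>z. \<phi> (t z)"
    have \<psi>: "lin K ?CB' ?KK ?\<psi>" by (rule lin_comp[OF t(1) l\<phi>])
    have \<phi>t: "\<phi> x = ?\<psi> (d x)" if x: "x \<in> carrier C" for x
    proof -
      have "\<phi> (x \<ominus>\<^bsub>C\<^esub> t (d x)) = \<zero>\<^bsub>?KK\<^esub>" using van lin_closed[OF split x] by simp
      thus ?thesis
        using lin_diff[OF C KK l\<phi> x, of "t (d x)"] lin_closed[OF lin_comp[OF dd t(1)] x] lin_closed[OF l\<phi>] x
        by (simp add: module_minus_eq_zero_iff[OF KK, simplified])
    qed
    \<comment> \<open>The functional induced on the boundaries is carried to the relations by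
      \<open>\<theta>\<close>. Pulling back by \<open>\<eta>\<close> returns it up to
      \<open>\<theta> \<eta> - 1\<close>, which maps cycles to boundaries; the discrepancy thus
      comes from a functional on all cycles and is a coboundary.\<close>
    define \<rho> where "\<rho> = (\<lambda>p\<in>R0. ?\<psi> (\<theta> p))"
    have \<rho>: "\<rho> \<in> carrier X0"
      using restrict_mod_hom[OF R lin_comp[OF \<theta>dC \<psi>]] by (simp add: X0_def \<rho>_def)
    let ?\<mu> = "\<lambda>z. \<theta> (\<eta> z) \<ominus>\<^bsub>C'\<^esub> z"
    have \<theta>\<eta>: "lin K ?CZ' C' (\<lambda>z. \<theta> (\<eta> z))"
      by (rule lin_incl[OF lin_comp[OF \<eta>(1) \<theta>]]) (use Z'c in auto)
    have \<mu>C: "lin K ?CZ' C' ?\<mu>"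
      by (intro lin_minus mCZ' C' \<theta>\<eta> lin_incl[OF lin_ident]) (use Z'c in auto)
    have \<mu>: "lin K ?CZ' ?CB' ?\<mu>"
    proof (rule lin_sub_cod[OF \<mu>C])
      fix z assume z: "z \<in> carrier ?CZ'"
      have te: "\<theta> (\<eta> z) \<in> Z'" using lin_closed[OF lin_comp[OF \<eta>(1) \<theta>] z] by simp
      have "q (?\<mu> z) = q (\<theta> (\<eta> z)) \<ominus>\<^bsub>H'\<^esub> q z"
        by (rule lin_diff_sub[OF C'(1) Z'(1) H' q(1) te]) (use z in simp)
      also have "\<dots> = \<zero>\<^bsub>H'\<^esub>"
        using q\<theta>[OF lin_closed[OF \<eta>(1) z]] \<eta>L[of z] z lin_closed[OF q(1) z]
        by (simp add: H'.minus_eq H'.r_neg)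
      finally show "?\<mu> z \<in> dC"
        using q(3)[OF submod_diff[OF C'(1) Z'(1) te, of z]] z by (simp add: dC_def)
    qed
    have "F \<rho> \<ominus>\<^bsub>D\<^esub> \<phi> = (\<lambda>x\<in>carrier C. ?\<psi> (?\<mu> (d x)))"
    proof (rule extensionalityI)
      interpret D: module K D by fact
      have Dc: "F \<rho> \<in> carrier D" "\<phi> \<in> carrier D" using Fc[OF \<rho>] \<phi>(1) by (auto simp: D_def)
      hence "F \<rho> \<ominus>\<^bsub>D\<^esub> \<phi> \<in> carrier D" by simp
      thus "F \<rho> \<ominus>\<^bsub>D\<^esub> \<phi> \<in> extensional (carrier C)" by (simp add: D_def ZZ_def mod_hom_iff)
      fix x assume x: "x \<in> carrier C"
      have ev: "lin K D ?KK (\<lambda>\<psi>. \<psi> x)" using x by (auto simp: lin_def D_def ZZ_def mod_hom_def)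
      have dx: "d x \<in> dC" using x by (simp add: dC_def)
      have "(F \<rho> \<ominus>\<^bsub>D\<^esub> \<phi>) x = F \<rho> x \<ominus>\<^bsub>?KK\<^esub> \<phi> x" by (rule lin_diff[OF D KK ev Dc])
      also have "\<dots> = ?\<psi> (\<theta> (\<eta> (d x))) \<ominus>\<^bsub>?KK\<^esub> ?\<psi> (d x)"
        using x \<eta>R[OF dx] \<phi>t[OF x] by (simp add: F_def \<rho>_def)
      also have "\<dots> = ?\<psi> (?\<mu> (d x))"
        by (rule lin_diff_sub[OF C'(1) dC KK \<psi> \<theta>R[OF \<eta>R[OF dx]] dx, symmetric])
      finally show "(F \<rho> \<ominus>\<^bsub>D\<^esub> \<phi>) x = (\<lambda>x\<in>carrier C. ?\<psi> (?\<mu> (d x))) x" using x by simp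
    qed simp
    hence "F \<rho> \<ominus>\<^bsub>D\<^esub> \<phi> \<in> BB" using BBI[OF lin_comp[OF \<mu> \<psi>]] by simp
    hence "?c (F \<rho>) = y"
      using coset_eq_iff[OF D BB] Fc[OF \<rho>] \<phi> by (simp add: D_def)
    thus "y \<in> f ` carrier (diamond K H')" using \<rho> by (auto simp: diac f(2) intro!: image_eqI)
  qed
  moreover have "g ` carrier ?Y = carrier (dual_module K H)"
  proof (intro equalityI subsetI)
    fix y assume "y \<in> g ` carrier ?Y"
    thus "y \<in> carrier (dual_module K H)" using G(1) by (auto simp: Yc g(2))
  next
    fix \<chi> assume "\<chi> \<in> carrier (dual_module K H)"
    hence \<chi>: "\<chi> \<in> mod_hom K H ?KK" by simp
    have lq: "lin K ?CZ H (\<lambda>z. B +>\<^bsub>?CZ\<^esub> z)" unfolding H_def by (rule lin_coset[OF mCZ BZ])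
    note l0 = lin_comp[OF lq mod_hom_lin[OF \<chi>]]
    \<comment> \<open>The functional on homology is extended to \<open>C\<close> through the
      projection onto the cycles provided by the splitting \<open>t\<close>.\<close>
    define \<phi> where "\<phi> = (\<lambda>x\<in>carrier C. \<chi> (B +>\<^bsub>?CZ\<^esub> (x \<ominus>\<^bsub>C\<^esub> t (d x))))"
    have \<phi>C: "\<phi> \<in> mod_hom K C ?KK"
      unfolding \<phi>_def by (rule restrict_mod_hom[OF C lin_comp[OF split l0]])
    have t0: "t \<zero>\<^bsub>C'\<^esub> = \<zero>\<^bsub>C\<^esub>" using lin_zero[OF mCB' C t(1)] by simp
    have \<phi>Z: "\<phi> z = \<chi> (B +>\<^bsub>?CZ\<^esub> z)" if "z \<in> Z" for z
    proof -
      have "z \<in> carrier C" "d z = \<zero>\<^bsub>C'\<^esub>" using that by (auto simp: Z_def)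
      moreover from this have "z \<ominus>\<^bsub>C\<^esub> \<zero>\<^bsub>C\<^esub> = z"
        using C.minus_eq[of z "\<zero>\<^bsub>C\<^esub>"] lin_uminus[OF C C lin_const_zero[OF C], of z] by simp
      ultimately show ?thesis by (simp add: \<phi>_def t0)
    qed
    have "\<phi> b = \<zero>\<^bsub>K\<^esub>" if b: "b \<in> B" for b
    proof -
      have bZ: "b \<in> Z" using submod_closed[OF BZ b] by simp
      have "B +>\<^bsub>?CZ\<^esub> b = \<zero>\<^bsub>H\<^esub>" using coset_zero_iff[OF mCZ BZ] bZ b by (simp add: H_def quot_module_sel)
      thus ?thesis using \<phi>Z[OF bZ] lin_zero[OF mH KK mod_hom_lin[OF \<chi>]] by simp
    qed
    hence \<phi>: "\<phi> \<in> ZZ" using \<phi>C by (simp add: ZZ_def)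
    have "G \<phi> = \<chi>" by (rule G_eqI[OF \<phi> \<chi>]) (simp add: \<phi>Z)
    thus "\<chi> \<in> g ` carrier ?Y" using \<phi> g(2)[OF \<phi>] by (auto simp: Yc intro!: image_eqI)
  qed
  ultimately have "short_exact K (diamond K H') f ?Y g (dual_module K H)"
    using f(1) g(1) by (simp add: short_exact_def a_kernel_eq)
  thus ?thesis unfolding D_def ZZ_def BB_def H_def Z_def dual_module_sel(1) by blast
qed

section \<open>Linear correspondences and double complexes\<close>

text \<open>Additive relations between modules that induce an isomorphism of the quotients by \<open>B\<close> and
  \<open>B'\<close>; unlike isomorphisms between the quotients themselves they compose without choices of
  representatives.\<close>

definition corr ::
  "'k ring \<Rightarrow> ('k, 'a) module \<Rightarrow> 'a set \<Rightarrow> ('k, 'b) module \<Rightarrow> 'b set \<Rightarrow> ('a \<Rightarrow> 'b \<Rightarrow> bool) \<Rightarrow> bool"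
  where
  "corr K M B N B' R \<longleftrightarrow>
     (\<forall>x y. R x y \<longrightarrow> x \<in> carrier M \<and> y \<in> carrier N) \<and>
     (\<forall>x\<in>carrier M. \<exists>y. R x y) \<and> (\<forall>y\<in>carrier N. \<exists>x. R x y) \<and>
     (\<forall>x y x' y'. R x y \<longrightarrow> R x' y' \<longrightarrow> R (x \<oplus>\<^bsub>M\<^esub> x') (y \<oplus>\<^bsub>N\<^esub> y')) \<and>
     (\<forall>a\<in>carrier K. \<forall>x y. R x y \<longrightarrow> R (a \<odot>\<^bsub>M\<^esub> x) (a \<odot>\<^bsub>N\<^esub> y)) \<and>
     (\<forall>x y. R x y \<longrightarrow> (x \<in> B \<longleftrightarrow> y \<in> B'))"

lemma corr_id: "corr K M B M B (\<lambda>x y. x \<in> carrier M \<and> y = x)" if "module K M"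
proof -
  interpret M: module K M by fact
  show ?thesis unfolding corr_def by auto
qed

lemma corr_comp:
  assumes "corr K M B N B' R" "corr K N B' P B'' S"
  shows "corr K M B P B'' (\<lambda>x z. \<exists>y. R x y \<and> S y z)"
  using assms unfolding corr_def by (intro conjI) (meson, meson, meson, meson, meson, meson)

lemma corr_sym: "corr K M B N B' R \<Longrightarrow> corr K N B' M B (\<lambda>y x. R x y)"
  unfolding corr_def by meson

lemma corr_iso:
  assumes "module K M" "lin K M N f" "bij_betw f (carrier M) (carrier N)" "B \<subseteq> carrier M" "f ` B = B'"
  shows "corr K M B N B' (\<lambda>x y. x \<in> carrier M \<and> y = f x)"
proof -
  interpret M: module K M by fact
  have inj: "inj_on f (carrier M)" and im: "f ` carrier M = carrier N"
    using assms(3) by (auto simp: bij_betw_def)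
  have "x \<in> B \<longleftrightarrow> f x \<in> B'" if "x \<in> carrier M" for x
    using that inj assms(4,5) by (auto simp: inj_on_def subset_iff)
  moreover have "\<exists>x\<in>carrier M. y = f x" if "y \<in> carrier N" for y using that im by blast
  ultimately show ?thesis
    unfolding corr_def
    by (auto simp: lin_add[OF assms(2)] lin_smult[OF assms(2)] lin_closed[OF assms(2)])
qed

text \<open>A partner \<open>f x\<close> is chosen for each \<open>x\<close>, in general not
  linearly. Applied to differences, the last clause of \<open>corr\<close> says that classes agree
  on one side exactly when they do on the other; this gives additivity, well-definedness and
  injectivity, and totality on the right gives surjectivity.\<close>

lemma corr_quot:
  assumes M: "module K M" and B: "submod K M B" and N: "module K N" and B': "submod K N B'"
    and R: "corr K M B N B' R"
  shows "\<exists>h. lin K (quot_module M B) (quot_module N B') h \<and>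
             bij_betw h (carrier (quot_module M B)) (carrier (quot_module N B'))"
proof -
  interpret M: module K M by fact
  interpret N: module K N by fact
  have c: "x \<in> carrier M \<and> y \<in> carrier N" if "R x y" for x y
    using R that unfolding corr_def by meson
  have l: "\<exists>y. R x y" if "x \<in> carrier M" for x using R that unfolding corr_def by meson
  have r: "\<exists>x. R x y" if "y \<in> carrier N" for y using R that unfolding corr_def by meson
  have add: "R (x \<oplus>\<^bsub>M\<^esub> x') (y \<oplus>\<^bsub>N\<^esub> y')" if "R x y" "R x' y'" for x y x' y'
    using R that unfolding corr_def by meson
  have sm: "R (a \<odot>\<^bsub>M\<^esub> x) (a \<odot>\<^bsub>N\<^esub> y)" if "R x y" "a \<in> carrier K" for a x y
    using R that unfolding corr_def by meson
  have iff: "x \<in> B \<longleftrightarrow> y \<in> B'" if "R x y" for x y using R that unfolding corr_def by meson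
  have diff: "R (x \<ominus>\<^bsub>M\<^esub> x') (y \<ominus>\<^bsub>N\<^esub> y')" if "R x y" "R x' y'" for x y x' y'
    using add[OF that(1) sm[OF that(2), of "\<ominus>\<^bsub>K\<^esub> \<one>\<^bsub>K\<^esub>"]] c[OF that(2)]
    by (simp add: M.minus_eq N.minus_eq module_uminus[OF M] module_uminus[OF N])
  define f where "f x = (SOME y. R x y)" for x
  have f: "R x (f x)" if "x \<in> carrier M" for x unfolding f_def using l[OF that] by (rule someI_ex)
  let ?c = "\<lambda>y. B' +>\<^bsub>N\<^esub> y" and ?b = "\<lambda>y. B +>\<^bsub>M\<^esub> y"
  have eq: "?b x = ?b x' \<longleftrightarrow> ?c y = ?c y'" if "R x y" "R x' y'" for x y x' y'
    using coset_eq_iff[OF M B] coset_eq_iff[OF N B'] c[OF that(1)] c[OF that(2)] iff[OF diff[OF that]]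
    by simp
  have F: "lin K M (quot_module N B') (\<lambda>x. ?c (f x))"
  proof (rule linI)
    fix x assume x: "x \<in> carrier M"
    note fx = f[OF x] c[OF f[OF x]]
    show "?c (f x) \<in> carrier (quot_module N B')" using fx by (auto simp: quot_module_sel(1))
    show "?c (f (x \<oplus>\<^bsub>M\<^esub> y)) = ?c (f x) \<oplus>\<^bsub>quot_module N B'\<^esub> ?c (f y)" if y: "y \<in> carrier M" for y
    proof -
      have "?c (f (x \<oplus>\<^bsub>M\<^esub> y)) = ?c (f x \<oplus>\<^bsub>N\<^esub> f y)"
        using eq[OF f[of "x \<oplus>\<^bsub>M\<^esub> y"] add[OF f[OF x] f[OF y]]] x y by simp
      also have "\<dots> = ?c (f x) \<oplus>\<^bsub>quot_module N B'\<^esub> ?c (f y)"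
        using fx c[OF f[OF y]] by (simp only: coset_add[OF N B'])
      finally show ?thesis .
    qed
    show "?c (f (a \<odot>\<^bsub>M\<^esub> x)) = a \<odot>\<^bsub>quot_module N B'\<^esub> ?c (f x)" if a: "a \<in> carrier K" for a
    proof -
      have "?c (f (a \<odot>\<^bsub>M\<^esub> x)) = ?c (a \<odot>\<^bsub>N\<^esub> f x)"
        using eq[OF f[of "a \<odot>\<^bsub>M\<^esub> x"] sm[OF f[OF x] a]] x a by simp
      also have "\<dots> = a \<odot>\<^bsub>quot_module N B'\<^esub> ?c (f x)"
        using fx a by (simp only: coset_smult[OF N B'])
      finally show ?thesis .
    qed
  qed
  have F0: "?c (f x) = \<zero>\<^bsub>quot_module N B'\<^esub>" if "x \<in> B" for x
  proof -
    have x: "x \<in> carrier M" using submod_closed[OF B that] .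
    show ?thesis using iff[OF f[OF x]] that coset_zero_iff[OF N B'] c[OF f[OF x]]
      by (simp add: quot_module_sel(2))
  qed
  have "\<exists>h\<in>mod_hom K (quot_module M B) (quot_module N B'). \<forall>x\<in>carrier M. h (?b x) = ?c (f x)"
    by (rule quot_lift[OF M B module_quot[OF N B'] F F0])
  then obtain h where "h \<in> mod_hom K (quot_module M B) (quot_module N B')"
    and h2: "\<forall>x\<in>carrier M. h (?b x) = ?c (f x)" by blast
  note h = mod_hom_lin[OF this(1)] h2
  have "inj_on h (carrier (quot_module M B))"
  proof (rule inj_onI)
    fix X Y assume XY: "X \<in> carrier (quot_module M B)" "Y \<in> carrier (quot_module M B)" "h X = h Y"
    then obtain x y where xy: "x \<in> carrier M" "y \<in> carrier M" "X = ?b x" "Y = ?b y"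
      unfolding quot_module_sel(1) by blast
    have "?c (f x) = ?c (f y)" using h(2) xy XY(3) by simp
    thus "X = Y" using eq[OF f[OF xy(1)] f[OF xy(2)]] xy by simp
  qed
  moreover have "carrier (quot_module N B') \<subseteq> h ` carrier (quot_module M B)"
  proof
    fix Y assume "Y \<in> carrier (quot_module N B')"
    then obtain y where y: "y \<in> carrier N" "Y = ?c y" unfolding quot_module_sel(1) by blast
    obtain x where x: "R x y" using r[OF y(1)] by blast
    have xc: "x \<in> carrier M" using c[OF x] by blast
    have "h (?b x) = Y" using eq[OF f[OF xc] x] h(2) xc y(2) by simp
    moreover have "?b x \<in> carrier (quot_module M B)" using xc unfolding quot_module_sel(1) by blast
    ultimately show "Y \<in> h ` carrier (quot_module M B)" by blast
  qed
  moreover have "h ` carrier (quot_module M B) \<subseteq> carrier (quot_module N B')"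
    using lin_closed[OF h(1)] by blast
  ultimately show ?thesis using h(1) unfolding bij_betw_def by blast
qed

lemma short_exact_iso:
  assumes "short_exact K X f Y g Z" "module K X" "module K Y" "module K Y'"
    and h: "lin K Y Y' h" "bij_betw h (carrier Y) (carrier Y')"
  shows "\<exists>f' g'. short_exact K X f' Y' g' Z"
proof -
  let ?f = "restrict (\<lambda>x. h (f x)) (carrier X)"
  let ?i = "inv_into (carrier Y) h"
  let ?g = "restrict (\<lambda>y. g (?i y)) (carrier Y')"
  have f: "lin K X Y f" and g: "lin K Y Z g" and inj: "inj_on f (carrier X)"
    and ker: "f ` carrier X = {y \<in> carrier Y. g y = \<zero>\<^bsub>Z\<^esub>}" and surj: "g ` carrier Y = carrier Z"
    using assms(1) by (auto simp: short_exact_def mod_hom_iff a_kernel_eq)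
  have i: "lin K Y' Y ?i" by (rule lin_inv[OF assms(3) h])
  have hi: "inj_on h (carrier Y)" and him: "h ` carrier Y = carrier Y'"
    using h(2) by (auto simp: bij_betw_def)
  have ih: "?i (h y) = y" if "y \<in> carrier Y" for y using hi that by simp
  have "?f \<in> mod_hom K X Y'" by (rule restrict_mod_hom[OF assms(2) lin_comp[OF f h(1)]])
  moreover have "?g \<in> mod_hom K Y' Z" by (rule restrict_mod_hom[OF assms(4) lin_comp[OF i g]])
  moreover have "inj_on ?f (carrier X)"
    using inj hi lin_closed[OF f] by (auto simp: inj_on_def)
  moreover have "?f ` carrier X = {y \<in> carrier Y'. ?g y = \<zero>\<^bsub>Z\<^esub>}"
  proof -
    have "?f ` carrier X = h ` (f ` carrier X)" by (auto simp: image_image)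
    also have "\<dots> = {y \<in> h ` carrier Y. g (?i y) = \<zero>\<^bsub>Z\<^esub>}"
      unfolding ker by (auto simp: ih)
    finally show ?thesis unfolding him by auto
  qed
  moreover have "?g ` carrier Y' = carrier Z"
  proof -
    have "?g ` carrier Y' = (\<lambda>y. g (?i y)) ` h ` carrier Y" unfolding him by auto
    also have "\<dots> = g ` carrier Y" by (auto simp: image_image ih)
    finally show ?thesis using surj by simp
  qed
  ultimately show ?thesis unfolding short_exact_def a_kernel_eq by blast
qed

text \<open>The squares commute without signs, since no total complex is formed. Exactness holds in
  the first direction where the first index is positive and in the second where the second index is;
  what remains is the cohomology along the two edges.\<close>

locale double_complex =
  fixes K :: "'k ring" and D :: "nat \<Rightarrow> nat \<Rightarrow> ('k, 'w) module"
    and d \<delta> :: "nat \<Rightarrow> nat \<Rightarrow> 'w \<Rightarrow> 'w"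
  assumes mod: "module K (D p q)"
    and dl: "lin K (D p q) (D (Suc p) q) (d p q)"
    and \<delta>l: "lin K (D p q) (D p (Suc q)) (\<delta> p q)"
    and comm: "x \<in> carrier (D p q) \<Longrightarrow> d p (Suc q) (\<delta> p q x) = \<delta> (Suc p) q (d p q x)"
    and dd: "x \<in> carrier (D p q) \<Longrightarrow> d (Suc p) q (d p q x) = \<zero>\<^bsub>D (Suc (Suc p)) q\<^esub>"
    and \<delta>\<delta>: "x \<in> carrier (D p q) \<Longrightarrow> \<delta> p (Suc q) (\<delta> p q x) = \<zero>\<^bsub>D p (Suc (Suc q))\<^esub>"
    and exd: "x \<in> carrier (D (Suc p) q) \<Longrightarrow> d (Suc p) q x = \<zero>\<^bsub>D (Suc (Suc p)) q\<^esub> \<Longrightarrow>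
                \<exists>y\<in>carrier (D p q). d p q y = x"
    and ex\<delta>: "x \<in> carrier (D p (Suc q)) \<Longrightarrow> \<delta> p (Suc q) x = \<zero>\<^bsub>D p (Suc (Suc q))\<^esub> \<Longrightarrow>
                \<exists>y\<in>carrier (D p q). \<delta> p q y = x"
begin

definition cyc where
  "cyc p q = {x \<in> carrier (D p q). d p q x = \<zero>\<^bsub>D (Suc p) q\<^esub> \<and> \<delta> p q x = \<zero>\<^bsub>D p (Suc q)\<^esub>}"

text \<open>On the edge \<open>q = 0\<close>, \<open>cyc\<close> modulo \<open>bdh\<close> is the
  cohomology under \<open>d\<close> of the complex of \<open>\<delta>\<close>-cycles; on the edge
  \<open>p = 0\<close>, \<open>cyc\<close> modulo \<open>bdv\<close> is the cohomology under
  \<open>\<delta>\<close> of the complex of \<open>d\<close>-cycles.\<close>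

definition bdh where
  "bdh p q = (case p of 0 \<Rightarrow> {\<zero>\<^bsub>D 0 q\<^esub>} |
     Suc p' \<Rightarrow> d p' q ` {y \<in> carrier (D p' q). \<delta> p' q y = \<zero>\<^bsub>D p' (Suc q)\<^esub>})"

definition bdv where
  "bdv p q = (case q of 0 \<Rightarrow> {\<zero>\<^bsub>D p 0\<^esub>} |
     Suc q' \<Rightarrow> \<delta> p q' ` {y \<in> carrier (D p q'). d p q' y = \<zero>\<^bsub>D (Suc p) q'\<^esub>})"

text \<open>Away from the edges exactness writes the cycles as images, so both sides are the image
  of \<open>D p q\<close> under the diagonal of a commuting square.\<close>

lemma bdh_eq_bdv: "bdh (Suc p) (Suc q) = bdv (Suc p) (Suc q)"
proof -
  have "bdh (Suc p) (Suc q) = (\<lambda>z. d p (Suc q) (\<delta> p q z)) ` carrier (D p q)"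
  proof -
    have "{y \<in> carrier (D p (Suc q)). \<delta> p (Suc q) y = \<zero>\<^bsub>D p (Suc (Suc q))\<^esub>} = \<delta> p q ` carrier (D p q)"
      using ex\<delta>[of _ p q] \<delta>\<delta>[of _ p q] lin_closed[OF \<delta>l] by blast
    thus ?thesis by (simp add: bdh_def image_image)
  qed
  also have "\<dots> = (\<lambda>z. \<delta> (Suc p) q (d p q z)) ` carrier (D p q)"
    by (rule image_cong) (auto simp: comm)
  also have "\<dots> = bdv (Suc p) (Suc q)"
  proof -
    have "{y \<in> carrier (D (Suc p) q). d (Suc p) q y = \<zero>\<^bsub>D (Suc (Suc p)) q\<^esub>} = d p q ` carrier (D p q)"
      using exd[of _ p q] dd[of _ p q] lin_closed[OF dl] by blast
    thus ?thesis by (simp add: bdv_def image_image)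
  qed
  finally show ?thesis .
qed

lemma submod_cyc: "submod K (D p q) (cyc p q)"
proof -
  have "cyc p q = {x \<in> carrier (D p q). d p q x = \<zero>\<^bsub>D (Suc p) q\<^esub>} \<inter>
                  {x \<in> carrier (D p q). \<delta> p q x = \<zero>\<^bsub>D p (Suc q)\<^esub>}" by (auto simp: cyc_def)
  thus ?thesis using submod_inter[OF submod_kernel[OF mod mod dl] submod_kernel[OF mod mod \<delta>l]] by simp
qed

text \<open>One move along the antidiagonal: an element of \<open>D p q\<close> relates its image
  under \<open>d\<close> to its image under \<open>\<delta>\<close>. Exactness supplies such an
  element for every cycle on either side, and commutativity makes the other image a cycle
  too.\<close>

lemma corr_step:
  "corr K ((D (Suc p) q)\<lparr>carrier := cyc (Suc p) q\<rparr>) (bdh (Suc p) q)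
          ((D p (Suc q))\<lparr>carrier := cyc p (Suc q)\<rparr>) (bdv p (Suc q))
     (\<lambda>x y. \<exists>z\<in>carrier (D p q). x = d p q z \<and> y = \<delta> p q z \<and> x \<in> cyc (Suc p) q \<and> y \<in> cyc p (Suc q))"
proof -
  interpret D: module K "D p q" by (rule mod)
  have d0: "d p q z \<ominus>\<^bsub>D (Suc p) q\<^esub> d p q y = \<zero>\<^bsub>D (Suc p) q\<^esub> \<longleftrightarrow> d p q z = d p q y"
    if "z \<in> carrier (D p q)" "y \<in> carrier (D p q)" for z y
    using module_minus_eq_zero_iff[OF mod] lin_closed[OF dl] that by blast
  have \<delta>0: "\<delta> p q z \<ominus>\<^bsub>D p (Suc q)\<^esub> \<delta> p q y = \<zero>\<^bsub>D p (Suc q)\<^esub> \<longleftrightarrow> \<delta> p q z = \<delta> p q y"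
    if "z \<in> carrier (D p q)" "y \<in> carrier (D p q)" for z y
    using module_minus_eq_zero_iff[OF mod] lin_closed[OF \<delta>l] that by blast
  have sub: "z \<ominus>\<^bsub>D p q\<^esub> (z \<ominus>\<^bsub>D p q\<^esub> y) = y" if "z \<in> carrier (D p q)" "y \<in> carrier (D p q)" for z y
    using that by (simp add: D.minus_eq D.minus_add D.a_assoc[symmetric] D.r_neg D.add.inv_mult_group[folded a_inv_def])
  \<comment> \<open>If \<open>d z = d y\<close> with \<open>y\<close> a
    \<open>\<delta>\<close>-cycle, then \<open>z - y\<close> is a \<open>d\<close>-cycle with the
    same image under \<open>\<delta>\<close> as \<open>z\<close>; the converse is symmetric.\<close>
  have bd: "d p q z \<in> bdh (Suc p) q \<longleftrightarrow> \<delta> p q z \<in> bdv p (Suc q)" if z: "z \<in> carrier (D p q)" for z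
  proof
    assume "d p q z \<in> bdh (Suc p) q"
    then obtain y where y: "y \<in> carrier (D p q)" "\<delta> p q y = \<zero>\<^bsub>D p (Suc q)\<^esub>" "d p q z = d p q y"
      by (auto simp: bdh_def)
    let ?u = "z \<ominus>\<^bsub>D p q\<^esub> y"
    have "d p q ?u = \<zero>\<^bsub>D (Suc p) q\<^esub>"
      using d0[OF z y(1)] y(3) lin_diff[OF mod mod dl z y(1)] by simp
    moreover have "\<delta> p q (z \<ominus>\<^bsub>D p q\<^esub> ?u) = \<zero>\<^bsub>D p (Suc q)\<^esub>" using sub[OF z y(1)] y(2) by simp
    hence "\<delta> p q z = \<delta> p q ?u" using \<delta>0[OF z, of ?u] lin_diff[OF mod mod \<delta>l z, of ?u] z y by simp
    ultimately show "\<delta> p q z \<in> bdv p (Suc q)" using z y(1) unfolding bdv_def by auto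
  next
    assume "\<delta> p q z \<in> bdv p (Suc q)"
    then obtain y where y: "y \<in> carrier (D p q)" "d p q y = \<zero>\<^bsub>D (Suc p) q\<^esub>" "\<delta> p q z = \<delta> p q y"
      by (auto simp: bdv_def)
    let ?u = "z \<ominus>\<^bsub>D p q\<^esub> y"
    have "\<delta> p q ?u = \<zero>\<^bsub>D p (Suc q)\<^esub>"
      using \<delta>0[OF z y(1)] y(3) lin_diff[OF mod mod \<delta>l z y(1)] by simp
    moreover have "d p q (z \<ominus>\<^bsub>D p q\<^esub> ?u) = \<zero>\<^bsub>D (Suc p) q\<^esub>" using sub[OF z y(1)] y(2) by simp
    hence "d p q z = d p q ?u" using d0[OF z, of ?u] lin_diff[OF mod mod dl z, of ?u] z y by simp
    ultimately show "d p q z \<in> bdh (Suc p) q" using z y(1) unfolding bdh_def by auto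
  qed
  have left: "\<exists>z\<in>carrier (D p q). x = d p q z \<and> \<delta> p q z \<in> cyc p (Suc q)" if x: "x \<in> cyc (Suc p) q" for x
  proof -
    obtain z where z: "z \<in> carrier (D p q)" "d p q z = x" using exd[of x p q] x by (auto simp: cyc_def)
    have "\<delta> p q z \<in> cyc p (Suc q)"
      using x comm[OF z(1)] \<delta>\<delta>[OF z(1)] lin_closed[OF \<delta>l z(1)] z(2) by (simp add: cyc_def)
    thus ?thesis using z by blast
  qed
  have right: "\<exists>z\<in>carrier (D p q). y = \<delta> p q z \<and> d p q z \<in> cyc (Suc p) q" if y: "y \<in> cyc p (Suc q)" for y
  proof -
    obtain z where z: "z \<in> carrier (D p q)" "\<delta> p q z = y" using ex\<delta>[of y p q] y by (auto simp: cyc_def)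
    have "d p q z \<in> cyc (Suc p) q"
      using y comm[OF z(1)] dd[OF z(1)] lin_closed[OF dl z(1)] z(2) by (simp add: cyc_def)
    thus ?thesis using z by blast
  qed
  have cyc: "submod K (D p q) (cyc p q)" for p q
    by (rule submod_cyc)
  have cyc_add: "x \<oplus>\<^bsub>D p q\<^esub> y \<in> cyc p q" if "x \<in> cyc p q" "y \<in> cyc p q" for p q x y
    using cyc[of p q] that by (simp add: submod_def)
  have cyc_sm: "a \<odot>\<^bsub>D p q\<^esub> x \<in> cyc p q" if "x \<in> cyc p q" "a \<in> carrier K" for p q x a
    using cyc[of p q] that by (simp add: submod_def)
  show ?thesis
    unfolding corr_def
  proof (intro conjI allI ballI impI, goal_cases)
    case (1 x y) thus ?case by auto
  next
    case (2 x y) thus ?case by auto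
  next
    case (3 x) thus ?case using left[of x] by auto
  next
    case (4 y) thus ?case using right[of y] by auto
  next
    case (5 x y x' y')
    then obtain z z' where z: "z \<in> carrier (D p q)" "x = d p q z" "y = \<delta> p q z"
      and z': "z' \<in> carrier (D p q)" "x' = d p q z'" "y' = \<delta> p q z'"
      and m: "x \<in> cyc (Suc p) q" "y \<in> cyc p (Suc q)" "x' \<in> cyc (Suc p) q" "y' \<in> cyc p (Suc q)" by blast
    show ?case
      by (rule bexI[of _ "z \<oplus>\<^bsub>D p q\<^esub> z'"])
        (use z z' cyc_add[OF m(1,3)] cyc_add[OF m(2,4)]
          in \<open>simp_all add: lin_add[OF dl] lin_add[OF \<delta>l]\<close>)
  next
    case (6 a x y)
    then obtain z where z: "z \<in> carrier (D p q)" "x = d p q z" "y = \<delta> p q z"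
      and m: "x \<in> cyc (Suc p) q" "y \<in> cyc p (Suc q)" by blast
    show ?case
      by (rule bexI[of _ "a \<odot>\<^bsub>D p q\<^esub> z"])
        (use 6(1) z cyc_sm[OF m(1)] cyc_sm[OF m(2)]
          in \<open>simp_all add: lin_smult[OF dl] lin_smult[OF \<delta>l]\<close>)
  next
    case (7 x y) thus ?case using bd by blast
  qed
qed

lemma corr_edges:
  "\<exists>R. corr K ((D n 0)\<lparr>carrier := cyc n 0\<rparr>) (bdh n 0) ((D 0 n)\<lparr>carrier := cyc 0 n\<rparr>) (bdv 0 n) R"
proof -
  \<comment> \<open>\<open>corr_step\<close> starts with \<open>bdh\<close> and ends with
    \<open>bdv\<close>; this choice, together with \<open>bdh_eq_bdv\<close> in the interior, makes
    the end of each step the beginning of the next.\<close>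
  define B where "B p q = (if q = 0 then bdh p q else bdv p q)" for p q
  have step: "\<exists>R. corr K ((D (Suc p) q)\<lparr>carrier := cyc (Suc p) q\<rparr>) (B (Suc p) q)
          ((D p (Suc q))\<lparr>carrier := cyc p (Suc q)\<rparr>) (B p (Suc q)) R" for p q
  proof -
    have "B (Suc p) q = bdh (Suc p) q" by (cases q) (auto simp: B_def bdh_eq_bdv)
    moreover have "B p (Suc q) = bdv p (Suc q)" by (simp add: B_def)
    ultimately show ?thesis by simp (rule exI, rule corr_step)
  qed
  have "\<exists>R. corr K ((D (p + q) 0)\<lparr>carrier := cyc (p + q) 0\<rparr>) (B (p + q) 0)
          ((D p q)\<lparr>carrier := cyc p q\<rparr>) (B p q) R" for p q
  proof (induction q arbitrary: p)
    case 0
    show ?case using corr_id[OF module_submod[OF mod submod_cyc]] by auto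
  next
    case (Suc q)
    from Suc.IH[of "Suc p"] step[of p q] show ?case using corr_comp by fastforce
  qed
  from this[of 0 n] have "\<exists>R. corr K ((D n 0)\<lparr>carrier := cyc n 0\<rparr>) (B n 0) ((D 0 n)\<lparr>carrier := cyc 0 n\<rparr>) (B 0 n) R"
    by simp
  moreover have "B 0 n = bdv 0 n" by (cases n) (auto simp: B_def bdh_def bdv_def)
  moreover have "B n 0 = bdh n 0" by (simp add: B_def)
  ultimately show ?thesis by simp
qed

end

section \<open>Normalization\<close>

text \<open>A cosimplicial module on which all maps between finite ordinals act, monotone or not. This is
  what a functor on a category with coproducts yields, and it makes every cosimplicial identity
  below a computation with functions on numbers.\<close>

locale fin_module =
  fixes K :: "'k ring" and V :: "nat \<Rightarrow> ('k, 'v) module"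
    and act :: "nat \<Rightarrow> nat \<Rightarrow> (nat \<Rightarrow> nat) \<Rightarrow> 'v \<Rightarrow> 'v"
  assumes mod: "module K (V n)"
    and act_lin: "\<alpha> \<in> {..m} \<rightarrow> {..n} \<Longrightarrow> lin K (V m) (V n) (act m n \<alpha>)"
    and act_id: "(\<And>i. i \<le> n \<Longrightarrow> \<alpha> i = i) \<Longrightarrow> x \<in> carrier (V n) \<Longrightarrow> act n n \<alpha> x = x"
    and act_comp: "\<alpha> \<in> {..m} \<rightarrow> {..n} \<Longrightarrow> \<beta> \<in> {..n} \<rightarrow> {..k} \<Longrightarrow> (\<And>i. i \<le> m \<Longrightarrow> \<gamma> i = \<beta> (\<alpha> i)) \<Longrightarrow>
           x \<in> carrier (V m) \<Longrightarrow> act n k \<beta> (act m n \<alpha> x) = act m k \<gamma> x"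

text \<open>\<open>idem act n i\<close> is the idempotent \<open>d\<^sup>i\<^sup>+\<^sup>1 s\<^sup>i\<close> of level \<open>n\<close>, defined for \<open>i < n\<close>.\<close>

definition idem :: "(nat \<Rightarrow> nat \<Rightarrow> (nat \<Rightarrow> nat) \<Rightarrow> 'v \<Rightarrow> 'v) \<Rightarrow> nat \<Rightarrow> nat \<Rightarrow> 'v \<Rightarrow> 'v" where
  "idem act n i = act n n (id(Suc i := i))"

text \<open>The composite of the factors \<open>1 - idem i\<close> for \<open>i < k\<close>, the
  largest index applied last. The idempotents do not commute in general; in this order the result
  lies in the kernels of all of them.\<close>

primrec proj ::
  "(nat \<Rightarrow> ('k, 'v) module) \<Rightarrow> (nat \<Rightarrow> nat \<Rightarrow> (nat \<Rightarrow> nat) \<Rightarrow> 'v \<Rightarrow> 'v) \<Rightarrow> nat \<Rightarrow> nat \<Rightarrow> 'v \<Rightarrow> 'v" where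
  "proj V act n 0 x = x"
| "proj V act n (Suc k) x = proj V act n k x \<ominus>\<^bsub>V n\<^esub> idem act n k (proj V act n k x)"

definition norm where
  "norm V act n = {x \<in> carrier (V n). \<forall>i<n. idem act n i x = \<zero>\<^bsub>V n\<^esub>}"

text \<open>The differential of the normalized complex: it agrees there with the alternating sum of the
  cofaces, because the projection kills the images of all cofaces but the first.\<close>

definition bd where
  "bd V act n x = proj V act (Suc n) (Suc n) (act n (Suc n) Suc x)"

context fin_module
begin

abbreviation "E \<equiv> idem act"
abbreviation "\<pi> \<equiv> proj V act"
abbreviation "N \<equiv> norm V act"
abbreviation "dd \<equiv> bd V act"

lemma zero_in [simp]: "\<zero>\<^bsub>V n\<^esub> \<in> carrier (V n)"
proof -
  interpret V: module K "V n" by (rule mod)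
  show ?thesis by simp
qed

lemma diff_zero: "x \<in> carrier (V n) \<Longrightarrow> x \<ominus>\<^bsub>V n\<^esub> \<zero>\<^bsub>V n\<^esub> = x"
proof -
  interpret V: module K "V n" by (rule mod)
  show "x \<in> carrier (V n) \<Longrightarrow> x \<ominus>\<^bsub>V n\<^esub> \<zero>\<^bsub>V n\<^esub> = x"
    using lin_uminus[OF mod mod lin_const_zero[OF mod], of x n n] by (simp add: V.minus_eq)
qed

lemma diff_self: "x \<in> carrier (V n) \<Longrightarrow> x \<ominus>\<^bsub>V n\<^esub> x = \<zero>\<^bsub>V n\<^esub>"
  using module_minus_eq_zero_iff[OF mod] by blast

lemma act_in: "\<alpha> \<in> {..m} \<rightarrow> {..n} \<Longrightarrow> x \<in> carrier (V m) \<Longrightarrow> act m n \<alpha> x \<in> carrier (V n)"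
  by (rule lin_closed[OF act_lin])

lemma act_zero: "\<alpha> \<in> {..m} \<rightarrow> {..n} \<Longrightarrow> act m n \<alpha> \<zero>\<^bsub>V m\<^esub> = \<zero>\<^bsub>V n\<^esub>"
  by (rule lin_zero[OF mod mod act_lin])

lemma act_cong:
  assumes "\<alpha> \<in> {..m} \<rightarrow> {..n}" "\<And>i. i \<le> m \<Longrightarrow> \<alpha> i = \<beta> i" "x \<in> carrier (V m)"
  shows "act m n \<alpha> x = act m n \<beta> x"
proof -
  have "act n n id (act m n \<alpha> x) = act m n \<beta> x"
    by (rule act_comp) (use assms in auto)
  moreover have "act n n id (act m n \<alpha> x) = act m n \<alpha> x"
    by (rule act_id) (use act_in assms in auto)
  ultimately show ?thesis by simp
qed

lemma act_eq:
  assumes "\<alpha> \<in> {..m} \<rightarrow> {..n}" "\<beta> \<in> {..n} \<rightarrow> {..k}" "\<alpha>' \<in> {..m} \<rightarrow> {..n'}" "\<beta>' \<in> {..n'} \<rightarrow> {..k}"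
    "\<And>i. i \<le> m \<Longrightarrow> \<beta>' (\<alpha>' i) = \<beta> (\<alpha> i)" "x \<in> carrier (V m)"
  shows "act n k \<beta> (act m n \<alpha> x) = act n' k \<beta>' (act m n' \<alpha>' x)"
  using act_comp[OF assms(1,2) _ assms(6), of "\<lambda>i. \<beta> (\<alpha> i)"]
    act_comp[OF assms(3,4) _ assms(6), of "\<lambda>i. \<beta> (\<alpha> i)"] assms(5) by simp

lemma idem_fun: "i < n \<Longrightarrow> id(Suc i := i) \<in> {..n} \<rightarrow> {..n}"
  by auto

lemma idem_lin: "i < n \<Longrightarrow> lin K (V n) (V n) (E n i)"
  unfolding idem_def by (rule act_lin[OF idem_fun])

lemma idem_in: "i < n \<Longrightarrow> x \<in> carrier (V n) \<Longrightarrow> E n i x \<in> carrier (V n)"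
  by (rule lin_closed[OF idem_lin])

lemma idem_zero: "i < n \<Longrightarrow> E n i \<zero>\<^bsub>V n\<^esub> = \<zero>\<^bsub>V n\<^esub>"
  by (rule lin_zero[OF mod mod idem_lin])

lemma idem_diff: "i < n \<Longrightarrow> x \<in> carrier (V n) \<Longrightarrow> y \<in> carrier (V n) \<Longrightarrow>
    E n i (x \<ominus>\<^bsub>V n\<^esub> y) = E n i x \<ominus>\<^bsub>V n\<^esub> E n i y"
  by (rule lin_diff[OF mod mod idem_lin])

lemma idem_idem: "i < n \<Longrightarrow> x \<in> carrier (V n) \<Longrightarrow> E n i (E n i x) = E n i x"
  unfolding idem_def by (rule act_comp) auto

lemma proj_lin: "k \<le> n \<Longrightarrow> lin K (V n) (V n) (\<pi> n k)"
proof (induction k)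
  case 0
  have "\<pi> n 0 = (\<lambda>x. x)" by (rule ext) simp
  thus ?case by (simp only: lin_ident)
next
  case (Suc k)
  have "\<pi> n (Suc k) = (\<lambda>x. \<pi> n k x \<ominus>\<^bsub>V n\<^esub> E n k (\<pi> n k x))" by (rule ext) simp
  moreover have "lin K (V n) (V n) (\<lambda>x. \<pi> n k x \<ominus>\<^bsub>V n\<^esub> E n k (\<pi> n k x))"
    by (intro lin_minus mod lin_comp[OF Suc.IH idem_lin] Suc.IH) (use Suc.prems in auto)
  ultimately show ?case by (simp only:)
qed

lemma proj_in: "k \<le> n \<Longrightarrow> x \<in> carrier (V n) \<Longrightarrow> \<pi> n k x \<in> carrier (V n)"
  by (rule lin_closed[OF proj_lin])

lemma idem_proj: "j < k \<Longrightarrow> k \<le> n \<Longrightarrow> x \<in> carrier (V n) \<Longrightarrow> E n j (\<pi> n k x) = \<zero>\<^bsub>V n\<^esub>"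
proof (induction k)
  case (Suc k)
  let ?y = "\<pi> n k x"
  have y: "?y \<in> carrier (V n)" by (rule proj_in) (use Suc.prems in auto)
  have ey: "E n k ?y \<in> carrier (V n)" by (rule idem_in) (use Suc.prems y in auto)
  have *: "E n j (\<pi> n (Suc k) x) = E n j ?y \<ominus>\<^bsub>V n\<^esub> E n j (E n k ?y)"
    using Suc.prems y ey by (simp add: idem_diff)
  show ?case
  proof (cases "j = k")
    case True
    thus ?thesis using * Suc.prems y by (simp add: idem_idem diff_self idem_in)
  next
    case False
    hence jk: "j < k" using Suc.prems by simp
    have z: "E n j ?y = \<zero>\<^bsub>V n\<^esub>" using Suc.IH jk Suc.prems by simp
    \<comment> \<open>\<open>idem j\<close> after \<open>idem k\<close> is rewritten as a map
      applied after \<open>idem j\<close>, which already kills \<open>?y\<close>. Its value at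
      \<open>Suc k\<close> is where \<open>idem j\<close> sends \<open>k\<close>: this is
      \<open>j\<close> if \<open>k = Suc j\<close>, and \<open>k\<close> otherwise.\<close>
    let ?g = "id(Suc k := (id(Suc j := j)) k)"
    have g: "?g \<in> {..n} \<rightarrow> {..n}" using jk Suc.prems by auto
    have "E n j (E n k ?y) = act n n ?g (E n j ?y)"
      unfolding idem_def by (rule act_eq) (use jk Suc.prems y in auto)
    also have "\<dots> = \<zero>\<^bsub>V n\<^esub>" unfolding z by (rule act_zero[OF g])
    finally show ?thesis using * z by (simp add: diff_self)
  qed
qed simp

lemma normD: "x \<in> N n \<Longrightarrow> x \<in> carrier (V n)" "x \<in> N n \<Longrightarrow> i < n \<Longrightarrow> E n i x = \<zero>\<^bsub>V n\<^esub>"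
  by (auto simp: norm_def)

lemma proj_norm: "x \<in> carrier (V n) \<Longrightarrow> \<pi> n n x \<in> N n"
  by (simp add: norm_def proj_in idem_proj)

lemma proj_fix: "x \<in> N n \<Longrightarrow> k \<le> n \<Longrightarrow> \<pi> n k x = x"
  by (induction k) (auto simp: normD diff_zero)

text \<open>For \<open>l < k\<close> the map underlying \<open>idem l\<close> after
  \<open>idem k\<close> avoids the value \<open>Suc k\<close>, so \<open>idem k\<close> fixes the
  result. Hence every factor of the projection before the \<open>k\<close>-th preserves the fixed
  points of \<open>idem k\<close>.\<close>

lemma proj_idem:
  "x \<in> carrier (V n) \<Longrightarrow> E n k x = x \<Longrightarrow> l \<le> k \<Longrightarrow> k < n \<Longrightarrow> E n k (\<pi> n l x) = \<pi> n l x"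
proof (induction l)
  case (Suc l)
  let ?y = "\<pi> n l x"
  have y: "?y \<in> carrier (V n)" by (rule proj_in) (use Suc.prems in auto)
  have ey: "E n l ?y \<in> carrier (V n)" by (rule idem_in) (use Suc.prems y in auto)
  have IH: "E n k ?y = ?y" using Suc by simp
  have "E n k (E n l ?y) = E n k (E n l (E n k ?y))" using IH by simp
  also have "\<dots> = E n l (E n k ?y)"
  proof -
    have "E n l (E n k ?y) = act n n ((id(Suc l := l)) \<circ> (id(Suc k := k))) ?y"
      unfolding idem_def by (rule act_comp) (use Suc.prems y in auto)
    moreover have "E n k (act n n ((id(Suc l := l)) \<circ> (id(Suc k := k))) ?y) = act n n ((id(Suc l := l)) \<circ> (id(Suc k := k))) ?y"
      unfolding idem_def by (rule act_comp) (use Suc.prems y in auto)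
    ultimately show ?thesis by simp
  qed
  finally have "E n k (E n l ?y) = E n l ?y" using IH by simp
  thus ?case using IH Suc.prems y ey by (simp add: idem_diff)
qed simp

text \<open>Up to stage \<open>k\<close> the element stays fixed by \<open>idem k\<close>; the
  factor \<open>1 - idem k\<close> then annihilates it.\<close>

lemma proj_kills:
  assumes "x \<in> carrier (V n)" "E n k x = x" "k < n"
  shows "\<pi> n n x = \<zero>\<^bsub>V n\<^esub>"
proof -
  have "\<pi> n l x = \<zero>\<^bsub>V n\<^esub>" if "k < l" "l \<le> n" for l
    using that
  proof (induction l)
    case (Suc l)
    show ?case
    proof (cases "l = k")
      case True
      thus ?thesis using proj_idem[OF assms(1,2) order.refl assms(3)] proj_in[of k n x] assms
        by (simp add: diff_self)
    next
      case False
      thus ?thesis using Suc by (simp add: idem_zero diff_self)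
    qed
  qed simp
  thus ?thesis using assms(3) by simp
qed

section \<open>The differential of the normalized complex\<close>

lemma Suc_fun: "Suc \<in> {..n} \<rightarrow> {..Suc n}"
  by auto

lemma act_Suc_idem:
  assumes "i < n" "x \<in> carrier (V n)"
  shows "act n (Suc n) Suc (E n i x) = E (Suc n) (Suc i) (act n (Suc n) Suc x)"
  unfolding idem_def by (rule act_eq) (use assms in auto)

lemma proj_act_Suc_idem:
  assumes "i < n" "x \<in> carrier (V n)"
  shows "\<pi> (Suc n) (Suc n) (act n (Suc n) Suc (E n i x)) = \<zero>\<^bsub>V (Suc n)\<^esub>"
proof (rule proj_kills[of _ _ "Suc i"])
  show "act n (Suc n) Suc (E n i x) \<in> carrier (V (Suc n))"
    using assms by (intro act_in Suc_fun idem_in)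
  have "act n (Suc n) Suc x \<in> carrier (V (Suc n))" by (rule act_in[OF Suc_fun assms(2)])
  thus "E (Suc n) (Suc i) (act n (Suc n) Suc (E n i x)) = act n (Suc n) Suc (E n i x)"
    using assms by (simp add: act_Suc_idem idem_idem)
qed (use assms in auto)

lemma bd_lin: "lin K (V n) (V (Suc n)) (dd n)"
proof -
  have "dd n = (\<lambda>x. \<pi> (Suc n) (Suc n) (act n (Suc n) Suc x))" by (rule ext) (simp add: bd_def)
  thus ?thesis using lin_comp[OF act_lin[OF Suc_fun] proj_lin[OF order.refl]] by simp
qed

lemma bd_norm: "x \<in> carrier (V n) \<Longrightarrow> dd n x \<in> N (Suc n)"
  unfolding bd_def by (intro proj_norm act_in Suc_fun)

text \<open>The shift turns \<open>idem k\<close> into \<open>idem (Suc k)\<close>, so whatever the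
  projection removes becomes fixed by an idempotent one level up and is killed there.\<close>

lemma bd_proj:
  assumes "k \<le> n" "x \<in> carrier (V n)"
  shows "dd n (\<pi> n k x) = dd n x"
  using assms(1)
proof (induction k)
  case (Suc k)
  let ?y = "\<pi> n k x"
  have y: "?y \<in> carrier (V n)" by (rule proj_in) (use Suc.prems assms in auto)
  have "dd n (\<pi> n (Suc k) x) = dd n ?y \<ominus>\<^bsub>V (Suc n)\<^esub> dd n (E n k ?y)"
    using Suc.prems y by (simp add: lin_diff[OF mod mod bd_lin] idem_in)
  also have "dd n (E n k ?y) = \<zero>\<^bsub>V (Suc n)\<^esub>"
    unfolding bd_def by (rule proj_act_Suc_idem) (use Suc.prems y in auto)
  finally show ?case using Suc lin_closed[OF bd_lin y] by (simp add: diff_zero)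
qed simp

text \<open>Once the inner projection is dropped by \<open>bd_proj\<close>, the double shift
  remains. It omits the value 1, hence is fixed by \<open>idem 0\<close> and killed by the outer
  projection.\<close>

lemma bd_bd:
  assumes "x \<in> carrier (V n)"
  shows "dd (Suc n) (dd n x) = \<zero>\<^bsub>V (Suc (Suc n))\<^esub>"
proof -
  let ?y = "act n (Suc n) Suc x"
  have y: "?y \<in> carrier (V (Suc n))" by (rule act_in[OF Suc_fun assms])
  have "dd (Suc n) (dd n x) = dd (Suc n) ?y"
    unfolding bd_def[of V act n] by (rule bd_proj[OF order.refl y])
  also have "\<dots> = \<pi> (Suc (Suc n)) (Suc (Suc n)) (act n (Suc (Suc n)) (\<lambda>i. Suc (Suc i)) x)"
    unfolding bd_def by (subst act_comp[of _ _ _ _ _ "\<lambda>i. Suc (Suc i)"]) (use assms in auto)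
  also have "\<dots> = \<zero>\<^bsub>V (Suc (Suc n))\<^esub>"
  proof (rule proj_kills[of _ _ 0])
    show "act n (Suc (Suc n)) (\<lambda>i. Suc (Suc i)) x \<in> carrier (V (Suc (Suc n)))"
      by (rule act_in[OF _ assms]) auto
    show "E (Suc (Suc n)) 0 (act n (Suc (Suc n)) (\<lambda>i. Suc (Suc i)) x) = act n (Suc (Suc n)) (\<lambda>i. Suc (Suc i)) x"
      unfolding idem_def by (rule act_comp) (use assms in auto)
  qed simp
  finally show ?thesis .
qed

lemma submod_norm: "submod K (V n) (N n)"
proof (rule submodI)
  interpret V: module K "V n" by (rule mod)
  show "N n \<subseteq> carrier (V n)" by (auto simp: norm_def)
  show "\<zero>\<^bsub>V n\<^esub> \<in> N n" by (simp add: norm_def idem_zero)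
  show "x \<oplus>\<^bsub>V n\<^esub> y \<in> N n" if "x \<in> N n" "y \<in> N n" for x y
    using that by (simp add: norm_def lin_add[OF idem_lin])
  show "a \<odot>\<^bsub>V n\<^esub> x \<in> N n" if "a \<in> carrier K" "x \<in> N n" for a x
    using that by (simp add: norm_def lin_smult[OF idem_lin])
qed

text \<open>The idempotent is a coface after the codegeneracy, and the codegeneracy absorbs the
  idempotent; so one vanishes on an element exactly when the other does.\<close>

lemma norm_codegen:
  "N n = {x \<in> carrier (V n). \<forall>m i. n = Suc m \<longrightarrow> i \<le> m \<longrightarrow>
            act (Suc m) m (\<lambda>j. if j \<le> i then j else j - 1) x = \<zero>\<^bsub>V m\<^esub>}"
proof -
  have "E (Suc m) i x = \<zero>\<^bsub>V (Suc m)\<^esub> \<longleftrightarrow> act (Suc m) m (\<lambda>j. if j \<le> i then j else j - 1) x = \<zero>\<^bsub>V m\<^esub>"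
    if i: "i \<le> m" and x: "x \<in> carrier (V (Suc m))" for m i x
  proof
    let ?s = "\<lambda>j. if j \<le> i then j else j - 1" and ?d = "\<lambda>j. if j < Suc i then j else Suc j"
    have s: "?s \<in> {..Suc m} \<rightarrow> {..m}" and d: "?d \<in> {..m} \<rightarrow> {..Suc m}" using i by auto
    have ds: "act m (Suc m) ?d (act (Suc m) m ?s x) = E (Suc m) i x"
      unfolding idem_def by (rule act_comp[OF s d _ x]) auto
    have sE: "act (Suc m) m ?s (E (Suc m) i x) = act (Suc m) m ?s x"
      unfolding idem_def by (rule act_comp[OF _ s _ x]) (use i in auto)
    show "E (Suc m) i x = \<zero>\<^bsub>V (Suc m)\<^esub>" if "act (Suc m) m ?s x = \<zero>\<^bsub>V m\<^esub>"
      using ds act_zero[OF d] unfolding that by simp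
    show "act (Suc m) m ?s x = \<zero>\<^bsub>V m\<^esub>" if "E (Suc m) i x = \<zero>\<^bsub>V (Suc m)\<^esub>"
      using sE act_zero[OF s] unfolding that by simp
  qed
  thus ?thesis unfolding norm_def by (cases n) (auto simp: less_Suc_eq_le)
qed

text \<open>The projection kills all cofaces except the one omitting 0, because the coface omitting
  \<open>i > 0\<close> is fixed by \<open>idem\<close> at \<open>i - 1\<close>. It remains to see
  that the sum is normalized: \<open>idem j\<close> kills every term except those with index
  \<open>j\<close> and \<open>j + 1\<close>, which it maps to the same element with opposite
  signs.\<close>

lemma alternating_sum:
  assumes "x \<in> N n"
  shows "finsum (V (Suc n)) (\<lambda>i. if even i then act n (Suc n) (\<lambda>j. if j < i then j else Suc j) x
      else \<ominus>\<^bsub>V (Suc n)\<^esub> act n (Suc n) (\<lambda>j. if j < i then j else Suc j) x) {..Suc n} = dd n x"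
    (is "finsum _ ?t _ = _")
proof -
  interpret W: module K "V (Suc n)" by (rule mod)
  let ?\<delta> = "\<lambda>i j. if j < i then j else Suc (j :: nat)"
  let ?d = "\<lambda>i. act n (Suc n) (?\<delta> i) x"
  have x: "x \<in> carrier (V n)" by (rule normD(1)[OF assms])
  have \<delta>: "?\<delta> i \<in> {..n} \<rightarrow> {..Suc n}" for i by auto
  have d: "?d i \<in> carrier (V (Suc n))" for i by (rule act_in[OF \<delta> x])
  have t: "?t i \<in> carrier (V (Suc n))" for i using d by simp
  have neg0: "\<ominus>\<^bsub>V (Suc n)\<^esub> \<zero>\<^bsub>V (Suc n)\<^esub> = \<zero>\<^bsub>V (Suc n)\<^esub>"
    using W.minus_equality[of "\<zero>\<^bsub>V (Suc n)\<^esub>" "\<zero>\<^bsub>V (Suc n)\<^esub>"] by simp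
  let ?y = "finsum (V (Suc n)) ?t {..Suc n}"
  have y: "?y \<in> carrier (V (Suc n))" by (rule W.finsum_closed) (use t in auto)
  have pt: "\<pi> (Suc n) (Suc n) (?t i) = \<zero>\<^bsub>V (Suc n)\<^esub>" if "0 < i" "i \<le> Suc n" for i
  proof -
    have "E (Suc n) (i - 1) (?d i) = ?d i"
      unfolding idem_def by (rule act_comp[OF \<delta> _ _ x]) (use that in auto)
    hence z: "\<pi> (Suc n) (Suc n) (?d i) = \<zero>\<^bsub>V (Suc n)\<^esub>"
      by (rule proj_kills[OF d]) (use that in auto)
    moreover have "\<pi> (Suc n) (Suc n) (\<ominus>\<^bsub>V (Suc n)\<^esub> ?d i) = \<ominus>\<^bsub>V (Suc n)\<^esub> \<pi> (Suc n) (Suc n) (?d i)"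
      by (rule lin_uminus[OF mod mod proj_lin[OF order.refl] d])
    ultimately show ?thesis by (cases "even i") (simp_all only: neg0 if_True if_False)
  qed
  have "\<pi> (Suc n) (Suc n) ?y = finsum (V (Suc n)) (\<lambda>i. \<pi> (Suc n) (Suc n) (?t i)) {..Suc n}"
    by (rule lin_finsum[OF mod mod proj_lin[OF order.refl]]) (use t in auto)
  also have "\<dots> = finsum (V (Suc n)) (\<lambda>i. \<pi> (Suc n) (Suc n) (?t i)) {0}"
    by (rule W.add.finprod_mono_neutral_cong_right)
       (use pt t in \<open>auto intro!: proj_in simp del: proj.simps\<close>)
  also have "\<dots> = \<pi> (Suc n) (Suc n) (?t 0)"
    using W.finsum_insert[of "{}" 0 "\<lambda>i. \<pi> (Suc n) (Suc n) (?t i)"] proj_in[OF order.refl t[of 0]]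
    by (simp del: proj.simps)
  also have "\<dots> = dd n x"
    using act_cong[OF \<delta> _ x, of 0 Suc] by (simp add: bd_def del: proj.simps)
  finally have py: "\<pi> (Suc n) (Suc n) ?y = dd n x" .
  have "E (Suc n) j ?y = \<zero>\<^bsub>V (Suc n)\<^esub>" if j: "j < Suc n" for j
  proof -
    have Ed0: "E (Suc n) j (?d i) = \<zero>\<^bsub>V (Suc n)\<^esub>" if i: "i \<le> Suc n" "i \<noteq> j" "i \<noteq> Suc j" for i
    proof -
      \<comment> \<open>The idempotent moves past the coface, its index lowered by one if the coface
        inserts below it, and then acts on a normalized element.\<close>
      let ?j = "if i < j then j - 1 else j"
      have jn: "?j < n" using i j by auto
      have "E (Suc n) j (?d i) = act n (Suc n) (?\<delta> i) (E n ?j x)"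
        unfolding idem_def by (rule act_eq[OF \<delta> _ _ \<delta> _ x]) (use i j jn in auto)
      also have "\<dots> = \<zero>\<^bsub>V (Suc n)\<^esub>" using normD(2)[OF assms jn] act_zero[OF \<delta>] by simp
      finally show ?thesis .
    qed
    have Ed1: "E (Suc n) j (?d i) = ?d (Suc j)" if i: "i = j \<or> i = Suc j" for i
      unfolding idem_def by (rule act_comp[OF \<delta> _ _ x]) (use i j in auto)
    have neg: "E (Suc n) j (\<ominus>\<^bsub>V (Suc n)\<^esub> u) = \<ominus>\<^bsub>V (Suc n)\<^esub> E (Suc n) j u" if "u \<in> carrier (V (Suc n))" for u
      by (rule lin_uminus[OF mod mod idem_lin[OF j] that])
    have "E (Suc n) j ?y = finsum (V (Suc n)) (\<lambda>i. E (Suc n) j (?t i)) {..Suc n}"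
      by (rule lin_finsum[OF mod mod idem_lin[OF j]]) (use t in auto)
    also have "\<dots> = finsum (V (Suc n)) (\<lambda>i. E (Suc n) j (?t i)) {j, Suc j}"
    proof (rule W.add.finprod_mono_neutral_cong_right)
      show "E (Suc n) j (?t i) = \<zero>\<^bsub>V (Suc n)\<^esub>" if "i \<in> {..Suc n} - {j, Suc j}" for i
        using that Ed0[of i] d[of i] by (simp add: neg neg0)
    qed (use j t in \<open>auto intro!: idem_in\<close>)
    also have "\<dots> = E (Suc n) j (?t j) \<oplus>\<^bsub>V (Suc n)\<^esub> E (Suc n) j (?t (Suc j))"
    proof -
      have c: "E (Suc n) j (?t i) \<in> carrier (V (Suc n))" for i by (rule idem_in[OF j t])
      show ?thesis using c[of j] c[of "Suc j"]
        by (subst W.finsum_insert) (auto simp del: fun_upd_apply)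
    qed
    also have "\<dots> = \<zero>\<^bsub>V (Suc n)\<^esub>"
      using d[of j] d[of "Suc j"] Ed1[of j] Ed1[of "Suc j"] by (auto simp: neg W.r_neg W.l_neg)
    finally show ?thesis .
  qed
  hence "?y \<in> N (Suc n)" using y by (simp add: norm_def)
  from proj_fix[OF this order.refl] py show ?thesis by simp
qed

text \<open>At level 1 the projection subtracts from the first coface the second one, so the
  cocycles of degree 0 form an equalizer. In this form they are matched with compatible
  families.\<close>

lemma bd_zero_iff:
  assumes "x \<in> carrier (V 0)"
  shows "dd 0 x = \<zero>\<^bsub>V 1\<^esub> \<longleftrightarrow> act 0 1 Suc x = act 0 1 (\<lambda>_. 0) x"
proof -
  have 1: "act 0 1 Suc x \<in> carrier (V 1)" "act 0 1 (\<lambda>_. 0) x \<in> carrier (V 1)"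
    by (rule act_in[OF _ assms], simp)+
  have "E 1 0 (act 0 1 Suc x) = act 0 1 (\<lambda>_. 0) x"
    unfolding idem_def by (rule act_comp[OF _ _ _ assms]) auto
  thus ?thesis using module_minus_eq_zero_iff[OF mod 1] by (simp add: bd_def)
qed

end

subsection \<open>Contractions\<close>

text \<open>\<open>\<sigma>\<close> is an extra codegeneracy: it splits the first coface and is
  natural for the maps that fix 0 and shift another map by one. It will come from sending the copy
  with index 0 to a base point.\<close>

locale contracted_fin_module = fin_module +
  fixes \<sigma> :: "nat \<Rightarrow> 'b \<Rightarrow> 'b"
  assumes \<sigma>_lin: "lin K (V (Suc n)) (V n) (\<sigma> n)"
    and \<sigma>_act: "\<alpha> \<in> {..m} \<rightarrow> {..n} \<Longrightarrow> \<beta> 0 = 0 \<Longrightarrow> (\<And>i. i \<le> m \<Longrightarrow> \<beta> (Suc i) = Suc (\<alpha> i)) \<Longrightarrow>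
           x \<in> carrier (V (Suc m)) \<Longrightarrow> \<sigma> n (act (Suc m) (Suc n) \<beta> x) = act m n \<alpha> (\<sigma> m x)"
    and \<sigma>_Suc: "x \<in> carrier (V n) \<Longrightarrow> \<sigma> n (act n (Suc n) Suc x) = x"
begin

lemma \<sigma>_in: "x \<in> carrier (V (Suc n)) \<Longrightarrow> \<sigma> n x \<in> carrier (V n)"
  by (rule lin_closed[OF \<sigma>_lin])

lemma \<sigma>_idem: "i < n \<Longrightarrow> x \<in> carrier (V (Suc n)) \<Longrightarrow> \<sigma> n (E (Suc n) (Suc i) x) = E n i (\<sigma> n x)"
  unfolding idem_def by (rule \<sigma>_act) auto

lemma \<sigma>_norm: "x \<in> N (Suc n) \<Longrightarrow> \<sigma> n x \<in> N n"
  using \<sigma>_in lin_zero[OF mod mod \<sigma>_lin] by (auto simp: norm_def simp flip: \<sigma>_idem)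

text \<open>\<open>\<sigma>\<close> lowers the index of every idempotent except
  \<open>idem 0\<close>, which has no counterpart one level below and therefore stays under
  \<open>\<sigma>\<close>.\<close>

lemma \<sigma>_proj:
  assumes "k \<le> n" "x \<in> carrier (V (Suc n))"
  shows "\<sigma> n (\<pi> (Suc n) (Suc k) x) = \<pi> n k (\<sigma> n (x \<ominus>\<^bsub>V (Suc n)\<^esub> E (Suc n) 0 x))"
  using assms(1)
proof (induction k)
  case (Suc k)
  let ?y = "\<pi> (Suc n) (Suc k) x"
  have y: "?y \<in> carrier (V (Suc n))" by (rule proj_in) (use Suc.prems assms(2) in auto)
  have "\<sigma> n (\<pi> (Suc n) (Suc (Suc k)) x) = \<sigma> n (?y \<ominus>\<^bsub>V (Suc n)\<^esub> E (Suc n) (Suc k) ?y)"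
    by (simp only: proj.simps)
  also have "\<dots> = \<sigma> n ?y \<ominus>\<^bsub>V n\<^esub> \<sigma> n (E (Suc n) (Suc k) ?y)"
    by (rule lin_diff[OF mod mod \<sigma>_lin y idem_in]) (use Suc.prems y in auto)
  also have "\<sigma> n (E (Suc n) (Suc k) ?y) = E n k (\<sigma> n ?y)" using Suc.prems y by (simp only: \<sigma>_idem Suc_le_eq)
  finally show ?case using Suc by simp
qed simp

text \<open>Applying \<open>\<sigma>\<close> to \<open>dd x = 0\<close> yields the projection of
  \<open>x\<close> minus the first coface of \<open>\<sigma> x\<close>, which is
  \<open>x - dd (\<sigma> x)\<close> for normalized \<open>x\<close>.\<close>

lemma contraction:
  assumes x: "x \<in> N (Suc n)" and "dd (Suc n) x = \<zero>\<^bsub>V (Suc (Suc n))\<^esub>"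
  shows "dd n (\<sigma> n x) = x"
proof -
  have xc: "x \<in> carrier (V (Suc n))" by (rule normD(1)[OF x])
  \<comment> \<open>\<open>?\<beta>\<close> omits 1. It is what \<open>idem 0\<close> makes of the
    shift, and also the map that fixes 0 and shifts \<open>Suc\<close>, so
    \<open>\<sigma>_act\<close> applies to it.\<close>
  let ?n = "Suc n" and ?\<beta> = "\<lambda>i. if i = 0 then 0 else Suc i"
  let ?y = "act ?n (Suc ?n) Suc x"
  have y: "?y \<in> carrier (V (Suc ?n))" by (rule act_in[OF Suc_fun xc])
  have e: "E (Suc ?n) 0 ?y = act ?n (Suc ?n) ?\<beta> x"
    unfolding idem_def by (rule act_comp[OF Suc_fun _ _ xc]) auto
  have s: "\<sigma> ?n (act ?n (Suc ?n) ?\<beta> x) = act n ?n Suc (\<sigma> n x)"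
    by (rule \<sigma>_act[OF Suc_fun _ _ xc]) auto
  note ds = act_in[OF Suc_fun \<sigma>_in[OF xc]]
  have "\<zero>\<^bsub>V ?n\<^esub> = \<sigma> ?n (dd ?n x)" using assms(2) lin_zero[OF mod mod \<sigma>_lin] by simp
  also have "\<dots> = \<pi> ?n ?n (\<sigma> ?n (?y \<ominus>\<^bsub>V (Suc ?n)\<^esub> E (Suc ?n) 0 ?y))"
    unfolding bd_def by (rule \<sigma>_proj[OF order.refl y])
  also have "\<sigma> ?n (?y \<ominus>\<^bsub>V (Suc ?n)\<^esub> E (Suc ?n) 0 ?y) = \<sigma> ?n ?y \<ominus>\<^bsub>V ?n\<^esub> \<sigma> ?n (E (Suc ?n) 0 ?y)"
    by (rule lin_diff[OF mod mod \<sigma>_lin y idem_in]) (use y in auto)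
  also have "\<dots> = x \<ominus>\<^bsub>V ?n\<^esub> act n ?n Suc (\<sigma> n x)" by (simp only: e s \<sigma>_Suc[OF xc])
  also have "\<pi> ?n ?n \<dots> = \<pi> ?n ?n x \<ominus>\<^bsub>V ?n\<^esub> \<pi> ?n ?n (act n ?n Suc (\<sigma> n x))"
    by (rule lin_diff[OF mod mod proj_lin[OF order.refl] xc ds])
  also have "\<dots> = x \<ominus>\<^bsub>V ?n\<^esub> dd n (\<sigma> n x)" unfolding bd_def proj_fix[OF x order.refl] ..
  finally show ?thesis
    using module_minus_eq_zero_iff[OF mod xc, of "dd n (\<sigma> n x)"] lin_closed[OF bd_lin \<sigma>_in[OF xc]] by simp
qed

end

subsection \<open>Naturality\<close>

lemma idem_natural:
  assumes "\<And>m n \<alpha> x. \<alpha> \<in> {..m} \<rightarrow> {..n} \<Longrightarrow> x \<in> carrier (V m) \<Longrightarrow> \<eta> n (act m n \<alpha> x) = act' m n \<alpha> (\<eta> m x)"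
    "i < n" "x \<in> carrier (V n)"
  shows "\<eta> n (idem act n i x) = idem act' n i (\<eta> n x)"
  unfolding idem_def by (rule assms(1)) (use assms in auto)

lemma proj_natural:
  assumes V: "fin_module K V act" "fin_module K V' act'"
    and \<eta>: "\<And>n. lin K (V n) (V' n) (\<eta> n)"
    and nat: "\<And>m n \<alpha> x. \<alpha> \<in> {..m} \<rightarrow> {..n} \<Longrightarrow> x \<in> carrier (V m) \<Longrightarrow> \<eta> n (act m n \<alpha> x) = act' m n \<alpha> (\<eta> m x)"
    and "k \<le> n" "x \<in> carrier (V n)"
  shows "\<eta> n (proj V act n k x) = proj V' act' n k (\<eta> n x)"
  using assms(5)
proof (induction k)
  case (Suc k)
  interpret V: fin_module K V act by fact
  interpret V': fin_module K V' act' by fact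
  let ?y = "proj V act n k x"
  have y: "?y \<in> carrier (V n)" by (rule V.proj_in) (use Suc.prems assms in auto)
  have "\<eta> n (idem act n k ?y) = idem act' n k (\<eta> n ?y)"
    by (rule idem_natural[where V = V and \<eta> = \<eta> and act = act and act' = act'])
      (use nat Suc.prems y in auto)
  thus ?case using Suc y lin_diff[OF V.mod V'.mod \<eta> y V.idem_in[OF _ y], of k] by simp
qed simp

lemma bd_natural:
  assumes V: "fin_module K V act" "fin_module K V' act'"
    and \<eta>: "\<And>n. lin K (V n) (V' n) (\<eta> n)"
    and nat: "\<And>m n \<alpha> x. \<alpha> \<in> {..m} \<rightarrow> {..n} \<Longrightarrow> x \<in> carrier (V m) \<Longrightarrow> \<eta> n (act m n \<alpha> x) = act' m n \<alpha> (\<eta> m x)"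
    and x: "x \<in> carrier (V n)"
  shows "\<eta> (Suc n) (bd V act n x) = bd V' act' n (\<eta> n x)"
proof -
  interpret V: fin_module K V act by fact
  show ?thesis unfolding bd_def nat[OF V.Suc_fun x, symmetric]
    by (rule proj_natural[OF V \<eta> nat order.refl V.act_in[OF V.Suc_fun x]])
qed

lemma norm_natural:
  assumes V: "fin_module K V act" "fin_module K V' act'"
    and \<eta>: "\<And>n. lin K (V n) (V' n) (\<eta> n)"
    and nat: "\<And>m n \<alpha> x. \<alpha> \<in> {..m} \<rightarrow> {..n} \<Longrightarrow> x \<in> carrier (V m) \<Longrightarrow> \<eta> n (act m n \<alpha> x) = act' m n \<alpha> (\<eta> m x)"
    and x: "x \<in> norm V act n"
  shows "\<eta> n x \<in> norm V' act' n"
proof -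
  interpret V: fin_module K V act by fact
  interpret V': fin_module K V' act' by fact
  have xc: "x \<in> carrier (V n)" by (rule V.normD(1)[OF x])
  have "idem act' n i (\<eta> n x) = \<zero>\<^bsub>V' n\<^esub>" if "i < n" for i
  proof -
    have "idem act' n i (\<eta> n x) = \<eta> n (idem act n i x)"
      by (rule idem_natural[where V = V and \<eta> = \<eta> and act = act and act' = act', symmetric])
        (use nat that xc in auto)
    thus ?thesis using V.normD(2)[OF x that] lin_zero[OF V.mod V'.mod \<eta>] by simp
  qed
  thus ?thesis using lin_closed[OF \<eta> xc] by (simp add: norm_def)
qed

section \<open>Copies over another type\<close>

text \<open>The type token names the type of codes, which \<open>code\<close> carries only in its
  result type.\<close>

definition codable :: "'u itself \<Rightarrow> 'a set \<Rightarrow> bool" where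
  "codable _ S \<longleftrightarrow> (\<exists>e :: 'a \<Rightarrow> 'u. inj_on e S)"

lemma code_inj: "codable TYPE('u) S \<Longrightarrow> inj_on (code S :: 'a \<Rightarrow> 'u) S"
  unfolding codable_def code_def by (rule someI_ex[of "\<lambda>e. inj_on e S"])

lemma decode_code: "codable TYPE('u) S \<Longrightarrow> x \<in> S \<Longrightarrow> decode S (code S x :: 'u) = x"
  unfolding decode_def by (rule inv_into_f_f[OF code_inj])

lemma copy_sel:
  "carrier (copy M) = code (carrier M) ` carrier M"
  "\<zero>\<^bsub>copy M\<^esub> = code (carrier M) \<zero>\<^bsub>M\<^esub>"
  "x \<oplus>\<^bsub>copy M\<^esub> y = code (carrier M) (decode (carrier M) x \<oplus>\<^bsub>M\<^esub> decode (carrier M) y)"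
  "a \<odot>\<^bsub>copy M\<^esub> x = code (carrier M) (a \<odot>\<^bsub>M\<^esub> decode (carrier M) x)"
  by (simp_all add: copy_def Let_def)

lemma code_in: "x \<in> carrier M \<Longrightarrow> code (carrier M) x \<in> carrier (copy M)"
  by (simp add: copy_sel)

lemma copyE:
  assumes "y \<in> carrier (copy M)" obtains x where "x \<in> carrier M" "y = code (carrier M) x"
  using assms by (auto simp: copy_sel)

lemma code_lin:
  assumes "codable TYPE('u) (carrier M)"
  shows "lin K M (copy M :: ('k, 'u) module) (code (carrier M))"
  by (rule linI) (simp_all add: copy_sel decode_code[OF assms])

lemma module_copy:
  assumes "module K M" "codable TYPE('u) (carrier M)"
  shows "module K (copy M :: ('k, 'u) module)"
  by (rule module_image[OF assms(1), of "code (carrier M)"])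
    (simp_all add: copy_sel decode_code[OF assms(2)])

lemma code_bij:
  assumes "codable TYPE('u) (carrier M)"
  shows "bij_betw (code (carrier M)) (carrier M) (carrier (copy M :: ('k, 'u) module))"
  using code_inj[OF assms] by (simp add: bij_betw_def copy_sel)

lemma copy_map_code:
  assumes "codable TYPE('u) (carrier M)" "x \<in> carrier M"
  shows "(copy_map M N f :: 'u \<Rightarrow> 'v) (code (carrier M) x) = code (carrier N) (f x)"
  using assms by (simp add: copy_map_def decode_code)

lemma copy_map_cong:
  assumes "codable TYPE('u) (carrier M)" "\<And>x. x \<in> carrier M \<Longrightarrow> f x = g x"
  shows "(copy_map M N f :: 'u \<Rightarrow> 'v) = copy_map M N g"
  using assms by (auto simp: copy_map_def decode_code fun_eq_iff)

lemma copy_map_hom: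
  assumes "codable TYPE('u) (carrier M)" "codable TYPE('v) (carrier N)" "module K M" "lin K M N f"
  shows "(copy_map M N f :: 'u \<Rightarrow> 'v) \<in> mod_hom K (copy M) (copy N)"
proof -
  interpret M: module K M by fact
  note [simp] = lin_closed[OF assms(4)] decode_code[OF assms(1)] decode_code[OF assms(2)]
  have "lin K (copy M) (copy N) (copy_map M N f :: 'u \<Rightarrow> 'v)"
    by (rule linI; elim copyE; hypsubst)
      (simp_all add: copy_map_code[OF assms(1)] code_in copy_sel(3,4) lin_add[OF assms(4)] lin_smult[OF assms(4)])
  thus ?thesis by (simp add: mod_hom_iff copy_map_def copy_sel)
qed

lemma copy_map_id:
  assumes "codable TYPE('u) (carrier M)"
  shows "(copy_map M M (\<lambda>x. x) :: 'u \<Rightarrow> 'u) = (\<lambda>x\<in>carrier (copy M). x)"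
  using assms by (auto simp: copy_map_def copy_sel decode_code fun_eq_iff)

lemma copy_map_comp:
  assumes "codable TYPE('u) (carrier M)" "codable TYPE('v) (carrier N)"
    "\<And>x. x \<in> carrier M \<Longrightarrow> f x \<in> carrier N"
  shows "compose (carrier (copy M)) (copy_map N P g) (copy_map M N f :: 'u \<Rightarrow> 'v) = copy_map M P (\<lambda>x. g (f x))"
  using assms
  by (auto simp: copy_map_code[OF assms(1)] copy_map_code[OF assms(2)] copy_sel compose_def fun_eq_iff
      copy_map_def[of M P])
    (simp add: decode_code)

section \<open>Limits over categories with a weakly initial object and its copowers\<close>

lemma functorD:
  assumes "is_functor C (Mods K) F"
  shows "X \<in> Ob C \<Longrightarrow> module K (Fo F X)"
    and "X \<in> Ob C \<Longrightarrow> Y \<in> Ob C \<Longrightarrow> f \<in> Hom C X Y \<Longrightarrow> Fa F X Y f \<in> mod_hom K (Fo F X) (Fo F Y)"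
    and "X \<in> Ob C \<Longrightarrow> Y \<in> Ob C \<Longrightarrow> f \<in> Hom C X Y \<Longrightarrow> lin K (Fo F X) (Fo F Y) (Fa F X Y f)"
    and "X \<in> Ob C \<Longrightarrow> x \<in> carrier (Fo F X) \<Longrightarrow> Fa F X X (Id C X) x = x"
    and "X \<in> Ob C \<Longrightarrow> Y \<in> Ob C \<Longrightarrow> Z \<in> Ob C \<Longrightarrow> f \<in> Hom C X Y \<Longrightarrow> g \<in> Hom C Y Z \<Longrightarrow>
      x \<in> carrier (Fo F X) \<Longrightarrow> Fa F X Z (Comp C X g f) x = Fa F Y Z g (Fa F X Y f x)"
  using assms by (auto simp: is_functor_def Mods_def mod_hom_iff compose_def)

text \<open>\<open>c n\<close> plays the coproduct of \<open>n + 1\<close> copies of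
  \<open>c 0\<close>, and \<open>P\<close> is the action of maps between index sets. The universal
  property is stated only for splitting off the copy with index 0: the inclusions are
  \<open>P\<close> of the constant 0 and of \<open>Suc\<close>, and \<open>cp\<close> is the
  copairing. This is the form in which the contraction and the comparison of two arrows use
  it.\<close>

locale power_category =
  fixes K :: "'k ring" and C :: "('o, 'a) category" and c :: "nat \<Rightarrow> 'o"
    and P :: "nat \<Rightarrow> nat \<Rightarrow> (nat \<Rightarrow> nat) \<Rightarrow> 'a" and cp :: "nat \<Rightarrow> 'o \<Rightarrow> 'a \<Rightarrow> 'a \<Rightarrow> 'a"
  assumes cring: "cring K"
    and c_ob: "c n \<in> Ob C"
    and id_hom: "X \<in> Ob C \<Longrightarrow> Id C X \<in> Hom C X X"
    and comp_hom: "X \<in> Ob C \<Longrightarrow> Y \<in> Ob C \<Longrightarrow> Z \<in> Ob C \<Longrightarrow> f \<in> Hom C X Y \<Longrightarrow> g \<in> Hom C Y Z \<Longrightarrow>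
      Comp C X g f \<in> Hom C X Z"
    and comp_id: "X \<in> Ob C \<Longrightarrow> Y \<in> Ob C \<Longrightarrow> f \<in> Hom C X Y \<Longrightarrow> Comp C X f (Id C X) = f"
    and comp_assoc: "X \<in> Ob C \<Longrightarrow> Y \<in> Ob C \<Longrightarrow> Z \<in> Ob C \<Longrightarrow> W \<in> Ob C \<Longrightarrow>
      f \<in> Hom C X Y \<Longrightarrow> g \<in> Hom C Y Z \<Longrightarrow> h \<in> Hom C Z W \<Longrightarrow>
      Comp C X (Comp C Y h g) f = Comp C X h (Comp C X g f)"
    and P_hom: "\<alpha> \<in> {..m} \<rightarrow> {..n} \<Longrightarrow> P m n \<alpha> \<in> Hom C (c m) (c n)"
    and P_id: "(\<And>i. i \<le> n \<Longrightarrow> \<alpha> i = i) \<Longrightarrow> P n n \<alpha> = Id C (c n)"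
    and P_comp: "\<alpha> \<in> {..m} \<rightarrow> {..n} \<Longrightarrow> \<beta> \<in> {..n} \<rightarrow> {..k} \<Longrightarrow> (\<And>i. i \<le> m \<Longrightarrow> \<gamma> i = \<beta> (\<alpha> i)) \<Longrightarrow>
      Comp C (c m) (P n k \<beta>) (P m n \<alpha>) = P m k \<gamma>"
    and cp_hom: "X \<in> Ob C \<Longrightarrow> h \<in> Hom C (c 0) X \<Longrightarrow> f \<in> Hom C (c n) X \<Longrightarrow> cp n X h f \<in> Hom C (c (Suc n)) X"
    and cp_0: "X \<in> Ob C \<Longrightarrow> h \<in> Hom C (c 0) X \<Longrightarrow> f \<in> Hom C (c n) X \<Longrightarrow>
      Comp C (c 0) (cp n X h f) (P 0 (Suc n) (\<lambda>_. 0)) = h"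
    and cp_Suc: "X \<in> Ob C \<Longrightarrow> h \<in> Hom C (c 0) X \<Longrightarrow> f \<in> Hom C (c n) X \<Longrightarrow>
      Comp C (c n) (cp n X h f) (P n (Suc n) Suc) = f"
    and cp_unique: "X \<in> Ob C \<Longrightarrow> g \<in> Hom C (c (Suc n)) X \<Longrightarrow> g' \<in> Hom C (c (Suc n)) X \<Longrightarrow>
      Comp C (c 0) g (P 0 (Suc n) (\<lambda>_. 0)) = Comp C (c 0) g' (P 0 (Suc n) (\<lambda>_. 0)) \<Longrightarrow>
      Comp C (c n) g (P n (Suc n) Suc) = Comp C (c n) g' (P n (Suc n) Suc) \<Longrightarrow> g = g'"
    and weakly_initial: "X \<in> Ob C \<Longrightarrow> \<exists>h. h \<in> Hom C (c 0) X"
begin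

definition lev :: "('o, 'a, ('k, 'v) module, 'v \<Rightarrow> 'v) ftr \<Rightarrow> nat \<Rightarrow> ('k, 'v) module" where
  "lev F n = Fo F (c n)"

definition lact :: "('o, 'a, ('k, 'v) module, 'v \<Rightarrow> 'v) ftr \<Rightarrow> nat \<Rightarrow> nat \<Rightarrow> (nat \<Rightarrow> nat) \<Rightarrow> 'v \<Rightarrow> 'v" where
  "lact F m n \<alpha> = Fa F (c m) (c n) (P m n \<alpha>)"

lemma fin_module_functor:
  assumes F: "is_functor C (Mods K) F"
  shows "fin_module K (lev F) (lact F)"
proof -
  have 1: "module K (lev F n)" for n unfolding lev_def by (rule functorD(1)[OF F c_ob])
  have 2: "lin K (lev F m) (lev F n) (lact F m n \<alpha>)" if "\<alpha> \<in> {..m} \<rightarrow> {..n}" for \<alpha> m n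
    unfolding lev_def lact_def by (rule functorD(3)[OF F c_ob c_ob P_hom[OF that]])
  have 3: "lact F n n \<alpha> x = x" if "\<And>i. i \<le> n \<Longrightarrow> \<alpha> i = i" "x \<in> carrier (lev F n)" for n \<alpha> x
    using functorD(4)[OF F c_ob] that P_id[of n \<alpha>] unfolding lev_def lact_def by simp
  have 4: "lact F n k \<beta> (lact F m n \<alpha> x) = lact F m k \<gamma> x"
    if "\<alpha> \<in> {..m} \<rightarrow> {..n}" "\<beta> \<in> {..n} \<rightarrow> {..k}" "\<And>i. i \<le> m \<Longrightarrow> \<gamma> i = \<beta> (\<alpha> i)" "x \<in> carrier (lev F m)"
    for \<alpha> m n \<beta> k \<gamma> x
  proof -
    have "P m k \<gamma> = Comp C (c m) (P n k \<beta>) (P m n \<alpha>)" using P_comp[OF that(1,2,3)] by simp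
    thus ?thesis
      using functorD(5)[OF F c_ob c_ob c_ob P_hom[OF that(1)] P_hom[OF that(2)], of x] that(4)
      unfolding lev_def lact_def by simp
  qed
  show ?thesis using 1 2 3 4 by (rule fin_module.intro)
qed

definition pt :: "'o \<Rightarrow> 'a" where
  "pt X = (SOME h. h \<in> Hom C (c 0) X)"

lemma pt_hom: "X \<in> Ob C \<Longrightarrow> pt X \<in> Hom C (c 0) X"
  unfolding pt_def by (rule someI_ex) (rule weakly_initial)

text \<open>Both sides have the same two legs, so they agree by uniqueness of the copairing. This
  becomes the naturality of the extra codegeneracy.\<close>

lemma cp_P:
  assumes X: "X \<in> Ob C" and h: "h \<in> Hom C (c 0) X" and f: "f \<in> Hom C (c n) X"
    and \<alpha>: "\<alpha> \<in> {..m} \<rightarrow> {..n}" and \<beta>: "\<beta> 0 = 0" "\<And>i. i \<le> m \<Longrightarrow> \<beta> (Suc i) = Suc (\<alpha> i)"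
  shows "Comp C (c (Suc m)) (cp n X h f) (P (Suc m) (Suc n) \<beta>) = cp m X h (Comp C (c m) f (P m n \<alpha>))"
proof -
  have \<beta>': "\<beta> \<in> {..Suc m} \<rightarrow> {..Suc n}"
  proof
    fix i assume "i \<in> {..Suc m}"
    thus "\<beta> i \<in> {..Suc n}" using \<alpha> \<beta> by (cases i) auto
  qed
  have 0: "(\<lambda>_. 0) \<in> {..0} \<rightarrow> {..Suc m}" for m :: nat by simp
  have S: "Suc \<in> {..m} \<rightarrow> {..Suc m}" for m by auto
  note f\<alpha> = comp_hom[OF c_ob c_ob X P_hom[OF \<alpha>] f]
  note g = cp_hom[OF X h f]
  have "Comp C (c 0) (Comp C (c (Suc m)) (cp n X h f) (P (Suc m) (Suc n) \<beta>)) (P 0 (Suc m) (\<lambda>_. 0))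
      = Comp C (c 0) (cp n X h f) (Comp C (c 0) (P (Suc m) (Suc n) \<beta>) (P 0 (Suc m) (\<lambda>_. 0)))"
    by (rule comp_assoc[OF c_ob c_ob c_ob X P_hom[OF 0] P_hom[OF \<beta>'] g])
  also have "Comp C (c 0) (P (Suc m) (Suc n) \<beta>) (P 0 (Suc m) (\<lambda>_. 0)) = P 0 (Suc n) (\<lambda>_. 0)"
    by (rule P_comp[OF 0 \<beta>']) (simp add: \<beta>)
  also have "Comp C (c 0) (cp n X h f) (P 0 (Suc n) (\<lambda>_. 0)) = h" by (rule cp_0[OF X h f])
  also have "\<dots> = Comp C (c 0) (cp m X h (Comp C (c m) f (P m n \<alpha>))) (P 0 (Suc m) (\<lambda>_. 0))"
    by (rule cp_0[OF X h f\<alpha>, symmetric])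
  finally have e0: "Comp C (c 0) (Comp C (c (Suc m)) (cp n X h f) (P (Suc m) (Suc n) \<beta>)) (P 0 (Suc m) (\<lambda>_. 0))
    = Comp C (c 0) (cp m X h (Comp C (c m) f (P m n \<alpha>))) (P 0 (Suc m) (\<lambda>_. 0))" .
  have "Comp C (c m) (Comp C (c (Suc m)) (cp n X h f) (P (Suc m) (Suc n) \<beta>)) (P m (Suc m) Suc)
      = Comp C (c m) (cp n X h f) (Comp C (c m) (P (Suc m) (Suc n) \<beta>) (P m (Suc m) Suc))"
    by (rule comp_assoc[OF c_ob c_ob c_ob X P_hom[OF S] P_hom[OF \<beta>'] g])
  also have "Comp C (c m) (P (Suc m) (Suc n) \<beta>) (P m (Suc m) Suc) = P m (Suc n) (\<lambda>i. Suc (\<alpha> i))"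
    by (rule P_comp[OF S \<beta>']) (simp add: \<beta>)
  also have "\<dots> = Comp C (c m) (P n (Suc n) Suc) (P m n \<alpha>)"
    by (rule P_comp[OF \<alpha> S, symmetric]) simp
  also have "Comp C (c m) (cp n X h f) \<dots> = Comp C (c m) (Comp C (c n) (cp n X h f) (P n (Suc n) Suc)) (P m n \<alpha>)"
    by (rule comp_assoc[OF c_ob c_ob c_ob X P_hom[OF \<alpha>] P_hom[OF S] g, symmetric])
  also have "\<dots> = Comp C (c m) f (P m n \<alpha>)" by (simp only: cp_Suc[OF X h f])
  also have "\<dots> = Comp C (c m) (cp m X h (Comp C (c m) f (P m n \<alpha>))) (P m (Suc m) Suc)"
    by (rule cp_Suc[OF X h f\<alpha>, symmetric])
  finally have e1: "Comp C (c m) (Comp C (c (Suc m)) (cp n X h f) (P (Suc m) (Suc n) \<beta>)) (P m (Suc m) Suc)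
    = Comp C (c m) (cp m X h (Comp C (c m) f (P m n \<alpha>))) (P m (Suc m) Suc)" .
  show ?thesis
    by (rule cp_unique[OF X comp_hom[OF c_ob c_ob X P_hom[OF \<beta>'] g] cp_hom[OF X h f\<alpha>] e0 e1])
qed

subsection \<open>Injective functors are contractible\<close>

text \<open>An arrow of this category record does not determine its target, so a coordinate is
  indexed by the target together with the arrow.\<close>

definition idx :: "'o \<Rightarrow> ('o \<times> 'a) set" where
  "idx X = {(Y, f). Y \<in> Ob C \<and> f \<in> Hom C X Y}"

definition cofree_mod :: "('o, 'a, ('k, 'w) module, 'w \<Rightarrow> 'w) ftr \<Rightarrow> 'o \<Rightarrow> ('k, 'o \<times> 'a \<Rightarrow> 'w) module" where
  "cofree_mod I X = prod_module (idx X) (\<lambda>p. Fo I (fst p))"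

definition cofree_map :: "'o \<Rightarrow> 'o \<Rightarrow> 'a \<Rightarrow> ('o \<times> 'a \<Rightarrow> 'w) \<Rightarrow> ('o \<times> 'a \<Rightarrow> 'w)" where
  "cofree_map X X' g y = (\<lambda>p\<in>idx X'. y (fst p, Comp C X (snd p) g))"

text \<open>The functor cofree on the values of \<open>I\<close>. It contains \<open>I\<close>, so an injective \<open>I\<close> is a retract
  of it, and its value on a copower is a product of sets of functions on powers of a nonempty set,
  on which a base point gives a contraction.\<close>

definition cofree ::
  "('o, 'a, ('k, 'w) module, 'w \<Rightarrow> 'w) ftr \<Rightarrow> ('o, 'a, ('k, 'w) module, 'w \<Rightarrow> 'w) ftr" where
  "cofree I = \<lparr>Fo = (\<lambda>X. copy (cofree_mod I X)),
               Fa = (\<lambda>X X' g. copy_map (cofree_mod I X) (cofree_mod I X') (cofree_map X X' g))\<rparr>"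

context
  fixes I :: "('o, 'a, ('k, 'w) module, 'w \<Rightarrow> 'w) ftr"
  assumes inj: "injective_ftr K C I"
    and large: "\<exists>e :: ('o \<times> 'a \<Rightarrow> 'w) \<Rightarrow> 'w. inj e"
begin

lemma I_functor: "is_functor C (Mods K) I"
  using inj by (simp add: injective_ftr_def)

text \<open>Here the size of \<open>'w\<close> enters: injectivity of \<open>I\<close> speaks only
  about functors with values over \<open>'w\<close>, so the product over all arrows out of
  \<open>X\<close> needs codes in that type.\<close>

lemma cofree_codable: "codable TYPE('w) (carrier (cofree_mod I X))"
  using large unfolding codable_def by (meson inj_on_subset subset_UNIV)

lemma module_cofree_mod: "X \<in> Ob C \<Longrightarrow> module K (cofree_mod I X)"
  unfolding cofree_mod_def
  by (rule module_prod[OF cring]) (auto simp: idx_def intro: functorD(1)[OF I_functor])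

lemma cofree_map_lin:
  assumes "X \<in> Ob C" "X' \<in> Ob C" "g \<in> Hom C X X'"
  shows "lin K (cofree_mod I X) (cofree_mod I X') (cofree_map X X' g)"
proof -
  have "(fst p, Comp C X (snd p) g) \<in> idx X" if "p \<in> idx X'" for p
    using that assms comp_hom[of X X' "fst p" g "snd p"] by (auto simp: idx_def)
  moreover have "x (fst p, Comp C X (snd p) g) \<in> carrier (Fo I (fst p))"
    if "x \<in> carrier (cofree_mod I X)" "p \<in> idx X'" for x p
    using that calculation[OF that(2)] unfolding cofree_mod_def prod_module_sel by (metis PiE_mem fst_conv)
  ultimately show ?thesis
    by (intro linI) (auto simp: cofree_mod_def cofree_map_def fun_eq_iff restrict_def)
qed

lemma cofree_functor: "is_functor C (Mods K) (cofree I)"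
  unfolding is_functor_def
proof (intro conjI ballI)
  fix X assume X: "X \<in> Ob C"
  show "Fo (cofree I) X \<in> Ob (Mods K)"
    using module_copy[OF module_cofree_mod[OF X] cofree_codable] by (simp add: cofree_def Mods_def)
  have "copy_map (cofree_mod I X) (cofree_mod I X) (cofree_map X X (Id C X))
      = (copy_map (cofree_mod I X) (cofree_mod I X) (\<lambda>x. x) :: 'w \<Rightarrow> 'w)"
  proof (rule copy_map_cong[OF cofree_codable])
    fix x assume "x \<in> carrier (cofree_mod I X)"
    thus "cofree_map X X (Id C X) x = x"
      using comp_id[OF X] by (auto simp: cofree_map_def cofree_mod_def idx_def fun_eq_iff
          restrict_def PiE_iff extensional_def)
  qed
  thus "Fa (cofree I) X X (Id C X) = Id (Mods K) (Fo (cofree I) X)"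
    using copy_map_id[OF cofree_codable, of X] by (simp add: cofree_def Mods_def)
  fix Y assume Y: "Y \<in> Ob C"
  show "Fa (cofree I) X Y f \<in> Hom (Mods K) (Fo (cofree I) X) (Fo (cofree I) Y)" if f: "f \<in> Hom C X Y" for f
    using copy_map_hom[OF cofree_codable cofree_codable module_cofree_mod[OF X] cofree_map_lin[OF X Y f]]
    by (simp add: cofree_def Mods_def)
  fix Z f g assume Z: "Z \<in> Ob C" and f: "f \<in> Hom C X Y" and g: "g \<in> Hom C Y Z"
  have "compose (carrier (copy (cofree_mod I X)))
         (copy_map (cofree_mod I Y) (cofree_mod I Z) (cofree_map Y Z g) :: 'w \<Rightarrow> 'w)
         (copy_map (cofree_mod I X) (cofree_mod I Y) (cofree_map X Y f) :: 'w \<Rightarrow> 'w)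
      = copy_map (cofree_mod I X) (cofree_mod I Z) (\<lambda>x. cofree_map Y Z g (cofree_map X Y f x))"
    by (rule copy_map_comp[OF cofree_codable cofree_codable lin_closed[OF cofree_map_lin[OF X Y f]]])
  also have "\<dots> = copy_map (cofree_mod I X) (cofree_mod I Z) (cofree_map X Z (Comp C X g f))"
  proof (rule copy_map_cong[OF cofree_codable])
    fix x assume "x \<in> carrier (cofree_mod I X)"
    have "Comp C Y (snd p) g \<in> Hom C Y (fst p)" if "p \<in> idx Z" for p
      using comp_hom[OF Y Z _ g] that by (auto simp: idx_def)
    moreover have "Comp C X (Comp C Y (snd p) g) f = Comp C X (snd p) (Comp C X g f)" if "p \<in> idx Z" for p
      using comp_assoc[OF X Y Z _ f g] that by (auto simp: idx_def)
    ultimately show "cofree_map Y Z g (cofree_map X Y f x) = cofree_map X Z (Comp C X g f) x"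
      by (auto simp: cofree_map_def fun_eq_iff restrict_def idx_def)
  qed
  finally show "Fa (cofree I) X Z (Comp C X g f)
      = Comp (Mods K) (Fo (cofree I) X) (Fa (cofree I) Y Z g) (Fa (cofree I) X Y f)"
    by (simp add: cofree_def Mods_def)
qed

definition unit :: "'o \<Rightarrow> 'w \<Rightarrow> 'o \<times> 'a \<Rightarrow> 'w" where
  "unit X x = (\<lambda>p\<in>idx X. Fa I X (fst p) (snd p) x)"

lemma unit_lin: "X \<in> Ob C \<Longrightarrow> lin K (Fo I X) (cofree_mod I X) (unit X)"
proof -
  assume X: "X \<in> Ob C"
  have "unit X = (\<lambda>x. \<lambda>p\<in>idx X. Fa I X (fst p) (snd p) x)" by (rule ext) (simp add: unit_def)
  thus ?thesis unfolding cofree_mod_def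
    using lin_into_prod[OF functorD(1)[OF I_functor X], of "idx X" "\<lambda>p. Fo I (fst p)"
        "\<lambda>x p. Fa I X (fst p) (snd p) x"] functorD(3)[OF I_functor X]
    by (auto simp: idx_def)
qed

text \<open>\<open>unit\<close> collects the images of an element under all arrows. Its coordinate
  at the identity is the element itself, so it is a monomorphism, and injectivity extends the
  identity of \<open>I\<close> along it.\<close>

lemma retraction:
  "\<exists>r. mod_nat K C (cofree I) I r \<and>
     (\<forall>X\<in>Ob C. \<forall>x\<in>carrier (Fo I X). r X (code (carrier (cofree_mod I X)) (unit X x)) = x)"
proof -
  let ?m = "\<lambda>X. \<lambda>x\<in>carrier (Fo I X). code (carrier (cofree_mod I X)) (unit X x) :: 'w"
  have ul: "lin K (Fo I X) (Fo (cofree I) X) (\<lambda>x. code (carrier (cofree_mod I X)) (unit X x))" if "X \<in> Ob C" for X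
    using lin_comp[OF unit_lin[OF that] code_lin[OF cofree_codable]] by (simp add: cofree_def)
  have "mod_nat K C I (cofree I) ?m"
    unfolding mod_nat_def
  proof (intro conjI ballI)
    fix X assume X: "X \<in> Ob C"
    show "?m X \<in> mod_hom K (Fo I X) (Fo (cofree I) X)"
      by (rule restrict_mod_hom[OF functorD(1)[OF I_functor X] ul[OF X]])
    fix Y f x assume Y: "Y \<in> Ob C" and f: "f \<in> Hom C X Y" and x: "x \<in> carrier (Fo I X)"
    have fx: "Fa I X Y f x \<in> carrier (Fo I Y)" by (rule lin_closed[OF functorD(3)[OF I_functor X Y f] x])
    have "unit Y (Fa I X Y f x) = cofree_map X Y f (unit X x)"
    proof (rule extensionalityI)
      fix p assume p: "p \<in> idx Y"
      hence p': "fst p \<in> Ob C" "snd p \<in> Hom C Y (fst p)" by (auto simp: idx_def)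
      show "unit Y (Fa I X Y f x) p = cofree_map X Y f (unit X x) p"
        using p p' functorD(5)[OF I_functor X Y p'(1) f p'(2) x] comp_hom[OF X Y p'(1) f p'(2)]
        by (simp add: unit_def cofree_map_def idx_def)
    qed (auto simp: unit_def cofree_map_def)
    thus "?m Y (Fa I X Y f x) = Fa (cofree I) X Y f (?m X x)"
      using x fx
      by (simp add: cofree_def copy_map_code[OF cofree_codable lin_closed[OF unit_lin[OF X] x]])
  qed
  moreover have "\<forall>X\<in>Ob C. inj_on (?m X) (carrier (Fo I X))"
  proof (intro ballI inj_onI)
    fix X x y assume X: "X \<in> Ob C" and xy: "x \<in> carrier (Fo I X)" "y \<in> carrier (Fo I X)" "?m X x = ?m X y"
    have "unit X x = unit X y"
      by (rule inj_onD[OF code_inj[OF cofree_codable]])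
        (use xy lin_closed[OF unit_lin[OF X]] in auto)
    hence "unit X x (X, Id C X) = unit X y (X, Id C X)" by simp
    thus "x = y" using X id_hom[OF X] functorD(4)[OF I_functor X] xy by (simp add: unit_def idx_def)
  qed
  moreover have "mod_nat K C I I (\<lambda>X. \<lambda>x\<in>carrier (Fo I X). x)"
    unfolding mod_nat_def
  proof (intro conjI ballI)
    show "(\<lambda>x\<in>carrier (Fo I X). x) \<in> mod_hom K (Fo I X) (Fo I X)" if "X \<in> Ob C" for X
      by (rule restrict_mod_hom[OF functorD(1)[OF I_functor that] lin_ident])
    show "(\<lambda>x\<in>carrier (Fo I Y). x) (Fa I X Y f x) = Fa I X Y f ((\<lambda>x\<in>carrier (Fo I X). x) x)"
      if "X \<in> Ob C" "Y \<in> Ob C" "f \<in> Hom C X Y" "x \<in> carrier (Fo I X)" for X Y f x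
      using lin_closed[OF functorD(3)[OF I_functor that(1-3)] that(4)] that(4) by simp
  qed
  ultimately have "\<exists>r. mod_nat K C (cofree I) I r \<and>
     (\<forall>X\<in>Ob C. \<forall>x\<in>carrier (Fo I X). r X (?m X x) = (\<lambda>x\<in>carrier (Fo I X). x) x)"
    using inj cofree_functor I_functor unfolding injective_ftr_def by blast
  thus ?thesis by simp
qed

text \<open>The base points \<open>pt Y\<close> are not natural in \<open>Y\<close>, so they define
  no contraction on \<open>I\<close> directly. The coordinates of the cofree functor are independent
  of each other, which removes the need for naturality; the retraction then leads back to
  \<open>I\<close>.\<close>

lemma contractible: "\<exists>\<sigma>. contracted_fin_module K (lev I) (lact I) \<sigma>"
proof -
  interpret fin_module K "lev I" "lact I" by (rule fin_module_functor[OF I_functor])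
  obtain r where r: "mod_nat K C (cofree I) I r"
    and ru: "\<And>X x. X \<in> Ob C \<Longrightarrow> x \<in> carrier (Fo I X) \<Longrightarrow> r X (code (carrier (cofree_mod I X)) (unit X x)) = x"
    using retraction by blast
  have rl: "lin K (Fo (cofree I) X) (Fo I X) (r X)" if "X \<in> Ob C" for X
    using r that by (simp add: mod_nat_def mod_hom_iff)
  have rn: "r Y (Fa (cofree I) X Y f y) = Fa I X Y f (r X y)"
    if "X \<in> Ob C" "Y \<in> Ob C" "f \<in> Hom C X Y" "y \<in> carrier (Fo (cofree I) X)" for X Y f y
    using r that unfolding mod_nat_def by blast
  \<comment> \<open>At the coordinate \<open>(Y, f)\<close> the copairing sends the copy with index
    0 to the base point of \<open>Y\<close> and the others by \<open>f\<close>. Restricted along the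
    shift it is \<open>f\<close> again, so \<open>\<tau>\<close> after the first coface is
    \<open>unit\<close>, which the retraction undoes.\<close>
  define \<tau> where "\<tau> n x = (\<lambda>p\<in>idx (c n). Fa I (c (Suc n)) (fst p) (cp n (fst p) (pt (fst p)) (snd p)) x)" for n and x :: 'w
  define \<sigma> where "\<sigma> n x = r (c n) (code (carrier (cofree_mod I (c n))) (\<tau> n x))" for n x
  have \<tau>: "lin K (lev I (Suc n)) (cofree_mod I (c n)) (\<tau> n)" for n
  proof -
    have "\<tau> n = (\<lambda>x. \<lambda>p\<in>idx (c n). Fa I (c (Suc n)) (fst p) (cp n (fst p) (pt (fst p)) (snd p)) x)"
      by (rule ext) (simp add: \<tau>_def)
    moreover have "lin K (Fo I (c (Suc n))) (Fo I (fst p)) (\<lambda>x. Fa I (c (Suc n)) (fst p) (cp n (fst p) (pt (fst p)) (snd p)) x)"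
      if "p \<in> idx (c n)" for p
      using that by (intro functorD(3)[OF I_functor c_ob] cp_hom pt_hom) (auto simp: idx_def)
    ultimately show ?thesis unfolding cofree_mod_def lev_def
      by (simp only:) (rule lin_into_prod[OF functorD(1)[OF I_functor c_ob]])
  qed
  have "contracted_fin_module K (lev I) (lact I) \<sigma>"
  proof
    fix n
    have "\<sigma> n = (\<lambda>x. r (c n) (code (carrier (cofree_mod I (c n))) (\<tau> n x)))" by (rule ext) (simp add: \<sigma>_def)
    moreover have "lin K (copy (cofree_mod I (c n))) (Fo I (c n)) (r (c n))"
      using rl[OF c_ob] by (simp add: cofree_def)
    ultimately show "lin K (lev I (Suc n)) (lev I n) (\<sigma> n)"
      using lin_comp[OF lin_comp[OF \<tau> code_lin[OF cofree_codable]]] by (simp add: lev_def)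
  next
    fix \<alpha> m n \<beta> x
    assume \<alpha>: "\<alpha> \<in> {..m} \<rightarrow> {..n}" and \<beta>: "\<beta> 0 = 0" "\<And>i. i \<le> m \<Longrightarrow> \<beta> (Suc i) = Suc (\<alpha> i)"
      and x: "x \<in> carrier (lev I (Suc m))"
    have \<beta>': "\<beta> \<in> {..Suc m} \<rightarrow> {..Suc n}"
    proof
      fix i assume "i \<in> {..Suc m}"
      thus "\<beta> i \<in> {..Suc n}" using \<alpha> \<beta> by (cases i) auto
    qed
    have "\<tau> n (lact I (Suc m) (Suc n) \<beta> x) = cofree_map (c m) (c n) (P m n \<alpha>) (\<tau> m x)"
    proof (rule extensionalityI)
      fix p assume p: "p \<in> idx (c n)"
      obtain Y f where p': "p = (Y, f)" "Y \<in> Ob C" "f \<in> Hom C (c n) Y" using p by (auto simp: idx_def)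
      note g = cp_hom[OF p'(2) pt_hom[OF p'(2)] p'(3)]
      have "\<tau> n (lact I (Suc m) (Suc n) \<beta> x) p
          = Fa I (c (Suc n)) Y (cp n Y (pt Y) f) (Fa I (c (Suc m)) (c (Suc n)) (P (Suc m) (Suc n) \<beta>) x)"
        using p by (simp add: \<tau>_def p'(1) lact_def)
      also have "\<dots> = Fa I (c (Suc m)) Y (Comp C (c (Suc m)) (cp n Y (pt Y) f) (P (Suc m) (Suc n) \<beta>)) x"
        by (rule functorD(5)[OF I_functor c_ob c_ob p'(2) P_hom[OF \<beta>'] g, symmetric]) (use x in \<open>simp add: lev_def\<close>)
      also have "\<dots> = Fa I (c (Suc m)) Y (cp m Y (pt Y) (Comp C (c m) f (P m n \<alpha>))) x"
        using cp_P[OF p'(2) pt_hom[OF p'(2)] p'(3) \<alpha> \<beta>] by simp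
      also have "\<dots> = cofree_map (c m) (c n) (P m n \<alpha>) (\<tau> m x) p"
        using p comp_hom[OF c_ob c_ob p'(2) P_hom[OF \<alpha>] p'(3)] by (simp add: \<tau>_def cofree_map_def p' idx_def)
      finally show "\<tau> n (lact I (Suc m) (Suc n) \<beta> x) p = cofree_map (c m) (c n) (P m n \<alpha>) (\<tau> m x) p" .
    qed (auto simp: \<tau>_def cofree_map_def)
    moreover note \<tau>m = lin_closed[OF \<tau> x]
    moreover have "code (carrier (cofree_mod I (c n))) (cofree_map (c m) (c n) (P m n \<alpha>) (\<tau> m x))
      = Fa (cofree I) (c m) (c n) (P m n \<alpha>) (code (carrier (cofree_mod I (c m))) (\<tau> m x))"
      by (simp add: cofree_def copy_map_code[OF cofree_codable \<tau>m])
    moreover have "code (carrier (cofree_mod I (c m))) (\<tau> m x) \<in> carrier (Fo (cofree I) (c m))"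
      using code_in[OF \<tau>m] by (simp add: cofree_def)
    ultimately show "\<sigma> n (lact I (Suc m) (Suc n) \<beta> x) = lact I m n \<alpha> (\<sigma> m x)"
      using rn[OF c_ob c_ob P_hom[OF \<alpha>]] by (simp add: \<sigma>_def lact_def)
  next
    fix n x assume x: "x \<in> carrier (lev I n)"
    have S: "Suc \<in> {..n} \<rightarrow> {..Suc n}" by auto
    have "\<tau> n (lact I n (Suc n) Suc x) = unit (c n) x"
    proof (rule extensionalityI)
      fix p assume p: "p \<in> idx (c n)"
      obtain Y f where p': "p = (Y, f)" "Y \<in> Ob C" "f \<in> Hom C (c n) Y" using p by (auto simp: idx_def)
      note g = cp_hom[OF p'(2) pt_hom[OF p'(2)] p'(3)]
      have "\<tau> n (lact I n (Suc n) Suc x) p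
          = Fa I (c (Suc n)) Y (cp n Y (pt Y) f) (Fa I (c n) (c (Suc n)) (P n (Suc n) Suc) x)"
        using p by (simp add: \<tau>_def p'(1) lact_def)
      also have "\<dots> = Fa I (c n) Y (Comp C (c n) (cp n Y (pt Y) f) (P n (Suc n) Suc)) x"
        by (rule functorD(5)[OF I_functor c_ob c_ob p'(2) P_hom[OF S] g, symmetric]) (use x in \<open>simp add: lev_def\<close>)
      also have "\<dots> = unit (c n) x p"
        using cp_Suc[OF p'(2) pt_hom[OF p'(2)] p'(3)] p by (simp add: unit_def p'(1))
      finally show "\<tau> n (lact I n (Suc n) Suc x) p = unit (c n) x p" .
    qed (auto simp: \<tau>_def unit_def)
    thus "\<sigma> n (lact I n (Suc n) Suc x) = x" using ru[OF c_ob] x by (simp add: \<sigma>_def lev_def)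
  qed
  thus ?thesis by blast
qed

end

end

subsection \<open>Derived limits\<close>

lemma normal_module:
  assumes "fin_module K V act"
  shows "module K ((V n)\<lparr>carrier := norm V act n\<rparr>)"
proof -
  interpret fin_module K V act by fact
  show ?thesis by (rule module_submod[OF mod submod_norm])
qed

definition ncocycles where
  "ncocycles V act n = {x \<in> norm V act n. bd V act n x = \<zero>\<^bsub>V (Suc n)\<^esub>}"

definition ncoboundaries where
  "ncoboundaries V act n = (case n of 0 \<Rightarrow> {\<zero>\<^bsub>V 0\<^esub>} | Suc m \<Rightarrow> bd V act m ` norm V act m)"

context power_category
begin

text \<open>The first index is the cosimplicial degree, the second that of the resolution. Exactness
  in the first direction is the contraction of each \<open>I q\<close>; in the second it is the
  pointwise exactness of the resolution.\<close>

lemma injective_double_complex: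
  fixes I :: "nat \<Rightarrow> ('o, 'a, ('k, 'w) module, 'w \<Rightarrow> 'w) ftr"
  assumes large: "\<exists>e :: ('o \<times> 'a \<Rightarrow> 'w) \<Rightarrow> 'w. inj e"
    and res: "injective_resolution K C T I \<delta> \<epsilon>"
  shows "double_complex K (\<lambda>p q. (lev (I q) p)\<lparr>carrier := norm (lev (I q)) (lact (I q)) p\<rparr>)
    (\<lambda>p q. bd (lev (I q)) (lact (I q)) p) (\<lambda>p q. \<delta> q (c p))"
proof -
  let ?V = "\<lambda>q. lev (I q)" and ?A = "\<lambda>q. lact (I q)"
  let ?N = "\<lambda>q p. norm (?V q) (?A q) p"
  have inj: "injective_ftr K C (I q)" for q using res by (simp add: injective_resolution_def)
  have F: "is_functor C (Mods K) (I q)" for q using inj by (simp add: injective_ftr_def)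
  have fm: "fin_module K (?V q) (?A q)" for q by (rule fin_module_functor[OF F])
  have \<delta>n: "mod_nat K C (I q) (I (Suc q)) (\<delta> q)" for q using res by (simp add: injective_resolution_def)
  have \<delta>l: "lin K (?V q p) (?V (Suc q) p) (\<delta> q (c p))" for p q
    using \<delta>n[of q] c_ob by (simp add: mod_nat_def mod_hom_iff lev_def)
  have \<delta>a: "\<delta> q (c n) (?A q m n \<alpha> x) = ?A (Suc q) m n \<alpha> (\<delta> q (c m) x)"
    if "\<alpha> \<in> {..m} \<rightarrow> {..n}" "x \<in> carrier (?V q m)" for q m n \<alpha> x
    using \<delta>n[of q] c_ob P_hom[OF that(1)] that(2) unfolding mod_nat_def lev_def lact_def by blast
  have ex: "\<delta> q (c p) ` carrier (?V q p) = {x \<in> carrier (?V (Suc q) p). \<delta> (Suc q) (c p) x = \<zero>\<^bsub>?V (Suc (Suc q)) p\<^esub>}" for p q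
    using res c_ob[of p] by (simp add: injective_resolution_def a_kernel_eq lev_def)
  have nat_norm: "\<delta> q (c p) x \<in> ?N (Suc q) p" if "x \<in> ?N q p" for p q x
    by (rule norm_natural[where V = "?V q" and V' = "?V (Suc q)" and act = "?A q" and act' = "?A (Suc q)" and \<eta> = "\<lambda>p. \<delta> q (c p)", OF fm fm \<delta>l \<delta>a that])
  have nat_bd: "\<delta> q (c (Suc p)) (bd (?V q) (?A q) p x) = bd (?V (Suc q)) (?A (Suc q)) p (\<delta> q (c p) x)"
    if "x \<in> carrier (?V q p)" for p q x
    by (rule bd_natural[where V = "?V q" and V' = "?V (Suc q)" and act = "?A q" and act' = "?A (Suc q)" and \<eta> = "\<lambda>p. \<delta> q (c p)", OF fm fm \<delta>l \<delta>a that])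
  have nat_proj: "\<delta> q (c p) (proj (?V q) (?A q) p k x) = proj (?V (Suc q)) (?A (Suc q)) p k (\<delta> q (c p) x)"
    if "k \<le> p" "x \<in> carrier (?V q p)" for p q k x
    by (rule proj_natural[where V = "?V q" and V' = "?V (Suc q)" and act = "?A q" and act' = "?A (Suc q)" and \<eta> = "\<lambda>p. \<delta> q (c p)", OF fm fm \<delta>l \<delta>a that])
  show ?thesis
  proof (rule double_complex.intro)
    fix p q
    interpret V: fin_module K "?V q" "?A q" by (rule fm)
    interpret V': fin_module K "?V (Suc q)" "?A (Suc q)" by (rule fm)
    show "module K ((?V q p)\<lparr>carrier := ?N q p\<rparr>)" by (rule normal_module[OF fm])
    show "lin K ((?V q p)\<lparr>carrier := ?N q p\<rparr>) ((?V q (Suc p))\<lparr>carrier := ?N q (Suc p)\<rparr>) (bd (?V q) (?A q) p)"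
      by (rule lin_sub_cod[OF lin_sub_dom[OF V.bd_lin]]) (auto simp: V.normD(1) intro: V.bd_norm)
    show "lin K ((?V q p)\<lparr>carrier := ?N q p\<rparr>) ((?V (Suc q) p)\<lparr>carrier := ?N (Suc q) p\<rparr>) (\<delta> q (c p))"
      by (rule lin_sub_cod[OF lin_sub_dom[OF \<delta>l]])
        (auto simp: V.normD(1) intro: nat_norm)
    fix x
    show "bd (?V (Suc q)) (?A (Suc q)) p (\<delta> q (c p) x) = \<delta> q (c (Suc p)) (bd (?V q) (?A q) p x)"
      if "x \<in> carrier ((?V q p)\<lparr>carrier := ?N q p\<rparr>)"
      by (rule nat_bd[symmetric]) (use that V.normD(1) in auto)
    show "bd (?V q) (?A q) (Suc p) (bd (?V q) (?A q) p x) = \<zero>\<^bsub>(?V q (Suc (Suc p)))\<lparr>carrier := ?N q (Suc (Suc p))\<rparr>\<^esub>"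
      if "x \<in> carrier ((?V q p)\<lparr>carrier := ?N q p\<rparr>)"
      using V.bd_bd that V.normD(1) by simp
    show "\<delta> (Suc q) (c p) (\<delta> q (c p) x) = \<zero>\<^bsub>(?V (Suc (Suc q)) p)\<lparr>carrier := ?N (Suc (Suc q)) p\<rparr>\<^esub>"
      if "x \<in> carrier ((?V q p)\<lparr>carrier := ?N q p\<rparr>)"
      using ex[of q p] that V.normD(1)[of x p] by auto
    show "\<exists>y\<in>carrier ((?V q p)\<lparr>carrier := ?N q p\<rparr>). bd (?V q) (?A q) p y = x"
      if "x \<in> carrier ((?V q (Suc p))\<lparr>carrier := ?N q (Suc p)\<rparr>)"
        "bd (?V q) (?A q) (Suc p) x = \<zero>\<^bsub>(?V q (Suc (Suc p)))\<lparr>carrier := ?N q (Suc (Suc p))\<rparr>\<^esub>"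
    proof -
      obtain \<sigma> where \<sigma>: "contracted_fin_module K (?V q) (?A q) \<sigma>" using contractible[OF inj large] by blast
      interpret S: contracted_fin_module K "?V q" "?A q" \<sigma> by (rule \<sigma>)
      show ?thesis using that S.contraction[of x p] S.\<sigma>_norm[of x p] by auto
    qed
    show "\<exists>y\<in>carrier ((?V q p)\<lparr>carrier := ?N q p\<rparr>). \<delta> q (c p) y = x"
      if x: "x \<in> carrier ((?V (Suc q) p)\<lparr>carrier := ?N (Suc q) p\<rparr>)"
        "\<delta> (Suc q) (c p) x = \<zero>\<^bsub>(?V (Suc (Suc q)) p)\<lparr>carrier := ?N (Suc (Suc q)) p\<rparr>\<^esub>"
    proof -
      have "x \<in> \<delta> q (c p) ` carrier (?V q p)" using ex[of q p] x V'.normD(1)[of x p] by simp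
      then obtain y where y: "y \<in> carrier (?V q p)" "x = \<delta> q (c p) y" by blast
      \<comment> \<open>The preimage given by exactness need not be normalized. Its projection is,
        and by naturality still maps to \<open>x\<close>, which the projection fixes.\<close>
      have "\<delta> q (c p) (V.\<pi> p p y) = V'.\<pi> p p x"
        unfolding y(2) by (rule nat_proj[OF order.refl y(1)])
      also have "\<dots> = x" by (rule V'.proj_fix) (use x in auto)
      finally show ?thesis using V.proj_norm[OF y(1)] by auto
    qed
  qed
qed

text \<open>In resolution degree 0 the \<open>\<delta>\<close>-cycles are the image of
  \<open>T\<close> under the injective augmentation, so cycles and boundaries on this edge are those
  of the normalized complex of \<open>T\<close>.\<close>

lemma corr_augmentation:
  fixes I :: "nat \<Rightarrow> ('o, 'a, ('k, 'w) module, 'w \<Rightarrow> 'w) ftr"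
  assumes T: "is_functor C (Mods K) T"
    and large: "\<exists>e :: ('o \<times> 'a \<Rightarrow> 'w) \<Rightarrow> 'w. inj e"
    and res: "injective_resolution K C T I \<delta> \<epsilon>"
  defines "D \<equiv> \<lambda>p q. (lev (I q) p)\<lparr>carrier := norm (lev (I q)) (lact (I q)) p\<rparr>"
    and "d \<equiv> \<lambda>p q. bd (lev (I q)) (lact (I q)) p" and "\<delta>' \<equiv> \<lambda>p q. \<delta> q (c p)"
  shows "\<exists>R. corr K ((lev T n)\<lparr>carrier := ncocycles (lev T) (lact T) n\<rparr>) (ncoboundaries (lev T) (lact T) n)
      ((D n 0)\<lparr>carrier := double_complex.cyc D d \<delta>' n 0\<rparr>) (double_complex.bdh D d \<delta>' n 0) R"
proof -
  interpret DC: double_complex K D d \<delta>'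
    unfolding D_def d_def \<delta>'_def by (rule injective_double_complex[OF large res])
  have F: "is_functor C (Mods K) (I 0)" using res by (simp add: injective_resolution_def injective_ftr_def)
  note fT = fin_module_functor[OF T] and fI = fin_module_functor[OF F]
  interpret T: fin_module K "lev T" "lact T" by (rule fT)
  interpret I: fin_module K "lev (I 0)" "lact (I 0)" by (rule fI)
  have \<epsilon>n: "mod_nat K C T (I 0) \<epsilon>" using res by (simp add: injective_resolution_def)
  have \<epsilon>l: "lin K (lev T p) (lev (I 0) p) (\<epsilon> (c p))" for p
    using \<epsilon>n c_ob by (simp add: mod_nat_def mod_hom_iff lev_def)
  have \<epsilon>a: "\<epsilon> (c n) (lact T m n \<alpha> x) = lact (I 0) m n \<alpha> (\<epsilon> (c m) x)"
    if "\<alpha> \<in> {..m} \<rightarrow> {..n}" "x \<in> carrier (lev T m)" for m n \<alpha> x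
    using \<epsilon>n c_ob P_hom[OF that(1)] that(2) unfolding mod_nat_def lev_def lact_def by blast
  have inj: "inj_on (\<epsilon> (c p)) (carrier (lev T p))" for p
    using res c_ob[of p] by (simp add: injective_resolution_def lev_def)
  have ex: "\<epsilon> (c p) ` carrier (lev T p) = {x \<in> carrier (lev (I 0) p). \<delta> 0 (c p) x = \<zero>\<^bsub>lev (I 1) p\<^esub>}" for p
    using res c_ob[of p] by (simp add: injective_resolution_def a_kernel_eq lev_def)
  have \<epsilon>0: "\<epsilon> (c p) \<zero>\<^bsub>lev T p\<^esub> = \<zero>\<^bsub>lev (I 0) p\<^esub>" for p by (rule lin_zero[OF T.mod I.mod \<epsilon>l])
  have zero: "\<epsilon> (c p) x = \<zero>\<^bsub>lev (I 0) p\<^esub> \<longleftrightarrow> x = \<zero>\<^bsub>lev T p\<^esub>" if "x \<in> carrier (lev T p)" for x p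
    using inj_on_eq_iff[OF inj that T.zero_in] by (simp add: \<epsilon>0)
  have nat_E: "\<epsilon> (c p) (idem (lact T) p i x) = idem (lact (I 0)) p i (\<epsilon> (c p) x)" if "i < p" "x \<in> carrier (lev T p)" for p i x
    by (rule idem_natural[where V = "lev T" and act = "lact T" and act' = "lact (I 0)"
          and \<eta> = "\<lambda>p. \<epsilon> (c p)", OF \<epsilon>a that])
  have nat_bd: "\<epsilon> (c (Suc p)) (bd (lev T) (lact T) p x) = bd (lev (I 0)) (lact (I 0)) p (\<epsilon> (c p) x)"
    if "x \<in> carrier (lev T p)" for p x
    by (rule bd_natural[where V = "lev T" and V' = "lev (I 0)" and act = "lact T" and act' = "lact (I 0)"
          and \<eta> = "\<lambda>p. \<epsilon> (c p)", OF fT fI \<epsilon>l \<epsilon>a that])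
  have nrm: "\<epsilon> (c p) x \<in> I.N p \<longleftrightarrow> x \<in> T.N p" if x: "x \<in> carrier (lev T p)" for x p
  proof -
    have "idem (lact (I 0)) p i (\<epsilon> (c p) x) = \<zero>\<^bsub>lev (I 0) p\<^esub> \<longleftrightarrow> idem (lact T) p i x = \<zero>\<^bsub>lev T p\<^esub>" if "i < p" for i
      using nat_E[OF that x] zero[OF T.idem_in[OF that x]] by simp
    thus ?thesis using x lin_closed[OF \<epsilon>l x] by (simp add: norm_def)
  qed
  have img: "\<epsilon> (c p) ` T.N p = {y \<in> I.N p. \<delta> 0 (c p) y = \<zero>\<^bsub>lev (I 1) p\<^esub>}" for p
  proof (intro equalityI subsetI)
    fix y assume "y \<in> \<epsilon> (c p) ` T.N p"
    then obtain x where x: "x \<in> T.N p" "y = \<epsilon> (c p) x" by blast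
    have "y \<in> \<epsilon> (c p) ` carrier (lev T p)" using x T.normD(1) by blast
    thus "y \<in> {y \<in> I.N p. \<delta> 0 (c p) y = \<zero>\<^bsub>lev (I 1) p\<^esub>}"
      using ex[of p] nrm[of x p] x T.normD(1)[OF x(1)] by simp
  next
    fix y assume y: "y \<in> {y \<in> I.N p. \<delta> 0 (c p) y = \<zero>\<^bsub>lev (I 1) p\<^esub>}"
    hence "y \<in> \<epsilon> (c p) ` carrier (lev T p)" using ex[of p] I.normD(1) by simp
    then obtain x where x: "x \<in> carrier (lev T p)" "y = \<epsilon> (c p) x" by blast
    thus "y \<in> \<epsilon> (c p) ` T.N p" using nrm[OF x(1)] y by simp
  qed
  have cyc: "\<epsilon> (c p) ` ncocycles (lev T) (lact T) p = DC.cyc p 0" for p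
  proof -
    have "bd (lev (I 0)) (lact (I 0)) p (\<epsilon> (c p) x) = \<zero>\<^bsub>lev (I 0) (Suc p)\<^esub> \<longleftrightarrow> bd (lev T) (lact T) p x = \<zero>\<^bsub>lev T (Suc p)\<^esub>"
      if "x \<in> T.N p" for x
      using nat_bd[OF T.normD(1)[OF that]] zero[OF lin_closed[OF T.bd_lin T.normD(1)[OF that]]] by simp
    hence "\<epsilon> (c p) ` ncocycles (lev T) (lact T) p
        = {y \<in> \<epsilon> (c p) ` T.N p. bd (lev (I 0)) (lact (I 0)) p y = \<zero>\<^bsub>lev (I 0) (Suc p)\<^esub>}"
      by (auto simp: ncocycles_def)
    thus ?thesis unfolding img DC.cyc_def by (auto simp: D_def d_def \<delta>'_def)
  qed
  have bdr: "\<epsilon> (c n) ` ncoboundaries (lev T) (lact T) n = DC.bdh n 0"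
  proof (cases n)
    case 0
    thus ?thesis using zero[OF T.zero_in, of 0] unfolding DC.bdh_def by (simp add: ncoboundaries_def D_def)
  next
    case (Suc m)
    have "\<epsilon> (c (Suc m)) ` bd (lev T) (lact T) m ` T.N m = bd (lev (I 0)) (lact (I 0)) m ` \<epsilon> (c m) ` T.N m"
      unfolding image_image by (rule image_cong[OF refl]) (rule nat_bd[OF T.normD(1)])
    thus ?thesis unfolding img DC.bdh_def by (simp add: Suc ncoboundaries_def D_def d_def \<delta>'_def)
  qed
  have sT: "submod K (lev T n) (ncocycles (lev T) (lact T) n)"
  proof -
    have "ncocycles (lev T) (lact T) n = T.N n \<inter> {x \<in> carrier (lev T n). bd (lev T) (lact T) n x = \<zero>\<^bsub>lev T (Suc n)\<^esub>}"
      using T.normD(1) by (auto simp: ncocycles_def)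
    thus ?thesis using submod_inter[OF T.submod_norm submod_kernel[OF T.mod T.mod T.bd_lin]] by simp
  qed
  note mT = module_submod[OF T.mod sT]
  have "corr K ((lev T n)\<lparr>carrier := ncocycles (lev T) (lact T) n\<rparr>) (ncoboundaries (lev T) (lact T) n)
      ((D n 0)\<lparr>carrier := DC.cyc n 0\<rparr>) (DC.bdh n 0)
      (\<lambda>x y. x \<in> carrier ((lev T n)\<lparr>carrier := ncocycles (lev T) (lact T) n\<rparr>) \<and> y = \<epsilon> (c n) x)"
  proof (rule corr_iso[OF mT])
    have zc: "ncocycles (lev T) (lact T) n \<subseteq> carrier (lev T n)" using submod_closed[OF sT] by blast
    show "lin K ((lev T n)\<lparr>carrier := ncocycles (lev T) (lact T) n\<rparr>) ((D n 0)\<lparr>carrier := DC.cyc n 0\<rparr>) (\<epsilon> (c n))"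
      using lin_sub_cod[OF lin_sub_dom[OF \<epsilon>l zc], of "DC.cyc n 0"] cyc[of n] unfolding D_def by auto
    show "bij_betw (\<epsilon> (c n)) (carrier ((lev T n)\<lparr>carrier := ncocycles (lev T) (lact T) n\<rparr>))
        (carrier ((D n 0)\<lparr>carrier := DC.cyc n 0\<rparr>))"
      using inj_on_subset[OF inj zc] cyc[of n] by (simp add: bij_betw_def)
    show "ncoboundaries (lev T) (lact T) n \<subseteq> carrier ((lev T n)\<lparr>carrier := ncocycles (lev T) (lact T) n\<rparr>)"
      using T.bd_bd T.bd_norm T.normD(1) T.submod_norm lin_zero[OF T.mod T.mod T.bd_lin]
      by (auto simp: ncoboundaries_def ncocycles_def submod_def split: nat.splits)
    show "\<epsilon> (c n) ` ncoboundaries (lev T) (lact T) n = DC.bdh n 0" by (rule bdr)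
  qed
  thus ?thesis by blast
qed

section \<open>Limits as cocycles of degree 0\<close>

lemma lim_module_sel [simp]:
  "carrier (lim_module C T) = {s \<in> \<Pi>\<^sub>E c\<in>Ob C. carrier (Fo T c).
        \<forall>c\<in>Ob C. \<forall>c'\<in>Ob C. \<forall>f\<in>Hom C c c'. Fa T c c' f (s c) = s c'}"
  "\<zero>\<^bsub>lim_module C T\<^esub> = (\<lambda>c\<in>Ob C. \<zero>\<^bsub>Fo T c\<^esub>)"
  "s \<oplus>\<^bsub>lim_module C T\<^esub> t = (\<lambda>c\<in>Ob C. s c \<oplus>\<^bsub>Fo T c\<^esub> t c)"
  "a \<odot>\<^bsub>lim_module C T\<^esub> s = (\<lambda>c\<in>Ob C. a \<odot>\<^bsub>Fo T c\<^esub> s c)"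
  by (simp_all add: lim_module_def)

lemma module_lim:
  assumes F: "is_functor C (Mods K) F"
  shows "module K (lim_module C F)"
proof -
  have p: "module K (prod_module (Ob C) (Fo F))"
    by (rule module_prod[OF cring]) (rule functorD(1)[OF F])
  have "submod K (prod_module (Ob C) (Fo F)) (carrier (lim_module C F))"
  proof (rule submodI)
    interpret p: module K "prod_module (Ob C) (Fo F)" by (rule p)
    show "\<zero>\<^bsub>prod_module (Ob C) (Fo F)\<^esub> \<in> carrier (lim_module C F)"
      using p.zero_closed lin_zero[OF functorD(1)[OF F] functorD(1)[OF F] functorD(3)[OF F]] by auto
    show "s \<oplus>\<^bsub>prod_module (Ob C) (Fo F)\<^esub> t \<in> carrier (lim_module C F)"
      if "s \<in> carrier (lim_module C F)" "t \<in> carrier (lim_module C F)" for s t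
      using p.a_closed[of s t] that lin_add[OF functorD(3)[OF F]] by (auto simp: PiE_iff)
    show "a \<odot>\<^bsub>prod_module (Ob C) (Fo F)\<^esub> s \<in> carrier (lim_module C F)"
      if "a \<in> carrier K" "s \<in> carrier (lim_module C F)" for a s
      using p.smult_closed[of a s] that lin_smult[OF functorD(3)[OF F]] by (auto simp: PiE_iff)
  qed auto
  from module_submod[OF p this] show ?thesis by (simp add: lim_module_def)
qed

lemma lim_eval_lin: "lin K (lim_module C F) (Fo F (c 0)) (\<lambda>s. s (c 0))"
  using c_ob by (auto simp: lin_def)

text \<open>By weak initiality a compatible family is determined by its value at \<open>c 0\<close>.
  Conversely, two arrows from \<open>c 0\<close> to the same object factor through
  \<open>c 1\<close> by their copairing, so they agree on an element on which the two cofaces agree;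
  its images under arbitrary arrows then form a compatible family.\<close>

lemma lim_eval_bij:
  assumes F: "is_functor C (Mods K) F"
  shows "bij_betw (\<lambda>s. s (c 0)) (carrier (lim_module C F)) (ncocycles (lev F) (lact F) 0)"
proof -
  interpret F: fin_module K "lev F" "lact F" by (rule fin_module_functor[OF F])
  have S: "Suc \<in> {..0} \<rightarrow> {..Suc 0}" and 0: "(\<lambda>_. 0) \<in> {..0} \<rightarrow> {..Suc 0}" by auto
  have Z: "ncocycles (lev F) (lact F) 0 = {x \<in> carrier (lev F 0). lact F 0 1 Suc x = lact F 0 1 (\<lambda>_. 0) x}"
    using F.bd_zero_iff by (auto simp: ncocycles_def norm_def)
  show ?thesis
  proof (rule bij_betwI')
    fix s t assume s: "s \<in> carrier (lim_module C F)" and t: "t \<in> carrier (lim_module C F)"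
    show "s (c 0) = t (c 0) \<longleftrightarrow> s = t"
    proof
      assume e: "s (c 0) = t (c 0)"
      have "s X = t X" if X: "X \<in> Ob C" for X
      proof -
        have "s X = Fa F (c 0) X (pt X) (s (c 0))" using s X c_ob pt_hom[OF X] by auto
        also have "\<dots> = Fa F (c 0) X (pt X) (t (c 0))" using e by simp
        also have "\<dots> = t X" using t X c_ob pt_hom[OF X] by auto
        finally show ?thesis .
      qed
      moreover have "s \<in> extensional (Ob C)" "t \<in> extensional (Ob C)" using s t by (auto simp: PiE_def)
      ultimately show "s = t" by (rule_tac extensionalityI) auto
    qed simp
  next
    fix s assume s: "s \<in> carrier (lim_module C F)"
    have "lact F 0 1 \<alpha> (s (c 0)) = s (c 1)" if "\<alpha> \<in> {..0} \<rightarrow> {..Suc 0}" for \<alpha>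
      using s c_ob P_hom[OF that] by (simp add: lact_def)
    thus "s (c 0) \<in> ncocycles (lev F) (lact F) 0" unfolding Z using S 0 s c_ob by (auto simp: lev_def)
  next
    fix x assume "x \<in> ncocycles (lev F) (lact F) 0"
    hence x: "x \<in> carrier (Fo F (c 0))" "lact F 0 1 Suc x = lact F 0 1 (\<lambda>_. 0) x"
      unfolding Z by (auto simp: lev_def)
    have eq: "Fa F (c 0) X f x = Fa F (c 0) X g x" if X: "X \<in> Ob C" and f: "f \<in> Hom C (c 0) X" and g: "g \<in> Hom C (c 0) X" for X f g
    proof -
      note h = cp_hom[OF X f g]
      have "Fa F (c 0) X f x = Fa F (c 0) X (Comp C (c 0) (cp 0 X f g) (P 0 (Suc 0) (\<lambda>_. 0))) x"
        using cp_0[OF X f g] by simp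
      also have "\<dots> = Fa F (c (Suc 0)) X (cp 0 X f g) (lact F 0 1 (\<lambda>_. 0) x)"
        using functorD(5)[OF F c_ob c_ob X P_hom[OF 0] h x(1)] by (simp add: lact_def)
      also have "\<dots> = Fa F (c (Suc 0)) X (cp 0 X f g) (lact F 0 1 Suc x)" using x(2) by simp
      also have "\<dots> = Fa F (c 0) X (Comp C (c 0) (cp 0 X f g) (P 0 (Suc 0) Suc)) x"
        using functorD(5)[OF F c_ob c_ob X P_hom[OF S] h x(1)] by (simp add: lact_def)
      also have "\<dots> = Fa F (c 0) X g x" using cp_Suc[OF X f g] by simp
      finally show ?thesis .
    qed
    let ?s = "\<lambda>X\<in>Ob C. Fa F (c 0) X (pt X) x"
    have "?s \<in> carrier (lim_module C F)"
      unfolding lim_module_sel mem_Collect_eq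
    proof (intro conjI ballI)
      show "?s \<in> (\<Pi>\<^sub>E X\<in>Ob C. carrier (Fo F X))"
        using lin_closed[OF functorD(3)[OF F c_ob _ pt_hom] x(1)] by auto
      fix X Y f assume X: "X \<in> Ob C" and Y: "Y \<in> Ob C" and f: "f \<in> Hom C X Y"
      have "Fa F X Y f (Fa F (c 0) X (pt X) x) = Fa F (c 0) Y (Comp C (c 0) f (pt X)) x"
        by (rule functorD(5)[OF F c_ob X Y pt_hom[OF X] f x(1), symmetric])
      also have "\<dots> = Fa F (c 0) Y (pt Y) x"
        by (rule eq[OF Y comp_hom[OF c_ob X Y pt_hom[OF X] f] pt_hom[OF Y]])
      finally show "Fa F X Y f (?s X) = ?s Y" using X Y by simp
    qed
    moreover have "x = ?s (c 0)"
      using eq[OF c_ob pt_hom[OF c_ob] id_hom[OF c_ob]] functorD(4)[OF F c_ob x(1)] c_ob by simp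
    ultimately show "\<exists>s\<in>carrier (lim_module C F). x = s (c 0)" by (rule_tac bexI[of _ ?s])
  qed
qed

lemma lim_map_lin:
  assumes F: "is_functor C (Mods K) F" and G: "is_functor C (Mods K) G" and \<eta>: "mod_nat K C F G \<eta>"
  shows "lin K (lim_module C F) (lim_module C G) (lim_map C F \<eta>)"
proof -
  interpret L: module K "lim_module C F" by (rule module_lim[OF F])
  have \<eta>l: "lin K (Fo F X) (Fo G X) (\<eta> X)" if "X \<in> Ob C" for X
    using \<eta> that by (simp add: mod_nat_def mod_hom_iff)
  have \<eta>n: "Fa G X Y f (\<eta> X x) = \<eta> Y (Fa F X Y f x)"
    if "X \<in> Ob C" "Y \<in> Ob C" "f \<in> Hom C X Y" "x \<in> carrier (Fo F X)" for X Y f x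
    using \<eta> that by (simp add: mod_nat_def)
  show ?thesis
  proof (rule linI)
    fix s assume s: "s \<in> carrier (lim_module C F)"
    have sX: "s X \<in> carrier (Fo F X)" if "X \<in> Ob C" for X using s that by auto
    have sf: "Fa F X Y f (s X) = s Y" if "X \<in> Ob C" "Y \<in> Ob C" "f \<in> Hom C X Y" for X Y f using s that by auto
    show "lim_map C F \<eta> s \<in> carrier (lim_module C G)"
      using s sX lin_closed[OF \<eta>l] by (auto simp: lim_map_def \<eta>n sf)
    show "lim_map C F \<eta> (s \<oplus>\<^bsub>lim_module C F\<^esub> t) = lim_map C F \<eta> s \<oplus>\<^bsub>lim_module C G\<^esub> lim_map C F \<eta> t"
      if t: "t \<in> carrier (lim_module C F)" for t
    proof -
      have tX: "t X \<in> carrier (Fo F X)" if "X \<in> Ob C" for X using t that by auto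
      show ?thesis using L.a_closed[OF s t] s t sX tX lin_add[OF \<eta>l]
        by (simp add: lim_map_def fun_eq_iff restrict_def del: lim_module_sel(1))
    qed
    show "lim_map C F \<eta> (a \<odot>\<^bsub>lim_module C F\<^esub> s) = a \<odot>\<^bsub>lim_module C G\<^esub> lim_map C F \<eta> s" if a: "a \<in> carrier K" for a
      using L.smult_closed[OF a s] s sX lin_smult[OF \<eta>l a]
      by (simp add: lim_map_def fun_eq_iff restrict_def del: lim_module_sel(1))
  qed
qed

text \<open>In cosimplicial degree 0 the \<open>d\<close>-cycles of \<open>I q\<close> are its
  limit, by evaluation at \<open>c 0\<close>. \<open>L\<close> and \<open>B\<close> are the cocycles
  and coboundaries of the complex of limits that defines the derived functor.\<close>

lemma corr_limit:
  fixes I :: "nat \<Rightarrow> ('o, 'a, ('k, 'w) module, 'w \<Rightarrow> 'w) ftr" and n :: nat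
  assumes large: "\<exists>e :: ('o \<times> 'a \<Rightarrow> 'w) \<Rightarrow> 'w. inj e"
    and res: "injective_resolution K C T I \<delta> \<epsilon>"
  defines "D \<equiv> \<lambda>p q. (lev (I q) p)\<lparr>carrier := norm (lev (I q)) (lact (I q)) p\<rparr>"
    and "d \<equiv> \<lambda>p q. bd (lev (I q)) (lact (I q)) p" and "\<delta>' \<equiv> \<lambda>p q. \<delta> q (c p)"
  defines "L \<equiv> (lim_module C (I n))\<lparr>carrier := {s \<in> carrier (lim_module C (I n)).
       lim_map C (I n) (\<delta> n) s = \<zero>\<^bsub>lim_module C (I (Suc n))\<^esub>}\<rparr>"
    and "B \<equiv> (case n of 0 \<Rightarrow> {\<zero>\<^bsub>lim_module C (I 0)\<^esub>} | Suc m \<Rightarrow> lim_map C (I m) (\<delta> m) ` carrier (lim_module C (I m)))"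
  shows "module K L" "submod K L B"
    "\<exists>R. corr K L B ((D 0 n)\<lparr>carrier := double_complex.cyc D d \<delta>' 0 n\<rparr>) (double_complex.bdv D d \<delta>' 0 n) R"
proof -
  interpret DC: double_complex K D d \<delta>'
    unfolding D_def d_def \<delta>'_def by (rule injective_double_complex[OF large res])
  have F: "is_functor C (Mods K) (I q)" for q using res by (simp add: injective_resolution_def injective_ftr_def)
  have \<delta>n: "mod_nat K C (I q) (I (Suc q)) (\<delta> q)" for q using res by (simp add: injective_resolution_def)
  note lm = lim_map_lin[OF F F \<delta>n]
  note ml = module_lim[OF F]
  have \<delta>\<delta>: "\<delta> (Suc q) X (\<delta> q X x) = \<zero>\<^bsub>Fo (I (Suc (Suc q))) X\<^esub>"
    if "X \<in> Ob C" "x \<in> carrier (Fo (I q) X)" for q X x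
    using res that unfolding injective_resolution_def a_kernel_eq by blast
  let ?L = "\<lambda>q. lim_module C (I q)"
  let ?e = "\<lambda>s. s (c 0)"
  have ev: "?e (lim_map C (I q) (\<delta> q) s) = \<delta> q (c 0) (?e s)" if "s \<in> carrier (?L q)" for q s
    using that c_ob by (simp add: lim_map_def del: lim_module_sel(1)) 
  have bij: "inj_on ?e (carrier (?L q))" "?e ` carrier (?L q) = ncocycles (lev (I q)) (lact (I q)) 0" for q
    using lim_eval_bij[OF F, of q] by (auto simp: bij_betw_def)
  have N0: "norm (lev (I q)) (lact (I q)) 0 = carrier (lev (I q) 0)" for q by (simp add: norm_def)
  have Ks: "submod K (?L n) {s \<in> carrier (?L n). lim_map C (I n) (\<delta> n) s = \<zero>\<^bsub>?L (Suc n)\<^esub>}"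
    by (rule submod_kernel[OF ml ml lm])
  show L: "module K L" unfolding L_def by (rule module_submod[OF ml Ks])
  show B: "submod K L B"
  proof (cases n)
    case 0
    thus ?thesis using submod_zero[OF L] by (simp add: B_def L_def)
  next
    case (Suc m)
    have "lim_map C (I (Suc m)) (\<delta> (Suc m)) (lim_map C (I m) (\<delta> m) s) = \<zero>\<^bsub>?L (Suc (Suc m))\<^esub>"
      if s: "s \<in> carrier (?L m)" for s
    proof (rule inj_onD[OF bij(1)])
      note t = lin_closed[OF lm s]
      show "?e (lim_map C (I (Suc m)) (\<delta> (Suc m)) (lim_map C (I m) (\<delta> m) s)) = ?e \<zero>\<^bsub>?L (Suc (Suc m))\<^esub>"
        using \<delta>\<delta>[OF c_ob lin_closed[OF lim_eval_lin s]] c_ob[of 0] by (simp only: ev[OF t] ev[OF s]) simp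
      show "lim_map C (I (Suc m)) (\<delta> (Suc m)) (lim_map C (I m) (\<delta> m) s) \<in> carrier (?L (Suc (Suc m)))"
        by (rule lin_closed[OF lm t])
      interpret M: module K "?L (Suc (Suc m))" by (rule ml)
      show "\<zero>\<^bsub>?L (Suc (Suc m))\<^esub> \<in> carrier (?L (Suc (Suc m)))" by (rule M.zero_closed)
    qed
    hence "lin K (?L m) L (lim_map C (I m) (\<delta> m))"
      unfolding L_def Suc by (intro lin_sub_cod[OF lm]) (simp add: lin_closed[OF lm] del: lim_module_sel)
    from submod_image[OF ml L this submod_carrier[OF ml]] show ?thesis by (simp add: B_def Suc)
  qed
  have "corr K L B ((D 0 n)\<lparr>carrier := DC.cyc 0 n\<rparr>) (DC.bdv 0 n) (\<lambda>s x. s \<in> carrier L \<and> x = ?e s)"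
  proof (rule corr_iso[OF L])
    have cyc: "?e ` carrier L = DC.cyc 0 n"
    proof -
      have "lim_map C (I n) (\<delta> n) s = \<zero>\<^bsub>?L (Suc n)\<^esub> \<longleftrightarrow> \<delta> n (c 0) (?e s) = \<zero>\<^bsub>lev (I (Suc n)) 0\<^esub>"
        if s: "s \<in> carrier (?L n)" for s
      proof -
        interpret M: module K "?L (Suc n)" by (rule ml)
        have "lim_map C (I n) (\<delta> n) s = \<zero>\<^bsub>?L (Suc n)\<^esub> \<longleftrightarrow> ?e (lim_map C (I n) (\<delta> n) s) = ?e \<zero>\<^bsub>?L (Suc n)\<^esub>"
          using inj_on_eq_iff[OF bij(1) lin_closed[OF lm s] M.zero_closed] by simp
        thus ?thesis using ev[OF s] c_ob by (simp add: lev_def)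
      qed
      hence "?e ` carrier L = {x \<in> ?e ` carrier (?L n). \<delta> n (c 0) x = \<zero>\<^bsub>lev (I (Suc n)) 0\<^esub>}"
        unfolding L_def by (auto simp del: lim_module_sel)
      thus ?thesis unfolding bij(2) DC.cyc_def by (auto simp: D_def d_def \<delta>'_def ncocycles_def)
    qed
    have "lin K (?L n) (D 0 n) ?e" using lim_eval_lin[of "I n"] by (simp add: D_def N0) (simp add: lev_def)
    thus "lin K L ((D 0 n)\<lparr>carrier := DC.cyc 0 n\<rparr>) ?e"
      using cyc by (intro lin_sub_cod) (auto simp: L_def intro!: lin_sub_dom)
    show "bij_betw ?e (carrier L) (carrier ((D 0 n)\<lparr>carrier := DC.cyc 0 n\<rparr>))"
    proof -
      have "carrier L \<subseteq> carrier (?L n)" by (auto simp: L_def simp del: lim_module_sel)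
      thus ?thesis using inj_on_subset[OF bij(1)] cyc by (simp add: bij_betw_def)
    qed
    show "B \<subseteq> carrier L" using submod_closed[OF B] by blast
    show "?e ` B = DC.bdv 0 n"
    proof (cases n)
      case 0
      thus ?thesis using c_ob unfolding DC.bdv_def by (simp add: B_def D_def lev_def)
    next
      case (Suc m)
      have "?e ` lim_map C (I m) (\<delta> m) ` carrier (?L m) = \<delta> m (c 0) ` ?e ` carrier (?L m)"
        unfolding image_image by (rule image_cong[OF refl]) (rule ev)
      thus ?thesis unfolding bij(2) DC.bdv_def by (simp add: B_def Suc D_def d_def \<delta>'_def ncocycles_def)
    qed
  qed
  thus "\<exists>R. corr K L B ((D 0 n)\<lparr>carrier := DC.cyc 0 n\<rparr>) (DC.bdv 0 n) R" by blast
qed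

text \<open>The path leads from the normalized complex of \<open>T\<close> through the double
  complex to the limits of the resolution. The outcome stays a correspondence, to be composed with
  that of the dual complex before any passage to quotients.\<close>

theorem derived_lim_corr:
  fixes I :: "nat \<Rightarrow> ('o, 'a, ('k, 'w) module, 'w \<Rightarrow> 'w) ftr"
  assumes T: "is_functor C (Mods K) T"
    and large: "\<exists>e :: ('o \<times> 'a \<Rightarrow> 'w) \<Rightarrow> 'w. inj e"
    and res: "injective_resolution K C T I \<delta> \<epsilon>"
  shows "\<exists>L B R. derived_lim C I \<delta> n = quot_module L B \<and> module K L \<and> submod K L B \<and>
     corr K ((lev T n)\<lparr>carrier := ncocycles (lev T) (lact T) n\<rparr>) (ncoboundaries (lev T) (lact T) n) L B R"
proof -
  let ?D = "\<lambda>p q. (lev (I q) p)\<lparr>carrier := norm (lev (I q)) (lact (I q)) p\<rparr>"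
  let ?d = "\<lambda>p q. bd (lev (I q)) (lact (I q)) p" and ?\<delta> = "\<lambda>p q. \<delta> q (c p)"
  interpret DC: double_complex K ?D ?d ?\<delta> by (rule injective_double_complex[OF large res])
  obtain R1 where R1: "corr K ((lev T n)\<lparr>carrier := ncocycles (lev T) (lact T) n\<rparr>) (ncoboundaries (lev T) (lact T) n)
      ((?D n 0)\<lparr>carrier := DC.cyc n 0\<rparr>) (DC.bdh n 0) R1"
    using corr_augmentation[OF T large res] by blast
  obtain R2 where R2: "corr K ((?D n 0)\<lparr>carrier := DC.cyc n 0\<rparr>) (DC.bdh n 0)
      ((?D 0 n)\<lparr>carrier := DC.cyc 0 n\<rparr>) (DC.bdv 0 n) R2"
    using DC.corr_edges by blast
  note l = corr_limit[OF large res, of n]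
  from l(3) obtain R3 where R3: "corr K
    ((lim_module C (I n))\<lparr>carrier := {s \<in> carrier (lim_module C (I n)).
       lim_map C (I n) (\<delta> n) s = \<zero>\<^bsub>lim_module C (I (Suc n))\<^esub>}\<rparr>)
    (case n of 0 \<Rightarrow> {\<zero>\<^bsub>lim_module C (I 0)\<^esub>} | Suc m \<Rightarrow> lim_map C (I m) (\<delta> m) ` carrier (lim_module C (I m)))
    ((?D 0 n)\<lparr>carrier := DC.cyc 0 n\<rparr>) (DC.bdv 0 n) R3" by blast
  have "derived_lim C I \<delta> n = quot_module
    ((lim_module C (I n))\<lparr>carrier := {s \<in> carrier (lim_module C (I n)).
       lim_map C (I n) (\<delta> n) s = \<zero>\<^bsub>lim_module C (I (Suc n))\<^esub>}\<rparr>)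
    (case n of 0 \<Rightarrow> {\<zero>\<^bsub>lim_module C (I 0)\<^esub>} | Suc m \<Rightarrow> lim_map C (I m) (\<delta> m) ` carrier (lim_module C (I m)))"
    by (simp add: derived_lim_def cohomology_def Let_def a_kernel_eq del: lim_module_sel cong: nat.case_cong)
  with l(1,2) corr_comp[OF corr_comp[OF R1 R2] corr_sym[OF R3]] show ?thesis by blast
qed

end

section \<open>The category of presentations of a free module\<close>

lemma codable_subset: "codable TYPE('u) S \<Longrightarrow> T \<subseteq> S \<Longrightarrow> codable TYPE('u) T"
  unfolding codable_def by (meson inj_on_subset)

lemma codable_bij:
  assumes "codable TYPE('u) S" "bij_betw f S T" shows "codable TYPE('u) T"
proof -
  from assms(1) obtain e :: "'a \<Rightarrow> 'u" where e: "inj_on e S" by (auto simp: codable_def)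
  have "inj_on (e \<circ> inv_into S f) T"
    using bij_betw_inv_into[OF assms(2)] e by (intro comp_inj_on) (auto simp: bij_betw_def)
  thus ?thesis unfolding codable_def by blast
qed

lemma infinite_pairing:
  assumes "infinite (UNIV :: 'u set)" shows "\<exists>p :: 'u \<times> 'u \<Rightarrow> 'u. inj p"
proof -
  obtain p :: "'u \<times> 'u \<Rightarrow> 'u" where "bij_betw p (UNIV \<times> UNIV) UNIV"
    using iffD2[OF card_of_ordIso card_of_Times_same_infinite[OF assms]] by blast
  thus ?thesis by (auto simp: bij_betw_def)
qed

text \<open>A pairing on the infinite type is iterated: the new coordinate is paired with the code
  of the restricted tuple.\<close>

lemma codable_power:
  assumes "infinite (UNIV :: 'u set)" "finite I"
  shows "codable TYPE('u) (\<Pi>\<^sub>E i\<in>I. S i :: 'u set)"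
proof -
  obtain p :: "'u \<times> 'u \<Rightarrow> 'u" where p: "inj p" using infinite_pairing[OF assms(1)] by blast
  show ?thesis
    using assms(2)
  proof (induction I rule: finite_induct)
    case empty
    show ?case unfolding codable_def by (rule exI[of _ "\<lambda>_. undefined"]) simp
  next
    case (insert i I)
    then obtain e :: "('a \<Rightarrow> 'u) \<Rightarrow> 'u" where e: "inj_on e (\<Pi>\<^sub>E i\<in>I. S i)" by (auto simp: codable_def)
    have "inj_on (\<lambda>f. p (f i, e (restrict f I))) (\<Pi>\<^sub>E i\<in>insert i I. S i)"
    proof (rule inj_onI)
      fix f g assume fg: "f \<in> (\<Pi>\<^sub>E i\<in>insert i I. S i)" "g \<in> (\<Pi>\<^sub>E i\<in>insert i I. S i)"
        "p (f i, e (restrict f I)) = p (g i, e (restrict g I))"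
      have 1: "f i = g i" "e (restrict f I) = e (restrict g I)" using injD[OF p fg(3)] by auto
      have 2: "restrict f I = restrict g I"
      proof -
        have "restrict f I \<in> (\<Pi>\<^sub>E i\<in>I. S i)" "restrict g I \<in> (\<Pi>\<^sub>E i\<in>I. S i)" using fg by auto
        from inj_on_eq_iff[OF e this] 1(2) show ?thesis by blast
      qed
      show "f = g"
      proof (rule extensionalityI)
        show "f \<in> extensional (insert i I)" "g \<in> extensional (insert i I)" using fg by (auto simp: PiE_def)
        show "f x = g x" if "x \<in> insert i I" for x
          using that 1(1) fun_cong[OF 2, of x] by (cases "x = i") auto
      qed
    qed
    thus ?case unfolding codable_def by blast
  qed
qed

lemma finsum_fibers:
  assumes "abelian_monoid G" "finite S" "finite T" "\<And>i. i \<in> S \<Longrightarrow> f i \<in> T" "\<And>i. i \<in> S \<Longrightarrow> g i \<in> carrier G"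
  shows "finsum G (\<lambda>j. finsum G g {i\<in>S. f i = j}) T = finsum G g S"
proof -
  interpret G: abelian_monoid G by fact
  have S: "S = (\<Union>j\<in>T. {i\<in>S. f i = j})" using assms(4) by auto
  have "finsum G g (\<Union>j\<in>T. {i\<in>S. f i = j}) = finsum G (\<lambda>j. finsum G g {i\<in>S. f i = j}) T"
    by (rule G.add.finprod_UN_disjoint) (use assms in \<open>auto simp: pairwise_def disjnt_def\<close>)
  thus ?thesis using S by simp
qed

text \<open>The pushforward of tuples along a map of indices, with zero on empty fibres; it is
  functorial for all maps. Inserting a zero and merging two entries are its values on the cofaces
  and codegeneracies.\<close>

definition push :: "('k, 'u) module \<Rightarrow> nat \<Rightarrow> nat \<Rightarrow> (nat \<Rightarrow> nat) \<Rightarrow> (nat \<Rightarrow> 'u) \<Rightarrow> (nat \<Rightarrow> 'u)" where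
  "push A m n \<alpha> a = (\<lambda>j\<in>{..n}. finsum A a {i\<in>{..m}. \<alpha> i = j})"

lemma power_module_sel [simp]:
  "carrier (power_module A n) = (\<Pi>\<^sub>E i\<in>{..n}. carrier A)"
  "\<zero>\<^bsub>power_module A n\<^esub> = (\<lambda>i\<in>{..n}. \<zero>\<^bsub>A\<^esub>)"
  "a \<oplus>\<^bsub>power_module A n\<^esub> b = (\<lambda>i\<in>{..n}. a i \<oplus>\<^bsub>A\<^esub> b i)"
  "r \<odot>\<^bsub>power_module A n\<^esub> a = (\<lambda>i\<in>{..n}. r \<odot>\<^bsub>A\<^esub> a i)"
  by (simp_all add: power_module_def)

lemma module_power: "module K A \<Longrightarrow> module K (power_module A n)"
  unfolding power_module_def by (rule module_prod) (auto dest: module_cring)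

lemma power_elem: "a \<in> carrier (power_module A n) \<Longrightarrow> i \<le> n \<Longrightarrow> a i \<in> carrier A"
  by auto

lemma power_proj_lin: "i \<le> n \<Longrightarrow> lin K (power_module A n) A (\<lambda>a. a i)"
  by (rule linI) auto

lemma power_finsum_lin:
  assumes "module K A" "S \<subseteq> {..n}"
  shows "lin K (power_module A n) A (\<lambda>a. finsum A a S)"
  using lin_sum[OF module_power[OF assms(1)] assms(1), of S n "\<lambda>i a. a i"] assms(2)
    finite_subset[OF assms(2)] power_proj_lin by (metis atMost_iff finite_atMost subsetD)

lemma push_lin:
  assumes "module K A"
  shows "lin K (power_module A m) (power_module A n) (push A m n \<alpha>)"
proof -
  have "push A m n \<alpha> = (\<lambda>a. \<lambda>j\<in>{..n}. finsum A a {i\<in>{..m}. \<alpha> i = j})" by (rule ext) (simp add: push_def)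
  moreover have "lin K (power_module A m) (power_module A n) (\<lambda>a. \<lambda>j\<in>{..n}. finsum A a {i\<in>{..m}. \<alpha> i = j})"
    unfolding power_module_def[of A n]
    by (rule lin_into_prod[OF module_power[OF assms]]) (rule power_finsum_lin[OF assms], auto)
  ultimately show ?thesis by simp
qed

lemma push_in:
  fixes K :: "'k ring"
  shows "module K A \<Longrightarrow> a \<in> carrier (power_module A m) \<Longrightarrow> push A m n \<alpha> a \<in> carrier (power_module A n)"
  by (rule lin_closed[OF push_lin[where K = K]])

lemma push_id:
  assumes "module K A" "\<And>i. i \<le> n \<Longrightarrow> \<alpha> i = i" "a \<in> carrier (power_module A n)"
  shows "push A n n \<alpha> a = a"
proof (rule extensionalityI)
  interpret A: module K A by fact
  fix j assume j: "j \<in> {..n}"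
  have "{i \<in> {..n}. \<alpha> i = j} = {j}" using assms(2) j by auto
  thus "push A n n \<alpha> a j = a j" using j power_elem[OF assms(3)] by (simp add: push_def)
qed (use assms(3) in \<open>auto simp: push_def PiE_def\<close>)

lemma push_comp:
  assumes A: "module K A" and \<alpha>: "\<alpha> \<in> {..m} \<rightarrow> {..n}" and \<beta>: "\<beta> \<in> {..n} \<rightarrow> {..k}"
    and \<gamma>: "\<And>i. i \<le> m \<Longrightarrow> \<gamma> i = \<beta> (\<alpha> i)" and a: "a \<in> carrier (power_module A m)"
  shows "push A n k \<beta> (push A m n \<alpha> a) = push A m k \<gamma> a"
proof (rule extensionalityI)
  interpret A: module K A by fact
  fix l assume l: "l \<in> {..k}"
  have "push A n k \<beta> (push A m n \<alpha> a) l = finsum A (push A m n \<alpha> a) {j \<in> {..n}. \<beta> j = l}"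
    using l by (simp add: push_def)
  also have "\<dots> = finsum A (\<lambda>j. finsum A a {i \<in> {i \<in> {..m}. \<gamma> i = l}. \<alpha> i = j}) {j \<in> {..n}. \<beta> j = l}"
  proof (rule A.finsum_cong')
    fix j assume j: "j \<in> {j \<in> {..n}. \<beta> j = l}"
    have "{i \<in> {..m}. \<alpha> i = j} = {i \<in> {i \<in> {..m}. \<gamma> i = l}. \<alpha> i = j}" using j \<gamma> by auto
    thus "push A m n \<alpha> a j = finsum A a {i \<in> {i \<in> {..m}. \<gamma> i = l}. \<alpha> i = j}"
      using j by (simp add: push_def)
  qed (use power_elem[OF a] in \<open>auto intro!: A.finsum_closed\<close>)
  also have "\<dots> = finsum A a {i \<in> {..m}. \<gamma> i = l}"
    by (rule finsum_fibers) (use \<alpha> \<gamma> power_elem[OF a] A.abelian_monoid_axioms in auto)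
  finally show "push A n k \<beta> (push A m n \<alpha> a) l = push A m k \<gamma> a l" using l by (simp add: push_def)
qed (auto simp: push_def)

lemma push_total:
  assumes A: "module K A" and \<alpha>: "\<alpha> \<in> {..m} \<rightarrow> {..n}" and a: "a \<in> carrier (power_module A m)"
  shows "finsum A (push A m n \<alpha> a) {..n} = finsum A a {..m}"
proof -
  interpret A: module K A by fact
  have "finsum A (push A m n \<alpha> a) {..n} = finsum A (\<lambda>j. finsum A a {i \<in> {..m}. \<alpha> i = j}) {..n}"
    by (rule A.finsum_cong') (use power_elem[OF a] in \<open>auto simp: push_def intro!: A.finsum_closed\<close>)
  also have "\<dots> = finsum A a {..m}"
    by (rule finsum_fibers) (use \<alpha> power_elem[OF a] A.abelian_monoid_axioms in auto)
  finally show ?thesis .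
qed

lemma insert_zero_push:
  assumes A: "module K A" and i: "i \<le> Suc n" and a: "a \<in> carrier (power_module A n)"
  shows "insert_zero A n i a = push A n (Suc n) (\<lambda>j. if j < i then j else Suc j) a"
proof (rule extensionalityI)
  interpret A: module K A by fact
  fix j assume j: "j \<in> {..Suc n}"
  consider "j < i" | "j = i" | "i < j" by linarith
  thus "insert_zero A n i a j = push A n (Suc n) (\<lambda>j. if j < i then j else Suc j) a j"
  proof cases
    case 1
    hence "{k \<in> {..n}. (if k < i then k else Suc k) = j} = {j}" using i by auto
    thus ?thesis using 1 j a i power_elem[OF a, of j] by (simp add: insert_zero_def push_def)
  next
    case 2
    hence "{k \<in> {..n}. (if k < i then k else Suc k) = j} = {}" by auto
    thus ?thesis using 2 j a by (simp add: insert_zero_def push_def)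
  next
    case 3
    hence "{k \<in> {..n}. (if k < i then k else Suc k) = j} = {j - 1}" using j by auto
    thus ?thesis using 3 j a power_elem[OF a, of "j - 1"] by (auto simp: insert_zero_def push_def)
  qed
qed (use a in \<open>auto simp: insert_zero_def push_def\<close>)

lemma merge_entries_push:
  assumes A: "module K A" and i: "i \<le> n" and a: "a \<in> carrier (power_module A (Suc n))"
  shows "merge_entries A n i a = push A (Suc n) n (\<lambda>j. if j \<le> i then j else j - 1) a"
proof (rule extensionalityI)
  interpret A: module K A by fact
  fix j assume j: "j \<in> {..n}"
  note ac = power_elem[OF a]
  consider "j < i" | "j = i" | "i < j" by linarith
  thus "merge_entries A n i a j = push A (Suc n) n (\<lambda>j. if j \<le> i then j else j - 1) a j"
  proof cases
    case 1
    hence "{k \<in> {..Suc n}. (if k \<le> i then k else k - 1) = j} = {j}" using i by auto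
    thus ?thesis using 1 j a i ac[of j] by (simp add: merge_entries_def push_def)
  next
    case 2
    hence "{k \<in> {..Suc n}. (if k \<le> i then k else k - 1) = j} = {i, Suc i}" using i by auto
    thus ?thesis using 2 j a i ac[of i] ac[of "Suc i"] by (simp add: merge_entries_def push_def)
  next
    case 3
    hence "{k \<in> {..Suc n}. (if k \<le> i then k else k - 1) = j} = {Suc j}" using j by auto
    thus ?thesis using 3 j a ac[of "Suc j"] by (simp add: merge_entries_def push_def)
  qed
qed (use a in \<open>auto simp: merge_entries_def push_def\<close>)

lemma coord_system_separated_module:
  assumes "coord_system K M J e c" shows "separated K M"
proof -
  have J: "finite J" and c: "\<And>j. j \<in> J \<Longrightarrow> lin K M (self_module K) (c j)"
    using assms by (auto simp: coord_system_def)
  obtain h where h: "bij_betw h {..<card J} J" using ex_bij_betw_nat_finite[OF J] by (auto simp: atLeast0LessThan)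
  show ?thesis unfolding separated_def
  proof (intro exI[of _ "card J"] exI[of _ "\<lambda>i. c (h i)"] conjI allI impI ballI)
    show "lin K M (self_module K) (c (h j))" if "j < card J" for j
      using h that by (intro c) (auto simp: bij_betw_def)
    fix x assume x: "x \<in> carrier M" "\<forall>j<card J. c (h j) x = \<zero>\<^bsub>K\<^esub>"
    show "x = \<zero>\<^bsub>M\<^esub>"
    proof (rule coord_system_separated[OF assms x(1)])
      fix j assume "j \<in> J"
      then obtain i where "i < card J" "j = h i" using h by (auto simp: bij_betw_def)
      thus "c j x = \<zero>\<^bsub>K\<^esub>" using x(2) by simp
    qed
  qed
qed

section \<open>Powers of A as presentations\<close>

locale free_target =
  fixes K :: "'k ring" and A :: "('k, 'u) module"
  assumes pd: "principal_domain K"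
    and u_infinite: "infinite (UNIV :: 'u set)"
    and free: "free_module K A" and fin_gen: "fin_gen_module K A"
begin

lemma dom: "domain K" using pd by (simp add: principal_domain_def)
lemma cr: "cring K" using dom by (simp add: domain_def)
lemma A: "module K A" using free by (simp add: free_module_def)

sublocale A: module K A by (rule A)

lemma coords: "\<exists>J c. coord_system K A J (\<lambda>b. b) c \<and> biorthogonal K J (\<lambda>b. b) c"
  by (rule free_fin_gen_coord_system[OF dom free fin_gen])

lemma codable_pow: "codable TYPE('u) (carrier (power_module A n))"
  using codable_power[OF u_infinite, of "{..n}"] by simp

definition cpow :: "nat \<Rightarrow> ('k, 'u) module" where "cpow n = copy (power_module A n)"
abbreviation (input) enc :: "nat \<Rightarrow> (nat \<Rightarrow> 'u) \<Rightarrow> 'u" where "enc n \<equiv> code (carrier (power_module A n))"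
abbreviation (input) dec :: "nat \<Rightarrow> 'u \<Rightarrow> nat \<Rightarrow> 'u" where "dec n \<equiv> decode (carrier (power_module A n))"
definition pobj :: "nat \<Rightarrow> ('k, 'u) pres" where "pobj = pres_power A (id_pres A)"
definition pmap :: "nat \<Rightarrow> nat \<Rightarrow> (nat \<Rightarrow> nat) \<Rightarrow> 'u \<Rightarrow> 'u" where
  "pmap m n \<alpha> = copy_map (power_module A m) (power_module A n) (push A m n \<alpha>)"

lemma module_cpow: "module K (cpow n)"
  unfolding cpow_def by (rule module_copy[OF module_power[OF A] codable_pow])

lemma enc_lin: "lin K (power_module A n) (cpow n) (enc n)"
  unfolding cpow_def by (rule code_lin[OF codable_pow])

lemma enc_bij: "bij_betw (enc n) (carrier (power_module A n)) (carrier (cpow n))"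
  unfolding cpow_def by (rule code_bij[OF codable_pow])

lemma dec_enc: "a \<in> carrier (power_module A n) \<Longrightarrow> dec n (enc n a) = a"
  by (rule decode_code[OF codable_pow])

lemma enc_in: "a \<in> carrier (power_module A n) \<Longrightarrow> enc n a \<in> carrier (cpow n)"
  by (rule lin_closed[OF enc_lin])

lemma cpowE:
  assumes "x \<in> carrier (cpow n)" obtains a where "a \<in> carrier (power_module A n)" "x = enc n a"
  using assms unfolding cpow_def by (rule copyE)

lemma pmap_enc: "a \<in> carrier (power_module A m) \<Longrightarrow> pmap m n \<alpha> (enc m a) = enc n (push A m n \<alpha> a)"
  unfolding pmap_def by (rule copy_map_code[OF codable_pow])

lemma pmap_hom: "pmap m n \<alpha> \<in> mod_hom K (cpow m) (cpow n)"
  unfolding pmap_def cpow_def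
  by (rule copy_map_hom[OF codable_pow codable_pow module_power[OF A] push_lin[OF A]])

lemma fst_pobj: "fst (pobj n) = cpow n"
  by (simp add: pobj_def pres_power_def id_pres_def cpow_def)

lemma snd_pobj_enc: "a \<in> carrier (power_module A n) \<Longrightarrow> snd (pobj n) (enc n a) = finsum A a {..n}"
proof -
  assume a: "a \<in> carrier (power_module A n)"
  have "snd (pobj n) (enc n a) = finsum A (\<lambda>i. (\<lambda>x\<in>carrier A. x) (dec n (enc n a) i)) {..n}"
    using enc_in[OF a] by (simp add: pobj_def pres_power_def id_pres_def cpow_def)
  also have "\<dots> = finsum A a {..n}"
    unfolding dec_enc[OF a] by (rule A.finsum_cong') (use a in auto)
  finally show ?thesis .
qed

lemma snd_pobj_hom: "snd (pobj n) \<in> mod_hom K (cpow n) A"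
proof -
  note t = power_finsum_lin[OF A, of "{..n}" n, simplified]
  have "lin K (cpow n) A (snd (pobj n))"
  proof (rule linI)
    fix x assume "x \<in> carrier (cpow n)"
    then obtain a where a: "a \<in> carrier (power_module A n)" "x = enc n a" by (rule cpowE)
    interpret P: module K "power_module A n" by (rule module_power[OF A])
    show "snd (pobj n) x \<in> carrier A" using lin_closed[OF t a(1)] snd_pobj_enc a by simp
    show "snd (pobj n) (x \<oplus>\<^bsub>cpow n\<^esub> y) = snd (pobj n) x \<oplus>\<^bsub>A\<^esub> snd (pobj n) y" if "y \<in> carrier (cpow n)" for y
    proof -
      from that obtain b where b: "b \<in> carrier (power_module A n)" "y = enc n b" by (rule cpowE)
      have "x \<oplus>\<^bsub>cpow n\<^esub> y = enc n (a \<oplus>\<^bsub>power_module A n\<^esub> b)"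
        unfolding a(2) b(2) by (rule lin_add[OF enc_lin a(1) b(1), symmetric])
      thus ?thesis
        unfolding a(2) b(2) using lin_add[OF t a(1) b(1)] P.a_closed[OF a(1) b(1)] a b
        by (simp only: snd_pobj_enc)
    qed
    show "snd (pobj n) (r \<odot>\<^bsub>cpow n\<^esub> x) = r \<odot>\<^bsub>A\<^esub> snd (pobj n) x" if r: "r \<in> carrier K" for r
    proof -
      have "r \<odot>\<^bsub>cpow n\<^esub> x = enc n (r \<odot>\<^bsub>power_module A n\<^esub> a)"
        unfolding a(2) by (rule lin_smult[OF enc_lin r a(1), symmetric])
      thus ?thesis
        unfolding a(2) using lin_smult[OF t r a(1)] P.smult_closed[OF r a(1)] a
        by (simp only: snd_pobj_enc)
    qed
  qed
  thus ?thesis by (simp add: mod_hom_iff pobj_def pres_power_def id_pres_def cpow_def)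
qed

lemma push_point:
  assumes "x \<in> carrier A"
  shows "push A 0 n (\<lambda>_. 0) (\<lambda>j\<in>{..0}. x) = (\<lambda>j\<in>{..n}. if j = 0 then x else \<zero>\<^bsub>A\<^esub>)"
proof (rule ext)
  fix j :: nat
  have "{i \<in> {..0::nat}. 0 = j} = (if j = 0 then {0} else {})" by auto
  thus "push A 0 n (\<lambda>_. 0) (\<lambda>j\<in>{..0}. x) j = (\<lambda>j\<in>{..n}. if j = 0 then x else \<zero>\<^bsub>A\<^esub>) j"
    using assms by (simp add: push_def)
qed

lemma push_shift:
  assumes "b \<in> carrier (power_module A n)"
  shows "push A n (Suc n) Suc b = (\<lambda>j\<in>{..Suc n}. if j = 0 then \<zero>\<^bsub>A\<^esub> else b (j - 1))"
proof (rule ext)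
  fix j :: nat
  have "{i \<in> {..n}. Suc i = j} = (if j = 0 \<or> Suc n < j then {} else {j - 1})" by auto
  thus "push A n (Suc n) Suc b j = (\<lambda>j\<in>{..Suc n}. if j = 0 then \<zero>\<^bsub>A\<^esub> else b (j - 1)) j"
    using power_elem[OF assms, of "j - 1"] by (simp add: push_def)
qed

lemma free_cpow: "free_module K (cpow n)"
proof -
  obtain J c where c: "coord_system K A J (\<lambda>b. b) c" "biorthogonal K J (\<lambda>b. b) c" using coords by blast
  have f: "finite {..n}" by simp
  note p = coord_system_prod[OF c f, folded power_module_def]
  show ?thesis
    using coord_system_free[OF dom coord_system_iso[OF p(1) module_cpow enc_lin enc_bij]
        biorthogonal_iso[OF p enc_bij]] by blast
qed

lemma pobj_ob: "pobj n \<in> Ob (Pres K A)"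
proof -
  have "snd (pobj n) ` carrier (cpow n) = carrier A"
  proof (intro equalityI subsetI)
    show "x \<in> carrier A" if "x \<in> snd (pobj n) ` carrier (cpow n)" for x
      using that mod_hom_closed[OF snd_pobj_hom] by blast
    fix x assume x: "x \<in> carrier A"
    let ?u = "\<lambda>j\<in>{..0::nat}. x"
    have u: "?u \<in> carrier (power_module A 0)" using x by simp
    have pu: "push A 0 n (\<lambda>_. 0) ?u \<in> carrier (power_module A n)" by (rule push_in[OF A u])
    have "snd (pobj n) (enc n (push A 0 n (\<lambda>_. 0) ?u)) = finsum A ?u {..0}"
      unfolding snd_pobj_enc[OF pu] by (rule push_total[OF A _ u]) simp
    also have "\<dots> = x" using x by simp
    finally show "x \<in> snd (pobj n) ` carrier (cpow n)" using enc_in[OF pu] by (metis imageI)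
  qed
  thus ?thesis using free_cpow[of n] snd_pobj_hom[of n]
    by (cases "pobj n") (use fst_pobj[of n] in \<open>auto simp: Pres_def\<close>)
qed

lemma Pres_sel:
  "(F, p) \<in> Ob (Pres K A) \<longleftrightarrow> free_module K F \<and> p \<in> mod_hom K F A \<and> p ` carrier F = carrier A"
  "f \<in> Hom (Pres K A) X Y \<longleftrightarrow> f \<in> mod_hom K (fst X) (fst Y) \<and> (\<forall>x\<in>carrier (fst X). snd Y (f x) = snd X x)"
  "Id (Pres K A) X = (\<lambda>x\<in>carrier (fst X). x)"
  "Comp (Pres K A) X g f = compose (carrier (fst X)) g f"
  by (auto simp: Pres_def split: prod.splits)

lemma Pres_ob:
  "X \<in> Ob (Pres K A) \<longleftrightarrow> free_module K (fst X) \<and> snd X \<in> mod_hom K (fst X) A \<and> snd X ` carrier (fst X) = carrier A"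
  using Pres_sel(1)[of "fst X" "snd X"] by simp

lemma Pres_module: "X \<in> Ob (Pres K A) \<Longrightarrow> module K (fst X)"
  by (simp add: Pres_ob free_module_def)

definition cop :: "nat \<Rightarrow> ('k, 'u) pres \<Rightarrow> ('u \<Rightarrow> 'u) \<Rightarrow> ('u \<Rightarrow> 'u) \<Rightarrow> 'u \<Rightarrow> 'u" where
  "cop n X h f = (\<lambda>x\<in>carrier (cpow (Suc n)).
     h (enc 0 (\<lambda>j\<in>{..0}. dec (Suc n) x 0)) \<oplus>\<^bsub>fst X\<^esub> f (enc n (\<lambda>j\<in>{..n}. dec (Suc n) x (Suc j))))"

lemma head_in: "a \<in> carrier (power_module A (Suc n)) \<Longrightarrow> (\<lambda>j\<in>{..0}. a 0) \<in> carrier (power_module A 0)"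
  and tail_in: "a \<in> carrier (power_module A (Suc n)) \<Longrightarrow> (\<lambda>j\<in>{..n}. a (Suc j)) \<in> carrier (power_module A n)"
  by auto

lemma cop_enc: "a \<in> carrier (power_module A (Suc n)) \<Longrightarrow>
    cop n X h f (enc (Suc n) a) = h (enc 0 (\<lambda>j\<in>{..0}. a 0)) \<oplus>\<^bsub>fst X\<^esub> f (enc n (\<lambda>j\<in>{..n}. a (Suc j)))"
  by (simp only: cop_def restrict_apply enc_in dec_enc if_True)

lemma hom_zero: "lin K M N f \<Longrightarrow> module K M \<Longrightarrow> module K N \<Longrightarrow> f \<zero>\<^bsub>M\<^esub> = \<zero>\<^bsub>N\<^esub>"
  by (rule lin_zero)

lemma enc_zero: "enc n (\<lambda>j\<in>{..n}. \<zero>\<^bsub>A\<^esub>) = \<zero>\<^bsub>cpow n\<^esub>"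
  using lin_zero[OF module_power[OF A] module_cpow enc_lin, of n] by simp

text \<open>The objects are coded tuples, so most axioms reduce to identities for
  \<open>push\<close>. Uniqueness of the copairing holds because each tuple is the sum of its first
  entry and its remaining entries, both padded with zeros; existence of an arrow out of the identity
  presentation is projectivity of \<open>A\<close>.\<close>

lemma power_category: "power_category K (Pres K A) pobj pmap cop"
proof (rule power_category.intro)
  show "cring K" by (rule cr)
  show "pobj n \<in> Ob (Pres K A)" for n by (rule pobj_ob)
  show "Id (Pres K A) X \<in> Hom (Pres K A) X X" if "X \<in> Ob (Pres K A)" for X
    using restrict_mod_hom[OF Pres_module[OF that] lin_ident] by (simp add: Pres_sel)
  show "Comp (Pres K A) X g f \<in> Hom (Pres K A) X Z"
    if "X \<in> Ob (Pres K A)" "Y \<in> Ob (Pres K A)" "Z \<in> Ob (Pres K A)" "f \<in> Hom (Pres K A) X Y" "g \<in> Hom (Pres K A) Y Z"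
    for X Y Z f g
    using restrict_mod_hom[OF Pres_module[OF that(1)] lin_comp, of "fst Y" f "fst Z" g] that(4,5)
      mod_hom_closed[of f K "fst X" "fst Y"]
    by (simp add: Pres_sel compose_def mod_hom_lin)
  show "Comp (Pres K A) X f (Id (Pres K A) X) = f" if "f \<in> Hom (Pres K A) X Y" for X Y f
    using that by (auto simp: Pres_sel compose_def fun_eq_iff dest: mod_hom_undefined)
  show "Comp (Pres K A) X (Comp (Pres K A) Y h g) f = Comp (Pres K A) X h (Comp (Pres K A) X g f)"
    if "f \<in> Hom (Pres K A) X Y" for X Y f g h
    using that by (auto simp: Pres_sel compose_def fun_eq_iff dest: mod_hom_closed)
  show "pmap m n \<alpha> \<in> Hom (Pres K A) (pobj m) (pobj n)" if "\<alpha> \<in> {..m} \<rightarrow> {..n}" for \<alpha> m n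
    unfolding Pres_sel fst_pobj
  proof (intro conjI pmap_hom ballI)
    fix x assume "x \<in> carrier (cpow m)"
    then obtain a where a: "a \<in> carrier (power_module A m)" "x = enc m a" by (rule cpowE)
    show "snd (pobj n) (pmap m n \<alpha> x) = snd (pobj m) x"
      unfolding a(2) pmap_enc[OF a(1)] snd_pobj_enc[OF a(1)] snd_pobj_enc[OF push_in[OF A a(1)]]
      by (rule push_total[OF A that a(1)])
  qed
  show "pmap n n \<alpha> = Id (Pres K A) (pobj n)" if "\<And>i. i \<le> n \<Longrightarrow> \<alpha> i = i" for n \<alpha>
    unfolding Pres_sel fst_pobj
  proof (rule extensionalityI)
    fix x assume x: "x \<in> carrier (cpow n)"
    then obtain a where a: "a \<in> carrier (power_module A n)" "x = enc n a" by (rule cpowE)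
    have "push A n n \<alpha> a = a" by (rule push_id[OF A that a(1)])
    thus "pmap n n \<alpha> x = (\<lambda>x\<in>carrier (cpow n). x) x"
      using x unfolding a(2) pmap_enc[OF a(1)] by simp
  qed (use pmap_hom[of n n \<alpha>] in \<open>auto simp: mod_hom_iff\<close>)
  show "Comp (Pres K A) (pobj m) (pmap n k \<beta>) (pmap m n \<alpha>) = pmap m k \<gamma>"
    if "\<alpha> \<in> {..m} \<rightarrow> {..n}" "\<beta> \<in> {..n} \<rightarrow> {..k}" "\<And>i. i \<le> m \<Longrightarrow> \<gamma> i = \<beta> (\<alpha> i)" for \<alpha> m n \<beta> k \<gamma>
    unfolding Pres_sel fst_pobj
  proof (rule extensionalityI)
    fix x assume x: "x \<in> carrier (cpow m)"
    then obtain a where a: "a \<in> carrier (power_module A m)" "x = enc m a" by (rule cpowE)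
    show "compose (carrier (cpow m)) (pmap n k \<beta>) (pmap m n \<alpha>) x = pmap m k \<gamma> x"
      using x unfolding compose_def a(2)
      by (simp only: restrict_apply if_True pmap_enc[OF a(1)] pmap_enc[OF push_in[OF A a(1)]] push_comp[OF A that a(1)])
  qed (use pmap_hom[of m k \<gamma>] in \<open>auto simp: mod_hom_iff compose_def\<close>)
  fix n X h f
  assume X: "X \<in> Ob (Pres K A)"
  note mX = Pres_module[OF X]
  interpret X: module K "fst X" by (rule mX)
  have lX: "lin K (fst X) A (snd X)" using X by (simp add: Pres_ob mod_hom_lin)
  show "\<exists>h. h \<in> Hom (Pres K A) (pobj 0) X"
  proof -
    obtain J c where c: "coord_system K A J (\<lambda>b. b) c" using coords by blast
    have "snd X ` carrier (fst X) = carrier A" using X by (simp add: Pres_ob)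
    \<comment> \<open>A linear section of the given presentation; preceded by decoding a tuple with
      one entry it becomes the required arrow.\<close>
    from separated_lift[OF pd A coord_system_separated_module[OF c] mX A lX this lin_ident]
    obtain s where s: "lin K A (fst X) s" "\<forall>x\<in>carrier A. snd X (s x) = x" by blast
    have dl: "lin K (cpow 0) (power_module A 0) (inv_into (carrier (power_module A 0)) (enc 0))"
      by (rule lin_inv[OF module_power[OF A] enc_lin enc_bij])
    let ?h = "\<lambda>x\<in>carrier (cpow 0). s (inv_into (carrier (power_module A 0)) (enc 0) x 0)"
    have 1: "?h \<in> mod_hom K (cpow 0) (fst X)"
      by (rule restrict_mod_hom[OF module_cpow lin_comp[OF lin_comp[OF dl power_proj_lin] s(1)]]) simp
    have "snd X (?h x) = snd (pobj 0) x" if "x \<in> carrier (cpow 0)" for x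
    proof -
      from that obtain a where a: "a \<in> carrier (power_module A 0)" "x = enc 0 a" by (rule cpowE)
      have "inv_into (carrier (power_module A 0)) (enc 0) x = a"
        unfolding a(2) by (rule inv_into_f_f[OF bij_betw_imp_inj_on[OF enc_bij] a(1)])
      moreover have "a 0 \<in> carrier A" using power_elem[OF a(1)] by simp
      moreover have "finsum A a {..0} = a 0" using \<open>a 0 \<in> carrier A\<close> by simp
      ultimately show ?thesis using that s(2) snd_pobj_enc[OF a(1)] a(2) by simp
    qed
    with 1 show ?thesis unfolding Pres_sel fst_pobj by blast
  qed
  {
    fix g g'
    assume g: "g \<in> Hom (Pres K A) (pobj (Suc n)) X" and g': "g' \<in> Hom (Pres K A) (pobj (Suc n)) X"
      and e0: "Comp (Pres K A) (pobj 0) g (pmap 0 (Suc n) (\<lambda>_. 0)) = Comp (Pres K A) (pobj 0) g' (pmap 0 (Suc n) (\<lambda>_. 0))"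
      and e1: "Comp (Pres K A) (pobj n) g (pmap n (Suc n) Suc) = Comp (Pres K A) (pobj n) g' (pmap n (Suc n) Suc)"
    have l: "lin K (cpow (Suc n)) (fst X) g" "lin K (cpow (Suc n)) (fst X) g'"
      using g g' by (simp_all add: Pres_sel fst_pobj mod_hom_lin)
    show "g = g'"
    proof (rule mod_hom_eqI)
      show "g \<in> mod_hom K (cpow (Suc n)) (fst X)" "g' \<in> mod_hom K (cpow (Suc n)) (fst X)"
        using g g' by (simp_all add: Pres_sel fst_pobj)
      fix x assume "x \<in> carrier (cpow (Suc n))"
      then obtain a where a: "a \<in> carrier (power_module A (Suc n))" "x = enc (Suc n) a" by (rule cpowE)
      let ?u = "push A 0 (Suc n) (\<lambda>_. 0) (\<lambda>j\<in>{..0}. a 0)" and ?v = "push A n (Suc n) Suc (\<lambda>j\<in>{..n}. a (Suc j))"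
      have u: "?u \<in> carrier (power_module A (Suc n))" by (rule push_in[OF A head_in[OF a(1)]])
      have v: "?v \<in> carrier (power_module A (Suc n))" by (rule push_in[OF A tail_in[OF a(1)]])
      have "a = ?u \<oplus>\<^bsub>power_module A (Suc n)\<^esub> ?v"
      proof (rule extensionalityI)
        fix j assume j: "j \<in> {..Suc n}"
        note ac = power_elem[OF a(1)]
        show "a j = (?u \<oplus>\<^bsub>power_module A (Suc n)\<^esub> ?v) j"
          unfolding push_point[OF ac[OF le0]] push_shift[OF tail_in[OF a(1)]]
          using j ac[of j] by (cases j) auto
      qed (use a(1) in \<open>auto simp: PiE_def\<close>)
      hence x: "x = enc (Suc n) ?u \<oplus>\<^bsub>cpow (Suc n)\<^esub> enc (Suc n) ?v"
        using lin_add[OF enc_lin u v] a(2) by simp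
      have "g (enc (Suc n) ?u) = g' (enc (Suc n) ?u)"
        using fun_cong[OF e0, of "enc 0 (\<lambda>j\<in>{..0}. a 0)"] enc_in[OF head_in[OF a(1)]]
        by (simp only: Pres_sel fst_pobj compose_def restrict_apply if_True pmap_enc[OF head_in[OF a(1)]])
      moreover have "g (enc (Suc n) ?v) = g' (enc (Suc n) ?v)"
        using fun_cong[OF e1, of "enc n (\<lambda>j\<in>{..n}. a (Suc j))"] enc_in[OF tail_in[OF a(1)]]
        by (simp only: Pres_sel fst_pobj compose_def restrict_apply if_True pmap_enc[OF tail_in[OF a(1)]])
      ultimately show "g x = g' x"
        unfolding x using lin_add[OF l(1) enc_in[OF u] enc_in[OF v]] lin_add[OF l(2) enc_in[OF u] enc_in[OF v]] by simp
    qed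
  }
  assume h: "h \<in> Hom (Pres K A) (pobj 0) X" and f: "f \<in> Hom (Pres K A) (pobj n) X"
  have lh: "lin K (cpow 0) (fst X) h" and lf: "lin K (cpow n) (fst X) f"
    using h f by (simp_all add: Pres_sel fst_pobj mod_hom_lin)
  have ph: "snd X (h x) = snd (pobj 0) x" if "x \<in> carrier (cpow 0)" for x
    using h that by (simp add: Pres_sel fst_pobj)
  have pf: "snd X (f x) = snd (pobj n) x" if "x \<in> carrier (cpow n)" for x
    using f that by (simp add: Pres_sel fst_pobj)
  show "cop n X h f \<in> Hom (Pres K A) (pobj (Suc n)) X"
    unfolding Pres_sel fst_pobj
  proof (intro conjI ballI)
    let ?S = "power_module A (Suc n)"
    have dl: "lin K (cpow (Suc n)) ?S (inv_into (carrier ?S) (enc (Suc n)))"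
      by (rule lin_inv[OF module_power[OF A] enc_lin enc_bij])
    have hl: "lin K ?S (power_module A 0) (\<lambda>a. \<lambda>j\<in>{..0}. a 0)"
      unfolding power_module_def[of A 0]
      by (rule lin_into_prod[OF module_power[OF A]]) (rule power_proj_lin, simp)
    have tl: "lin K ?S (power_module A n) (\<lambda>a. \<lambda>j\<in>{..n}. a (Suc j))"
      unfolding power_module_def[of A n]
      by (rule lin_into_prod[OF module_power[OF A]]) (rule power_proj_lin, simp)
    have "lin K ?S (fst X) (\<lambda>a. h (enc 0 (\<lambda>j\<in>{..0}. a 0)) \<oplus>\<^bsub>fst X\<^esub> f (enc n (\<lambda>j\<in>{..n}. a (Suc j))))"
      by (intro lin_plus mX lin_comp[OF lin_comp[OF hl enc_lin] lh] lin_comp[OF lin_comp[OF tl enc_lin] lf])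
    from restrict_mod_hom[OF module_cpow lin_comp[OF dl this]]
    show "cop n X h f \<in> mod_hom K (cpow (Suc n)) (fst X)"
      by (simp only: cop_def decode_def)
    fix x assume "x \<in> carrier (cpow (Suc n))"
    then obtain a where a: "a \<in> carrier ?S" "x = enc (Suc n) a" by (rule cpowE)
    note eh = enc_in[OF head_in[OF a(1)]] and et = enc_in[OF tail_in[OF a(1)]]
    have "snd X (cop n X h f x) = snd (pobj 0) (enc 0 (\<lambda>j\<in>{..0}. a 0)) \<oplus>\<^bsub>A\<^esub> snd (pobj n) (enc n (\<lambda>j\<in>{..n}. a (Suc j)))"
      unfolding a(2) cop_enc[OF a(1)] lin_add[OF lX lin_closed[OF lh eh] lin_closed[OF lf et]] ph[OF eh] pf[OF et] by (rule refl)
    also have "\<dots> = finsum A (\<lambda>j\<in>{..0::nat}. a 0) {..0} \<oplus>\<^bsub>A\<^esub> finsum A (\<lambda>j\<in>{..n}. a (Suc j)) {..n}"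
      unfolding snd_pobj_enc[OF head_in[OF a(1)]] snd_pobj_enc[OF tail_in[OF a(1)]] by (rule refl)
    also have "finsum A (\<lambda>j\<in>{..0::nat}. a 0) {..0} = a 0" using power_elem[OF a(1), of 0] by simp
    also have "finsum A (\<lambda>j\<in>{..n}. a (Suc j)) {..n} = finsum A (\<lambda>j. a (Suc j)) {..n}"
      by (rule A.finsum_cong') (use power_elem[OF a(1)] in auto)
    also have "a 0 \<oplus>\<^bsub>A\<^esub> \<dots> = finsum A a {..Suc n}"
    proof -
      have ac: "a i \<in> carrier A" if "i \<le> Suc n" for i using power_elem[OF a(1) that] .
      have "finsum A (\<lambda>j. a (Suc j)) {..n} \<in> carrier A" using ac by (auto intro!: A.finsum_closed)
      thus ?thesis using A.finsum_Suc2[of a n] ac A.a_comm[of "a 0"] by auto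
    qed
    finally show "snd X (cop n X h f x) = snd (pobj (Suc n)) x"
      unfolding a(2) snd_pobj_enc[OF a(1)] .
  qed
  show "Comp (Pres K A) (pobj 0) (cop n X h f) (pmap 0 (Suc n) (\<lambda>_. 0)) = h"
    unfolding Pres_sel fst_pobj
  proof (rule extensionalityI)
    fix x assume x: "x \<in> carrier (cpow 0)"
    then obtain a where a: "a \<in> carrier (power_module A 0)" "x = enc 0 a" by (rule cpowE)
    have a0: "a 0 \<in> carrier A" using power_elem[OF a(1)] by simp
    have ae: "a = (\<lambda>j\<in>{..0}. a 0)" using a(1) by (auto simp: fun_eq_iff PiE_def extensional_def)
    let ?u = "push A 0 (Suc n) (\<lambda>_. 0) a"
    have u: "?u \<in> carrier (power_module A (Suc n))" by (rule push_in[OF A a(1)])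
    have ue: "?u = (\<lambda>j\<in>{..Suc n}. if j = 0 then a 0 else \<zero>\<^bsub>A\<^esub>)"
      using push_point[OF a0, of "Suc n"] ae by simp
    have "cop n X h f (enc (Suc n) ?u) = h (enc 0 (\<lambda>j\<in>{..0}. a 0)) \<oplus>\<^bsub>fst X\<^esub> f (enc n (\<lambda>j\<in>{..n}. \<zero>\<^bsub>A\<^esub>))"
      unfolding cop_enc[OF u] by (simp add: ue cong: restrict_cong)
    also have "\<dots> = h x"
      unfolding ae[symmetric] a(2)[symmetric] enc_zero hom_zero[OF lf module_cpow mX]
      using lin_closed[OF lh x] by simp
    finally show "compose (carrier (cpow 0)) (cop n X h f) (pmap 0 (Suc n) (\<lambda>_. 0)) x = h x"
      using x unfolding compose_def by (simp only: restrict_apply if_True a(2) pmap_enc[OF a(1)])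
  qed (use h in \<open>auto simp: Pres_sel fst_pobj mod_hom_iff compose_def\<close>)
  show "Comp (Pres K A) (pobj n) (cop n X h f) (pmap n (Suc n) Suc) = f"
    unfolding Pres_sel fst_pobj
  proof (rule extensionalityI)
    fix x assume x: "x \<in> carrier (cpow n)"
    then obtain a where a: "a \<in> carrier (power_module A n)" "x = enc n a" by (rule cpowE)
    have ae: "a = (\<lambda>j\<in>{..n}. a j)" using a(1) by (auto simp: fun_eq_iff PiE_def extensional_def)
    let ?u = "push A n (Suc n) Suc a"
    have u: "?u \<in> carrier (power_module A (Suc n))" by (rule push_in[OF A a(1)])
    have "cop n X h f (enc (Suc n) ?u) = h (enc 0 (\<lambda>j\<in>{..0}. \<zero>\<^bsub>A\<^esub>)) \<oplus>\<^bsub>fst X\<^esub> f (enc n (\<lambda>j\<in>{..n}. a j))"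
      unfolding cop_enc[OF u] by (simp add: push_shift[OF a(1)] cong: restrict_cong)
    also have "\<dots> = f x"
      unfolding ae[symmetric] a(2)[symmetric] enc_zero hom_zero[OF lh module_cpow mX]
      using lin_closed[OF lf x] by simp
    finally show "compose (carrier (cpow n)) (cop n X h f) (pmap n (Suc n) Suc) x = f x"
      using x unfolding compose_def by (simp only: restrict_apply if_True a(2) pmap_enc[OF a(1)])
  qed (use f in \<open>auto simp: Pres_sel fst_pobj mod_hom_iff compose_def\<close>)
qed

lemma relations_functor: "is_functor (Pres K A) (Mods K) (relations A)"
proof -
  have Fo: "Fo (relations A) X = (fst X)\<lparr>carrier := a_kernel (fst X) A (snd X)\<rparr>" for X :: "('k, 'u) pres"
    by (simp add: relations_def split: prod.splits)
  have Fa: "Fa (relations A) X Y f = restrict f (a_kernel (fst X) A (snd X))" for X Y :: "('k, 'u) pres" and f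
    by (simp add: relations_def split: prod.splits)
  have sub: "submod K (fst X) (a_kernel (fst X) A (snd X))" if "X \<in> Ob (Pres K A)" for X
    unfolding a_kernel_eq using that
    by (intro submod_kernel[OF Pres_module A]) (auto simp: Pres_ob mod_hom_lin)
  note m = module_submod[OF Pres_module sub]
  have ker: "f x \<in> a_kernel (fst Y) A (snd Y)"
    if "f \<in> Hom (Pres K A) X Y" "x \<in> a_kernel (fst X) A (snd X)" for X Y f x
    using that by (auto simp: Pres_sel a_kernel_eq dest: mod_hom_closed)
  show ?thesis
    unfolding is_functor_def
  proof (intro conjI ballI)
    fix X assume X: "X \<in> Ob (Pres K A)"
    let ?K = "a_kernel (fst X) A (snd X)"
    have sX: "?K \<subseteq> carrier (fst X)" by (auto simp: a_kernel_eq)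
    show "Fo (relations A) X \<in> Ob (Mods K)" using m[OF X X] by (simp add: Fo Mods_def)
    show "Fa (relations A) X X (Id (Pres K A) X) = Id (Mods K) (Fo (relations A) X)"
      using sX by (auto simp: Fo Fa Mods_def Pres_sel restrict_def fun_eq_iff)
    fix Y f assume Y: "Y \<in> Ob (Pres K A)" and f: "f \<in> Hom (Pres K A) X Y"
    have "lin K (fst X) (fst Y) f" using f by (simp add: Pres_sel mod_hom_lin)
    hence "lin K ((fst X)\<lparr>carrier := ?K\<rparr>) ((fst Y)\<lparr>carrier := a_kernel (fst Y) A (snd Y)\<rparr>) f"
      by (intro lin_sub_cod lin_sub_dom sX) (use ker[OF f] in auto)
    from restrict_mod_hom[OF m[OF X X] this]
    show "Fa (relations A) X Y f \<in> Hom (Mods K) (Fo (relations A) X) (Fo (relations A) Y)"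
      by (simp add: Fo Fa Mods_def)
    fix Z g assume Z: "Z \<in> Ob (Pres K A)" and g: "g \<in> Hom (Pres K A) Y Z"
    show "Fa (relations A) X Z (Comp (Pres K A) X g f)
        = Comp (Mods K) (Fo (relations A) X) (Fa (relations A) Y Z g) (Fa (relations A) X Y f)"
      using ker[OF f] sX by (auto simp: Fo Fa Mods_def Pres_sel compose_def restrict_def fun_eq_iff)
  qed
qed

end

lemma ftr_comp_functor:
  assumes "is_functor C D S" "is_functor D E T" shows "is_functor C E (ftr_comp T S)"
  using assms unfolding is_functor_def ftr_comp_def by simp

section \<open>Universal coefficients for complexes and duals of Moore complexes\<close>

lemma module_ext1:
  assumes M: "module K M" and N: "module K N" shows "module K (ext1 K M N)"
proof -
  note cr = module_cring[OF M]
  let ?P = "free_on K (carrier M)" and ?L = "lin_comb K M (carrier M)"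
  let ?R = "?P\<lparr>carrier := a_kernel ?P M ?L\<rparr>"
  have mP: "module K ?P" by (rule module_free_on[OF cr])
  have L: "lin K ?P M ?L" unfolding lin_comb_fsum by (rule lin_fsum[OF M])
  have sR: "submod K ?P (a_kernel ?P M ?L)" unfolding a_kernel_eq by (rule submod_kernel[OF mP M L])
  have R: "module K ?R" by (rule module_submod[OF mP sR])
  have Rc: "a_kernel ?P M ?L \<subseteq> carrier ?P" using submod_closed[OF sR] by auto
  have "lin K (hom_module K ?P N) (hom_module K ?R N) (\<lambda>\<phi>. restrict \<phi> (carrier ?R))"
  proof (rule linI)
    show "restrict x (carrier ?R) \<in> carrier (hom_module K ?R N)" if "x \<in> carrier (hom_module K ?P N)" for x
      using restrict_mod_hom[OF R lin_sub_dom[OF mod_hom_lin[of x K ?P N] Rc]] that by simp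
  qed (use Rc in \<open>auto simp: fun_eq_iff restrict_def\<close>)
  from submod_image[OF module_hom[OF mP N] module_hom[OF R N] this submod_carrier[OF module_hom[OF mP N]]]
  show ?thesis
    unfolding ext1_def Let_def by (intro module_quot module_hom R N) simp
qed

lemma module_homology:
  assumes C: "\<And>n. module K (Cm C n)" and d: "\<And>n. lin K (Cm C (Suc n)) (Cm C n) (Cd C n)"
    and dd: "\<And>n x. x \<in> carrier (Cm C (Suc (Suc n))) \<Longrightarrow> Cd C n (Cd C (Suc n) x) = \<zero>\<^bsub>Cm C n\<^esub>"
  shows "module K (homology C n)"
proof -
  let ?Z = "case n of 0 \<Rightarrow> carrier (Cm C 0) | Suc m \<Rightarrow> a_kernel (Cm C n) (Cm C m) (Cd C m)"
  have Z: "submod K (Cm C n) ?Z"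
    by (cases n) (use submod_carrier[OF C] submod_kernel[OF C C d] in \<open>auto simp: a_kernel_eq\<close>)
  have "Cd C n ` carrier (Cm C (Suc n)) \<subseteq> ?Z"
    using lin_closed[OF d] dd by (cases n) (auto simp: a_kernel_eq)
  from submod_restrict[OF submod_image[OF C C d submod_carrier[OF C]] this]
  show ?thesis unfolding homology_def Let_def by (intro module_quot module_submod[OF C Z])
qed

text \<open>A functional is determined by its values on the spanning vectors \<open>e j\<close>.
  Together with \<open>separated_sub\<close> this brings the Moore complex of the duals within reach
  of the lifting lemma.\<close>

lemma separated_dual:
  assumes "coord_system K M J e c" shows "separated K (dual_module K M)"
proof -
  have M: "module K M" and J: "finite J" and e: "\<And>j. j \<in> J \<Longrightarrow> e j \<in> carrier M"
    and c: "\<And>j. j \<in> J \<Longrightarrow> lin K M (self_module K) (c j)"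
    and sum: "\<And>x. x \<in> carrier M \<Longrightarrow> finsum M (\<lambda>j. c j x \<odot>\<^bsub>M\<^esub> e j) J = x"
    using assms by (auto simp: coord_system_def)
  interpret M: module K M by fact
  have KK: "module K (self_module K)" by (rule module_self) (rule M.is_cring)
  interpret KK: module K "self_module K" by fact
  obtain h where h: "bij_betw h {..<card J} J" using ex_bij_betw_nat_finite[OF J] by (auto simp: atLeast0LessThan)
  have hJ: "h i \<in> J" if "i < card J" for i using h that by (auto simp: bij_betw_def)
  show ?thesis unfolding separated_def
  proof (intro exI[of _ "card J"] exI[of _ "\<lambda>i \<phi>. \<phi> (e (h i))"] conjI allI impI ballI)
    show "lin K (dual_module K M) (self_module K) (\<lambda>\<phi>. \<phi> (e (h i)))" if "i < card J" for i
      using e[OF hJ[OF that]] by (auto simp: lin_def mod_hom_def)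
    fix \<phi> assume \<phi>: "\<phi> \<in> carrier (dual_module K M)" "\<forall>i<card J. \<phi> (e (h i)) = \<zero>\<^bsub>K\<^esub>"
    hence l: "lin K M (self_module K) \<phi>" by (simp add: mod_hom_lin)
    have z: "\<phi> (e j) = \<zero>\<^bsub>K\<^esub>" if "j \<in> J" for j
    proof -
      obtain i where "i < card J" "j = h i" using h \<open>j \<in> J\<close> by (auto simp: bij_betw_def)
      thus ?thesis using \<phi>(2) by simp
    qed
    have cc: "c j x \<in> carrier K" if "j \<in> J" "x \<in> carrier M" for j x
      using lin_closed[OF c[OF that(1)] that(2)] by simp
    have "\<phi> x = \<zero>\<^bsub>K\<^esub>" if x: "x \<in> carrier M" for x
    proof -
      have "\<phi> x = \<phi> (finsum M (\<lambda>j. c j x \<odot>\<^bsub>M\<^esub> e j) J)" by (simp only: sum[OF x])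
      also have "\<dots> = finsum (self_module K) (\<lambda>j. \<phi> (c j x \<odot>\<^bsub>M\<^esub> e j)) J"
        by (rule lin_finsum[OF M KK l J]) (use cc e x in auto)
      also have "\<dots> = finsum (self_module K) (\<lambda>j. \<zero>\<^bsub>self_module K\<^esub>) J"
        by (rule KK.finsum_cong') (auto simp: lin_smult[OF l] cc e x z)
      also have "\<dots> = \<zero>\<^bsub>self_module K\<^esub>" by (rule KK.finsum_zero)
      finally show ?thesis by simp
    qed
    thus "\<phi> = \<zero>\<^bsub>dual_module K M\<^esub>"
      using \<phi>(1) by (auto simp: mod_hom_iff fun_eq_iff restrict_def extensional_def)
  qed
qed

text \<open>The image of \<open>d\<close> is projective, so the kernel is a direct summand, and
  composing with the projection onto it extends the functional.\<close>

lemma kernel_functional_extends: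
  fixes K :: "'k ring" and M :: "('k, 'a) module" and N :: "('k, 'b) module"
  assumes pd: "principal_domain K" and M: "module K M" and N: "module K N" "separated K N"
    and d: "lin K M N d"
    and \<phi>: "lin K (M\<lparr>carrier := {x \<in> carrier M. d x = \<zero>\<^bsub>N\<^esub>}\<rparr>) (self_module K) \<phi>"
  shows "\<exists>\<psi>. lin K M (self_module K) \<psi> \<and> (\<forall>z\<in>{x \<in> carrier M. d x = \<zero>\<^bsub>N\<^esub>}. \<psi> z = \<phi> z)"
proof -
  interpret M: module K M by fact
  have mB: "module K (N\<lparr>carrier := d ` carrier M\<rparr>)"
    by (rule module_submod[OF N(1) submod_image[OF M N(1) d submod_carrier[OF M]]])
  obtain t where t: "lin K (N\<lparr>carrier := d ` carrier M\<rparr>) M t"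
    and r: "lin K M (M\<lparr>carrier := {x \<in> carrier M. d x = \<zero>\<^bsub>N\<^esub>}\<rparr>) (\<lambda>x. x \<ominus>\<^bsub>M\<^esub> t (d x))"
    using image_section[OF pd M N d] by blast
  have "t \<zero>\<^bsub>N\<^esub> = \<zero>\<^bsub>M\<^esub>" using lin_zero[OF mB M t] by simp
  moreover have "z \<ominus>\<^bsub>M\<^esub> \<zero>\<^bsub>M\<^esub> = z" if "z \<in> carrier M" for z
    using that lin_uminus[OF M M lin_const_zero[OF M], of z] by (simp add: M.minus_eq)
  ultimately show ?thesis
    by (intro exI[of _ "\<lambda>x. \<phi> (x \<ominus>\<^bsub>M\<^esub> t (d x))"] conjI lin_comp[OF r \<phi>]) auto
qed

text \<open>The general step applies to each pair of consecutive degrees; degree 0 becomes an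
  instance of it by placing the zero module below.\<close>

lemma universal_coefficients_complex:
  fixes K :: "'k ring" and C :: "('k, 'a) cpx"
  assumes pd: "principal_domain K" and C: "\<And>n. module K (Cm C n)" "\<And>n. separated K (Cm C n)"
    and d: "\<And>n. lin K (Cm C (Suc n)) (Cm C n) (Cd C n)"
    and dd: "\<And>n x. x \<in> carrier (Cm C (Suc (Suc n))) \<Longrightarrow> Cd C n (Cd C (Suc n) x) = \<zero>\<^bsub>Cm C n\<^esub>"
  shows "\<exists>f g. short_exact K (diamond K (case i of 0 \<Rightarrow> zero_module | Suc m \<Rightarrow> homology C m)) f
           (cohomology (dual_cpx K C) i) g (dual_module K (homology C i))"
proof -
  have cr: "cring K" by (rule module_cring[OF C(1)])
  let ?B = "\<lambda>n. Cd C n ` carrier (Cm C (Suc n))"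
  have B: "submod K (Cm C n) (?B n)" for n by (rule submod_image[OF C(1) C(1) d submod_carrier[OF C(1)]])
  have ker: "a_kernel (dual_module K (Cm C n)) (dual_module K (Cm C (Suc n))) (dual_map K (Cm C (Suc n)) (Cm C n) (Cd C n))
      = {\<phi> \<in> carrier (dual_module K (Cm C n)). \<forall>b\<in>?B n. \<phi> b = \<zero>\<^bsub>K\<^esub>}" for n
    by (auto simp: a_kernel_eq dual_map_def fun_eq_iff restrict_def)
  have im: "dual_map K (Cm C (Suc n)) (Cm C n) (Cd C n) ` carrier (dual_module K (Cm C n))
      = (\<lambda>\<psi>. \<lambda>x\<in>carrier (Cm C (Suc n)). \<psi> (Cd C n x)) ` carrier (dual_module K (Cm C n))" for n
    by (rule image_cong) (auto simp: dual_map_def)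
  have coh: "cohomology (dual_cpx K C) n = quot_module ((dual_module K (Cm C n))
        \<lparr>carrier := {\<phi> \<in> carrier (dual_module K (Cm C n)). \<forall>b\<in>?B n. \<phi> b = \<zero>\<^bsub>K\<^esub>}\<rparr>)
      (case n of 0 \<Rightarrow> {\<lambda>x\<in>carrier (Cm C 0). \<zero>\<^bsub>K\<^esub>} | Suc m \<Rightarrow>
        (\<lambda>\<psi>. \<lambda>x\<in>carrier (Cm C (Suc m)). \<psi> (Cd C m x)) ` carrier (dual_module K (Cm C m)))" for n
    unfolding cohomology_def Let_def dual_cpx_def cpx.simps ker by (cases n) (simp_all add: im del: dual_module_sel(1))
  show ?thesis
  proof (cases i)
    case 0
    \<comment> \<open>The zero module is taken over the type of homology classes, so that it fits
      the other branch of the case distinction.\<close>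
    let ?z = "zero_module :: ('k, 'a set) module"
    have z: "module K ?z" by (rule module_zero[OF cr])
    have dz: "lin K (Cm C 0) ?z (\<lambda>_. undefined)" using lin_const_zero[OF z] by simp
    have sz: "separated K ?z" unfolding separated_def by (rule exI[of _ 0]) simp
    have zz: "submod K ?z {undefined}" using submod_carrier[OF z] by simp
    have "\<exists>f g. short_exact K (diamond K ?z) f
      (quot_module ((dual_module K (Cm C 0))\<lparr>carrier := {\<phi> \<in> carrier (dual_module K (Cm C 0)). \<forall>b\<in>?B 0. \<phi> b = \<zero>\<^bsub>K\<^esub>}\<rparr>)
         ((\<lambda>\<psi>. \<lambda>x\<in>carrier (Cm C 0). \<psi> undefined) ` carrier (dual_module K ?z))) g
      (dual_module K (quot_module ((Cm C 0)\<lparr>carrier := {x \<in> carrier (Cm C 0). undefined = \<zero>\<^bsub>?z\<^esub>}\<rparr>) (?B 0)))"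
    proof (rule universal_coefficients[OF pd C(1) z sz dz B _ zz _ z, where q = "\<lambda>x. x"])
      show "lin K (?z\<lparr>carrier := {undefined}\<rparr>) ?z (\<lambda>x. x)" by (rule lin_sub_dom[OF lin_ident]) simp
      show "x = \<zero>\<^bsub>?z\<^esub> \<longleftrightarrow> x \<in> (\<lambda>_. undefined) ` carrier (Cm C 0)" if "x \<in> {undefined}" for x
      proof -
        interpret C0: module K "Cm C 0" by (rule C(1))
        show ?thesis using that C0.zero_closed by auto
      qed
      show "\<exists>\<psi>. lin K ?z (self_module K) \<psi> \<and> (\<forall>z\<in>{undefined}. \<psi> z = \<phi> z)"
        if "lin K (?z\<lparr>carrier := {undefined}\<rparr>) (self_module K) \<phi>" for \<phi>
        by (rule exI[of _ \<phi>]) (use that in \<open>auto simp: lin_def\<close>)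
    qed auto
    \<comment> \<open>The coboundaries of degree 0 arise here as pullbacks from the zero module;
      they have to be recognized as the zero submodule that \<open>cohomology\<close>
      prescribes.\<close>
    moreover have "(\<lambda>\<psi>. \<lambda>x\<in>carrier (Cm C 0). \<psi> undefined) ` carrier (dual_module K ?z) = {\<lambda>x\<in>carrier (Cm C 0). \<zero>\<^bsub>K\<^esub>}"
    proof -
      have z0: "\<psi> undefined = \<zero>\<^bsub>K\<^esub>" if "\<psi> \<in> carrier (dual_module K ?z)" for \<psi>
        using that lin_zero[OF z module_self[OF cr], of \<psi>] by (simp add: mod_hom_lin)
      have "carrier (dual_module K ?z) \<noteq> {}"
      proof -
        interpret D: module K "dual_module K ?z" by (rule module_dual[OF z])
        show ?thesis using D.zero_closed by blast
      qed
      moreover have "(\<lambda>\<psi>. \<lambda>x\<in>carrier (Cm C 0). \<psi> undefined) ` carrier (dual_module K ?z)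
          = (\<lambda>\<psi>. \<lambda>x\<in>carrier (Cm C 0). \<zero>\<^bsub>K\<^esub>) ` carrier (dual_module K ?z)"
        by (rule image_cong[OF refl]) (simp only: z0)
      ultimately show ?thesis by (simp only: image_constant_conv if_False)
    qed
    ultimately show ?thesis unfolding coh 0 by (simp add: homology_def del: dual_module_sel)
  next
    case (Suc m)
    let ?Z = "case m of 0 \<Rightarrow> carrier (Cm C 0) | Suc l \<Rightarrow> a_kernel (Cm C m) (Cm C l) (Cd C l)"
    have Z: "submod K (Cm C m) ?Z"
      by (cases m) (use submod_carrier[OF C(1)] submod_kernel[OF C(1) C(1) d] in \<open>auto simp: a_kernel_eq\<close>)
    have BZ: "?B m \<subseteq> ?Z"
      using lin_closed[OF d] dd by (cases m) (auto simp: a_kernel_eq)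
    have sB: "submod K ((Cm C m)\<lparr>carrier := ?Z\<rparr>) (?B m)" by (rule submod_restrict[OF B BZ])
    note mZ = module_submod[OF C(1) Z]
    have hom: "homology C m = quot_module ((Cm C m)\<lparr>carrier := ?Z\<rparr>) (?B m)"
      by (simp add: homology_def Let_def)
    have "\<exists>f g. short_exact K (diamond K (homology C m)) f
      (quot_module ((dual_module K (Cm C i))\<lparr>carrier := {\<phi> \<in> carrier (dual_module K (Cm C i)). \<forall>b\<in>?B i. \<phi> b = \<zero>\<^bsub>K\<^esub>}\<rparr>)
         ((\<lambda>\<psi>. \<lambda>x\<in>carrier (Cm C i). \<psi> (Cd C m x)) ` carrier (dual_module K (Cm C m)))) g
      (dual_module K (quot_module ((Cm C i)\<lparr>carrier := {x \<in> carrier (Cm C i). Cd C m x = \<zero>\<^bsub>Cm C m\<^esub>}\<rparr>) (?B i)))"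
    proof (rule universal_coefficients[OF pd C(1) C(1,2) d[of m, folded Suc] B _ Z])
      show "Cd C m b = \<zero>\<^bsub>Cm C m\<^esub>" if "b \<in> ?B i" for b using that dd Suc by auto
      show "Cd C m x \<in> ?Z" if "x \<in> carrier (Cm C i)" for x using that BZ Suc by blast
      show "module K (homology C m)" unfolding hom by (rule module_quot[OF mZ sB])
      show "lin K ((Cm C m)\<lparr>carrier := ?Z\<rparr>) (homology C m) (\<lambda>x. ?B m +>\<^bsub>(Cm C m)\<lparr>carrier := ?Z\<rparr>\<^esub> x)"
        unfolding hom by (rule lin_coset[OF mZ sB])
      show "(\<lambda>x. ?B m +>\<^bsub>(Cm C m)\<lparr>carrier := ?Z\<rparr>\<^esub> x) ` ?Z = carrier (homology C m)"
        unfolding hom quot_module_sel(1) by (simp add: Setcompr_eq_image)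
      show "?B m +>\<^bsub>(Cm C m)\<lparr>carrier := ?Z\<rparr>\<^esub> z = \<zero>\<^bsub>homology C m\<^esub> \<longleftrightarrow> z \<in> Cd C m ` carrier (Cm C i)" if "z \<in> ?Z" for z
        unfolding hom quot_module_sel(2) Suc by (rule coset_zero_iff[OF mZ sB]) (use that in simp)
      \<comment> \<open>In degree 0 every element is a cycle; in higher degrees the cycles are the
        kernel of a differential, which splits off.\<close>
      show "\<exists>\<psi>. lin K (Cm C m) (self_module K) \<psi> \<and> (\<forall>z\<in>?Z. \<psi> z = \<phi> z)"
        if \<phi>: "lin K ((Cm C m)\<lparr>carrier := ?Z\<rparr>) (self_module K) \<phi>" for \<phi>
      proof (cases m)
        case 0
        have "lin K (Cm C m) (self_module K) \<phi>" using \<phi> 0 by (simp add: lin_def)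
        thus ?thesis by blast
      next
        case (Suc l)
        show ?thesis
          using kernel_functional_extends[OF pd C(1) C(1,2) d[of l], of \<phi>] \<phi> unfolding Suc by (simp add: a_kernel_eq)
      qed
    qed
    thus ?thesis unfolding coh by (simp add: Suc homology_def[of C "Suc m"] a_kernel_eq del: dual_module_sel)
  qed
qed

lemma corr_cochain:
  assumes C: "\<And>n. module K (Cm C n)" and D: "\<And>n. module K (Cm D n)"
    and f: "\<And>n. lin K (Cm C n) (Cm D n) (f n)" "\<And>n. bij_betw (f n) (carrier (Cm C n)) (carrier (Cm D n))"
    and d: "\<And>n. lin K (Cm C n) (Cm C (Suc n)) (Cd C n)"
    and dd: "\<And>n x. x \<in> carrier (Cm C n) \<Longrightarrow> Cd C (Suc n) (Cd C n x) = \<zero>\<^bsub>Cm C (Suc (Suc n))\<^esub>"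
    and comm: "\<And>n x. x \<in> carrier (Cm C n) \<Longrightarrow> f (Suc n) (Cd C n x) = Cd D n (f n x)"
    and d': "\<And>n. lin K (Cm D n) (Cm D (Suc n)) (Cd D n)"
  shows "\<exists>L B R. cohomology D n = quot_module L B \<and> module K L \<and> submod K L B \<and>
    corr K ((Cm C n)\<lparr>carrier := {x \<in> carrier (Cm C n). Cd C n x = \<zero>\<^bsub>Cm C (Suc n)\<^esub>}\<rparr>)
      (case n of 0 \<Rightarrow> {\<zero>\<^bsub>Cm C 0\<^esub>} | Suc m \<Rightarrow> Cd C m ` carrier (Cm C m)) L B R"
proof -
  let ?Z = "{x \<in> carrier (Cm C n). Cd C n x = \<zero>\<^bsub>Cm C (Suc n)\<^esub>}"
  let ?Z' = "{x \<in> carrier (Cm D n). Cd D n x = \<zero>\<^bsub>Cm D (Suc n)\<^esub>}"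
  let ?B = "case n of 0 \<Rightarrow> {\<zero>\<^bsub>Cm C 0\<^esub>} | Suc m \<Rightarrow> Cd C m ` carrier (Cm C m)"
  let ?B' = "case n of 0 \<Rightarrow> {\<zero>\<^bsub>Cm D 0\<^esub>} | Suc m \<Rightarrow> Cd D m ` carrier (Cm D m)"
  have Z: "submod K (Cm C n) ?Z" by (rule submod_kernel[OF C C d])
  have Z': "submod K (Cm D n) ?Z'" by (rule submod_kernel[OF D D d'])
  note mZ = module_submod[OF C Z] and mZ' = module_submod[OF D Z']
  have inj: "inj_on (f n) (carrier (Cm C n))" and im: "f n ` carrier (Cm C n) = carrier (Cm D n)" for n
    using f(2)[of n] by (auto simp: bij_betw_def)
  have f0: "f m \<zero>\<^bsub>Cm C m\<^esub> = \<zero>\<^bsub>Cm D m\<^esub>" for m by (rule lin_zero[OF C D f(1)])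
  have zero: "f m x = \<zero>\<^bsub>Cm D m\<^esub> \<longleftrightarrow> x = \<zero>\<^bsub>Cm C m\<^esub>" if "x \<in> carrier (Cm C m)" for m x
  proof -
    interpret C: module K "Cm C m" by (rule C)
    show ?thesis using inj_on_eq_iff[OF inj that C.zero_closed] f0 by simp
  qed
  have ZZ: "f n ` ?Z = ?Z'"
  proof -
    have "Cd D n (f n x) = \<zero>\<^bsub>Cm D (Suc n)\<^esub> \<longleftrightarrow> Cd C n x = \<zero>\<^bsub>Cm C (Suc n)\<^esub>" if "x \<in> carrier (Cm C n)" for x
      using zero[OF lin_closed[OF d that]] comm[OF that] by simp
    thus ?thesis unfolding im[symmetric] by auto
  qed
  have BB: "f n ` ?B = ?B'"
  proof (cases n)
    case (Suc m)
    have "f (Suc m) ` Cd C m ` carrier (Cm C m) = Cd D m ` f m ` carrier (Cm C m)"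
      unfolding image_image by (rule image_cong[OF refl]) (rule comm)
    thus ?thesis by (simp add: Suc im)
  qed (simp add: f0)
  have BZ: "?B \<subseteq> ?Z"
  proof (cases n)
    case 0
    interpret C: module K "Cm C 0" by (rule C)
    show ?thesis using lin_zero[OF C C d] by (simp add: 0)
  next
    case (Suc m)
    thus ?thesis using dd lin_closed[OF d] by auto
  qed
  have sB: "submod K (Cm C n) ?B"
    by (cases n) (use submod_zero[OF C] submod_image[OF C C d submod_carrier[OF C]] in auto)
  have sB': "submod K ((Cm D n)\<lparr>carrier := ?Z'\<rparr>) ?B'"
  proof (rule submod_restrict)
    show "submod K (Cm D n) ?B'" unfolding BB[symmetric] by (rule submod_image[OF C D f(1) sB])
    show "?B' \<subseteq> ?Z'" unfolding BB[symmetric] ZZ[symmetric] by (rule image_mono[OF BZ])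
  qed
  have "corr K ((Cm C n)\<lparr>carrier := ?Z\<rparr>) ?B ((Cm D n)\<lparr>carrier := ?Z'\<rparr>) ?B' (\<lambda>x y. x \<in> carrier ((Cm C n)\<lparr>carrier := ?Z\<rparr>) \<and> y = f n x)"
  proof (rule corr_iso[OF mZ])
    show "lin K ((Cm C n)\<lparr>carrier := ?Z\<rparr>) ((Cm D n)\<lparr>carrier := ?Z'\<rparr>) (f n)"
    proof (rule lin_sub_cod[OF lin_sub_dom[OF f(1)]])
      show "f n x \<in> ?Z'" if "x \<in> carrier ((Cm C n)\<lparr>carrier := ?Z\<rparr>)" for x
        unfolding ZZ[symmetric] using that by (intro imageI) simp
    qed auto
    show "bij_betw (f n) (carrier ((Cm C n)\<lparr>carrier := ?Z\<rparr>)) (carrier ((Cm D n)\<lparr>carrier := ?Z'\<rparr>))"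
    proof -
      have "?Z \<subseteq> carrier (Cm C n)" by auto
      from inj_on_subset[OF inj this] ZZ show ?thesis by (simp add: bij_betw_def)
    qed
    show "?B \<subseteq> carrier ((Cm C n)\<lparr>carrier := ?Z\<rparr>)" using BZ by simp
    show "f n ` ?B = ?B'" by (rule BB)
  qed
  moreover have "cohomology D n = quot_module ((Cm D n)\<lparr>carrier := ?Z'\<rparr>) ?B'"
    by (simp add: cohomology_def Let_def a_kernel_eq)
  ultimately show ?thesis using mZ' sB' by blast
qed

text \<open>\<open>V\<close> stands for the cosimplicial module of relations after
  \<open>\<Phi>\<close>, \<open>W\<close> for \<open>\<Phi>\<close> on the coded duals of the
  Eilenberg-MacLane modules, \<open>\<Psi>\<close> for the isomorphism between them, and
  \<open>X\<close> for the simplicial dual of \<open>W\<close>. The Moore complex is defined by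
  faces, so \<open>\<Psi>\<close> is compared with cofaces only; codegeneracies enter through the
  action on \<open>V\<close>.\<close>

locale moore_dual = fin_module K V act
  for K :: "'k ring" and V :: "nat \<Rightarrow> ('k, 'v) module" and act +
  fixes W :: "nat \<Rightarrow> ('k, 'w) module" and \<Psi> :: "nat \<Rightarrow> 'v \<Rightarrow> 'w" and fc :: "nat \<Rightarrow> nat \<Rightarrow> 'w \<Rightarrow> 'w"
    and X :: "(('k, 'w \<Rightarrow> 'k) module, ('w \<Rightarrow> 'k) \<Rightarrow> ('w \<Rightarrow> 'k)) simplicial"
  assumes W: "\<And>n. module K (W n)"
    and W_coords: "\<And>n. \<exists>(J :: 'w set) e c. coord_system K (W n) J e c"
    and \<Psi>_lin: "\<And>n. lin K (V n) (W n) (\<Psi> n)"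
    and \<Psi>_bij: "\<And>n. bij_betw (\<Psi> n) (carrier (V n)) (carrier (W n))"
    and \<Psi>_face: "\<And>n i v. i \<le> Suc n \<Longrightarrow> v \<in> carrier (V n) \<Longrightarrow>
           \<Psi> (Suc n) (act n (Suc n) (\<lambda>j. if j < i then j else Suc j) v) = fc n i (\<Psi> n v)"
    and X_sob: "\<And>n. sob X n = dual_module K (W n)"
    and X_face: "\<And>n i. face X n i = dual_map K (W n) (W (Suc n)) (fc n i)"
begin

definition moore where
  "moore n = {\<phi> \<in> mod_hom K (W n) (self_module K). \<forall>i<n. \<forall>v\<in>carrier (V n). \<phi> (\<Psi> n (E n i v)) = \<zero>\<^bsub>K\<^esub>}"

lemma W_elem: "w \<in> carrier (W n) \<Longrightarrow> \<exists>v\<in>carrier (V n). w = \<Psi> n v"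
  using \<Psi>_bij[of n] by (auto simp: bij_betw_def)

lemma \<delta>_fun: "(\<lambda>j. if j < i then j else Suc j) \<in> {..n} \<rightarrow> {..Suc n}"
  by auto

text \<open>The face with index \<open>k + 1\<close> is the transpose of the coface with that index,
  whose image is the image of \<open>idem k\<close>. The shift by one explains why the faces with
  \<open>i \<ge> 1\<close> in the Moore complex match all idempotents \<open>i < n\<close>.\<close>

lemma face_zero_iff:
  assumes \<phi>: "\<phi> \<in> mod_hom K (W (Suc m)) (self_module K)" and k: "k \<le> m"
  shows "face X m (Suc k) \<phi> = \<zero>\<^bsub>sob X m\<^esub> \<longleftrightarrow> (\<forall>v\<in>carrier (V (Suc m)). \<phi> (\<Psi> (Suc m) (E (Suc m) k v)) = \<zero>\<^bsub>K\<^esub>)"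
proof -
  let ?d = "\<lambda>j. if j < Suc k then j else Suc j" and ?s = "\<lambda>j. if j \<le> k then j else j - 1"
  have s: "?s \<in> {..Suc m} \<rightarrow> {..m}" using k by auto
  have d: "?d \<in> {..m} \<rightarrow> {..Suc m}" by auto
  have "face X m (Suc k) \<phi> = \<zero>\<^bsub>sob X m\<^esub> \<longleftrightarrow> (\<forall>w\<in>carrier (W m). \<phi> (fc m (Suc k) w) = \<zero>\<^bsub>K\<^esub>)"
    using \<phi> by (auto simp: X_sob X_face dual_map_def fun_eq_iff restrict_def)
  also have "\<dots> \<longleftrightarrow> (\<forall>v\<in>carrier (V m). \<phi> (\<Psi> (Suc m) (act m (Suc m) ?d v)) = \<zero>\<^bsub>K\<^esub>)"
  proof -
    have e: "\<Psi> (Suc m) (act m (Suc m) ?d v) = fc m (Suc k) (\<Psi> m v)" if "v \<in> carrier (V m)" for v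
      using \<Psi>_face[of "Suc k" m v] k that by simp
    have "\<forall>w\<in>carrier (W m). P w" if "\<forall>v\<in>carrier (V m). P (\<Psi> m v)" for P
      using W_elem that by blast
    from this[of "\<lambda>w. \<phi> (fc m (Suc k) w) = \<zero>\<^bsub>K\<^esub>"] show ?thesis
      using lin_closed[OF \<Psi>_lin, of _ m] by (simp only: e cong: ball_cong) blast
  qed
  also have "\<dots> \<longleftrightarrow> (\<forall>v\<in>carrier (V (Suc m)). \<phi> (\<Psi> (Suc m) (E (Suc m) k v)) = \<zero>\<^bsub>K\<^esub>)"
  proof (intro iffI ballI)
    fix v assume v: "v \<in> carrier (V (Suc m))" and z: "\<forall>v\<in>carrier (V m). \<phi> (\<Psi> (Suc m) (act m (Suc m) ?d v)) = \<zero>\<^bsub>K\<^esub>"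
    have "E (Suc m) k v = act m (Suc m) ?d (act (Suc m) m ?s v)"
      unfolding idem_def by (rule act_comp[OF s d _ v, symmetric]) auto
    thus "\<phi> (\<Psi> (Suc m) (E (Suc m) k v)) = \<zero>\<^bsub>K\<^esub>" using z act_in[OF s v] by simp
  next
    fix v assume v: "v \<in> carrier (V m)" and z: "\<forall>v\<in>carrier (V (Suc m)). \<phi> (\<Psi> (Suc m) (E (Suc m) k v)) = \<zero>\<^bsub>K\<^esub>"
    have "E (Suc m) k (act m (Suc m) ?d v) = act m (Suc m) ?d v"
      unfolding idem_def by (rule act_comp[OF d _ _ v]) (use k in auto)
    thus "\<phi> (\<Psi> (Suc m) (act m (Suc m) ?d v)) = \<zero>\<^bsub>K\<^esub>" using z act_in[OF d v] by metis
  qed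
  finally show ?thesis .
qed

lemma normalized_eq:
  "Cm (normalized X) n = (dual_module K (W n))\<lparr>carrier := moore n\<rparr>"
  "Cd (normalized X) n = restrict (face X n 0) (moore (Suc n))"
proof -
  have *: "{x \<in> carrier (sob X n). \<forall>m i. n = Suc m \<longrightarrow> 1 \<le> i \<longrightarrow> i \<le> n \<longrightarrow> face X m i x = \<zero>\<^bsub>sob X m\<^esub>} = moore n" for n
  proof (cases n)
    case 0
    thus ?thesis by (simp add: X_sob moore_def)
  next
    case (Suc m)
    have shift: "(\<forall>i. 1 \<le> i \<longrightarrow> i \<le> Suc m \<longrightarrow> Q i) \<longleftrightarrow> (\<forall>k<Suc m. Q (Suc k))" for Q
    proof (intro iffI allI impI)
      fix i assume "\<forall>k<Suc m. Q (Suc k)" "1 \<le> i" "i \<le> Suc m"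
      thus "Q i" by (cases i) auto
    qed auto
    have "\<phi> \<in> {x \<in> carrier (sob X n). \<forall>m i. n = Suc m \<longrightarrow> 1 \<le> i \<longrightarrow> i \<le> n \<longrightarrow> face X m i x = \<zero>\<^bsub>sob X m\<^esub>}
      \<longleftrightarrow> \<phi> \<in> moore n" for \<phi>
    proof -
      have "(\<forall>m' i. n = Suc m' \<longrightarrow> 1 \<le> i \<longrightarrow> i \<le> n \<longrightarrow> face X m' i \<phi> = \<zero>\<^bsub>sob X m'\<^esub>)
        \<longleftrightarrow> (\<forall>k<Suc m. face X m (Suc k) \<phi> = \<zero>\<^bsub>sob X m\<^esub>)"
        unfolding Suc shift[of "\<lambda>i. face X m i \<phi> = \<zero>\<^bsub>sob X m\<^esub>", symmetric] by blast
      thus ?thesis using face_zero_iff[of \<phi> m]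
        unfolding moore_def mem_Collect_eq Suc X_sob[of "Suc m"] dual_module_sel(1) less_Suc_eq_le by blast
    qed
    thus ?thesis by blast
  qed
  show "Cm (normalized X) n = (dual_module K (W n))\<lparr>carrier := moore n\<rparr>"
    by (simp only: normalized_def Let_def * X_sob[symmetric] cpx.simps)
  show "Cd (normalized X) n = restrict (face X n 0) (moore (Suc n))"
    by (simp only: normalized_def Let_def * cpx.simps)
qed

lemma moore_hom: "\<phi> \<in> moore n \<Longrightarrow> lin K (W n) (self_module K) \<phi>"
  by (simp add: moore_def mod_hom_lin)

lemma moore_pull: "\<phi> \<in> moore n \<Longrightarrow> lin K (V n) (self_module K) (\<lambda>v. \<phi> (\<Psi> n v))"
  by (rule lin_comp[OF \<Psi>_lin moore_hom])

lemma cr: "cring K" by (rule module_cring[OF mod])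

lemma KK: "module K (self_module K)" by (rule module_self[OF cr])

lemma submod_moore: "submod K (dual_module K (W n)) (moore n)"
proof (rule submodI)
  interpret D: module K "dual_module K (W n)" by (rule module_dual[OF W])
  interpret KK: module K "self_module K" by (rule KK)
  have *: "\<Psi> n (E n i v) \<in> carrier (W n)" if "i < n" "v \<in> carrier (V n)" for i v
    by (rule lin_closed[OF \<Psi>_lin idem_in[OF that]])
  have z: "\<zero>\<^bsub>K\<^esub> \<oplus>\<^bsub>K\<^esub> \<zero>\<^bsub>K\<^esub> = \<zero>\<^bsub>K\<^esub>" using KK.l_zero[OF KK.zero_closed] by simp
  show "moore n \<subseteq> carrier (dual_module K (W n))" by (auto simp: moore_def)
  show "\<zero>\<^bsub>dual_module K (W n)\<^esub> \<in> moore n" using D.zero_closed * by (simp add: moore_def)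
  show "x \<oplus>\<^bsub>dual_module K (W n)\<^esub> y \<in> moore n" if "x \<in> moore n" "y \<in> moore n" for x y
    using D.a_closed[of x y] that * by (simp add: moore_def z)
  show "a \<odot>\<^bsub>dual_module K (W n)\<^esub> x \<in> moore n" if "a \<in> carrier K" "x \<in> moore n" for a x
    using D.smult_closed[of a x] that * KK.smult_r_null[of a] by (simp add: moore_def)
qed

lemma moore_module: "module K (Cm (normalized X) n)"
  unfolding normalized_eq by (rule module_submod[OF module_dual[OF W] submod_moore])

lemma moore_separated: "separated K (Cm (normalized X) n)"
proof -
  obtain J :: "'w set" and e c where "coord_system K (W n) J e c" using W_coords by blast
  from separated_sub[OF separated_dual[OF this], of "moore n"] submod_closed[OF submod_moore]
  show ?thesis unfolding normalized_eq by blast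
qed

lemma face0:
  assumes "\<phi> \<in> mod_hom K (W (Suc n)) (self_module K)" "v \<in> carrier (V n)"
  shows "face X n 0 \<phi> (\<Psi> n v) = \<phi> (\<Psi> (Suc n) (act n (Suc n) Suc v))"
  using \<Psi>_face[of 0 n v] assms lin_closed[OF \<Psi>_lin assms(2)]
  by (simp add: X_face dual_map_def)

text \<open>Linearity is read off from the shift on \<open>V\<close>, carried to \<open>W\<close> by
  \<open>\<Psi>\<close> and its inverse.\<close>

lemma face0_hom:
  assumes "\<phi> \<in> mod_hom K (W (Suc n)) (self_module K)"
  shows "face X n 0 \<phi> \<in> mod_hom K (W n) (self_module K)"
proof -
  let ?i = "inv_into (carrier (V n)) (\<Psi> n)"
  have i: "lin K (W n) (V n) ?i" by (rule lin_inv[OF mod \<Psi>_lin \<Psi>_bij])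
  have S: "lin K (V n) (V (Suc n)) (act n (Suc n) Suc)" by (rule act_lin[OF Suc_fun])
  from restrict_mod_hom[OF W lin_comp[OF lin_comp[OF lin_comp[OF i S] \<Psi>_lin] mod_hom_lin[OF assms]]]
  have "(\<lambda>w\<in>carrier (W n). \<phi> (\<Psi> (Suc n) (act n (Suc n) Suc (?i w)))) \<in> mod_hom K (W n) (self_module K)" .
  moreover have "(\<lambda>w\<in>carrier (W n). \<phi> (\<Psi> (Suc n) (act n (Suc n) Suc (?i w)))) = face X n 0 \<phi>"
  proof (rule extensionalityI)
    fix w assume w: "w \<in> carrier (W n)"
    then obtain v where v: "v \<in> carrier (V n)" "w = \<Psi> n v" using W_elem by blast
    have "?i w = v" unfolding v(2) by (rule inv_into_f_f[OF bij_betw_imp_inj_on[OF \<Psi>_bij] v(1)])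
    thus "(\<lambda>w\<in>carrier (W n). \<phi> (\<Psi> (Suc n) (act n (Suc n) Suc (?i w)))) w = face X n 0 \<phi> w"
      using face0[OF assms v(1)] w v(2) by simp
  qed (use assms in \<open>auto simp: X_face dual_map_def\<close>)
  ultimately show ?thesis by simp
qed

lemma face0_moore: "\<phi> \<in> moore (Suc n) \<Longrightarrow> face X n 0 \<phi> \<in> moore n"
proof -
  assume \<phi>: "\<phi> \<in> moore (Suc n)"
  hence h: "\<phi> \<in> mod_hom K (W (Suc n)) (self_module K)" by (simp add: moore_def)
  have "face X n 0 \<phi> (\<Psi> n (E n i v)) = \<zero>\<^bsub>K\<^esub>" if i: "i < n" and v: "v \<in> carrier (V n)" for i v
    using \<phi> i act_in[OF Suc_fun v] unfolding face0[OF h idem_in[OF i v]] act_Suc_idem[OF i v] moore_def by auto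
  thus ?thesis using face0_hom[OF h] by (simp add: moore_def)
qed

lemma moore_d_lin: "lin K (Cm (normalized X) (Suc n)) (Cm (normalized X) n) (Cd (normalized X) n)"
proof -
  interpret D: module K "Cm (normalized X) (Suc n)" by (rule moore_module)
  have fcW: "fc n 0 w \<in> carrier (W (Suc n))" if "w \<in> carrier (W n)" for w
  proof -
    obtain v where v: "v \<in> carrier (V n)" "w = \<Psi> n v" using W_elem[OF \<open>w \<in> carrier (W n)\<close>] by blast
    show ?thesis using \<Psi>_face[of 0 n v] v lin_closed[OF \<Psi>_lin act_in[OF \<delta>_fun v(1)], of 0] by simp
  qed
  have "lin K ((dual_module K (W (Suc n)))\<lparr>carrier := moore (Suc n)\<rparr>) ((dual_module K (W n))\<lparr>carrier := moore n\<rparr>) (face X n 0)"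
  proof (rule linI)
    fix x assume x: "x \<in> carrier ((dual_module K (W (Suc n)))\<lparr>carrier := moore (Suc n)\<rparr>)"
    show "face X n 0 x \<in> carrier ((dual_module K (W n))\<lparr>carrier := moore n\<rparr>)" using x face0_moore by simp
    have xm: "x \<in> mod_hom K (W (Suc n)) (self_module K)" using x by (simp add: moore_def)
    interpret D': module K "dual_module K (W (Suc n))" by (rule module_dual[OF W])
    show "face X n 0 (x \<oplus>\<^bsub>(dual_module K (W (Suc n)))\<lparr>carrier := moore (Suc n)\<rparr>\<^esub> y)
        = face X n 0 x \<oplus>\<^bsub>(dual_module K (W n))\<lparr>carrier := moore n\<rparr>\<^esub> face X n 0 y"
      if "y \<in> carrier ((dual_module K (W (Suc n)))\<lparr>carrier := moore (Suc n)\<rparr>)" for y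
    proof -
      have ym: "y \<in> mod_hom K (W (Suc n)) (self_module K)" using that by (simp add: moore_def)
      show ?thesis using D'.a_closed[of x y] xm ym fcW
        by (simp add: X_face dual_map_def fun_eq_iff restrict_def)
    qed
    show "face X n 0 (a \<odot>\<^bsub>(dual_module K (W (Suc n)))\<lparr>carrier := moore (Suc n)\<rparr>\<^esub> x)
        = a \<odot>\<^bsub>(dual_module K (W n))\<lparr>carrier := moore n\<rparr>\<^esub> face X n 0 x" if "a \<in> carrier K" for a
      using D'.smult_closed[of a x] xm fcW that
      by (simp add: X_face dual_map_def fun_eq_iff restrict_def)
  qed
  thus ?thesis unfolding normalized_eq
    by (subst lin_cong[OF moore_module[unfolded normalized_eq], of _ _ "face X n 0"]) simp_all
qed

text \<open>Two applications of the face 0 transpose the double shift, which is fixed by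
  \<open>idem 0\<close>; on the image of that idempotent Moore functionals vanish.\<close>

lemma moore_dd:
  assumes "\<phi> \<in> carrier (Cm (normalized X) (Suc (Suc n)))"
  shows "Cd (normalized X) n (Cd (normalized X) (Suc n) \<phi>) = \<zero>\<^bsub>Cm (normalized X) n\<^esub>"
proof -
  have \<phi>: "\<phi> \<in> moore (Suc (Suc n))" using assms by (simp add: normalized_eq)
  hence h: "\<phi> \<in> mod_hom K (W (Suc (Suc n))) (self_module K)" by (simp add: moore_def)
  note f1 = face0_moore[OF \<phi>]
  have h1: "face X (Suc n) 0 \<phi> \<in> mod_hom K (W (Suc n)) (self_module K)" by (rule face0_hom[OF h])
  have "face X n 0 (face X (Suc n) 0 \<phi>) = (\<lambda>w\<in>carrier (W n). \<zero>\<^bsub>K\<^esub>)"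
  proof (rule extensionalityI)
    fix w assume w: "w \<in> carrier (W n)"
    then obtain v where v: "v \<in> carrier (V n)" "w = \<Psi> n v" using W_elem by blast
    let ?u = "act n (Suc (Suc n)) (\<lambda>i. Suc (Suc i)) v"
    have u: "?u \<in> carrier (V (Suc (Suc n)))" by (rule act_in[OF _ v(1)]) auto
    have "act (Suc n) (Suc (Suc n)) Suc (act n (Suc n) Suc v) = ?u"
      by (rule act_comp[OF Suc_fun Suc_fun _ v(1)]) simp
    also have "?u = E (Suc (Suc n)) 0 ?u"
      unfolding idem_def by (rule act_comp[OF _ _ _ v(1), symmetric]) auto
    finally have "face X n 0 (face X (Suc n) 0 \<phi>) w = \<phi> (\<Psi> (Suc (Suc n)) (E (Suc (Suc n)) 0 ?u))"
      unfolding v(2) face0[OF h1 v(1)] face0[OF h act_in[OF Suc_fun v(1)]] by simp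
    also have "\<dots> = \<zero>\<^bsub>K\<^esub>" using \<phi> u by (simp add: moore_def)
    finally show "face X n 0 (face X (Suc n) 0 \<phi>) w = (\<lambda>w\<in>carrier (W n). \<zero>\<^bsub>K\<^esub>) w" using w by simp
  qed (use face0_hom[OF h1] in \<open>auto simp: mod_hom_iff\<close>)
  thus ?thesis using \<phi> f1 by (simp add: normalized_eq)
qed

text \<open>Each factor of the projection changes its argument by an element of the image of an
  idempotent, on which Moore functionals vanish.\<close>

lemma moore_proj:
  assumes \<phi>: "\<phi> \<in> moore n" and v: "v \<in> carrier (V n)" and k: "k \<le> n"
  shows "\<phi> (\<Psi> n (\<pi> n k v)) = \<phi> (\<Psi> n v)"
  using k
proof (induction k)
  case (Suc k)
  interpret KK: module K "self_module K" by (rule KK)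
  let ?y = "\<pi> n k v"
  have y: "?y \<in> carrier (V n)" by (rule proj_in) (use Suc.prems v in auto)
  have ey: "E n k ?y \<in> carrier (V n)" by (rule idem_in) (use Suc.prems y in auto)
  have z: "\<phi> (\<Psi> n (E n k ?y)) = \<zero>\<^bsub>K\<^esub>" using \<phi> Suc.prems y by (simp add: moore_def)
  have "\<phi> (\<Psi> n (\<pi> n (Suc k) v)) = \<phi> (\<Psi> n ?y) \<ominus>\<^bsub>self_module K\<^esub> \<phi> (\<Psi> n (E n k ?y))"
    unfolding proj.simps by (rule lin_diff[OF mod KK moore_pull[OF \<phi>] y ey])
  also have "\<dots> = \<phi> (\<Psi> n ?y)"
    using lin_closed[OF moore_pull[OF \<phi>] y] z KK.minus_equality[of "\<zero>\<^bsub>K\<^esub>" "\<zero>\<^bsub>K\<^esub>"]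
    by (simp add: KK.minus_eq[simplified] KK.r_zero[simplified])
  finally show ?case using Suc by simp
qed simp

definition ev :: "nat \<Rightarrow> 'v \<Rightarrow> ('w \<Rightarrow> 'k) \<Rightarrow> 'k" where
  "ev n = (\<lambda>v\<in>N n. \<lambda>\<phi>\<in>moore n. \<phi> (\<Psi> n v))"

lemma ev_hom: "ev n \<in> mod_hom K ((V n)\<lparr>carrier := N n\<rparr>) (dual_module K (Cm (normalized X) n))"
proof -
  have evl: "(\<lambda>\<phi>\<in>moore n. \<phi> (\<Psi> n v)) \<in> mod_hom K ((dual_module K (W n))\<lparr>carrier := moore n\<rparr>) (self_module K)"
    if "v \<in> carrier (V n)" for v
  proof -
    have "lin K ((dual_module K (W n))\<lparr>carrier := moore n\<rparr>) (self_module K) (\<lambda>\<phi>. \<phi> (\<Psi> n v))"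
      using lin_closed[OF \<Psi>_lin that] by (intro linI) (auto simp: moore_def dest: mod_hom_closed)
    from restrict_mod_hom[OF moore_module[unfolded normalized_eq] this] show ?thesis by simp
  qed
  have Nc: "N n \<subseteq> carrier (V n)" using normD(1) by blast
  interpret VN: module K "(V n)\<lparr>carrier := N n\<rparr>" by (rule module_submod[OF mod submod_norm])
  have "lin K ((V n)\<lparr>carrier := N n\<rparr>) (dual_module K (Cm (normalized X) n)) (\<lambda>v. \<lambda>\<phi>\<in>moore n. \<phi> (\<Psi> n v))"
    unfolding normalized_eq
  proof (rule linI)
    fix x y a assume x: "x \<in> carrier ((V n)\<lparr>carrier := N n\<rparr>)"
    hence xc: "x \<in> carrier (V n)" using Nc by auto
    show "(\<lambda>\<phi>\<in>moore n. \<phi> (\<Psi> n x)) \<in> carrier (dual_module K ((dual_module K (W n))\<lparr>carrier := moore n\<rparr>))"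
      using evl[OF xc] by simp
    { assume "y \<in> carrier ((V n)\<lparr>carrier := N n\<rparr>)"
      hence yc: "y \<in> carrier (V n)" using Nc by auto
      show "(\<lambda>\<phi>\<in>moore n. \<phi> (\<Psi> n (x \<oplus>\<^bsub>(V n)\<lparr>carrier := N n\<rparr>\<^esub> y))) =
         (\<lambda>\<phi>\<in>moore n. \<phi> (\<Psi> n x)) \<oplus>\<^bsub>dual_module K ((dual_module K (W n))\<lparr>carrier := moore n\<rparr>)\<^esub> (\<lambda>\<phi>\<in>moore n. \<phi> (\<Psi> n y))"
        using lin_add[OF moore_pull xc yc] by (simp add: fun_eq_iff restrict_def) }
    { assume "a \<in> carrier K"
      thus "(\<lambda>\<phi>\<in>moore n. \<phi> (\<Psi> n (a \<odot>\<^bsub>(V n)\<lparr>carrier := N n\<rparr>\<^esub> x))) =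
         a \<odot>\<^bsub>dual_module K ((dual_module K (W n))\<lparr>carrier := moore n\<rparr>)\<^esub> (\<lambda>\<phi>\<in>moore n. \<phi> (\<Psi> n x))"
        using lin_smult[OF moore_pull _ xc] by (simp add: fun_eq_iff restrict_def) }
  qed
  from restrict_mod_hom[OF VN.module_axioms this] show ?thesis by (simp add: ev_def)
qed

text \<open>This is the transpose of the projection, transported along \<open>\<Psi>\<close>. It
  yields Moore functionals because the projection kills the image of every idempotent.\<close>

lemma proj_dual:
  assumes \<phi>: "\<phi> \<in> mod_hom K (W n) (self_module K)"
  defines "\<phi>' \<equiv> \<lambda>w\<in>carrier (W n). \<phi> (\<Psi> n (\<pi> n n (inv_into (carrier (V n)) (\<Psi> n) w)))"
  shows "\<phi>' \<in> moore n" "v \<in> carrier (V n) \<Longrightarrow> \<phi>' (\<Psi> n v) = \<phi> (\<Psi> n (\<pi> n n v))"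
proof -
  let ?i = "inv_into (carrier (V n)) (\<Psi> n)"
  have i: "lin K (W n) (V n) ?i" by (rule lin_inv[OF mod \<Psi>_lin \<Psi>_bij])
  have e: "\<phi>' (\<Psi> n v) = \<phi> (\<Psi> n (\<pi> n n v))" if v: "v \<in> carrier (V n)" for v
    using inv_into_f_f[OF bij_betw_imp_inj_on[OF \<Psi>_bij] v] lin_closed[OF \<Psi>_lin v] by (simp add: \<phi>'_def)
  show "v \<in> carrier (V n) \<Longrightarrow> \<phi>' (\<Psi> n v) = \<phi> (\<Psi> n (\<pi> n n v))" by (rule e)
  have "\<phi>' \<in> mod_hom K (W n) (self_module K)" unfolding \<phi>'_def
    by (rule restrict_mod_hom[OF W lin_comp[OF lin_comp[OF lin_comp[OF i proj_lin[OF order.refl]] \<Psi>_lin] mod_hom_lin[OF \<phi>]]])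
  moreover have "\<phi>' (\<Psi> n (E n k v)) = \<zero>\<^bsub>K\<^esub>" if k: "k < n" and v: "v \<in> carrier (V n)" for k v
  proof -
    have "\<pi> n n (E n k v) = \<zero>\<^bsub>V n\<^esub>" by (rule proj_kills[OF idem_in[OF k v] idem_idem[OF k v] k])
    thus ?thesis unfolding e[OF idem_in[OF k v]]
      using lin_zero[OF mod W \<Psi>_lin] lin_zero[OF W KK mod_hom_lin[OF \<phi>]] by simp
  qed
  ultimately show "\<phi>' \<in> moore n" by (simp add: moore_def)
qed

text \<open>Injectivity and surjectivity both come from composing functionals with the projection onto the
  normalized part, whose transpose is a projection onto the Moore subcomplex.\<close>

lemma ev_bij: "bij_betw (ev n) (carrier ((V n)\<lparr>carrier := N n\<rparr>)) (carrier (dual_module K (Cm (normalized X) n)))"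
proof -
  obtain J :: "'w set" and e c where cs: "coord_system K (W n) J e c" using W_coords by blast
  have sub: "module K ((V n)\<lparr>carrier := N n\<rparr>)" by (rule module_submod[OF mod submod_norm])
  have inj: "inj_on (ev n) (carrier ((V n)\<lparr>carrier := N n\<rparr>))"
  proof (rule lin_inj_on[OF sub module_dual[OF moore_module] mod_hom_lin[OF ev_hom]])
    fix v assume v: "v \<in> carrier ((V n)\<lparr>carrier := N n\<rparr>)" "ev n v = \<zero>\<^bsub>dual_module K (Cm (normalized X) n)\<^esub>"
    have vN: "v \<in> N n" using v by simp
    note vc = normD(1)[OF vN]
    have z: "\<phi> (\<Psi> n v) = \<zero>\<^bsub>K\<^esub>" if "\<phi> \<in> moore n" for \<phi>
      using fun_cong[OF v(2), of \<phi>] that vN by (simp add: ev_def normalized_eq)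
    have "\<Psi> n v = \<zero>\<^bsub>W n\<^esub>"
    proof (rule coord_system_separated[OF cs lin_closed[OF \<Psi>_lin vc]])
      fix j assume j: "j \<in> J"
      let ?\<phi> = "restrict (c j) (carrier (W n))"
      have \<phi>: "?\<phi> \<in> mod_hom K (W n) (self_module K)"
        using cs j by (intro restrict_mod_hom[OF W]) (auto simp: coord_system_def)
      from z[OF proj_dual(1)[OF \<phi>]] have "?\<phi> (\<Psi> n (\<pi> n n v)) = \<zero>\<^bsub>K\<^esub>" unfolding proj_dual(2)[OF \<phi> vc] .
      thus "c j (\<Psi> n v) = \<zero>\<^bsub>K\<^esub>" using proj_fix[OF vN order.refl] lin_closed[OF \<Psi>_lin vc] by simp
    qed
    hence "\<Psi> n v = \<Psi> n \<zero>\<^bsub>V n\<^esub>" using lin_zero[OF mod W \<Psi>_lin] by simp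
    thus "v = \<zero>\<^bsub>(V n)\<lparr>carrier := N n\<rparr>\<^esub>"
      using inj_onD[OF bij_betw_imp_inj_on[OF \<Psi>_bij] _ vc zero_in] by simp
  qed
  have "\<exists>v\<in>N n. ev n v = F" if F: "F \<in> carrier (dual_module K (Cm (normalized X) n))" for F
  proof -
    have lF: "lin K ((dual_module K (W n))\<lparr>carrier := moore n\<rparr>) (self_module K) F"
      using F by (simp add: normalized_eq mod_hom_lin)
    let ?p = "\<lambda>\<phi>. \<lambda>w\<in>carrier (W n). \<phi> (\<Psi> n (\<pi> n n (inv_into (carrier (V n)) (\<Psi> n) w)))"
    have in_W: "\<Psi> n (\<pi> n n (inv_into (carrier (V n)) (\<Psi> n) w)) \<in> carrier (W n)" if "w \<in> carrier (W n)" for w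
      by (rule lin_closed[OF \<Psi>_lin proj_in[OF order.refl lin_closed[OF lin_inv[OF mod \<Psi>_lin \<Psi>_bij] that]]])
    have "lin K (dual_module K (W n)) ((dual_module K (W n))\<lparr>carrier := moore n\<rparr>) ?p"
      using proj_dual(1) in_W by (intro linI) (auto simp: fun_eq_iff restrict_def)
    \<comment> \<open>\<open>F\<close> is defined on Moore functionals only; preceded by the
      transposed projection it becomes a functional on the whole dual, to which reflexivity of
      \<open>W n\<close> applies.\<close>
    from coord_system_reflexive[OF cs lin_comp[OF this lF]]
    obtain w where w: "w \<in> carrier (W n)" "\<forall>\<phi>\<in>mod_hom K (W n) (self_module K). F (?p \<phi>) = \<phi> w" by blast
    then obtain v where v: "v \<in> carrier (V n)" "w = \<Psi> n v" using W_elem by blast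
    have "ev n (\<pi> n n v) = F"
    proof (rule extensionalityI)
      show "ev n (\<pi> n n v) \<in> extensional (moore n)" using proj_norm[OF v(1)] by (simp add: ev_def)
      show "F \<in> extensional (moore n)" using F by (simp add: normalized_eq mod_hom_iff)
      fix \<phi> assume \<phi>: "\<phi> \<in> moore n"
      have h: "\<phi> \<in> mod_hom K (W n) (self_module K)" using \<phi> by (simp add: moore_def)
      have "?p \<phi> = \<phi>"
      proof (rule mod_hom_eqI)
        show "?p \<phi> \<in> mod_hom K (W n) (self_module K)" using proj_dual(1)[OF h] by (simp add: moore_def)
        show "\<phi> \<in> mod_hom K (W n) (self_module K)" by (rule h)
        fix w assume "w \<in> carrier (W n)"
        then obtain u where u: "u \<in> carrier (V n)" "w = \<Psi> n u" using W_elem by blast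
        show "?p \<phi> w = \<phi> w" unfolding u(2) proj_dual(2)[OF h u(1)] by (rule moore_proj[OF \<phi> u(1) order.refl])
      qed
      hence "F \<phi> = \<phi> w" using w(2) h by metis
      also have "\<dots> = \<phi> (\<Psi> n (\<pi> n n v))" unfolding v(2) by (rule moore_proj[OF \<phi> v(1) order.refl, symmetric])
      finally show "ev n (\<pi> n n v) \<phi> = F \<phi>" using \<phi> proj_norm[OF v(1)] by (simp add: ev_def)
    qed
    thus ?thesis using proj_norm[OF v(1)] by blast
  qed
  hence "carrier (dual_module K (Cm (normalized X) n)) \<subseteq> ev n ` N n" by blast
  moreover have "ev n ` N n \<subseteq> carrier (dual_module K (Cm (normalized X) n))"
    using mod_hom_closed[OF ev_hom] by auto
  ultimately show ?thesis using inj by (simp add: bij_betw_def)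
qed

text \<open>Moore functionals do not see the projection contained in \<open>dd\<close>, so only the
  shift is left, and its transpose is the face 0. As both differentials are reduced to their first
  term, no sign has to be inserted.\<close>

lemma ev_comm:
  assumes v: "v \<in> N n"
  shows "ev (Suc n) (dd n v) = Cd (dual_cpx K (normalized X)) n (ev n v)"
proof -
  have vc: "v \<in> carrier (V n)" by (rule normD(1)[OF v])
  have evd: "ev n v \<in> carrier (dual_module K (Cm (normalized X) n))"
    by (rule mod_hom_closed[OF ev_hom]) (use v in simp)
  show ?thesis
  proof (rule extensionalityI[of _ "moore (Suc n)"])
    fix \<phi> assume \<phi>: "\<phi> \<in> moore (Suc n)"
    have h: "\<phi> \<in> mod_hom K (W (Suc n)) (self_module K)" using \<phi> by (simp add: moore_def)
    have "ev (Suc n) (dd n v) \<phi> = \<phi> (\<Psi> (Suc n) (dd n v))" using \<phi> bd_norm[OF vc] by (simp add: ev_def)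
    also have "\<dots> = \<phi> (\<Psi> (Suc n) (act n (Suc n) Suc v))"
      unfolding bd_def by (rule moore_proj[OF \<phi> act_in[OF Suc_fun vc] order.refl])
    also have "\<dots> = face X n 0 \<phi> (\<Psi> n v)" by (rule face0[OF h vc, symmetric])
    also have "\<dots> = Cd (dual_cpx K (normalized X)) n (ev n v) \<phi>"
      using \<phi> evd v face0_moore[OF \<phi>]
      by (simp add: dual_cpx_def dual_map_def normalized_eq) (simp add: ev_def)
    finally show "ev (Suc n) (dd n v) \<phi> = Cd (dual_cpx K (normalized X)) n (ev n v) \<phi>" .
  qed (use bd_norm[OF vc] evd in \<open>auto simp: ev_def dual_cpx_def dual_map_def normalized_eq\<close>)
qed

end

section \<open>The duality between presentations and Eilenberg-MacLane modules\<close>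

lemma finite_surjections: "finite (surjections n)"
proof (rule finite_subset)
  show "surjections n \<subseteq> (\<Pi>\<^sub>E i\<in>{..n}. {..n})"
  proof
    fix \<sigma> assume \<sigma>: "\<sigma> \<in> surjections n"
    have im: "\<sigma> ` {..n} = {..\<sigma> n}" using \<sigma> by (simp add: surjections_def)
    have "card {..\<sigma> n} \<le> card {..n}" unfolding im[symmetric] by (rule card_image_le) simp
    hence "\<sigma> n \<le> n" by simp
    moreover have "\<sigma> i \<le> \<sigma> n" if "i \<le> n" for i using im that by blast
    ultimately show "\<sigma> \<in> (\<Pi>\<^sub>E i\<in>{..n}. {..n})" using \<sigma> by (auto simp: surjections_def PiE_iff intro: order_trans)
  qed
qed (simp add: finite_PiE)

text \<open>The complex behind \<open>K(B, 1)\<close> is concentrated in degree 1, so all other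
  surjections index zero summands.\<close>

definition surj1 :: "nat \<Rightarrow> (nat \<Rightarrow> nat) set" where
  "surj1 n = {\<sigma> \<in> surjections n. \<sigma> n = 1}"

lemma finite_surj1: "finite (surj1 n)"
  by (simp add: surj1_def finite_surjections)

text \<open>For \<open>1 \<le> j \<le> n\<close> these maps exhaust \<open>surj1 n\<close>, so
  \<open>K(B, 1)\<close> has \<open>n\<close> copies of \<open>B\<close> at level
  \<open>n\<close>.\<close>

definition step :: "nat \<Rightarrow> nat \<Rightarrow> nat \<Rightarrow> nat" where
  "step n j = (\<lambda>i\<in>{..n}. if i < j then 0 else 1)"

lemma surj1_values:
  assumes "\<sigma> \<in> surj1 n" "i \<le> n" shows "\<sigma> i = 0 \<or> \<sigma> i = 1"
proof -
  have "\<sigma> ` {..n} = {..1}" using assms(1) by (simp add: surj1_def surjections_def)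
  hence "\<sigma> i \<in> {..1}" using assms(2) by blast
  thus ?thesis by auto
qed

lemma surj1_mono: "\<sigma> \<in> surj1 n \<Longrightarrow> i \<le> j \<Longrightarrow> j \<le> n \<Longrightarrow> \<sigma> i \<le> \<sigma> j"
  by (auto simp: surj1_def surjections_def mono_on_def)

lemma surj1_zero: "\<sigma> \<in> surj1 n \<Longrightarrow> \<sigma> 0 = 0"
proof -
  assume \<sigma>: "\<sigma> \<in> surj1 n"
  hence "0 \<in> \<sigma> ` {..n}" by (simp add: surj1_def surjections_def)
  then obtain i where "i \<le> n" "\<sigma> i = 0" by auto
  thus ?thesis using surj1_mono[OF \<sigma>, of 0 i] by simp
qed

lemma surj1I:
  assumes "\<sigma> \<in> extensional {..n}" "mono_on {..n} \<sigma>" "\<sigma> n = 1" "\<exists>i\<le>n. \<sigma> i = 0"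
  shows "\<sigma> \<in> surj1 n"
proof -
  have "\<sigma> i \<le> 1" if "i \<le> n" for i using mono_onD[OF assms(2), of i n] assms(3) that by simp
  hence "\<sigma> ` {..n} = {..1}"
  proof (intro equalityI subsetI)
    show "x \<in> \<sigma> ` {..n}" if "x \<in> {..1}" for x
    proof -
      obtain i where "i \<le> n" "\<sigma> i = 0" using assms(4) by blast
      moreover have "x = 0 \<or> x = 1" using that by auto
      ultimately show ?thesis using assms(3) by (metis atMost_iff image_eqI order.refl)
    qed
  qed auto
  thus ?thesis using assms by (simp add: surj1_def surjections_def)
qed

lemma step_surj1: "1 \<le> j \<Longrightarrow> j \<le> n \<Longrightarrow> step n j \<in> surj1 n"
  by (rule surj1I) (auto simp: step_def mono_on_def intro: exI[of _ 0])

lemma surj1_step: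
  assumes "\<sigma> \<in> surj1 n" shows "\<exists>j\<in>{1..n}. \<sigma> = step n j"
proof -
  define j where "j = (LEAST i. \<sigma> i = 1)"
  have n: "\<sigma> n = 1" using assms by (simp add: surj1_def)
  have j: "\<sigma> j = 1" unfolding j_def by (rule LeastI[of "\<lambda>i. \<sigma> i = 1", OF n])
  have jn: "j \<le> n" unfolding j_def by (rule Least_le) (rule n)
  have "j \<noteq> 0" using j surj1_zero[OF assms] by (metis zero_neq_one)
  moreover have "\<sigma> = step n j"
  proof (rule extensionalityI)
    show "\<sigma> \<in> extensional {..n}" using assms by (simp add: surj1_def surjections_def)
    fix i assume i: "i \<in> {..n}"
    show "\<sigma> i = step n j i"
    proof (cases "i < j")
      case True
      hence "\<sigma> i \<noteq> 1" unfolding j_def by (rule not_less_Least)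
      thus ?thesis using surj1_values[OF assms, of i] i True by (auto simp: step_def)
    next
      case False
      hence "1 \<le> \<sigma> i" using surj1_mono[OF assms, of j i] i j by simp
      thus ?thesis using surj1_values[OF assms, of i] i False by (auto simp: step_def)
    qed
  qed (simp add: step_def)
  ultimately show ?thesis using jn by (intro bexI[of _ j]) auto
qed

lemma step_zeros: "j \<le> n \<Longrightarrow> {i \<in> {..n}. step n j i = 0} = {..<j}"
  by (auto simp: step_def)

section \<open>Linearity of the Dold-Kan operators and isomorphisms under a functor\<close>

lemma module_dk:
  assumes "\<And>k. module K (Cm C k)" shows "module K (dk_module C n)"
  unfolding dk_module_def by (rule module_prod) (use assms module_cring in blast)+

lemma dk_map_lin:
  assumes C: "\<And>k. module K (Cm C k)" and d: "\<And>k. lin K (Cm C (Suc k)) (Cm C k) (Cd C k)"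
  shows "lin K (dk_module C n) (dk_module C m) (dk_map C m n \<alpha>)"
proof -
  let ?f = "\<lambda>\<tau> \<sigma> x. if \<sigma> n = \<tau> m \<and> (\<forall>j\<le>m. \<sigma> (\<alpha> j) = \<tau> j) then x \<sigma>
             else if \<sigma> n = Suc (\<tau> m) \<and> (\<forall>j\<le>m. \<sigma> (\<alpha> j) = Suc (\<tau> j)) then Cd C (\<tau> m) (x \<sigma>)
             else \<zero>\<^bsub>Cm C (\<tau> m)\<^esub>"
  note Q = module_dk[of K C, OF C]
  have p: "lin K (dk_module C n) (Cm C (\<sigma> n)) (\<lambda>x. x \<sigma>)" if "\<sigma> \<in> surjections n" for \<sigma>
    unfolding dk_module_def using that by (rule lin_proj)
  have "lin K (dk_module C n) (dk_module C m) (\<lambda>x. \<lambda>\<tau>\<in>surjections m. finsum (Cm C (\<tau> m)) (\<lambda>\<sigma>. ?f \<tau> \<sigma> x) (surjections n))"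
    unfolding dk_module_def[of C m]
  proof (rule lin_into_prod[OF Q lin_sum[OF Q C finite_surjections]])
    fix \<tau> \<sigma> assume \<sigma>: "\<sigma> \<in> surjections n"
    consider "\<sigma> n = \<tau> m \<and> (\<forall>j\<le>m. \<sigma> (\<alpha> j) = \<tau> j)"
      | "\<not> (\<sigma> n = \<tau> m \<and> (\<forall>j\<le>m. \<sigma> (\<alpha> j) = \<tau> j))" "\<sigma> n = Suc (\<tau> m) \<and> (\<forall>j\<le>m. \<sigma> (\<alpha> j) = Suc (\<tau> j))"
      | "\<not> (\<sigma> n = \<tau> m \<and> (\<forall>j\<le>m. \<sigma> (\<alpha> j) = \<tau> j))" "\<not> (\<sigma> n = Suc (\<tau> m) \<and> (\<forall>j\<le>m. \<sigma> (\<alpha> j) = Suc (\<tau> j)))" by blast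
    thus "lin K (dk_module C n) (Cm C (\<tau> m)) (?f \<tau> \<sigma>)"
    proof cases
      case 1
      have "?f \<tau> \<sigma> = (\<lambda>x. x \<sigma>)" unfolding if_P[OF 1] ..
      thus ?thesis using p[OF \<sigma>] 1 by simp
    next
      case 2
      have "?f \<tau> \<sigma> = (\<lambda>x. Cd C (\<tau> m) (x \<sigma>))" unfolding if_not_P[OF 2(1)] if_P[OF 2(2)] ..
      thus ?thesis using lin_comp[OF p[OF \<sigma>], of "Cm C (\<tau> m)" "Cd C (\<tau> m)"] d[of "\<tau> m"] 2 by simp
    next
      case 3
      have "?f \<tau> \<sigma> = (\<lambda>x. \<zero>\<^bsub>Cm C (\<tau> m)\<^esub>)" unfolding if_not_P[OF 3(1)] if_not_P[OF 3(2)] ..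
      thus ?thesis using lin_const_zero[OF C] by simp
    qed
  qed
  thus ?thesis unfolding dk_map_def lin_restrict[OF Q] .
qed

lemma functor_iso_bij:
  assumes \<Phi>: "is_functor (Mods K) (Mods K) \<Phi>" and M: "module K M" and N: "module K N"
    and f: "f \<in> mod_hom K M N" "bij_betw f (carrier M) (carrier N)"
  shows "bij_betw (Fa \<Phi> M N f) (carrier (Fo \<Phi> M)) (carrier (Fo \<Phi> N))"
proof -
  let ?g = "restrict (inv_into (carrier M) f) (carrier N)"
  have g: "?g \<in> mod_hom K N M" by (rule restrict_mod_hom[OF N lin_inv[OF M mod_hom_lin[OF f(1)] f(2)]])
  have ob: "M \<in> Ob (Mods K)" "N \<in> Ob (Mods K)" using M N by (simp_all add: Mods_def)
  have hm: "f \<in> Hom (Mods K) M N" "?g \<in> Hom (Mods K) N M" using f g by (simp_all add: Mods_def)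
  have fg: "Comp (Mods K) M ?g f = Id (Mods K) M"
    using bij_betw_imp_inj_on[OF f(2)] mod_hom_closed[OF f(1)] by (auto simp: Mods_def compose_def fun_eq_iff)
  have gf: "Comp (Mods K) N f ?g = Id (Mods K) N"
    using f(2) by (auto simp: Mods_def compose_def fun_eq_iff bij_betw_def f_inv_into_f)
  show ?thesis
  proof (rule bij_betw_byWitness[where f' = "Fa \<Phi> N M ?g"])
    show "\<forall>x\<in>carrier (Fo \<Phi> M). Fa \<Phi> N M ?g (Fa \<Phi> M N f x) = x"
      using functorD(5)[OF \<Phi> ob ob(1) hm, symmetric] functorD(4)[OF \<Phi> ob(1)] unfolding fg by simp
    show "\<forall>y\<in>carrier (Fo \<Phi> N). Fa \<Phi> M N f (Fa \<Phi> N M ?g y) = y"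
      using functorD(5)[OF \<Phi> ob(2,1,2) hm(2,1), symmetric] functorD(4)[OF \<Phi> ob(2)] unfolding gf by simp
    show "Fa \<Phi> M N f ` carrier (Fo \<Phi> M) \<subseteq> carrier (Fo \<Phi> N)"
      using lin_closed[OF functorD(3)[OF \<Phi> ob hm(1)]] by blast
    show "Fa \<Phi> N M ?g ` carrier (Fo \<Phi> N) \<subseteq> carrier (Fo \<Phi> M)"
      using lin_closed[OF functorD(3)[OF \<Phi> ob(2,1) hm(2)]] by blast
  qed
qed

section \<open>The perfect pairing of zero-sum tuples with K(A^v, 1)\<close>

context free_target
begin

abbreviation "KK \<equiv> self_module K"

lemma mKK: "module K KK" by (rule module_self[OF cr])

definition em :: "('k, 'u \<Rightarrow> 'k) cpx" where "em = concentrated (dual_module K A) 1"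

abbreviation "Q \<equiv> dk_module em"

definition rel :: "nat \<Rightarrow> ('k, nat \<Rightarrow> 'u) module" where
  "rel n = (power_module A n)\<lparr>carrier := {a \<in> carrier (power_module A n). finsum A a {..n} = \<zero>\<^bsub>A\<^esub>}\<rparr>"

lemma em_module: "module K (Cm em k)"
  using module_dual[OF A] module_submod[OF module_dual[OF A] submod_zero[OF module_dual[OF A]]]
  by (simp add: em_def concentrated_def)

lemma em_d: "Cd em k x = \<zero>\<^bsub>dual_module K A\<^esub>" if "x \<in> carrier (Cm em (Suc k))"
  using that by (auto simp: em_def concentrated_def split: if_splits)

lemma em_zero: "\<zero>\<^bsub>Cm em k\<^esub> = \<zero>\<^bsub>dual_module K A\<^esub>"
  by (simp add: em_def concentrated_def)

lemma em_d_lin: "lin K (Cm em (Suc k)) (Cm em k) (Cd em k)"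
proof -
  interpret C: module K "Cm em (Suc k)" by (rule em_module)
  have "lin K (Cm em (Suc k)) (Cm em k) (\<lambda>x. \<zero>\<^bsub>Cm em k\<^esub>)" by (rule lin_const_zero[OF em_module])
  thus ?thesis by (subst lin_cong[OF em_module]) (simp_all only: em_d em_zero)
qed

lemma module_Q: "module K (Q n)"
  by (rule module_dk[OF em_module])

lemma em_lin: "x \<in> carrier (Cm em k) \<Longrightarrow> x \<in> mod_hom K A KK"
proof -
  assume x: "x \<in> carrier (Cm em k)"
  interpret D: module K "dual_module K A" by (rule module_dual[OF A])
  show ?thesis using x D.zero_closed by (auto simp: em_def concentrated_def split: if_splits)
qed

lemma Q_elem: "x \<in> carrier (Q n) \<Longrightarrow> \<sigma> \<in> surjections n \<Longrightarrow> x \<sigma> \<in> carrier (Cm em (\<sigma> n))"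
  unfolding dk_module_def prod_module_sel by (erule PiE_mem)

lemma Q_proj: "\<sigma> \<in> surj1 n \<Longrightarrow> lin K (Q n) (dual_module K A) (\<lambda>x. x \<sigma>)"
proof -
  assume \<sigma>: "\<sigma> \<in> surj1 n"
  hence "lin K (Q n) (Cm em (\<sigma> n)) (\<lambda>x. x \<sigma>)"
    unfolding dk_module_def by (intro lin_proj) (simp add: surj1_def)
  thus ?thesis using \<sigma> by (simp add: surj1_def em_def concentrated_def)
qed

lemma Q_ext: "x \<in> carrier (Q n) \<Longrightarrow> x \<in> extensional (surjections n)"
  by (auto simp: dk_module_def PiE_def)

lemma Q_trivial: "x \<in> carrier (Q n) \<Longrightarrow> \<sigma> \<in> surjections n \<Longrightarrow> \<sigma> \<notin> surj1 n \<Longrightarrow> x \<sigma> = \<zero>\<^bsub>dual_module K A\<^esub>"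
  using Q_elem[of x n \<sigma>] by (auto simp: surj1_def em_def concentrated_def)

definition hd :: "nat \<Rightarrow> (nat \<Rightarrow> 'u) \<Rightarrow> (nat \<Rightarrow> nat) \<Rightarrow> 'u" where
  "hd n a \<sigma> = finsum A a {i\<in>{..n}. \<sigma> i = 0}"

definition pair :: "nat \<Rightarrow> (nat \<Rightarrow> 'u) \<Rightarrow> ((nat \<Rightarrow> nat) \<Rightarrow> 'u \<Rightarrow> 'k) \<Rightarrow> 'k" where
  "pair n a x = finsum KK (\<lambda>\<sigma>. x \<sigma> (hd n a \<sigma>)) (surj1 n)"

lemma hd_lin: "lin K (power_module A n) A (\<lambda>a. hd n a \<sigma>)"
  unfolding hd_def by (rule power_finsum_lin[OF A]) auto

lemma hd_in: "a \<in> carrier (power_module A n) \<Longrightarrow> hd n a \<sigma> \<in> carrier A"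
  by (rule lin_closed[OF hd_lin])

lemma total_lin: "lin K (power_module A n) A (\<lambda>a. finsum A a {..n})"
  by (rule power_finsum_lin[OF A]) simp

lemma submod_rel: "submod K (power_module A n) {a \<in> carrier (power_module A n). finsum A a {..n} = \<zero>\<^bsub>A\<^esub>}"
  by (rule submod_kernel[OF module_power[OF A] A total_lin])

lemma module_rel: "module K (rel n)"
  unfolding rel_def by (rule module_submod[OF module_power[OF A] submod_rel])

lemma relD: "a \<in> carrier (rel n) \<Longrightarrow> a \<in> carrier (power_module A n)" "a \<in> carrier (rel n) \<Longrightarrow> finsum A a {..n} = \<zero>\<^bsub>A\<^esub>"
  by (auto simp: rel_def)

lemma eval_lin: "h \<in> carrier A \<Longrightarrow> lin K (dual_module K A) KK (\<lambda>\<phi>. \<phi> h)"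
  by (auto simp: lin_def mod_hom_def)

lemma pair_lin_right: "a \<in> carrier (power_module A n) \<Longrightarrow> lin K (Q n) KK (pair n a)"
proof -
  assume a: "a \<in> carrier (power_module A n)"
  have "pair n a = (\<lambda>x. finsum KK (\<lambda>\<sigma>. x \<sigma> (hd n a \<sigma>)) (surj1 n))" by (rule ext) (simp add: pair_def)
  thus ?thesis
    using lin_sum[OF module_Q mKK finite_surj1, of n n "\<lambda>\<sigma> x. x \<sigma> (hd n a \<sigma>)"]
      lin_comp[OF Q_proj eval_lin[OF hd_in[OF a]]] by simp
qed

lemma pair_lin_left: "x \<in> carrier (Q n) \<Longrightarrow> lin K (power_module A n) KK (\<lambda>a. pair n a x)"
proof -
  assume x: "x \<in> carrier (Q n)"
  have "lin K A KK (x \<sigma>)" if "\<sigma> \<in> surj1 n" for \<sigma>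
    using em_lin[OF Q_elem[OF x, of \<sigma>]] that by (simp add: surj1_def mod_hom_lin)
  thus ?thesis unfolding pair_def
    using lin_sum[OF module_power[OF A] mKK finite_surj1, of n n "\<lambda>\<sigma> a. x \<sigma> (hd n a \<sigma>)"]
      lin_comp[OF hd_lin] by blast
qed

definition \<Theta> :: "nat \<Rightarrow> (nat \<Rightarrow> 'u) \<Rightarrow> ((nat \<Rightarrow> nat) \<Rightarrow> 'u \<Rightarrow> 'k) \<Rightarrow> 'k" where
  "\<Theta> n a = (\<lambda>x\<in>carrier (Q n). pair n a x)"

lemma \<Theta>_lin: "lin K (rel n) (dual_module K (Q n)) (\<Theta> n)"
proof -
  have "lin K (power_module A n) (dual_module K (Q n)) (\<Theta> n)"
  proof (rule linI)
    fix a assume a: "a \<in> carrier (power_module A n)"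
    show "\<Theta> n a \<in> carrier (dual_module K (Q n))"
      using restrict_mod_hom[OF module_Q pair_lin_right[OF a]] by (simp add: \<Theta>_def)
    show "\<Theta> n (a \<oplus>\<^bsub>power_module A n\<^esub> b) = \<Theta> n a \<oplus>\<^bsub>dual_module K (Q n)\<^esub> \<Theta> n b" if b: "b \<in> carrier (power_module A n)" for b
      using lin_add[OF pair_lin_left a b] by (simp add: \<Theta>_def fun_eq_iff restrict_def del: power_module_sel)
    show "\<Theta> n (r \<odot>\<^bsub>power_module A n\<^esub> a) = r \<odot>\<^bsub>dual_module K (Q n)\<^esub> \<Theta> n a" if r: "r \<in> carrier K" for r
      using lin_smult[OF pair_lin_left r a] by (simp add: \<Theta>_def fun_eq_iff restrict_def del: power_module_sel)
  qed
  thus ?thesis unfolding rel_def by (rule lin_sub_dom) auto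
qed

definition heads :: "nat \<Rightarrow> (nat \<Rightarrow> 'u) \<Rightarrow> (nat \<Rightarrow> nat) \<Rightarrow> 'u" where
  "heads n a = (\<lambda>\<sigma>\<in>surj1 n. hd n a \<sigma>)"

abbreviation "HD n \<equiv> prod_module (surj1 n) (\<lambda>_. A)"

lemma module_HD: "module K (HD n)" by (rule module_prod[OF cr]) (rule A)

lemma heads_lin: "lin K (rel n) (HD n) (heads n)"
proof -
  have "heads n = (\<lambda>a. \<lambda>\<sigma>\<in>surj1 n. hd n a \<sigma>)" by (rule ext) (simp add: heads_def)
  moreover have "lin K (rel n) A (\<lambda>a. hd n a \<sigma>)" for \<sigma>
    unfolding rel_def by (rule lin_sub_dom[OF hd_lin]) auto
  ultimately show ?thesis using lin_into_prod[OF module_rel, of "surj1 n" n "\<lambda>_. A" "\<lambda>a \<sigma>. hd n a \<sigma>"] by simp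
qed

lemma partial_Suc: "a \<in> carrier (power_module A n) \<Longrightarrow> j \<le> n \<Longrightarrow>
    finsum A a {..<Suc j} = a j \<oplus>\<^bsub>A\<^esub> finsum A a {..<j}"
  using power_elem[of a A n] by (simp add: lessThan_Suc Pi_def)

lemma heads_step: "j \<in> {1..n} \<Longrightarrow> heads n a (step n j) = finsum A a {..<j}"
  using step_surj1[of j n] step_zeros[of j n] by (simp add: heads_def hd_def)

text \<open>The partial sums at \<open>1, ..., n\<close> determine a tuple with sum zero, since the
  empty sum and the total are zero anyway; differences of consecutive partial sums give the
  inverse.\<close>

lemma heads_bij: "bij_betw (heads n) (carrier (rel n)) (carrier (HD n))"
proof -
  have "inj_on (heads n) (carrier (rel n))"
  proof (rule lin_inj_on[OF module_rel module_HD heads_lin])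
    fix a assume a: "a \<in> carrier (rel n)" "heads n a = \<zero>\<^bsub>HD n\<^esub>"
    note ap = relD(1)[OF a(1)]
    have s: "finsum A a {..<j} = \<zero>\<^bsub>A\<^esub>" if "j \<le> Suc n" for j
    proof -
      consider "j = 0" | "j \<in> {1..n}" | "j = Suc n" using \<open>j \<le> Suc n\<close> by force
      thus ?thesis
      proof cases
        case 2
        have "heads n a (step n j) = \<zero>\<^bsub>A\<^esub>" unfolding a(2) using step_surj1 2 by simp
        thus ?thesis using heads_step[OF 2] by simp
      next
        case 3
        thus ?thesis using relD(2)[OF a(1)] by (simp add: lessThan_Suc_atMost)
      qed simp
    qed
    have "a j = \<zero>\<^bsub>A\<^esub>" if "j \<le> n" for j
      using partial_Suc[OF ap that] s[of j] s[of "Suc j"] that power_elem[OF ap that] by simp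
    thus "a = \<zero>\<^bsub>rel n\<^esub>" using ap by (auto simp: rel_def fun_eq_iff restrict_def PiE_iff extensional_def)
  qed
  moreover have "\<exists>a\<in>carrier (rel n). heads n a = t" if t: "t \<in> carrier (HD n)" for t
  proof -
    \<comment> \<open>The value zero at 0 is the empty sum; the value zero at \<open>n + 1\<close>
      forces the differences to have total zero.\<close>
    define T where "T j = (if j \<in> {1..n} then t (step n j) else \<zero>\<^bsub>A\<^esub>)" for j
    have T: "T j \<in> carrier A" for j using t step_surj1 by (auto simp: T_def)
    define a where "a = (\<lambda>i\<in>{..n}. T (Suc i) \<ominus>\<^bsub>A\<^esub> T i)"
    have a: "a \<in> carrier (power_module A n)" using T by (auto simp: a_def)
    have s: "j \<le> Suc n \<Longrightarrow> finsum A a {..<j} = T j" for j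
    proof (induction j)
      case 0 show ?case by (simp add: T_def)
    next
      case (Suc j)
      have "finsum A a {..<Suc j} = a j \<oplus>\<^bsub>A\<^esub> T j" using partial_Suc[OF a] Suc by simp
      also have "\<dots> = T (Suc j)" using Suc.prems T[of j] T[of "Suc j"]
        by (simp add: a_def A.minus_eq A.a_assoc A.l_neg)
      finally show ?case .
    qed
    have "finsum A a {..n} = \<zero>\<^bsub>A\<^esub>" using s[of "Suc n"] by (simp add: lessThan_Suc_atMost T_def)
    hence ar: "a \<in> carrier (rel n)" using a by (simp add: rel_def)
    have "heads n a = t"
    proof (rule extensionalityI)
      show "heads n a \<in> extensional (surj1 n)" by (simp add: heads_def)
      show "t \<in> extensional (surj1 n)" using t by (auto simp: PiE_def)
      fix \<sigma> assume "\<sigma> \<in> surj1 n"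
      then obtain j where j: "j \<in> {1..n}" "\<sigma> = step n j" using surj1_step by blast
      show "heads n a \<sigma> = t \<sigma>" unfolding j(2) heads_step[OF j(1)] using s[of j] j(1) by (simp add: T_def)
    qed
    with ar show ?thesis by blast
  qed
  ultimately show ?thesis using lin_closed[OF heads_lin] unfolding bij_betw_def by blast
qed

definition inc :: "nat \<Rightarrow> (nat \<Rightarrow> nat) \<Rightarrow> ('u \<Rightarrow> 'k) \<Rightarrow> (nat \<Rightarrow> nat) \<Rightarrow> 'u \<Rightarrow> 'k" where
  "inc n \<sigma> \<phi> = (\<lambda>\<tau>\<in>surjections n. if \<tau> = \<sigma> then \<phi> else \<zero>\<^bsub>dual_module K A\<^esub>)"

lemma inc_lin: "\<sigma> \<in> surj1 n \<Longrightarrow> lin K (dual_module K A) (Q n) (inc n \<sigma>)"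
proof -
  assume \<sigma>: "\<sigma> \<in> surj1 n"
  have "lin K (dual_module K A) (Cm em (\<tau> n)) (\<lambda>\<phi>. if \<tau> = \<sigma> then \<phi> else \<zero>\<^bsub>dual_module K A\<^esub>)" if "\<tau> \<in> surjections n" for \<tau>
  proof (cases "\<tau> = \<sigma>")
    case True
    thus ?thesis using \<sigma> lin_ident[of K "dual_module K A"] by (simp add: surj1_def em_def concentrated_def)
  next
    case False
    thus ?thesis using lin_const_zero[OF em_module, of "dual_module K A" "\<tau> n"] by (simp only: em_zero if_False)
  qed
  from lin_into_prod[OF module_dual[OF A] this]
  have "lin K (dual_module K A) (Q n) (\<lambda>\<phi>. \<lambda>\<tau>\<in>surjections n. if \<tau> = \<sigma> then \<phi> else \<zero>\<^bsub>dual_module K A\<^esub>)"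
    unfolding dk_module_def .
  moreover have "inc n \<sigma> = (\<lambda>\<phi>. \<lambda>\<tau>\<in>surjections n. if \<tau> = \<sigma> then \<phi> else \<zero>\<^bsub>dual_module K A\<^esub>)"
    by (rule ext) (simp only: inc_def)
  ultimately show ?thesis by simp
qed

lemma pair_inc:
  assumes \<sigma>: "\<sigma> \<in> surj1 n" and \<phi>: "\<phi> \<in> mod_hom K A KK" and a: "a \<in> carrier (power_module A n)"
  shows "pair n a (inc n \<sigma> \<phi>) = \<phi> (hd n a \<sigma>)"
proof -
  interpret KK: module K KK by (rule mKK)
  have c: "\<phi> (hd n a \<tau>) \<in> carrier K" for \<tau> using mod_hom_closed[OF \<phi> hd_in[OF a]] by simp
  have "pair n a (inc n \<sigma> \<phi>) = finsum KK (\<lambda>\<tau>. if \<sigma> = \<tau> then \<phi> (hd n a \<tau>) else \<zero>\<^bsub>KK\<^esub>) (surj1 n)"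
    unfolding pair_def
    by (rule KK.finsum_cong') (use c hd_in[OF a] in \<open>auto simp: inc_def surj1_def\<close>)
  also have "\<dots> = \<phi> (hd n a \<sigma>)"
    by (rule KK.finsum_singleton[OF \<sigma> finite_surj1]) (use c in auto)
  finally show ?thesis .
qed

lemma Q_sum:
  assumes x: "x \<in> carrier (Q n)"
  shows "finsum (Q n) (\<lambda>\<sigma>. inc n \<sigma> (x \<sigma>)) (surj1 n) = x" (is "?S = x")
proof (rule extensionalityI)
  interpret Q: module K "Q n" by (rule module_Q)
  have xd: "x \<sigma> \<in> carrier (dual_module K A)" if "\<sigma> \<in> surj1 n" for \<sigma>
    by (rule lin_closed[OF Q_proj[OF that] x])
  have i: "inc n \<sigma> (x \<sigma>) \<in> carrier (Q n)" if "\<sigma> \<in> surj1 n" for \<sigma>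
    by (rule lin_closed[OF inc_lin[OF that] xd[OF that]])
  have S: "?S \<in> carrier (Q n)" by (rule Q.finsum_closed) (use i in auto)
  show "?S \<in> extensional (surjections n)" by (rule Q_ext[OF S])
  show "x \<in> extensional (surjections n)" by (rule Q_ext[OF x])
  fix \<tau> assume \<tau>: "\<tau> \<in> surjections n"
  show "?S \<tau> = x \<tau>"
  proof (cases "\<tau> \<in> surj1 n")
    case False
    thus ?thesis using Q_trivial[OF S \<tau>] Q_trivial[OF x \<tau>] by simp
  next
    case True
    interpret D: module K "dual_module K A" by (rule module_dual[OF A])
    have "?S \<tau> = finsum (dual_module K A) (\<lambda>\<sigma>. inc n \<sigma> (x \<sigma>) \<tau>) (surj1 n)"
      by (rule lin_finsum[OF module_Q module_dual[OF A] Q_proj[OF True] finite_surj1 i])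
    also have "\<dots> = finsum (dual_module K A) (\<lambda>\<sigma>. if \<tau> = \<sigma> then x \<sigma> else \<zero>\<^bsub>dual_module K A\<^esub>) (surj1 n)"
    proof (rule D.finsum_cong')
      show "(\<lambda>\<sigma>. if \<tau> = \<sigma> then x \<sigma> else \<zero>\<^bsub>dual_module K A\<^esub>) \<in> surj1 n \<rightarrow> carrier (dual_module K A)"
        using xd D.zero_closed by (simp add: Pi_def del: dual_module_sel)
    qed (use \<tau> in \<open>simp_all add: inc_def del: dual_module_sel\<close>)
    also have "\<dots> = x \<tau>"
      by (rule D.finsum_singleton[OF True finite_surj1]) (use xd in blast)
    finally show ?thesis .
  qed
qed

text \<open>Restricting to single summands by \<open>inc\<close> reduces both halves to
  \<open>A\<close>: functionals on \<open>A\<close> separate the partial sums, and reflexivity of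
  \<open>A\<close> turns a functional on the whole module into one vector for each surjection, which
  \<open>heads_bij\<close> realizes as partial sums.\<close>

lemma \<Theta>_bij: "bij_betw (\<Theta> n) (carrier (rel n)) (carrier (dual_module K (Q n)))"
proof -
  obtain J c where cs: "coord_system K A J (\<lambda>b. b) c" using coords by blast
  have "inj_on (\<Theta> n) (carrier (rel n))"
  proof (rule lin_inj_on[OF module_rel module_dual[OF module_Q] \<Theta>_lin])
    fix a assume a: "a \<in> carrier (rel n)" "\<Theta> n a = \<zero>\<^bsub>dual_module K (Q n)\<^esub>"
    note ap = relD(1)[OF a(1)]
    have "hd n a \<sigma> = \<zero>\<^bsub>A\<^esub>" if \<sigma>: "\<sigma> \<in> surj1 n" for \<sigma>
    proof (rule coord_system_separated[OF cs hd_in[OF ap]])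
      fix j assume j: "j \<in> J"
      let ?\<phi> = "restrict (c j) (carrier A)"
      have \<phi>: "?\<phi> \<in> mod_hom K A KK"
        using cs j by (intro restrict_mod_hom[OF A]) (auto simp: coord_system_def)
      have i: "inc n \<sigma> ?\<phi> \<in> carrier (Q n)" by (rule lin_closed[OF inc_lin[OF \<sigma>]]) (use \<phi> in simp)
      have "?\<phi> (hd n a \<sigma>) = \<Theta> n a (inc n \<sigma> ?\<phi>)"
        using pair_inc[OF \<sigma> \<phi> ap] i by (simp add: \<Theta>_def)
      also have "\<dots> = \<zero>\<^bsub>K\<^esub>" unfolding a(2) using i by simp
      finally show "c j (hd n a \<sigma>) = \<zero>\<^bsub>K\<^esub>" using hd_in[OF ap] by simp
    qed
    hence "heads n a = heads n \<zero>\<^bsub>rel n\<^esub>"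
      unfolding lin_zero[OF module_rel module_HD heads_lin]
      by (simp add: heads_def fun_eq_iff restrict_def)
    moreover interpret R: module K "rel n" by (rule module_rel)
    have "\<zero>\<^bsub>rel n\<^esub> \<in> carrier (rel n)" by (rule R.zero_closed)
    ultimately show "a = \<zero>\<^bsub>rel n\<^esub>" using inj_onD[OF bij_betw_imp_inj_on[OF heads_bij] _ a(1)] by blast
  qed
  moreover have "\<exists>a\<in>carrier (rel n). \<Theta> n a = F" if F: "F \<in> carrier (dual_module K (Q n))" for F
  proof -
    have lF: "lin K (Q n) KK F" using F by (simp add: mod_hom_lin)
    have "\<exists>v\<in>carrier A. \<forall>\<phi>\<in>mod_hom K A KK. F (inc n \<sigma> \<phi>) = \<phi> v" if "\<sigma> \<in> surj1 n" for \<sigma>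
      by (rule coord_system_reflexive[OF cs lin_comp[OF inc_lin[OF that] lF]])
    then obtain v where v: "\<And>\<sigma>. \<sigma> \<in> surj1 n \<Longrightarrow> v \<sigma> \<in> carrier A"
      "\<And>\<sigma> \<phi>. \<sigma> \<in> surj1 n \<Longrightarrow> \<phi> \<in> mod_hom K A KK \<Longrightarrow> F (inc n \<sigma> \<phi>) = \<phi> (v \<sigma>)" by metis
    have "restrict v (surj1 n) \<in> carrier (HD n)" using v(1) by simp
    then obtain a where a: "a \<in> carrier (rel n)" "heads n a = restrict v (surj1 n)"
      using heads_bij[of n] by (metis (no_types, lifting) bij_betw_def imageE)
    have hv: "hd n a \<sigma> = v \<sigma>" if "\<sigma> \<in> surj1 n" for \<sigma> using fun_cong[OF a(2), of \<sigma>] that by (simp add: heads_def)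
    interpret KK: module K KK by (rule mKK)
    have "pair n a x = F x" if x: "x \<in> carrier (Q n)" for x
    proof -
      have xd: "x \<sigma> \<in> mod_hom K A KK" if "\<sigma> \<in> surj1 n" for \<sigma>
        using lin_closed[OF Q_proj[OF that] x] by simp
      have "F x = F (finsum (Q n) (\<lambda>\<sigma>. inc n \<sigma> (x \<sigma>)) (surj1 n))" by (simp only: Q_sum[OF x])
      also have "\<dots> = finsum KK (\<lambda>\<sigma>. F (inc n \<sigma> (x \<sigma>))) (surj1 n)"
        by (rule lin_finsum[OF module_Q mKK lF finite_surj1]) (use xd in \<open>auto intro: lin_closed[OF inc_lin]\<close>)
      also have "\<dots> = pair n a x" unfolding pair_def
      proof (rule KK.finsum_cong'[OF refl])
        show "(\<lambda>\<sigma>. x \<sigma> (hd n a \<sigma>)) \<in> surj1 n \<rightarrow> carrier KK"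
          using mod_hom_closed[OF xd hd_in[OF relD(1)[OF a(1)]]] by blast
        show "F (inc n \<sigma> (x \<sigma>)) = x \<sigma> (hd n a \<sigma>)" if "\<sigma> \<in> surj1 n" for \<sigma>
          using v(2)[OF that xd[OF that]] hv[OF that] by simp
      qed
      finally show ?thesis by simp
    qed
    hence "\<Theta> n a = F" using F by (auto simp: \<Theta>_def fun_eq_iff restrict_def mod_hom_iff extensional_def)
    with a(1) show ?thesis by blast
  qed
  ultimately show ?thesis using lin_closed[OF \<Theta>_lin] unfolding bij_betw_def by blast
qed

text \<open>The complex has zero differential, so the branch of \<open>dk_map\<close> for the coface
  omitting 0 contributes nothing; what remains are the surjections that restrict to
  \<open>\<tau>\<close> along \<open>\<alpha>\<close>.\<close>

lemma dk_map_value: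
  assumes x: "x \<in> carrier (Q n)" and \<tau>: "\<tau> \<in> surj1 m"
  shows "dk_map em m n \<alpha> x \<tau> = finsum (dual_module K A) x {\<sigma> \<in> surj1 n. \<forall>j\<le>m. \<sigma> (\<alpha> j) = \<tau> j}"
proof -
  interpret D: module K "dual_module K A" by (rule module_dual[OF A])
  have t: "\<tau> \<in> surjections m" "\<tau> m = 1" using \<tau> by (auto simp: surj1_def)
  have C1: "Cm em (\<tau> m) = dual_module K A" using t by (simp add: em_def concentrated_def)
  let ?S = "{\<sigma> \<in> surj1 n. \<forall>j\<le>m. \<sigma> (\<alpha> j) = \<tau> j}"
  let ?f = "\<lambda>\<sigma>. if \<sigma> n = \<tau> m \<and> (\<forall>j\<le>m. \<sigma> (\<alpha> j) = \<tau> j) then x \<sigma>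
             else if \<sigma> n = Suc (\<tau> m) \<and> (\<forall>j\<le>m. \<sigma> (\<alpha> j) = Suc (\<tau> j)) then Cd em (\<tau> m) (x \<sigma>)
             else \<zero>\<^bsub>Cm em (\<tau> m)\<^esub>"
  have xS: "x \<sigma> \<in> carrier (dual_module K A)" if "\<sigma> \<in> surj1 n" for \<sigma>
    by (rule lin_closed[OF Q_proj[OF that] x])
  have f1: "?f \<sigma> = x \<sigma>" if "\<sigma> \<in> ?S" for \<sigma> using that t by (simp add: surj1_def)
  have f0: "?f \<sigma> = \<zero>\<^bsub>dual_module K A\<^esub>" if \<sigma>: "\<sigma> \<in> surjections n - ?S" for \<sigma>
  proof -
    have n1: "\<not> (\<sigma> n = \<tau> m \<and> (\<forall>j\<le>m. \<sigma> (\<alpha> j) = \<tau> j))" using \<sigma> t by (simp add: surj1_def)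
    show ?thesis
    proof (cases "\<sigma> n = Suc (\<tau> m) \<and> (\<forall>j\<le>m. \<sigma> (\<alpha> j) = Suc (\<tau> j))")
      case True
      hence "x \<sigma> \<in> carrier (Cm em (Suc (\<tau> m)))" using Q_elem[OF x, of \<sigma>] \<sigma> by simp
      from em_d[OF this] show ?thesis unfolding if_not_P[OF n1] if_P[OF True] .
    next
      case False
      show ?thesis unfolding if_not_P[OF n1] if_not_P[OF False] em_zero ..
    qed
  qed
  have "dk_map em m n \<alpha> x \<tau> = finsum (Cm em (\<tau> m)) ?f (surjections n)"
    unfolding dk_map_def using x t(1) by (simp only: restrict_apply if_True)
  also have "\<dots> = finsum (dual_module K A) ?f (surjections n)" by (simp only: C1)
  also have "\<dots> = finsum (dual_module K A) x ?S"
  proof (rule D.add.finprod_mono_neutral_cong_right[OF finite_surjections])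
    show "?S \<subseteq> surjections n" by (auto simp: surj1_def)
    show "?f \<in> surjections n \<rightarrow> carrier (dual_module K A)"
    proof
      fix \<sigma> assume \<sigma>: "\<sigma> \<in> surjections n"
      show "?f \<sigma> \<in> carrier (dual_module K A)"
      proof (cases "\<sigma> \<in> ?S")
        case True
        thus ?thesis unfolding f1[OF True] by (intro xS) simp
      next
        case False
        hence "\<sigma> \<in> surjections n - ?S" using \<sigma> by blast
        from f0[OF this] show ?thesis using D.zero_closed by metis
      qed
    qed
  qed (use f0 f1 in auto)
  finally show ?thesis .
qed

text \<open>A surjection whose restriction along \<open>\<alpha>\<close> is constant contributes nothing to the left-hand
  side: the partial sum paired with it is empty or the total, which vanishes.\<close>

lemma pair_natural:
  assumes \<alpha>: "\<alpha> \<in> {..m} \<rightarrow> {..n}" "mono_on {..m} \<alpha>" and a: "a \<in> carrier (rel m)" and x: "x \<in> carrier (Q n)"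
  shows "pair n (push A m n \<alpha> a) x = pair m a (dk_map em m n \<alpha> x)"
proof -
  interpret KK: module K KK by (rule mKK)
  note ap = relD(1)[OF a]
  define r where "r \<sigma> = (\<lambda>i\<in>{..m}. \<sigma> (\<alpha> i))" for \<sigma> :: "nat \<Rightarrow> nat"
  define S where "S = {\<sigma> \<in> surj1 n. r \<sigma> \<in> surj1 m}"
  have xs: "lin K A KK (x \<sigma>)" if "\<sigma> \<in> surj1 n" for \<sigma>
    using lin_closed[OF Q_proj[OF that] x] by (simp add: mod_hom_lin)
  have \<alpha>n: "\<alpha> i \<le> n" if "i \<le> m" for i using \<alpha>(1) that by auto
  \<comment> \<open>Grouped along the fibres of \<open>\<alpha>\<close>, the partial sum of the
    pushed tuple over the zeros of \<open>\<sigma>\<close> is the partial sum of \<open>a\<close>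
    over the zeros of \<open>\<sigma>\<close> after \<open>\<alpha>\<close>.\<close>
  have h: "hd n (push A m n \<alpha> a) \<sigma> = hd m a (r \<sigma>)" for \<sigma>
  proof -
    have "hd n (push A m n \<alpha> a) \<sigma> = finsum A (\<lambda>j. finsum A a {i \<in> {i \<in> {..m}. \<sigma> (\<alpha> i) = 0}. \<alpha> i = j}) {j \<in> {..n}. \<sigma> j = 0}"
      unfolding hd_def
    proof (rule A.finsum_cong')
      fix j assume j: "j \<in> {j \<in> {..n}. \<sigma> j = 0}"
      have "{i \<in> {..m}. \<alpha> i = j} = {i \<in> {i \<in> {..m}. \<sigma> (\<alpha> i) = 0}. \<alpha> i = j}" using j by auto
      thus "push A m n \<alpha> a j = finsum A a {i \<in> {i \<in> {..m}. \<sigma> (\<alpha> i) = 0}. \<alpha> i = j}"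
        using j by (simp add: push_def)
    qed (use power_elem[OF ap] in \<open>auto intro!: A.finsum_closed\<close>)
    also have "\<dots> = finsum A a {i \<in> {..m}. \<sigma> (\<alpha> i) = 0}"
      by (rule finsum_fibers) (use \<alpha>n power_elem[OF ap] A.abelian_monoid_axioms in auto)
    also have "{i \<in> {..m}. \<sigma> (\<alpha> i) = 0} = {i \<in> {..m}. r \<sigma> i = 0}" by (auto simp: r_def)
    finally show ?thesis by (simp add: hd_def)
  qed
  have h0: "hd m a (r \<sigma>) = \<zero>\<^bsub>A\<^esub>" if \<sigma>: "\<sigma> \<in> surj1 n" "r \<sigma> \<notin> surj1 m" for \<sigma>
  proof -
    have mono: "mono_on {..m} (r \<sigma>)"
      using surj1_mono[OF \<sigma>(1)] mono_onD[OF \<alpha>(2)] \<alpha>n by (auto simp: r_def intro!: mono_onI)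
    have ext: "r \<sigma> \<in> extensional {..m}" by (simp add: r_def)
    have v: "r \<sigma> m = 0 \<or> r \<sigma> m = 1" using surj1_values[OF \<sigma>(1) \<alpha>n[OF order.refl]] by (simp add: r_def)
    show ?thesis
    proof (cases "r \<sigma> m = 0")
      case True
      hence "r \<sigma> i = 0" if "i \<le> m" for i using mono that unfolding mono_on_def by (metis atMost_iff le_zero_eq order.refl)
      hence "{i \<in> {..m}. r \<sigma> i = 0} = {..m}" by auto
      thus ?thesis using relD(2)[OF a] by (simp add: hd_def)
    next
      case False
      with v have "r \<sigma> m = 1" by simp
      from surj1I[OF ext mono this] \<sigma>(2) have "\<not> (\<exists>i\<le>m. r \<sigma> i = 0)" by metis
      hence "{i \<in> {..m}. r \<sigma> i = 0} = {}" by blast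
      thus ?thesis unfolding hd_def by (simp only: A.finsum_empty)
    qed
  qed
  have SS: "finite S" "S \<subseteq> surj1 n" using finite_surj1[of n] by (auto simp: S_def)
  have cK: "x \<sigma> (hd m a (r \<sigma>)) \<in> carrier KK" if "\<sigma> \<in> surj1 n" for \<sigma>
    by (rule lin_closed[OF xs[OF that] hd_in[OF ap]])
  have "pair n (push A m n \<alpha> a) x = finsum KK (\<lambda>\<sigma>. x \<sigma> (hd m a (r \<sigma>))) (surj1 n)"
    by (simp only: pair_def h)
  also have "\<dots> = finsum KK (\<lambda>\<sigma>. x \<sigma> (hd m a (r \<sigma>))) S"
  proof (rule KK.add.finprod_mono_neutral_cong_right[OF finite_surj1 SS(2)])
    show "x \<sigma> (hd m a (r \<sigma>)) = \<zero>\<^bsub>KK\<^esub>" if "\<sigma> \<in> surj1 n - S" for \<sigma>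
      using that h0[of \<sigma>] lin_zero[OF A mKK xs[of \<sigma>]] by (simp add: S_def)
  qed (use cK in auto)
  \<comment> \<open>The remaining surjections are grouped by their restriction
    \<open>\<tau>\<close>; each group is the index set of \<open>dk_map_value\<close>.\<close>
  also have "\<dots> = finsum KK (\<lambda>\<tau>. finsum KK (\<lambda>\<sigma>. x \<sigma> (hd m a (r \<sigma>))) {\<sigma> \<in> S. r \<sigma> = \<tau>}) (surj1 m)"
    by (rule finsum_fibers[OF KK.abelian_monoid_axioms SS(1) finite_surj1, symmetric])
      (use cK SS(2) in \<open>auto simp: S_def\<close>)
  also have "\<dots> = pair m a (dk_map em m n \<alpha> x)"
    unfolding pair_def
  proof (rule KK.finsum_cong'[OF refl])
    fix \<tau> assume \<tau>: "\<tau> \<in> surj1 m"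
    let ?T = "{\<sigma> \<in> surj1 n. \<forall>j\<le>m. \<sigma> (\<alpha> j) = \<tau> j}"
    have T: "{\<sigma> \<in> S. r \<sigma> = \<tau>} = ?T"
    proof -
      have e: "(\<forall>j\<le>m. \<sigma> (\<alpha> j) = \<tau> j) \<longleftrightarrow> r \<sigma> = \<tau>" for \<sigma>
        using \<tau> by (auto simp: r_def fun_eq_iff surj1_def surjections_def extensional_def)
      show ?thesis unfolding e using \<tau> by (auto simp: S_def)
    qed
    have fT: "finite ?T" using finite_surj1[of n] by simp
    have "dk_map em m n \<alpha> x \<tau> (hd m a \<tau>) = finsum KK (\<lambda>\<sigma>. x \<sigma> (hd m a \<tau>)) ?T"
      unfolding dk_map_value[OF x \<tau>]
      by (rule lin_finsum[OF module_dual[OF A] mKK eval_lin[OF hd_in[OF ap]] fT])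
        (use lin_closed[OF Q_proj x] in auto)
    also have "\<dots> = finsum KK (\<lambda>\<sigma>. x \<sigma> (hd m a (r \<sigma>))) {\<sigma> \<in> S. r \<sigma> = \<tau>}"
      unfolding T[symmetric] by (rule KK.finsum_cong') (use cK SS(2) in auto)
    finally show "finsum KK (\<lambda>\<sigma>. x \<sigma> (hd m a (r \<sigma>))) {\<sigma> \<in> S. r \<sigma> = \<tau>} = dk_map em m n \<alpha> x \<tau> (hd m a \<tau>)" by simp
  next
    have "dk_map em m n \<alpha> x \<in> carrier (Q m)" by (rule lin_closed[OF dk_map_lin[OF em_module em_d_lin] x])
    note q = this
    show "(\<lambda>\<tau>. dk_map em m n \<alpha> x \<tau> (hd m a \<tau>)) \<in> surj1 m \<rightarrow> carrier KK"
    proof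
      fix \<tau> assume \<tau>: "\<tau> \<in> surj1 m"
      have "dk_map em m n \<alpha> x \<tau> \<in> mod_hom K A KK" using lin_closed[OF Q_proj[OF \<tau>] q] by simp
      thus "dk_map em m n \<alpha> x \<tau> (hd m a \<tau>) \<in> carrier KK" by (rule mod_hom_closed[OF _ hd_in[OF ap]])
    qed
  qed
  finally show ?thesis .
qed

end

sublocale free_target \<subseteq> P: power_category K "Pres K A" pobj pmap cop
  by (rule power_category)

section \<open>The cosimplicial complex of relations and its comparison with the dual side\<close>

context free_target
begin

text \<open>Codegeneracies and cofaces of the coded powers are the action of particular index maps,
  so the joint kernel and the alternating sum turn into those of a
  \<open>fin_module\<close>.\<close>

lemma lim_complex:
  assumes T: "is_functor (Pres K A) (Mods K) T"
  shows "Cm (Lim_complex A (id_pres A) T) n = (P.lev T n)\<lparr>carrier := norm (P.lev T) (P.lact T) n\<rparr>"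
    and "x \<in> norm (P.lev T) (P.lact T) n \<Longrightarrow>
      Cd (Lim_complex A (id_pres A) T) n x = bd (P.lev T) (P.lact T) n x"
proof -
  interpret F: fin_module K "P.lev T" "P.lact T" by (rule P.fin_module_functor[OF T])
  let ?X = "cosimp_map T (pres_cosimplicial A (id_pres A))"
  have fst_id: "fst (id_pres A) = A" by (simp add: id_pres_def)
  have cob: "cob ?X n = P.lev T n" for n
    by (simp add: cosimp_map_def pres_cosimplicial_def P.lev_def pobj_def[symmetric])
  have cd: "codegen ?X m i = P.lact T (Suc m) m (\<lambda>j. if j \<le> i then j else j - 1)" if "i \<le> m" for m i
  proof -
    have "copy_map (power_module A (Suc m)) (power_module A m) (merge_entries A m i)
        = pmap (Suc m) m (\<lambda>j. if j \<le> i then j else j - 1)"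
      unfolding pmap_def by (rule copy_map_cong[OF codable_pow merge_entries_push[OF A that]])
    thus ?thesis by (simp add: cosimp_map_def pres_cosimplicial_def P.lact_def pobj_def[symmetric] fst_id)
  qed
  have cf: "coface ?X m i = P.lact T m (Suc m) (\<lambda>j. if j < i then j else Suc j)" if "i \<le> Suc m" for m i
  proof -
    have "copy_map (power_module A m) (power_module A (Suc m)) (insert_zero A m i)
        = pmap m (Suc m) (\<lambda>j. if j < i then j else Suc j)"
      unfolding pmap_def by (rule copy_map_cong[OF codable_pow insert_zero_push[OF A that]])
    thus ?thesis by (simp add: cosimp_map_def pres_cosimplicial_def P.lact_def pobj_def[symmetric] fst_id)
  qed
  have N: "{x \<in> carrier (cob ?X n). \<forall>m i. n = Suc m \<longrightarrow> i \<le> m \<longrightarrow> codegen ?X m i x = \<zero>\<^bsub>cob ?X m\<^esub>}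
      = norm (P.lev T) (P.lact T) n" for n
    unfolding F.norm_codegen cob by (auto simp: cd)
  show "Cm (Lim_complex A (id_pres A) T) n = (P.lev T n)\<lparr>carrier := norm (P.lev T) (P.lact T) n\<rparr>"
    by (simp only: Lim_complex_def conormalized_def Let_def N[unfolded cob] cpx.simps cob)
  assume x: "x \<in> norm (P.lev T) (P.lact T) n"
  interpret W: module K "P.lev T (Suc n)" by (rule F.mod)
  have d: "P.lact T n (Suc n) (\<lambda>j. if j < i then j else Suc j) x \<in> carrier (P.lev T (Suc n))" for i
    by (rule F.act_in[OF _ F.normD(1)[OF x]]) auto
  have "Cd (Lim_complex A (id_pres A) T) n x = finsum (P.lev T (Suc n))
      (\<lambda>i. if even i then coface ?X n i x else \<ominus>\<^bsub>P.lev T (Suc n)\<^esub> coface ?X n i x) {..Suc n}"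
    using x by (simp only: Lim_complex_def conormalized_def Let_def N[unfolded cob] cpx.simps cob restrict_apply if_True)
  also have "\<dots> = bd (P.lev T) (P.lact T) n x"
    unfolding F.alternating_sum[OF x, symmetric]
    by (rule W.finsum_cong') (use d in \<open>auto simp: cf\<close>)
  finally show "Cd (Lim_complex A (id_pres A) T) n x = bd (P.lev T) (P.lact T) n x" .
qed

definition robj :: "nat \<Rightarrow> ('k, 'u) module" where "robj n = Fo (relations A) (pobj n)"
definition qobj :: "nat \<Rightarrow> ('k, 'u) module" where "qobj n = copy (dual_module K (Q n))"
definition unenc :: "nat \<Rightarrow> 'u \<Rightarrow> nat \<Rightarrow> 'u" where "unenc n = inv_into (carrier (rel n)) (enc n)"
text \<open>\<open>\<Phi>\<close> accepts only modules over \<open>'u\<close>, so the duality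
  \<open>\<Theta>\<close> is transported to coded relations on one side and coded functionals on the
  other.\<close>

definition \<theta> :: "nat \<Rightarrow> 'u \<Rightarrow> 'u" where
  "\<theta> n = (\<lambda>r\<in>carrier (robj n). code (carrier (dual_module K (Q n))) (\<Theta> n (unenc n r)))"

lemma robj_eq: "robj n = (cpow n)\<lparr>carrier := a_kernel (cpow n) A (snd (pobj n))\<rparr>"
  by (cases "pobj n") (use fst_pobj[of n] in \<open>simp add: robj_def relations_def\<close>)

lemma robj_carrier: "carrier (robj n) = enc n ` carrier (rel n)"
proof -
  have "carrier (cpow n) = enc n ` carrier (power_module A n)"
    using enc_bij[of n] by (simp add: bij_betw_def)
  thus ?thesis unfolding robj_eq a_kernel_eq by (auto simp: rel_def snd_pobj_enc simp del: power_module_sel)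
qed

lemma module_robj: "module K (robj n)"
  unfolding robj_def by (rule functorD(1)[OF relations_functor pobj_ob])

lemma enc_rel: "lin K (rel n) (robj n) (enc n)" "bij_betw (enc n) (carrier (rel n)) (carrier (robj n))"
proof -
  have "lin K (rel n) (cpow n) (enc n)" unfolding rel_def by (rule lin_sub_dom[OF enc_lin]) auto
  thus "lin K (rel n) (robj n) (enc n)" using robj_carrier[of n] unfolding robj_eq by (intro lin_sub_cod) auto
  have "carrier (rel n) \<subseteq> carrier (power_module A n)" using relD(1) by blast
  from inj_on_subset[OF bij_betw_imp_inj_on[OF enc_bij] this]
  show "bij_betw (enc n) (carrier (rel n)) (carrier (robj n))" by (simp add: bij_betw_def robj_carrier)
qed

lemma unenc_enc: "a \<in> carrier (rel n) \<Longrightarrow> unenc n (enc n a) = a"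
  unfolding unenc_def by (rule inv_into_f_f[OF bij_betw_imp_inj_on[OF enc_rel(2)]])

text \<open>Functionals have codes because \<open>\<Theta>\<close> puts them in bijection with
  certain tuples in \<open>A\<close>, and tuples over an infinite type have codes in it.\<close>

lemma codable_dual: "codable TYPE('u) (carrier (dual_module K (Q n)))"
proof -
  have "carrier (rel n) \<subseteq> carrier (power_module A n)" using relD(1) by blast
  from codable_bij[OF codable_subset[OF codable_pow this] \<Theta>_bij] show ?thesis .
qed

lemma module_qobj: "module K (qobj n)"
  unfolding qobj_def by (rule module_copy[OF module_dual[OF module_Q] codable_dual])

lemma \<theta>_enc: "a \<in> carrier (rel n) \<Longrightarrow> \<theta> n (enc n a) = code (carrier (dual_module K (Q n))) (\<Theta> n a)"
  by (simp add: \<theta>_def robj_carrier unenc_enc del: dual_module_sel power_module_sel)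

lemma \<theta>_hom: "\<theta> n \<in> mod_hom K (robj n) (qobj n)"
  and \<theta>_bij: "bij_betw (\<theta> n) (carrier (robj n)) (carrier (qobj n))"
proof -
  have u: "lin K (robj n) (rel n) (unenc n)" unfolding unenc_def by (rule lin_inv[OF module_rel enc_rel])
  have ub: "bij_betw (unenc n) (carrier (robj n)) (carrier (rel n))"
    unfolding unenc_def by (rule bij_betw_inv_into[OF enc_rel(2)])
  show "\<theta> n \<in> mod_hom K (robj n) (qobj n)"
    unfolding \<theta>_def qobj_def
    by (rule restrict_mod_hom[OF module_robj lin_comp[OF lin_comp[OF u \<Theta>_lin] code_lin[OF codable_dual]]])
  have "bij_betw (code (carrier (dual_module K (Q n))) \<circ> (\<Theta> n \<circ> unenc n)) (carrier (robj n)) (carrier (qobj n))"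
    unfolding qobj_def by (rule bij_betw_trans[OF bij_betw_trans[OF ub \<Theta>_bij] code_bij[OF codable_dual]])
  thus "bij_betw (\<theta> n) (carrier (robj n)) (carrier (qobj n))"
    by (rule bij_betw_cong[THEN iffD1, rotated]) (simp add: \<theta>_def)
qed

text \<open>The partial sums identify this module with a finite power of \<open>A\<close>, whose
  coordinates are transported. Freeness is what the hypothesis on \<open>\<Phi>\<close> asks
  for.\<close>

lemma qobj_free: "free_module K (qobj n) \<and> fin_gen_module K (qobj n)"
proof -
  obtain J c where c: "coord_system K A J (\<lambda>b. b) c" "biorthogonal K J (\<lambda>b. b) c" using coords by blast
  note p = coord_system_prod[OF c finite_surj1[of n]]
  let ?i = "inv_into (carrier (rel n)) (heads n)"
  have i: "lin K (HD n) (rel n) ?i" by (rule lin_inv[OF module_rel heads_lin heads_bij])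
  have ib: "bij_betw ?i (carrier (HD n)) (carrier (rel n))" by (rule bij_betw_inv_into[OF heads_bij])
  let ?h = "\<lambda>x. code (carrier (dual_module K (Q n))) (\<Theta> n (?i x))"
  have h: "lin K (HD n) (qobj n) ?h"
    unfolding qobj_def by (rule lin_comp[OF lin_comp[OF i \<Theta>_lin] code_lin[OF codable_dual]])
  have hb: "bij_betw ?h (carrier (HD n)) (carrier (qobj n))"
    unfolding qobj_def using bij_betw_trans[OF bij_betw_trans[OF ib \<Theta>_bij] code_bij[OF codable_dual]]
    by (simp add: comp_def del: dual_module_sel)
  show ?thesis
    by (rule coord_system_free[OF dom coord_system_iso[OF p(1) module_qobj h hb] biorthogonal_iso[OF p hb]])
qed

text \<open>The map to which \<open>kuhn_dual\<close> applies \<open>\<Phi>\<close> when it forms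
  the face \<open>i\<close>.\<close>

definition qmap :: "nat \<Rightarrow> nat \<Rightarrow> 'u \<Rightarrow> 'u" where
  "qmap n i = copy_map (dual_module K (Q n)) (dual_module K (Q (Suc n)))
     (dual_map K (Q (Suc n)) (Q n) (dk_map em n (Suc n) (\<lambda>j. if j < i then j else Suc j)))"

lemma dual_map_lin:
  assumes "module K M" "module K N" "lin K M N f"
  shows "lin K (dual_module K N) (dual_module K M) (dual_map K M N f)"
proof (rule linI)
  interpret D: module K "dual_module K N" by (rule module_dual[OF assms(2)])
  fix \<phi> assume \<phi>: "\<phi> \<in> carrier (dual_module K N)"
  show "dual_map K M N f \<phi> \<in> carrier (dual_module K M)"
    using restrict_mod_hom[OF assms(1) lin_comp[OF assms(3) mod_hom_lin[of \<phi> K N KK]]] \<phi>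
    by (simp add: dual_map_def)
  show "dual_map K M N f (\<phi> \<oplus>\<^bsub>dual_module K N\<^esub> \<psi>) = dual_map K M N f \<phi> \<oplus>\<^bsub>dual_module K M\<^esub> dual_map K M N f \<psi>"
    if "\<psi> \<in> carrier (dual_module K N)" for \<psi>
    using D.a_closed[OF \<phi> that] \<phi> that lin_closed[OF assms(3)]
    by (simp add: dual_map_def fun_eq_iff restrict_def)
  show "dual_map K M N f (a \<odot>\<^bsub>dual_module K N\<^esub> \<phi>) = a \<odot>\<^bsub>dual_module K M\<^esub> dual_map K M N f \<phi>" if "a \<in> carrier K" for a
    using D.smult_closed[OF that \<phi>] \<phi> lin_closed[OF assms(3)]
    by (simp add: dual_map_def fun_eq_iff restrict_def)
qed

lemma qmap_hom: "qmap n i \<in> mod_hom K (qobj n) (qobj (Suc n))"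
  unfolding qmap_def qobj_def
  by (rule copy_map_hom[OF codable_dual codable_dual module_dual[OF module_Q]
      dual_map_lin[OF module_Q module_Q dk_map_lin[OF em_module em_d_lin]]])

text \<open>This is \<open>pair_natural\<close> for a coface, after removal of the codes. It is
  stated as an equality of composites, that is of morphisms of modules, so that
  \<open>\<Phi>\<close> can be applied to it.\<close>

lemma \<theta>_natural:
  fixes n i :: nat
  defines "\<delta> \<equiv> \<lambda>j. if j < i then j else Suc j"
  shows "compose (carrier (robj n)) (\<theta> (Suc n)) (Fa (relations A) (pobj n) (pobj (Suc n)) (pmap n (Suc n) \<delta>))
       = compose (carrier (robj n)) (qmap n i) (\<theta> n)"
proof (rule extensionalityI)
  fix r assume "r \<in> carrier (robj n)"
  then obtain a where a: "a \<in> carrier (rel n)" "r = enc n a" unfolding robj_carrier by blast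
  have \<delta>: "\<delta> \<in> {..n} \<rightarrow> {..Suc n}" "mono_on {..n} \<delta>" by (auto simp: \<delta>_def mono_on_def)
  have pa: "push A n (Suc n) \<delta> a \<in> carrier (rel (Suc n))"
    using push_in[OF A relD(1)[OF a(1)]] push_total[OF A \<delta>(1) relD(1)[OF a(1)]] relD(2)[OF a(1)]
    by (simp add: rel_def)
  have \<Theta>d: "\<Theta> n a \<in> carrier (dual_module K (Q n))" by (rule lin_closed[OF \<Theta>_lin a(1)])
  have "Fa (relations A) (pobj n) (pobj (Suc n)) (pmap n (Suc n) \<delta>) r = enc (Suc n) (push A n (Suc n) \<delta> a)"
  proof -
    have "Fa (relations A) (pobj n) (pobj (Suc n)) (pmap n (Suc n) \<delta>) = restrict (pmap n (Suc n) \<delta>) (carrier (robj n))"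
      by (simp add: relations_def robj_def split: prod.splits)
    thus ?thesis using a robj_carrier pmap_enc[OF relD(1)[OF a(1)]] by simp
  qed
  hence "\<theta> (Suc n) (Fa (relations A) (pobj n) (pobj (Suc n)) (pmap n (Suc n) \<delta>) r)
      = code (carrier (dual_module K (Q (Suc n)))) (\<Theta> (Suc n) (push A n (Suc n) \<delta> a))"
    by (simp only: \<theta>_enc[OF pa])
  also have "\<Theta> (Suc n) (push A n (Suc n) \<delta> a) = dual_map K (Q (Suc n)) (Q n) (dk_map em n (Suc n) \<delta>) (\<Theta> n a)"
  proof (rule ext)
    fix x
    show "\<Theta> (Suc n) (push A n (Suc n) \<delta> a) x = dual_map K (Q (Suc n)) (Q n) (dk_map em n (Suc n) \<delta>) (\<Theta> n a) x"
    proof (cases "x \<in> carrier (Q (Suc n))")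
      case True
      have "dk_map em n (Suc n) \<delta> x \<in> carrier (Q n)" by (rule lin_closed[OF dk_map_lin[OF em_module em_d_lin] True])
      thus ?thesis using \<Theta>d True pair_natural[OF \<delta> a(1) True]
        by (simp add: dual_map_def) (simp add: \<Theta>_def)
    qed (use \<Theta>d in \<open>simp add: \<Theta>_def dual_map_def\<close>)
  qed
  also have "code (carrier (dual_module K (Q (Suc n)))) \<dots> = qmap n i (code (carrier (dual_module K (Q n))) (\<Theta> n a))"
    unfolding qmap_def \<delta>_def[symmetric] by (rule copy_map_code[OF codable_dual \<Theta>d, symmetric])
  also have "\<dots> = qmap n i (\<theta> n r)" unfolding a(2) \<theta>_enc[OF a(1)] ..
  finally show "compose (carrier (robj n)) (\<theta> (Suc n)) (Fa (relations A) (pobj n) (pobj (Suc n)) (pmap n (Suc n) \<delta>)) r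
      = compose (carrier (robj n)) (qmap n i) (\<theta> n) r" using \<open>r \<in> carrier (robj n)\<close> by (simp add: compose_def)
qed (auto simp: compose_def)

text \<open>A functor preserves the isomorphisms \<open>\<theta>\<close> and their compatibility
  with cofaces; the values of \<open>\<Phi>\<close> on the modules \<open>qobj n\<close> have finite
  dual bases since these modules are free and finitely generated.\<close>

lemma moore_dual:
  fixes \<Phi> :: "(('k, 'u) module, 'u \<Rightarrow> 'u, ('k, 'v) module, 'v \<Rightarrow> 'v) ftr"
  assumes \<Phi>: "is_functor (Mods K) (Mods K) \<Phi>"
    and \<Phi>_free: "\<And>M. free_module K M \<Longrightarrow> fin_gen_module K M \<Longrightarrow>
                  free_module K (Fo \<Phi> M) \<and> fin_gen_module K (Fo \<Phi> M)"
  defines "T \<equiv> ftr_comp \<Phi> (relations A)"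
  shows "moore_dual K (P.lev T) (P.lact T) (\<lambda>n. Fo \<Phi> (qobj n)) (\<lambda>n. Fa \<Phi> (robj n) (qobj n) (\<theta> n))
    (\<lambda>n i. Fa \<Phi> (qobj n) (qobj (Suc n)) (qmap n i))
    (simp_map (kuhn_dual K \<Phi>) (eilenberg_maclane (dual_module K A) 1))"
proof -
  have T: "is_functor (Pres K A) (Mods K) T"
    unfolding T_def by (rule ftr_comp_functor[OF relations_functor \<Phi>])
  interpret F: fin_module K "P.lev T" "P.lact T" by (rule P.fin_module_functor[OF T])
  have ob: "robj n \<in> Ob (Mods K)" "qobj n \<in> Ob (Mods K)" for n
    using module_robj module_qobj by (simp_all add: Mods_def)
  have lev: "P.lev T n = Fo \<Phi> (robj n)" for n
    by (simp add: P.lev_def T_def ftr_comp_def robj_def)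
  have \<theta>h: "\<theta> n \<in> Hom (Mods K) (robj n) (qobj n)" for n using \<theta>_hom by (simp add: Mods_def)
  have qh: "qmap n i \<in> Hom (Mods K) (qobj n) (qobj (Suc n))" for n i using qmap_hom by (simp add: Mods_def)
  show ?thesis
  proof (intro moore_dual.intro moore_dual_axioms.intro)
    show "fin_module K (P.lev T) (P.lact T)" by (rule F.fin_module_axioms)
    fix n
    show "module K (Fo \<Phi> (qobj n))" by (rule functorD(1)[OF \<Phi> ob(2)])
    show "\<exists>(J :: 'v set) e c. coord_system K (Fo \<Phi> (qobj n)) J e c"
      using free_fin_gen_coord_system[OF dom, of "Fo \<Phi> (qobj n)"] \<Phi>_free qobj_free by blast
    show "lin K (P.lev T n) (Fo \<Phi> (qobj n)) (Fa \<Phi> (robj n) (qobj n) (\<theta> n))"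
      unfolding lev by (rule functorD(3)[OF \<Phi> ob \<theta>h])
    show "bij_betw (Fa \<Phi> (robj n) (qobj n) (\<theta> n)) (carrier (P.lev T n)) (carrier (Fo \<Phi> (qobj n)))"
      unfolding lev by (rule functor_iso_bij[OF \<Phi> module_robj module_qobj \<theta>_hom \<theta>_bij])
    fix i v assume i: "i \<le> Suc n" and v: "v \<in> carrier (P.lev T n)"
    let ?\<delta> = "\<lambda>j. if j < i then j else Suc j"
    let ?f = "Fa (relations A) (pobj n) (pobj (Suc n)) (pmap n (Suc n) ?\<delta>)"
    have \<delta>: "?\<delta> \<in> {..n} \<rightarrow> {..Suc n}" by auto
    have f: "?f \<in> Hom (Mods K) (robj n) (robj (Suc n))"
      using functorD(2)[OF relations_functor pobj_ob pobj_ob P.P_hom[OF \<delta>]] by (simp add: robj_def Mods_def)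
    have v': "v \<in> carrier (Fo \<Phi> (robj n))" using v by (simp add: lev)
    have "Fa \<Phi> (robj (Suc n)) (qobj (Suc n)) (\<theta> (Suc n)) (P.lact T n (Suc n) ?\<delta> v)
        = Fa \<Phi> (robj (Suc n)) (qobj (Suc n)) (\<theta> (Suc n)) (Fa \<Phi> (robj n) (robj (Suc n)) ?f v)"
      by (simp add: P.lact_def T_def ftr_comp_def robj_def)
    also have "\<dots> = Fa \<Phi> (robj n) (qobj (Suc n)) (Comp (Mods K) (robj n) (\<theta> (Suc n)) ?f) v"
      by (rule functorD(5)[OF \<Phi> ob(1) ob f \<theta>h v', symmetric])
    also have "Comp (Mods K) (robj n) (\<theta> (Suc n)) ?f = Comp (Mods K) (robj n) (qmap n i) (\<theta> n)"
      using \<theta>_natural[of n i] by (simp add: Mods_def)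
    also have "Fa \<Phi> (robj n) (qobj (Suc n)) \<dots> v = Fa \<Phi> (qobj n) (qobj (Suc n)) (qmap n i) (Fa \<Phi> (robj n) (qobj n) (\<theta> n) v)"
      by (rule functorD(5)[OF \<Phi> ob ob(2) \<theta>h qh v'])
    finally show "Fa \<Phi> (robj (Suc n)) (qobj (Suc n)) (\<theta> (Suc n)) (P.lact T n (Suc n) ?\<delta> v)
        = Fa \<Phi> (qobj n) (qobj (Suc n)) (qmap n i) (Fa \<Phi> (robj n) (qobj n) (\<theta> n) v)" .
  next
    fix n i
    show "sob (simp_map (kuhn_dual K \<Phi>) (eilenberg_maclane (dual_module K A) 1)) n = dual_module K (Fo \<Phi> (qobj n))"
      by (simp add: simp_map_def kuhn_dual_def eilenberg_maclane_def dold_kan_def qobj_def em_def)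
    show "face (simp_map (kuhn_dual K \<Phi>) (eilenberg_maclane (dual_module K A) 1)) n i =
        dual_map K (Fo \<Phi> (qobj n)) (Fo \<Phi> (qobj (Suc n))) (Fa \<Phi> (qobj n) (qobj (Suc n)) (qmap n i))"
      by (simp add: simp_map_def kuhn_dual_def eilenberg_maclane_def dold_kan_def qobj_def qmap_def em_def Let_def)
  qed
qed

end

section \<open>Comparison of the two complexes and the exact sequence for derived limits\<close>

theorem corollary4p2:
  fixes K :: "'k ring"
    and A :: "('k, 'u) module"
    and \<Phi> :: "(('k, 'u) module, 'u \<Rightarrow> 'u, ('k, 'v) module, 'v \<Rightarrow> 'v) ftr"
  assumes K: "principal_domain K"
    and u_infinite: "infinite (UNIV :: 'u set)"
    and u_large: "\<exists>e :: 'k \<Rightarrow> 'u. inj_on e (carrier K)"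
    and w_infinite: "infinite (UNIV :: 'w set)"
    and w_large: "\<exists>e :: 'v \<Rightarrow> 'w. inj e"
    and w_closed: "\<exists>e :: (('k, 'u) pres \<Rightarrow> 'w) \<Rightarrow> 'w. inj e"
    and A: "free_module K A" "fin_gen_module K A"
    and \<Phi>: "is_functor (Mods K) (Mods K) \<Phi>"
    and \<Phi>_free: "\<And>M. free_module K M \<Longrightarrow> fin_gen_module K M \<Longrightarrow>
                  free_module K (Fo \<Phi> M) \<and> fin_gen_module K (Fo \<Phi> M)"
  shows
    "cochain_isomorphic K
       (Lim_complex A (id_pres A) (ftr_comp \<Phi> (relations A)))
       (dual_cpx K (normalized (simp_map (kuhn_dual K \<Phi>)
                      (eilenberg_maclane (dual_module K A) 1)))) \<and>
     (\<forall>(I :: nat \<Rightarrow> (('k, 'u) pres, 'u \<Rightarrow> 'u, ('k, 'w) module, 'w \<Rightarrow> 'w) ftr) \<delta> \<epsilon>.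
        injective_resolution K (Pres K A) (ftr_comp \<Phi> (relations A)) I \<delta> \<epsilon> \<longrightarrow>
        (\<forall>i :: nat. \<exists>f g.
           short_exact K
             (diamond K (dold_puppe_free (kuhn_dual K \<Phi>) (dual_module K A) 1 (int i - 1)))
             f (derived_lim (Pres K A) I \<delta> i) g
             (dual_module K (dold_puppe_free (kuhn_dual K \<Phi>) (dual_module K A) 1 (int i)))))"
proof -
  interpret A: free_target K A by (rule free_target.intro[OF K u_infinite A])
  let ?T = "ftr_comp \<Phi> (relations A)"
  let ?X = "simp_map (kuhn_dual K \<Phi>) (eilenberg_maclane (dual_module K A) 1)"
  let ?C = "normalized ?X" and ?L = "Lim_complex A (id_pres A) ?T"
  have T: "is_functor (Pres K A) (Mods K) ?T" by (rule ftr_comp_functor[OF A.relations_functor \<Phi>])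
  interpret D: moore_dual K "A.P.lev ?T" "A.P.lact ?T" "\<lambda>n. Fo \<Phi> (A.qobj n)"
    "\<lambda>n. Fa \<Phi> (A.robj n) (A.qobj n) (A.\<theta> n)"
    "\<lambda>n i. Fa \<Phi> (A.qobj n) (A.qobj (Suc n)) (A.qmap n i)" ?X
    by (rule A.moore_dual[OF \<Phi> \<Phi>_free])
  note L = A.lim_complex[OF T]
  have Lc: "carrier (Cm ?L n) = D.N n" for n by (simp add: L)
  have f: "D.ev n \<in> mod_hom K (Cm ?L n) (Cm (dual_cpx K ?C) n)"
    "bij_betw (D.ev n) (carrier (Cm ?L n)) (carrier (Cm (dual_cpx K ?C) n))" for n
    using D.ev_hom[of n] D.ev_bij[of n] by (simp_all add: L(1) dual_cpx_def del: dual_module_sel)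
  have comm: "D.ev (Suc n) (Cd ?L n x) = Cd (dual_cpx K ?C) n (D.ev n x)" if "x \<in> carrier (Cm ?L n)" for n x
    using D.ev_comm[of x n] that by (simp add: Lc L(2))
  have iso: "cochain_isomorphic K ?L (dual_cpx K ?C)"
    unfolding cochain_isomorphic_def by (rule exI[of _ D.ev]) (use f comm in blast)
  have mL: "module K (Cm ?L n)" for n
    unfolding L(1) by (rule module_submod[OF D.mod D.submod_norm])
  have dL: "lin K (Cm ?L n) (Cm ?L (Suc n)) (Cd ?L n)" for n
  proof -
    have "lin K (Cm ?L n) (Cm ?L (Suc n)) (D.dd n)"
      unfolding L(1) by (rule lin_sub_cod[OF lin_sub_dom[OF D.bd_lin]]) (auto dest: D.normD(1) intro: D.bd_norm)
    thus ?thesis by (subst lin_cong[OF mL]) (auto simp: Lc L(2))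
  qed
  have ddL: "Cd ?L (Suc n) (Cd ?L n x) = \<zero>\<^bsub>Cm ?L (Suc (Suc n))\<^esub>" if "x \<in> carrier (Cm ?L n)" for n x
    using that D.bd_norm[OF D.normD(1), of x n] D.bd_bd[OF D.normD(1), of x n] by (simp add: L)
  have mD: "module K (Cm (dual_cpx K ?C) n)" for n
    using module_dual[OF D.moore_module] by (simp add: dual_cpx_def)
  have dD: "lin K (Cm (dual_cpx K ?C) n) (Cm (dual_cpx K ?C) (Suc n)) (Cd (dual_cpx K ?C) n)" for n
    using A.dual_map_lin[OF D.moore_module D.moore_module D.moore_d_lin] by (simp add: dual_cpx_def)
  have dp: "dold_puppe_free (kuhn_dual K \<Phi>) (dual_module K A) 1 (int i) = homology ?C i" for i
    by (simp add: dold_puppe_free_def)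
  \<comment> \<open>For \<open>i = 0\<close> the index \<open>int i - 1\<close> is negative, and the
    convention for derived functors yields the zero module.\<close>
  have dp': "dold_puppe_free (kuhn_dual K \<Phi>) (dual_module K A) 1 (int i - 1)
      = (case i of 0 \<Rightarrow> zero_module | Suc m \<Rightarrow> homology ?C m)" for i
    by (cases i) (simp_all add: dold_puppe_free_def)
  have "\<exists>f g. short_exact K (diamond K (case i of 0 \<Rightarrow> zero_module | Suc m \<Rightarrow> homology ?C m)) f
      (derived_lim (Pres K A) I \<delta> i) g (dual_module K (homology ?C i))"
    if res: "injective_resolution K (Pres K A) ?T I \<delta> \<epsilon>"
    for I :: "nat \<Rightarrow> (('k, 'u) pres, 'u \<Rightarrow> 'u, ('k, 'w) module, 'w \<Rightarrow> 'w) ftr" and \<delta> \<epsilon> i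
  proof -
    have large: "\<exists>e :: (('k, 'u) pres \<times> ('u \<Rightarrow> 'u) \<Rightarrow> 'w) \<Rightarrow> 'w. inj e"
    proof -
      obtain e :: "(('k, 'u) pres \<Rightarrow> 'w) \<Rightarrow> 'w" where e: "inj e" using w_closed by blast
      \<comment> \<open>A function of an object and an arrow is curried. The arrow is read as the
        second component of a presentation, so the given injection can be used for both arguments in
        turn.\<close>
      let ?e = "\<lambda>g. e (\<lambda>X. e (\<lambda>Y. g (X, snd Y)))"
      have "inj ?e"
      proof (rule injI)
        fix g h :: "('k, 'u) pres \<times> ('u \<Rightarrow> 'u) \<Rightarrow> 'w" assume "?e g = ?e h"
        hence "(\<lambda>X. e (\<lambda>Y. g (X, snd Y))) = (\<lambda>X. e (\<lambda>Y. h (X, snd Y)))" by (rule injD[OF e])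
        hence "e (\<lambda>Y. g (X, snd Y)) = e (\<lambda>Y. h (X, snd Y))" for X by (rule fun_cong)
        hence *: "(\<lambda>Y :: ('k, 'u) pres. g (X, snd Y)) = (\<lambda>Y. h (X, snd Y))" for X by (rule injD[OF e])
        show "g = h"
        proof (rule ext)
          fix p :: "('k, 'u) pres \<times> ('u \<Rightarrow> 'u)"
          show "g p = h p" using fun_cong[OF *[of "fst p"], of "(undefined, snd p)"] by simp
        qed
      qed
      thus ?thesis by blast
    qed
    obtain M B R where MB: "derived_lim (Pres K A) I \<delta> i = quot_module M B" "module K M" "submod K M B"
      and R: "corr K ((A.P.lev ?T i)\<lparr>carrier := ncocycles (A.P.lev ?T) (A.P.lact ?T) i\<rparr>)
        (ncoboundaries (A.P.lev ?T) (A.P.lact ?T) i) M B R"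
      using A.P.derived_lim_corr[OF T large res, of i] by blast
    obtain M' B' R' where MB': "cohomology (dual_cpx K ?C) i = quot_module M' B'" "module K M'" "submod K M' B'"
      and R': "corr K ((Cm ?L i)\<lparr>carrier := {x \<in> carrier (Cm ?L i). Cd ?L i x = \<zero>\<^bsub>Cm ?L (Suc i)\<^esub>}\<rparr>)
        (case i of 0 \<Rightarrow> {\<zero>\<^bsub>Cm ?L 0\<^esub>} | Suc m \<Rightarrow> Cd ?L m ` carrier (Cm ?L m)) M' B' R'"
      using corr_cochain[where f = D.ev and C = ?L and D = "dual_cpx K ?C" and n = i,
          OF mL mD mod_hom_lin[OF f(1)] f(2) dL ddL comm dD] by blast
    have Z: "(Cm ?L i)\<lparr>carrier := {x \<in> carrier (Cm ?L i). Cd ?L i x = \<zero>\<^bsub>Cm ?L (Suc i)\<^esub>}\<rparr>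
        = (A.P.lev ?T i)\<lparr>carrier := ncocycles (A.P.lev ?T) (A.P.lact ?T) i\<rparr>"
    proof -
      have "{x \<in> carrier (Cm ?L i). Cd ?L i x = \<zero>\<^bsub>Cm ?L (Suc i)\<^esub>} = ncocycles (A.P.lev ?T) (A.P.lact ?T) i"
        unfolding Lc ncocycles_def by (auto simp: L)
      thus ?thesis by (simp add: L(1))
    qed
    have B: "(case i of 0 \<Rightarrow> {\<zero>\<^bsub>Cm ?L 0\<^esub>} | Suc m \<Rightarrow> Cd ?L m ` carrier (Cm ?L m))
        = ncoboundaries (A.P.lev ?T) (A.P.lact ?T) i"
    proof (cases i)
      case (Suc m)
      have "Cd ?L m ` D.N m = D.dd m ` D.N m" by (rule image_cong[OF refl]) (rule L(2))
      thus ?thesis by (simp add: Suc ncoboundaries_def Lc)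
    qed (simp add: ncoboundaries_def L(1))
    \<comment> \<open>The derived limit and the cohomology of the dual complex both correspond to
      the normalized complex of relations; the correspondences are composed before passing to
      quotients.\<close>
    from corr_comp[OF corr_sym[OF R'[unfolded Z B]] R]
    obtain h where h: "lin K (quot_module M' B') (quot_module M B) h"
      "bij_betw h (carrier (quot_module M' B')) (carrier (quot_module M B))"
      using corr_quot[OF MB'(2,3) MB(2,3)] by blast
    obtain f g where fg: "short_exact K (diamond K (case i of 0 \<Rightarrow> zero_module | Suc m \<Rightarrow> homology ?C m)) f
        (quot_module M' B') g (dual_module K (homology ?C i))"
      using universal_coefficients_complex[OF K D.moore_module D.moore_separated D.moore_d_lin D.moore_dd, of i]
      unfolding MB'(1) by blast
    have "module K (case i of 0 \<Rightarrow> zero_module | Suc m \<Rightarrow> homology ?C m)"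
      using module_zero[OF A.cr] module_homology[OF D.moore_module D.moore_d_lin D.moore_dd]
      by (cases i) simp_all
    hence dm: "module K (diamond K (case i of 0 \<Rightarrow> zero_module | Suc m \<Rightarrow> homology ?C m))"
      unfolding diamond_def by (rule module_ext1[OF _ A.mKK])
    show ?thesis unfolding MB(1)
      by (rule short_exact_iso[OF fg dm module_quot[OF MB'(2,3)] module_quot[OF MB(2,3)] h])
  qed
  thus ?thesis using iso unfolding dp dp' by blast
qed

end
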